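(* Let $1<p<\infty$, $f\in L^p(\Omega)$, let $\beta:\Omega\to\mathbb{R}$ be non-negative, continuous and bounded, suppose $\partial\Omega\neq\emptyset$ and let $\Gamma\subset\partial\Omega$. For $\alpha\in\mathrm{M}^+(\Omega)$ let $\mathbb{P}(\alpha)$ denote the problem $$\min_{\mu}\ \mathcal{J}(\mu):=\frac1p\int_\Omega|\mathrm{div}\,\mu(x)-f(x)|^p\,dx+\int_\Omega\beta(x)\,d|\mu|(x)\quad\text{subject to}\quad\mu\in\mathbf{K}^p_\Gamma(\alpha;\mathrm{div}).$$ Let $\{\alpha_n\}$ be a sequence in $\mathrm{M}^+(\Omega)$ that converges in norm to $\alpha\in\mathrm{M}^+(\Omega)$ and satisfies the following conditions: in the Lebesgue decomposition $\alpha_n=g_n\alpha+\alpha_n^s$ with $\alpha_n^s\perp\alpha$ one has $\alpha_n^s\to0$ in norm in $\mathrm{M}(\Omega)$; for all $n$, $g_n\in\mathbf{C}_b^1(\overline{\Omega})$ and $\nabla g_n\in L^1(\Omega,\alpha)^N$; $\sup_{x\in\Omega}|g_n(x)-1|\to0$ as $n\to\infty$; for each $n$, $\nabla g_n$ vanishes on $\mathrm{supp}\,\alpha^s$, where $\alpha=F^\alpha\mathcal{L}^N+\alpha^s$ is the Lebesgue and Radon-Nikodym decomposition of $\alpha$ with respect to the Lebesgue measure $\mathcal{L}^N$ (with $\alpha^s\perp\mathcal{L}^N$); and $\||\nabla g_n|F^\alpha\|_{L^p(\Omega)}\to0$ as $n\to\infty$. Then for each $\alpha_n$ there exists a solution $\mu_n$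 to the problem $\mathbb{P}(\alpha_n)$ for which $$\mu_n\to\mu^*\ \text{narrowly in }\mathrm{M}(\Omega)^N\qquad\text{and}\qquad\mathrm{div}\,\mu_n\rightharpoonup\mathrm{div}\,\mu^*\ \text{weakly in }L^p(\Omega),$$ along a subsequence as $n\to\infty$, for some $\mu^*\in\mathbf{K}^p_\Gamma(\alpha;\mathrm{div})$ that solves $\mathbb{P}(\alpha)$.
   Context: $\Omega$ is an open subset of $\mathbb{R}^N$. $\mathrm{M}(\Omega)$ and $\mathrm{M}(\Omega)^N$ are the spaces of (finite) real-valued, respectively $\mathbb{R}^N$-valued, Borel measures on $\Omega$; $\mathrm{M}^+(\Omega)\subset\mathrm{M}(\Omega)$ is the set of non-negative ones. $|\mu|$ is the total variation measure (Euclidean norm), and $\|\mu\|_{\mathrm{M}(\Omega)^N}=|\mu|(\Omega)$. $\mu\le\sigma$ means $\sigma-\mu\in\mathrm{M}^+(\Omega)$. For $\phi=(\phi_i)$, $\int_\Omega\phi\cdot d\mu=\sum_i\int_\Omega\phi_i\,d\mu_i$. The sequence $\mu_n$ converges narrowly to $\mu$ if $\int_\Omega\phi\cdot d\mu_n\to\int_\Omega\phi\cdot d\mu$ for all $\phi\in C_b(\Omega)^N$ (bounded continuous functions). The support of a measure on $\Omega$ is the smallest relatively closed $C\subset\Omega$ whose complement in $\Omega$ has zero total variation. $g_n$ denotes the Radon-Nikodym density of the $\alpha$-absolutely continuous part of $\alpha_n$ (assumed to have the stated regular representative). $\mathrm{M}^p(\Omega;\mathrm{div})$ is the set of $\mu\in\mathrm{M}(\Omega)^N$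 for which there is $h\in L^p(\Omega)$ with $\int_\Omega\nabla\phi\cdot d\mu=-\int_\Omega\phi h\,dx$ for all $\phi\in C_c^\infty(\Omega)$; then $\mathrm{div}\,\mu:=h$. $C_b^1(\Omega)$ is the space of bounded functions in $C^1(\Omega)$ with bounded partial derivatives, and $\mathbf{C}_b^1(\overline{\Omega})=C_b^1(\Omega)\cap C(\overline{\Omega})$ is the subspace of those that extend continuously to $\overline{\Omega}$. The normal trace is $\mathrm{N}(\phi,\mu)=\int_\Omega\nabla\phi\cdot d\mu+\int_\Omega\phi\,\mathrm{div}\,\mu\,dx$. For non-empty $\Gamma\subset\partial\Omega$, $\mathrm{M}^p_\Gamma(\Omega;\mathrm{div})$ is the set of $\mu\in\mathrm{M}^p(\Omega;\mathrm{div})$ with $\mathrm{N}(\phi,\mu)=0$ for all $\phi\in\mathbf{C}_b^1(\overline{\Omega})$ such that $\phi=0$ on $\overline{\partial\Omega\setminus\Gamma}$; for $\Gamma=\emptyset$, $\mathrm{M}^p_\Gamma(\Omega;\mathrm{div})=\mathrm{M}^p(\Omega;\mathrm{div})$. $\mathbf{K}^p_\Gamma(\alpha;\mathrm{div})=\{\sigma\in\mathrm{M}^p_\Gamma(\Omega;\mathrm{div}):|\sigma|\le\alpha\}$. *)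

theory Defs
  imports "HOL-Analysis.Analysis"
begin

section \<open>Finite signed and vector-valued Borel measures\<close>

abbreviation borel_on :: "'a::topological_space set \<Rightarrow> 'a measure" where
  "borel_on \<Omega> \<equiv> restrict_space borel \<Omega>"

text \<open>Vector-valued measures are countably additive set functions; their values on non-Borel sets
  are irrelevant. Non-negative finite measures are library measures.\<close>

definition vec_measures :: "'a::topological_space set \<Rightarrow> ('a set \<Rightarrow> 'b::real_normed_vector) set" where
  "vec_measures \<Omega> = {\<mu>. \<forall>A. range A \<subseteq> sets (borel_on \<Omega>) \<and> disjoint_family A
      \<longrightarrow> (\<lambda>i::nat. \<mu> (A i)) sums \<mu> (\<Union>i. A i)}"

definition pos_measures :: "'a::topological_space set \<Rightarrow> 'a measure set" where
  "pos_measures \<Omega> = {\<alpha>. sets \<alpha> = sets (borel_on \<Omega>) \<and> finite_measure \<alpha>}"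

definition variation :: "'a::topological_space set \<Rightarrow> ('a set \<Rightarrow> 'b::real_normed_vector) \<Rightarrow> 'a set \<Rightarrow> ennreal" where
  "variation \<Omega> \<mu> A =
     (SUP P\<in>{P. range P \<subseteq> sets (borel_on \<Omega>) \<and> disjoint_family P \<and> (\<Union>i::nat. P i) = A}.
        \<Sum>i. ennreal (norm (\<mu> (P i))))"

definition tot_var :: "'a::topological_space set \<Rightarrow> ('a set \<Rightarrow> 'b::real_normed_vector) \<Rightarrow> 'a measure" where
  "tot_var \<Omega> \<mu> = measure_of \<Omega> (sets (borel_on \<Omega>)) (variation \<Omega> \<mu>)"

definition vm_norm :: "'a::topological_space set \<Rightarrow> ('a set \<Rightarrow> 'b::real_normed_vector) \<Rightarrow> ennreal" where
  "vm_norm \<Omega> \<mu> = emeasure (tot_var \<Omega> \<mu>) \<Omega>"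

text \<open>The positive part in the Jordan decomposition of a signed measure. The embedding
  \<^const>\<open>ennreal\<close> sends negative reals to 0, which does not affect the supremum because
  the empty set is admissible.\<close>

definition upper_variation :: "'a::topological_space set \<Rightarrow> ('a set \<Rightarrow> real) \<Rightarrow> 'a set \<Rightarrow> ennreal" where
  "upper_variation \<Omega> \<nu> A = (SUP B\<in>{B\<in>sets (borel_on \<Omega>). B \<subseteq> A}. ennreal (\<nu> B))"

definition pos_part :: "'a::topological_space set \<Rightarrow> ('a set \<Rightarrow> real) \<Rightarrow> 'a measure" where
  "pos_part \<Omega> \<nu> = measure_of \<Omega> (sets (borel_on \<Omega>)) (upper_variation \<Omega> \<nu>)"

definition signed_integral :: "'a::topological_space set \<Rightarrow> ('a set \<Rightarrow> real) \<Rightarrow> ('a \<Rightarrow> real) \<Rightarrow> real" where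
  "signed_integral \<Omega> \<nu> \<phi> = (LINT x|pos_part \<Omega> \<nu>. \<phi> x) - (LINT x|pos_part \<Omega> (\<lambda>A. - \<nu> A). \<phi> x)"

definition vec_integral ::
  "'a::topological_space set \<Rightarrow> ('a set \<Rightarrow> real^'n) \<Rightarrow> ('a \<Rightarrow> real^'n) \<Rightarrow> real" where
  "vec_integral \<Omega> \<mu> \<phi> = (\<Sum>i\<in>UNIV. signed_integral \<Omega> (\<lambda>A. \<mu> A $ i) (\<lambda>x. \<phi> x $ i))"

definition narrowly_converges ::
  "'a::topological_space set \<Rightarrow> (nat \<Rightarrow> 'a set \<Rightarrow> real^'n) \<Rightarrow> ('a set \<Rightarrow> real^'n) \<Rightarrow> bool" where
  "narrowly_converges \<Omega> \<mu>s \<mu> \<longleftrightarrow>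
     (\<forall>\<phi>. continuous_on \<Omega> \<phi> \<and> bounded (\<phi> ` \<Omega>)
        \<longrightarrow> (\<lambda>n. vec_integral \<Omega> (\<mu>s n) \<phi>) \<longlonglongrightarrow> vec_integral \<Omega> \<mu> \<phi>)"

definition mutually_singular :: "'a measure \<Rightarrow> 'a measure \<Rightarrow> bool" where
  "mutually_singular \<mu> \<nu> \<longleftrightarrow>
     (\<exists>S\<in>sets \<mu> \<inter> sets \<nu>. emeasure \<mu> S = 0 \<and> emeasure \<nu> (space \<nu> - S) = 0)"

text \<open>\<open>\<alpha> = g \<rho> + s\<close> with \<open>s\<close> singular to \<open>\<rho>\<close>. The reference measure \<open>\<rho>\<close> may live on a larger
  \<open>\<sigma>\<close>-algebra than \<open>\<alpha>\<close>, as Lebesgue measure does.\<close>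

definition lebesgue_decomposition ::
  "'a::topological_space set \<Rightarrow> 'a measure \<Rightarrow> 'a measure \<Rightarrow> ('a \<Rightarrow> real) \<Rightarrow> 'a measure \<Rightarrow> bool" where
  "lebesgue_decomposition \<Omega> \<alpha> \<rho> g s \<longleftrightarrow>
     s \<in> pos_measures \<Omega> \<and> mutually_singular s \<rho> \<and> integrable \<rho> g \<and>
     (\<forall>A\<in>sets (borel_on \<Omega>). measure \<alpha> A = (LINT x:A|\<rho>. g x) + measure s A)"

definition measure_support :: "'a::topological_space set \<Rightarrow> 'a measure \<Rightarrow> 'a set" where
  "measure_support \<Omega> \<nu> = \<Inter>{C. closedin (top_of_set \<Omega>) C \<and> emeasure \<nu> (\<Omega> - C) = 0}"


section \<open>Lebesgue and classical function spaces\<close>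

definition Lp_space :: "(real^'n) set \<Rightarrow> real \<Rightarrow> (real^'n \<Rightarrow> real) set" where
  "Lp_space \<Omega> p = {u. u \<in> borel_measurable (lebesgue_on \<Omega>) \<and>
      integrable (lebesgue_on \<Omega>) (\<lambda>x. \<bar>u x\<bar> powr p)}"

definition Lp_norm :: "(real^'n) set \<Rightarrow> real \<Rightarrow> (real^'n \<Rightarrow> real) \<Rightarrow> ennreal" where
  "Lp_norm \<Omega> p u = (let I = (\<integral>\<^sup>+x. ennreal (\<bar>u x\<bar> powr p) \<partial>lebesgue_on \<Omega>) in
      if I = \<infinity> then \<infinity> else ennreal (enn2real I powr (1 / p)))"

definition weakly_converges_Lp ::
  "(real^'n) set \<Rightarrow> real \<Rightarrow> (nat \<Rightarrow> real^'n \<Rightarrow> real) \<Rightarrow> (real^'n \<Rightarrow> real) \<Rightarrow> bool" where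
  "weakly_converges_Lp \<Omega> p us u \<longleftrightarrow> (\<forall>n. us n \<in> Lp_space \<Omega> p) \<and> u \<in> Lp_space \<Omega> p \<and>
     (\<forall>\<psi>\<in>Lp_space \<Omega> (p / (p - 1)).
        (\<lambda>n. LINT x|lebesgue_on \<Omega>. us n x * \<psi> x) \<longlonglongrightarrow> (LINT x|lebesgue_on \<Omega>. u x * \<psi> x))"

definition grad :: "(real^'n \<Rightarrow> real) \<Rightarrow> real^'n \<Rightarrow> real^'n" where
  "grad \<phi> x = (\<chi> i. frechet_derivative \<phi> (at x) (axis i 1))"

text \<open>\<open>C\<^sup>k\<close> on an open set, by iterated partial derivatives.\<close>

fun Ck_on :: "nat \<Rightarrow> (real^'n) set \<Rightarrow> (real^'n \<Rightarrow> real) \<Rightarrow> bool" where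
  "Ck_on 0 \<Omega> \<phi> \<longleftrightarrow> continuous_on \<Omega> \<phi>"
| "Ck_on (Suc k) \<Omega> \<phi> \<longleftrightarrow> (\<forall>x\<in>\<Omega>. \<phi> differentiable (at x)) \<and> (\<forall>i. Ck_on k \<Omega> (\<lambda>x. grad \<phi> x $ i))"

definition test_fun :: "(real^'n) set \<Rightarrow> (real^'n \<Rightarrow> real) set" where
  "test_fun \<Omega> = {\<phi>. (\<forall>k. Ck_on k \<Omega> \<phi>) \<and> (\<exists>K. compact K \<and> K \<subseteq> \<Omega> \<and> (\<forall>x\<in>\<Omega> - K. \<phi> x = 0))}"

definition Cb1 :: "(real^'n) set \<Rightarrow> (real^'n \<Rightarrow> real) set" where
  "Cb1 \<Omega> = {\<phi>. Ck_on 1 \<Omega> \<phi> \<and> bounded (\<phi> ` \<Omega>) \<and> bounded (grad \<phi> ` \<Omega>)}"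

text \<open>Members are represented by their continuous extension to the closure.\<close>

definition Cb1_bar :: "(real^'n) set \<Rightarrow> (real^'n \<Rightarrow> real) set" where
  "Cb1_bar \<Omega> = {\<phi>\<in>Cb1 \<Omega>. continuous_on (closure \<Omega>) \<phi>}"


section \<open>Measures with divergence in \<open>L\<^sup>p\<close>\<close>

definition has_divergence ::
  "(real^'n) set \<Rightarrow> real \<Rightarrow> ((real^'n) set \<Rightarrow> real^'n) \<Rightarrow> (real^'n \<Rightarrow> real) \<Rightarrow> bool" where
  "has_divergence \<Omega> p \<mu> h \<longleftrightarrow> h \<in> Lp_space \<Omega> p \<and>
     (\<forall>\<phi>\<in>test_fun \<Omega>. vec_integral \<Omega> \<mu> (grad \<phi>) = - (LINT x|lebesgue_on \<Omega>. \<phi> x * h x))"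

definition Mdiv :: "(real^'n) set \<Rightarrow> real \<Rightarrow> ((real^'n) set \<Rightarrow> real^'n) set" where
  "Mdiv \<Omega> p = {\<mu>\<in>vec_measures \<Omega>. \<exists>h. has_divergence \<Omega> p \<mu> h}"

text \<open>An arbitrary representative of the almost everywhere unique divergence.\<close>

definition vdiv :: "(real^'n) set \<Rightarrow> real \<Rightarrow> ((real^'n) set \<Rightarrow> real^'n) \<Rightarrow> real^'n \<Rightarrow> real" where
  "vdiv \<Omega> p \<mu> = (SOME h. has_divergence \<Omega> p \<mu> h)"

definition normal_trace ::
  "(real^'n) set \<Rightarrow> real \<Rightarrow> (real^'n \<Rightarrow> real) \<Rightarrow> ((real^'n) set \<Rightarrow> real^'n) \<Rightarrow> real" where
  "normal_trace \<Omega> p \<phi> \<mu> =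
     vec_integral \<Omega> \<mu> (grad \<phi>) + (LINT x|lebesgue_on \<Omega>. \<phi> x * vdiv \<Omega> p \<mu> x)"

text \<open>The integrability condition only says that the normal trace is defined. It is automatic if
  \<open>\<Omega>\<close> has finite Lebesgue measure, but for general open \<open>\<Omega>\<close> a bounded function times an \<open>L\<^sup>p\<close>
  function need not be integrable, and the Bochner integral would then be 0 by convention.\<close>

definition Mdiv_bc :: "(real^'n) set \<Rightarrow> real \<Rightarrow> (real^'n) set \<Rightarrow> ((real^'n) set \<Rightarrow> real^'n) set" where
  "Mdiv_bc \<Omega> p \<Gamma> = (if \<Gamma> = {} then Mdiv \<Omega> p else
     {\<mu>\<in>Mdiv \<Omega> p. \<forall>\<phi>\<in>Cb1_bar \<Omega>.
        (\<forall>x\<in>closure (frontier \<Omega> - \<Gamma>). \<phi> x = 0) \<and>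
        integrable (lebesgue_on \<Omega>) (\<lambda>x. \<phi> x * vdiv \<Omega> p \<mu> x)
        \<longrightarrow> normal_trace \<Omega> p \<phi> \<mu> = 0})"

definition Kdiv :: "(real^'n) set \<Rightarrow> real \<Rightarrow> (real^'n) set \<Rightarrow> (real^'n) measure
    \<Rightarrow> ((real^'n) set \<Rightarrow> real^'n) set" where
  "Kdiv \<Omega> p \<Gamma> \<alpha> = {\<sigma>\<in>Mdiv_bc \<Omega> p \<Gamma>.
     \<forall>A\<in>sets (borel_on \<Omega>). emeasure (tot_var \<Omega> \<sigma>) A \<le> emeasure \<alpha> A}"

definition objective :: "(real^'n) set \<Rightarrow> real \<Rightarrow> (real^'n \<Rightarrow> real) \<Rightarrow> (real^'n \<Rightarrow> real)
    \<Rightarrow> ((real^'n) set \<Rightarrow> real^'n) \<Rightarrow> real" where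
  "objective \<Omega> p f \<beta> \<mu> =
     1 / p * (LINT x|lebesgue_on \<Omega>. \<bar>vdiv \<Omega> p \<mu> x - f x\<bar> powr p) + (LINT x|tot_var \<Omega> \<mu>. \<beta> x)"

definition solves :: "(real^'n) set \<Rightarrow> real \<Rightarrow> (real^'n) set \<Rightarrow> (real^'n \<Rightarrow> real) \<Rightarrow> (real^'n \<Rightarrow> real)
    \<Rightarrow> (real^'n) measure \<Rightarrow> ((real^'n) set \<Rightarrow> real^'n) \<Rightarrow> bool" where
  "solves \<Omega> p \<Gamma> f \<beta> \<alpha> \<mu> \<longleftrightarrow> \<mu> \<in> Kdiv \<Omega> p \<Gamma> \<alpha> \<and>
     (\<forall>\<sigma>\<in>Kdiv \<Omega> p \<Gamma> \<alpha>. objective \<Omega> p f \<beta> \<mu> \<le> objective \<Omega> p f \<beta> \<sigma>)"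


section \<open>The variations are measures\<close>

lemma countably_additive_from_sub_super:
  fixes m :: "'a set \<Rightarrow> ennreal"
  assumes S: "sigma_algebra X S" and empty: "m {} = 0"
    and mono: "\<And>A B. A \<in> S \<Longrightarrow> B \<in> S \<Longrightarrow> A \<subseteq> B \<Longrightarrow> m A \<le> m B"
    and super: "\<And>A B. A \<in> S \<Longrightarrow> B \<in> S \<Longrightarrow> A \<inter> B = {} \<Longrightarrow> m A + m B \<le> m (A \<union> B)"
    and sub: "\<And>A. range A \<subseteq> S \<Longrightarrow> disjoint_family A \<Longrightarrow> m (\<Union>i::nat. A i) \<le> (\<Sum>i. m (A i))"
  shows "countably_additive S m"
proof (rule countably_additiveI)
  fix A :: "nat \<Rightarrow> 'a set"
  assume A: "range A \<subseteq> S" "disjoint_family A" "(\<Union>i. A i) \<in> S"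
  interpret sigma_algebra X S by fact
  have fin: "(\<Sum>i<n. m (A i)) \<le> m (\<Union>i<n. A i)" for n
  proof (induction n)
    case (Suc n)
    have "A i \<inter> A n = {}" if "i < n" for i
      using A(2) that by (simp add: disjoint_family_on_def)
    then have "(\<Union>i<n. A i) \<inter> A n = {}"
      by blast
    then have 1: "m (\<Union>i<n. A i) + m (A n) \<le> m ((\<Union>i<n. A i) \<union> A n)"
      using A(1) by (intro super finite_UN) auto
    have 2: "(\<Union>i<n. A i) \<union> A n = (\<Union>i<Suc n. A i)"
      by (auto simp: less_Suc_eq)
    have "(\<Sum>i<Suc n. m (A i)) \<le> m (\<Union>i<n. A i) + m (A n)"
      unfolding sum.lessThan_Suc by (rule add_right_mono[OF Suc])
    also note 1
    finally show ?case unfolding 2 .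
  qed (simp add: empty)
  have "(\<Sum>i<n. m (A i)) \<le> m (\<Union>i. A i)" for n
    using A by (intro order_trans[OF fin] mono) auto
  then have "(\<Sum>i. m (A i)) \<le> m (\<Union>i. A i)"
    by (intro suminf_le_const) auto
  with sub[OF A(1,2)] show "(\<Sum>i. m (A i)) = m (\<Union>i. A i)"
    by simp
qed

lemma vec_measures_sums:
  assumes "\<mu> \<in> vec_measures \<Omega>" "range A \<subseteq> sets (borel_on \<Omega>)" "disjoint_family A"
    and "(\<Union>i::nat. A i) = B"
  shows "(\<lambda>i. \<mu> (A i)) sums \<mu> B"
  using assms unfolding vec_measures_def by blast

lemma vec_measures_empty: "\<mu> \<in> vec_measures \<Omega> \<Longrightarrow> \<mu> {} = 0"
proof -
  assume "\<mu> \<in> vec_measures \<Omega>"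
  then have "(\<lambda>i::nat. \<mu> {}) sums \<mu> {}"
    by (rule vec_measures_sums) (auto simp: disjoint_family_on_def)
  then show ?thesis
    using summable_LIMSEQ_zero sums_summable LIMSEQ_const_iff by blast
qed

lemma vec_measures_Un:
  assumes "\<mu> \<in> vec_measures \<Omega>" "A \<in> sets (borel_on \<Omega>)" "B \<in> sets (borel_on \<Omega>)" "A \<inter> B = {}"
  shows "\<mu> (A \<union> B) = \<mu> A + \<mu> B"
proof -
  have "(\<lambda>i. \<mu> (binaryset A B i)) sums \<mu> (\<Union>i. binaryset A B i)"
    using assms by (intro vec_measures_sums)
      (auto simp: range_binaryset_eq disjoint_family_on_def binaryset_def)
  moreover have "(\<lambda>i. \<mu> (binaryset A B i)) sums (\<mu> A + \<mu> B)"
    using binaryset_sums[of \<mu>] vec_measures_empty[OF assms(1)] by blast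
  ultimately show ?thesis
    by (metis UN_binaryset_eq sums_unique2)
qed

lemma norm_sums_le_suminf:
  fixes f :: "nat \<Rightarrow> 'b::real_normed_vector"
  assumes "f sums s"
  shows "ennreal (norm s) \<le> (\<Sum>i. ennreal (norm (f i)))"
proof (rule LIMSEQ_le_const2)
  show "(\<lambda>n. ennreal (norm (\<Sum>i<n. f i))) \<longlonglongrightarrow> ennreal (norm s)"
    using assms by (intro tendsto_ennrealI tendsto_norm) (simp add: sums_def)
  have "ennreal (norm (\<Sum>i<n. f i)) \<le> (\<Sum>i. ennreal (norm (f i)))" for n
  proof -
    have "ennreal (norm (\<Sum>i<n. f i)) \<le> (\<Sum>i<n. ennreal (norm (f i)))"
      by (simp add: norm_sum sum_ennreal ennreal_leI)
    also have "\<dots> \<le> (\<Sum>i. ennreal (norm (f i)))"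
      by (intro sum_le_suminf) auto
    finally show ?thesis .
  qed
  then show "\<exists>N. \<forall>n\<ge>N. ennreal (norm (\<Sum>i<n. f i)) \<le> (\<Sum>i. ennreal (norm (f i)))"
    by blast
qed

lemma sums_le_suminf_ennreal:
  fixes f :: "nat \<Rightarrow> real"
  assumes "f sums s"
  shows "ennreal s \<le> (\<Sum>i. ennreal (f i))"
proof (rule LIMSEQ_le_const2)
  show "(\<lambda>n. ennreal (\<Sum>i<n. f i)) \<longlonglongrightarrow> ennreal s"
    using assms by (intro tendsto_ennrealI) (simp add: sums_def)
  have "ennreal (\<Sum>i<n. f i) \<le> (\<Sum>i. ennreal (f i))" for n
  proof -
    have "ennreal (\<Sum>i<n. f i) \<le> ennreal (\<Sum>i<n. max 0 (f i))"
      by (intro ennreal_leI sum_mono) auto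
    also have "\<dots> = (\<Sum>i<n. ennreal (max 0 (f i)))"
      by (simp add: sum_ennreal)
    also have "\<dots> = (\<Sum>i<n. ennreal (f i))"
      by (simp add: ennreal_max_0)
    also have "\<dots> \<le> (\<Sum>i. ennreal (f i))"
      by (intro sum_le_suminf) auto
    finally show ?thesis .
  qed
  then show "\<exists>N. \<forall>n\<ge>N. ennreal (\<Sum>i<n. f i) \<le> (\<Sum>i. ennreal (f i))"
    by blast
qed

lemma sigma_algebra_borel_on: "sigma_algebra \<Omega> (sets (borel_on \<Omega>))"
  using sets.sigma_algebra_axioms[of "borel_on \<Omega>"] by (simp add: space_restrict_space)

lemma variation_ge:
  assumes "range P \<subseteq> sets (borel_on \<Omega>)" "disjoint_family P" "(\<Union>i::nat. P i) = A"
  shows "(\<Sum>i. ennreal (norm (\<mu> (P i)))) \<le> variation \<Omega> \<mu> A"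
  unfolding variation_def using assms by (intro SUP_upper) auto

lemma variation_super:
  assumes "A \<in> sets (borel_on \<Omega>)" "B \<in> sets (borel_on \<Omega>)" "A \<inter> B = {}"
  shows "variation \<Omega> \<mu> A + variation \<Omega> \<mu> B \<le> variation \<Omega> \<mu> (A \<union> B)"
proof -
  let ?\<P> = "\<lambda>A. {P. range P \<subseteq> sets (borel_on \<Omega>) \<and> disjoint_family P \<and> (\<Union>i::nat. P i) = A}"
  let ?s = "\<lambda>P. \<Sum>i. ennreal (norm (\<mu> (P i)))"
  have ne: "?\<P> C \<noteq> {}" if "C \<in> sets (borel_on \<Omega>)" for C
  proof -
    have "(\<lambda>i::nat. if i = 0 then C else {}) \<in> ?\<P> C"
      using that by (auto simp: disjoint_family_on_def split: if_splits)
    then show ?thesis by blast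
  qed
  have *: "?s P + ?s Q \<le> variation \<Omega> \<mu> (A \<union> B)" if P: "P \<in> ?\<P> A" and Q: "Q \<in> ?\<P> B" for P Q
  proof -
    define R where "R i = (if even i then P (i div 2) else Q (i div 2))" for i
    have UR: "(\<Union>i. R i) = A \<union> B"
    proof
      show "(\<Union>i. R i) \<subseteq> A \<union> B"
        using P Q by (auto simp: R_def)
      have "P i = R (2 * i)" "Q i = R (2 * i + 1)" for i
        by (auto simp: R_def)
      then have "P i \<subseteq> (\<Union>i. R i)" "Q i \<subseteq> (\<Union>i. R i)" for i
        by (metis UN_upper UNIV_I)+
      moreover have "A = (\<Union>i. P i)" "B = (\<Union>i. Q i)"
        using P Q by auto
      ultimately show "A \<union> B \<subseteq> (\<Union>i. R i)"
        by (metis UN_least Un_least)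
    qed
    have dR: "disjoint_family R"
      unfolding disjoint_family_on_def
    proof (intro ballI impI)
      fix m n :: nat assume mn: "m \<noteq> n"
      have PA: "P i \<subseteq> A" and QB: "Q i \<subseteq> B" for i
        using P Q by auto
      have dP: "P i \<inter> P j = {}" and dQ: "Q i \<inter> Q j = {}" if "i \<noteq> j" for i j
        using P Q that by (auto simp: disjoint_family_on_def)
      consider "even m" "even n" | "odd m" "odd n" | "even m" "odd n" | "odd m" "even n"
        by blast
      then show "R m \<inter> R n = {}"
      proof cases
        case 1
        then have "m div 2 \<noteq> n div 2" using mn by (metis dvd_mult_div_cancel)
        with 1 show ?thesis by (simp add: R_def dP)
      next
        case 2
        then have "m div 2 \<noteq> n div 2" using mn by (metis odd_two_times_div_two_succ)
        with 2 show ?thesis by (simp add: R_def dQ)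
      next
        case 3
        then show ?thesis using PA[of "m div 2"] QB[of "n div 2"] assms(3) by (auto simp: R_def)
      next
        case 4
        then show ?thesis using PA[of "n div 2"] QB[of "m div 2"] assms(3) by (auto simp: R_def)
      qed
    qed
    have rR: "range R \<subseteq> sets (borel_on \<Omega>)"
      using P Q by (auto simp: R_def)
    have split: "(\<Sum>i<n. ennreal (norm (\<mu> (P i))) + ennreal (norm (\<mu> (Q i)))) =
        (\<Sum>i<2*n. ennreal (norm (\<mu> (R i))))" for n
      by (induction n) (simp_all add: R_def add.assoc)
    have "?s P + ?s Q = (\<Sum>i. ennreal (norm (\<mu> (P i))) + ennreal (norm (\<mu> (Q i))))"
      by (intro suminf_add) auto
    also have "\<dots> \<le> ?s R"
    proof (intro suminf_le_const)
      fix n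
      show "(\<Sum>i<n. ennreal (norm (\<mu> (P i))) + ennreal (norm (\<mu> (Q i)))) \<le> ?s R"
        unfolding split by (intro sum_le_suminf) auto
    qed auto
    also have "\<dots> \<le> variation \<Omega> \<mu> (A \<union> B)"
      by (rule variation_ge[OF rR dR UR])
    finally show ?thesis .
  qed
  have "variation \<Omega> \<mu> A + variation \<Omega> \<mu> B = (SUP P\<in>?\<P> A. SUP Q\<in>?\<P> B. ?s P + ?s Q)"
    unfolding variation_def
    by (simp only: ennreal_SUP_add_left[OF ne[OF assms(1)], symmetric]
        ennreal_SUP_add_right[OF ne[OF assms(2)], symmetric])
  also have "\<dots> \<le> variation \<Omega> \<mu> (A \<union> B)"
    by (intro SUP_least *)
  finally show ?thesis .
qed

lemma variation_empty: "\<mu> \<in> vec_measures \<Omega> \<Longrightarrow> variation \<Omega> \<mu> {} = 0"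
proof -
  assume "\<mu> \<in> vec_measures \<Omega>"
  then have "\<mu> {} = 0" by (rule vec_measures_empty)
  then have "variation \<Omega> \<mu> {} \<le> 0"
    unfolding variation_def by (intro SUP_least) auto
  then show ?thesis by simp
qed

lemma countably_additive_variation:
  assumes \<mu>: "\<mu> \<in> vec_measures \<Omega>"
  shows "countably_additive (sets (borel_on \<Omega>)) (variation \<Omega> \<mu>)"
proof (rule countably_additive_from_sub_super[OF sigma_algebra_borel_on])
  show "variation \<Omega> \<mu> {} = 0" by (rule variation_empty[OF \<mu>])
next
  fix A B assume AB: "A \<in> sets (borel_on \<Omega>)" "B \<in> sets (borel_on \<Omega>)" "A \<subseteq> B"
  then have "variation \<Omega> \<mu> A + variation \<Omega> \<mu> (B - A) \<le> variation \<Omega> \<mu> (A \<union> (B - A))"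
    by (intro variation_super) auto
  moreover have "A \<union> (B - A) = B" using AB by auto
  moreover have "variation \<Omega> \<mu> A \<le> variation \<Omega> \<mu> A + variation \<Omega> \<mu> (B - A)" by simp
  ultimately show "variation \<Omega> \<mu> A \<le> variation \<Omega> \<mu> B"
    by (metis order_trans)
next
  fix A B assume "A \<in> sets (borel_on \<Omega>)" "B \<in> sets (borel_on \<Omega>)" "A \<inter> B = {}"
  then show "variation \<Omega> \<mu> A + variation \<Omega> \<mu> B \<le> variation \<Omega> \<mu> (A \<union> B)"
    by (rule variation_super)
next
  fix A :: "nat \<Rightarrow> 'a set"
  assume A: "range A \<subseteq> sets (borel_on \<Omega>)" "disjoint_family A"
  show "variation \<Omega> \<mu> (\<Union>i. A i) \<le> (\<Sum>i. variation \<Omega> \<mu> (A i))"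
    unfolding variation_def[of _ _ "\<Union>i. A i"]
  proof (rule SUP_least, safe)
    fix P :: "nat \<Rightarrow> 'a set"
    assume P: "range P \<subseteq> sets (borel_on \<Omega>)" "disjoint_family P" "(\<Union>i. P i) = (\<Union>i. A i)"
    have PA: "P j \<inter> A i \<in> sets (borel_on \<Omega>)" for i j
      using P(1) A(1) by blast
    have "(\<lambda>i. \<mu> (P j \<inter> A i)) sums \<mu> (P j)" for j
    proof -
      have "(\<Union>i. P j \<inter> A i) = P j" using P(3) by auto
      moreover have "disjoint_family (\<lambda>i. P j \<inter> A i)"
        using A(2) by (auto simp: disjoint_family_on_def)
      ultimately show ?thesis
        using PA by (intro vec_measures_sums[OF \<mu>]) auto
    qed
    then have "(\<Sum>j. ennreal (norm (\<mu> (P j)))) \<le> (\<Sum>j. \<Sum>i. ennreal (norm (\<mu> (P j \<inter> A i))))"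
      by (intro suminf_le norm_sums_le_suminf) auto
    also have "\<dots> = (\<Sum>i. \<Sum>j. ennreal (norm (\<mu> (P j \<inter> A i))))"
      unfolding nn_integral_count_space_nat[of "\<lambda>j. \<Sum>i. ennreal (norm (\<mu> (P j \<inter> A i)))", symmetric]
      by (subst nn_integral_suminf) (simp_all add: nn_integral_count_space_nat)
    also have "\<dots> \<le> (\<Sum>i. variation \<Omega> \<mu> (A i))"
    proof (intro suminf_le variation_ge)
      fix i
      show "range (\<lambda>j. P j \<inter> A i) \<subseteq> sets (borel_on \<Omega>)" using PA by blast
      show "disjoint_family (\<lambda>j. P j \<inter> A i)"
        using P(2) by (auto simp: disjoint_family_on_def)
      show "(\<Union>j. P j \<inter> A i) = A i" using P(3) by auto
    qed auto
    finally show "(\<Sum>j. ennreal (norm (\<mu> (P j)))) \<le> (\<Sum>i. variation \<Omega> \<mu> (A i))" .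
  qed
qed

lemma sets_tot_var [simp]: "sets (tot_var \<Omega> \<mu>) = sets (borel_on \<Omega>)"
  unfolding tot_var_def
  by (rule sigma_algebra.sets_measure_of_eq[OF sigma_algebra_borel_on])

lemma emeasure_tot_var:
  assumes "\<mu> \<in> vec_measures \<Omega>" "A \<in> sets (borel_on \<Omega>)"
  shows "emeasure (tot_var \<Omega> \<mu>) A = variation \<Omega> \<mu> A"
  unfolding tot_var_def
  by (rule emeasure_measure_of_sigma[OF sigma_algebra_borel_on])
    (auto simp: positive_def variation_empty countably_additive_variation assms)

lemma upper_variation_ge:
  assumes "B \<in> sets (borel_on \<Omega>)" "B \<subseteq> A"
  shows "ennreal (\<nu> B) \<le> upper_variation \<Omega> \<nu> A"
  unfolding upper_variation_def using assms by (intro SUP_upper) auto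

lemma upper_variation_empty: "\<nu> \<in> vec_measures \<Omega> \<Longrightarrow> upper_variation \<Omega> \<nu> {} = 0"
proof -
  assume "\<nu> \<in> vec_measures \<Omega>"
  then have "\<nu> {} = 0" by (rule vec_measures_empty)
  then have "upper_variation \<Omega> \<nu> {} \<le> 0"
    unfolding upper_variation_def by (intro SUP_least) auto
  then show ?thesis by simp
qed

lemma countably_additive_upper_variation:
  assumes \<nu>: "\<nu> \<in> vec_measures \<Omega>"
  shows "countably_additive (sets (borel_on \<Omega>)) (upper_variation \<Omega> \<nu>)"
proof (rule countably_additive_from_sub_super[OF sigma_algebra_borel_on])
  show "upper_variation \<Omega> \<nu> {} = 0" by (rule upper_variation_empty[OF \<nu>])
next
  fix A B :: "'a set" assume "A \<subseteq> B"
  then show "upper_variation \<Omega> \<nu> A \<le> upper_variation \<Omega> \<nu> B"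
    unfolding upper_variation_def by (intro SUP_subset_mono order_refl) blast
next
  fix A B assume AB: "A \<in> sets (borel_on \<Omega>)" "B \<in> sets (borel_on \<Omega>)" "A \<inter> B = {}"
  let ?S = "\<lambda>A. {B\<in>sets (borel_on \<Omega>). B \<subseteq> A}"
  have ne: "?S C \<noteq> {}" for C
    using sets.empty_sets[of "borel_on \<Omega>"] by blast
  have *: "ennreal (\<nu> C) + ennreal (\<nu> D) \<le> upper_variation \<Omega> \<nu> (A \<union> B)"
    if C: "C \<in> ?S A" and D: "D \<in> ?S B" for C D
  proof -
    consider "\<nu> C \<le> 0" | "\<nu> D \<le> 0" | "\<nu> C \<ge> 0" "\<nu> D \<ge> 0" by linarith
    then show ?thesis
    proof cases
      case 1
      then show ?thesis using upper_variation_ge[of D \<Omega> "A \<union> B" \<nu>] D by (auto simp: ennreal_neg)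
    next
      case 2
      then show ?thesis using upper_variation_ge[of C \<Omega> "A \<union> B" \<nu>] C by (auto simp: ennreal_neg)
    next
      case 3
      then have "ennreal (\<nu> C) + ennreal (\<nu> D) = ennreal (\<nu> C + \<nu> D)"
        by simp
      also have "\<nu> C + \<nu> D = \<nu> (C \<union> D)"
        using AB(3) C D by (intro vec_measures_Un[OF \<nu>, symmetric]) auto
      also have "ennreal \<dots> \<le> upper_variation \<Omega> \<nu> (A \<union> B)"
        using C D by (intro upper_variation_ge) auto
      finally show ?thesis .
    qed
  qed
  have "upper_variation \<Omega> \<nu> A + upper_variation \<Omega> \<nu> B =
      (SUP C\<in>?S A. SUP D\<in>?S B. ennreal (\<nu> C) + ennreal (\<nu> D))"
    unfolding upper_variation_def
    by (simp only: ennreal_SUP_add_left[OF ne, symmetric] ennreal_SUP_add_right[OF ne, symmetric])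
  also have "\<dots> \<le> upper_variation \<Omega> \<nu> (A \<union> B)"
    by (intro SUP_least *)
  finally show "upper_variation \<Omega> \<nu> A + upper_variation \<Omega> \<nu> B \<le> upper_variation \<Omega> \<nu> (A \<union> B)" .
next
  fix A :: "nat \<Rightarrow> 'a set"
  assume A: "range A \<subseteq> sets (borel_on \<Omega>)" "disjoint_family A"
  show "upper_variation \<Omega> \<nu> (\<Union>i. A i) \<le> (\<Sum>i. upper_variation \<Omega> \<nu> (A i))"
    unfolding upper_variation_def[of _ _ "\<Union>i. A i"]
  proof (rule SUP_least, safe)
    fix B assume B: "B \<in> sets (borel_on \<Omega>)" "B \<subseteq> (\<Union>i. A i)"
    have BA: "B \<inter> A i \<in> sets (borel_on \<Omega>)" for i
      using B(1) A(1) by blast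
    have "(\<Union>i. B \<inter> A i) = B" using B(2) by auto
    moreover have "disjoint_family (\<lambda>i. B \<inter> A i)"
      using A(2) by (auto simp: disjoint_family_on_def)
    ultimately have "(\<lambda>i. \<nu> (B \<inter> A i)) sums \<nu> B"
      using BA by (intro vec_measures_sums[OF \<nu>]) auto
    then have "ennreal (\<nu> B) \<le> (\<Sum>i. ennreal (\<nu> (B \<inter> A i)))"
      by (rule sums_le_suminf_ennreal)
    also have "\<dots> \<le> (\<Sum>i. upper_variation \<Omega> \<nu> (A i))"
      using BA by (intro suminf_le upper_variation_ge) auto
    finally show "ennreal (\<nu> B) \<le> (\<Sum>i. upper_variation \<Omega> \<nu> (A i))" .
  qed
qed

lemma sets_pos_part [simp]: "sets (pos_part \<Omega> \<nu>) = sets (borel_on \<Omega>)"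
  unfolding pos_part_def
  by (rule sigma_algebra.sets_measure_of_eq[OF sigma_algebra_borel_on])

lemma emeasure_pos_part:
  assumes "\<nu> \<in> vec_measures \<Omega>" "A \<in> sets (borel_on \<Omega>)"
  shows "emeasure (pos_part \<Omega> \<nu>) A = upper_variation \<Omega> \<nu> A"
  unfolding pos_part_def
  by (rule emeasure_measure_of_sigma[OF sigma_algebra_borel_on])
    (auto simp: positive_def upper_variation_empty countably_additive_upper_variation assms)

end

theory Submission
  imports Defs "HOL-Library.Diagonal_Subsequence"
begin

text \<open>A measure bounded by \<open>\<alpha>\<close> has a density \<open>s\<close> with \<open>\<bar>s\<bar> \<le> 1\<close> with respect to \<open>\<alpha>\<close>, and the constraint becomes
  linear in the pair \<open>(s, h)\<close> of this density and the divergence. Pairs of bounded objective are weakly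
  sequentially compact, in duality with bounded functions for \<open>s\<close> and with \<open>L\<^sup>q\<close> for \<open>h\<close>, and the
  objective is lower semicontinuous by convexity. This gives minimizers as well as limits of minimizers for
  \<open>\<alpha>\<^sub>n \<rightarrow> \<alpha>\<close>. The limit is optimal because every competitor \<open>\<sigma>\<close> for \<open>\<alpha>\<close> is the limit of the competitors
  \<open>g\<^sub>n \<sigma>\<close> for \<open>\<alpha>\<^sub>n\<close>, whose divergence \<open>g\<^sub>n div \<sigma> + \<nabla>g\<^sub>n \<cdot> \<sigma>\<close> converges strongly: the last term only sees the
  part \<open>F\<close> of \<open>\<alpha>\<close>, as \<open>\<nabla>g\<^sub>n\<close> vanishes on the support of the singular part.\<close>

subsection \<open>Gradients and iterated partial derivatives\<close>

text \<open>The competitors \<open>g n\<close> \<sigma> are tested with products of \<phi> and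
  \<open>g n\<close>, which are only C^1, whereas \<open>has_divergence\<close> knows smooth tests
  only; this forces the mollification and \<open>C1_test_divergence\<close>. The divergence
  \<open>vdiv\<close> is an arbitrary representative, so a pair (s, h) fixes the objective only
  after almost everywhere uniqueness, proved with smooth bumps on boxes. Compactness is extracted in
  the fixed measure \<alpha>, although the density of the n-th minimizer belongs to
  \<open>\<alpha>n n\<close>. Densities are normalized to norm at most 1 at every point, so they
  make sense for both measures, and exchanging the measures costs at most B times their total
  variation distance for an integrand bounded by B. Convergence is obtained against all bounded
  measurable functions; it implies narrow convergence, and no tightness argument occurs. Lower
  semicontinuity comes from an affine minorant of the objective that touches it at the
  limit.\<close>

lemma has_derivative_grad:
  fixes \<phi> :: "real^'n \<Rightarrow> real"
  assumes "\<phi> differentiable (at x)"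
  shows "(\<phi> has_derivative (\<lambda>h. grad \<phi> x \<bullet> h)) (at x)"
proof -
  let ?D = "frechet_derivative \<phi> (at x)"
  have D: "(\<phi> has_derivative ?D) (at x)"
    using assms frechet_derivative_works by blast
  interpret linear ?D using D by (rule has_derivative_linear)
  have "?D h = grad \<phi> x \<bullet> h" for h
  proof -
    have "?D h = ?D (\<Sum>i\<in>UNIV. (h $ i) *\<^sub>R axis i 1)"
      using basis_expansion[of h] by (simp add: scalar_mult_eq_scaleR)
    also have "\<dots> = (\<Sum>i\<in>UNIV. h $ i * ?D (axis i 1))"
      by (simp add: sum scaleR)
    finally show ?thesis by (simp add: grad_def inner_vec_def mult.commute)
  qed
  then have "?D = (\<lambda>h. grad \<phi> x \<bullet> h)" by (rule ext)
  with D show ?thesis by (simp only:)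
qed

lemma grad_eqI:
  fixes \<phi> :: "real^'n \<Rightarrow> real"
  assumes "(\<phi> has_derivative (\<lambda>h. G \<bullet> h)) (at x)"
  shows "grad \<phi> x = G"
  using frechet_derivative_at[OF assms, symmetric]
  by (simp add: grad_def vec_eq_iff inner_axis)

lemma grad_mult:
  fixes \<phi> \<psi> :: "real^'n \<Rightarrow> real"
  assumes "\<phi> differentiable (at x)" "\<psi> differentiable (at x)"
  shows "grad (\<lambda>x. \<phi> x * \<psi> x) x = \<phi> x *\<^sub>R grad \<psi> x + \<psi> x *\<^sub>R grad \<phi> x"
  by (rule grad_eqI, rule has_derivative_eq_rhs,
      rule has_derivative_mult[OF assms[THEN has_derivative_grad]])
    (simp add: algebra_simps)

lemma grad_add:
  fixes \<phi> \<psi> :: "real^'n \<Rightarrow> real"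
  assumes "\<phi> differentiable (at x)" "\<psi> differentiable (at x)"
  shows "grad (\<lambda>x. \<phi> x + \<psi> x) x = grad \<phi> x + grad \<psi> x"
  by (rule grad_eqI, rule has_derivative_eq_rhs,
      rule has_derivative_add[OF assms[THEN has_derivative_grad]])
    (simp add: algebra_simps)

lemma has_derivative_compose_grad:
  fixes \<phi> :: "real^'n \<Rightarrow> real"
  assumes "\<phi> differentiable (at x)" "(f has_real_derivative D) (at (\<phi> x))"
  shows "((\<lambda>x. f (\<phi> x)) has_derivative (\<lambda>h. (D *\<^sub>R grad \<phi> x) \<bullet> h)) (at x)"
  by (rule has_derivative_eq_rhs,
      rule has_derivative_compose[OF has_derivative_grad[OF assms(1)]
        assms(2)[unfolded has_field_derivative_def]]) simp

lemma grad_compose: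
  fixes \<phi> :: "real^'n \<Rightarrow> real"
  assumes "\<phi> differentiable (at x)" "(f has_real_derivative D) (at (\<phi> x))"
  shows "grad (\<lambda>x. f (\<phi> x)) x = D *\<^sub>R grad \<phi> x"
  by (rule grad_eqI, rule has_derivative_compose_grad[OF assms])

lemma grad_const: "grad (\<lambda>_. c) x = 0"
  by (rule grad_eqI) simp

lemma differentiable_cong_open:
  fixes \<phi> \<psi> :: "real^'n \<Rightarrow> real"
  assumes "open \<Omega>" "x \<in> \<Omega>" "\<And>x. x \<in> \<Omega> \<Longrightarrow> \<phi> x = \<psi> x" "\<phi> differentiable (at x)"
  shows "\<psi> differentiable (at x)"
  using assms has_derivative_transform_within_open[of \<phi> _ x UNIV \<Omega> \<psi>]
  unfolding differentiable_def by metis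

lemma grad_cong_open:
  fixes \<phi> \<psi> :: "real^'n \<Rightarrow> real"
  assumes "open \<Omega>" "x \<in> \<Omega>" "\<And>x. x \<in> \<Omega> \<Longrightarrow> \<phi> x = \<psi> x" "\<phi> differentiable (at x)"
  shows "grad \<psi> x = grad \<phi> x"
  by (rule grad_eqI, rule has_derivative_transform_within_open[OF has_derivative_grad[OF assms(4)] assms(1-3)])

text \<open>On an open set differentiability and gradient depend only on nearby values, so the
  identity survives every iteration of partial derivatives. It lets the sum, product and chain
  rules, which hold only at points of differentiability, be substituted below
  \<open>Ck_on\<close>.\<close>

lemma Ck_on_cong:
  assumes "open \<Omega>" "\<And>x. x \<in> \<Omega> \<Longrightarrow> \<phi> x = \<psi> x" "Ck_on k \<Omega> \<phi>"
  shows "Ck_on k \<Omega> \<psi>"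
  using assms(2,3)
proof (induction k arbitrary: \<phi> \<psi>)
  case 0
  then show ?case using continuous_on_cong by force
next
  case (Suc k)
  have eq: "grad \<phi> x $ i = grad \<psi> x $ i" if "x \<in> \<Omega>" for x i
    using grad_cong_open[OF assms(1) that, of \<phi> \<psi>] Suc.prems that by simp
  have "Ck_on k \<Omega> (\<lambda>x. grad \<psi> x $ i)" for i
    by (rule Suc.IH[of "\<lambda>x. grad \<phi> x $ i" "\<lambda>x. grad \<psi> x $ i"]) (use Suc.prems eq in auto)
  moreover have "\<psi> differentiable (at x)" if "x \<in> \<Omega>" for x
    using differentiable_cong_open[OF assms(1) that, of \<phi> \<psi>] Suc.prems that by simp
  ultimately show ?case by simp
qed

lemma Ck_on_subset: "Ck_on k S \<phi> \<Longrightarrow> T \<subseteq> S \<Longrightarrow> Ck_on k T \<phi>"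
  by (induction k arbitrary: \<phi>) (auto intro: continuous_on_subset)

lemma Ck_on_continuous: "Ck_on k \<Omega> \<phi> \<Longrightarrow> continuous_on \<Omega> \<phi>"
  by (cases k) (auto intro!: continuous_at_imp_continuous_on differentiable_imp_continuous_within)

lemma Ck_on_Suc_imp: "Ck_on (Suc k) \<Omega> \<phi> \<Longrightarrow> Ck_on k \<Omega> \<phi>"
proof (induction k arbitrary: \<phi>)
  case 0
  then show ?case using Ck_on_continuous[OF 0] by simp
next
  case (Suc k)
  have "Ck_on (Suc k) \<Omega> (\<lambda>x. grad \<phi> x $ i)" for i
    using Suc.prems unfolding Ck_on.simps(2)[of "Suc k"] by blast
  then have "Ck_on k \<Omega> (\<lambda>x. grad \<phi> x $ i)" for i
    by (rule Suc.IH)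
  then show ?case
    using Suc.prems unfolding Ck_on.simps(2) by blast
qed

lemma Ck_on_const: "Ck_on k \<Omega> (\<lambda>_. c)"
proof (induction k arbitrary: c)
  case (Suc k)
  have "Ck_on k \<Omega> (\<lambda>x. grad (\<lambda>_. c) x $ i)" for i
    using Suc[of 0] unfolding grad_const by simp
  then show ?case by simp
qed simp

lemma Ck_on_add:
  assumes "open \<Omega>" "Ck_on k \<Omega> \<phi>" "Ck_on k \<Omega> \<psi>"
  shows "Ck_on k \<Omega> (\<lambda>x. \<phi> x + \<psi> x)"
  using assms(2,3)
proof (induction k arbitrary: \<phi> \<psi>)
  case (Suc k)
  have "Ck_on k \<Omega> (\<lambda>x. grad (\<lambda>x. \<phi> x + \<psi> x) x $ i)" for i
    by (rule Ck_on_cong[OF assms(1) _ Suc.IH[of "\<lambda>x. grad \<phi> x $ i" "\<lambda>x. grad \<psi> x $ i"]])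
      (use Suc.prems in \<open>auto simp: grad_add\<close>)
  with Suc.prems show ?case by auto
qed (auto intro: continuous_intros)

lemma Ck_on_mult:
  assumes "open \<Omega>" "Ck_on k \<Omega> \<phi>" "Ck_on k \<Omega> \<psi>"
  shows "Ck_on k \<Omega> (\<lambda>x. \<phi> x * \<psi> x)"
  using assms(2,3)
proof (induction k arbitrary: \<phi> \<psi>)
  case (Suc k)
  have "Ck_on k \<Omega> (\<lambda>x. \<phi> x * grad \<psi> x $ i + \<psi> x * grad \<phi> x $ i)" for i
    using Suc.prems Suc.prems[THEN Ck_on_Suc_imp]
    by (intro Ck_on_add[OF assms(1)] Suc.IH) auto
  then have "Ck_on k \<Omega> (\<lambda>x. grad (\<lambda>x. \<phi> x * \<psi> x) x $ i)" for i
    by (rule Ck_on_cong[OF assms(1), rotated]) (use Suc.prems in \<open>auto simp: grad_mult\<close>)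
  with Suc.prems show ?case by auto
qed (auto intro: continuous_intros)

lemma Ck_on_prod:
  assumes "open \<Omega>" "finite I" "\<And>i. i \<in> I \<Longrightarrow> Ck_on k \<Omega> (\<phi> i)"
  shows "Ck_on k \<Omega> (\<lambda>x. \<Prod>i\<in>I. \<phi> i x)"
  using assms(2,3)
  by (induction I rule: finite_induct) (auto intro: Ck_on_const Ck_on_mult[OF assms(1)])

text \<open>The derivative reproduces the exponential, which closes the induction. Needed for the
  functions 1 - exp(-k b) that fill up a box in
  \<open>Lp_zero_if_test_integrals_zero\<close>.\<close>

lemma Ck_on_exp:
  assumes "open \<Omega>" "Ck_on k \<Omega> \<phi>"
  shows "Ck_on k \<Omega> (\<lambda>x. exp (\<phi> x))"
  using assms(2)
proof (induction k arbitrary: \<phi>)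
  case (Suc k)
  have "Ck_on k \<Omega> (\<lambda>x. exp (\<phi> x) * grad \<phi> x $ i)" for i
    using Suc.prems Suc.prems[THEN Ck_on_Suc_imp]
    by (intro Ck_on_mult[OF assms(1)] Suc.IH) auto
  then have "Ck_on k \<Omega> (\<lambda>x. grad (\<lambda>x. exp (\<phi> x)) x $ i)" for i
    by (rule Ck_on_cong[OF assms(1), rotated])
      (use Suc.prems in \<open>auto simp: grad_compose[OF _ DERIV_exp]\<close>)
  moreover have "(\<lambda>x. exp (\<phi> x)) differentiable (at x)" if "x \<in> \<Omega>" for x
    using has_derivative_compose_grad[OF _ DERIV_exp, of \<phi> x] Suc.prems that
    by (auto simp: differentiable_def)
  ultimately show ?case by simp
qed (auto intro: continuous_intros)

subsection \<open>Smooth bump functions\<close>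

text \<open>For m = 0 this is the classical smooth function exp(-1/t), extended by 0. The poles of
  order m are carried along because the derivative of a member is a linear combination of members,
  so smoothness becomes one induction over the whole family.\<close>

definition flat :: "nat \<Rightarrow> real \<Rightarrow> real" where
  "flat m t = (if t \<le> 0 then 0 else exp (- 1 / t) / t ^ m)"

text \<open>Substituting u = 1/t reduces this to the decay of u^m / exp u at infinity.\<close>

lemma flat_tendsto_0: "(flat m \<longlongrightarrow> 0) (at_right 0)"
proof -
  have "((\<lambda>u. u ^ m / exp u) \<longlongrightarrow> (0::real)) at_top"
    by (rule tendsto_power_div_exp_0)
  then have "((\<lambda>t. inverse t ^ m / exp (inverse t)) \<longlongrightarrow> (0::real)) (at_right 0)"
    by (rule filterlim_compose[OF _ filterlim_inverse_at_top_right])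
  moreover have "\<forall>\<^sub>F t in at_right 0. inverse t ^ m / exp (inverse t) = flat m t"
    unfolding flat_def
    by (auto simp: eventually_at_filter exp_minus field_simps)
  ultimately show ?thesis by (rule Lim_transform_eventually)
qed

text \<open>The difference quotient of \<^term>\<open>flat m\<close> at \<open>0\<close> is \<^term>\<open>flat (Suc m)\<close>.\<close>

lemma flat_has_derivative:
  "(flat m has_real_derivative (- real m * flat (Suc m) t + flat (m + 2) t)) (at t)"
proof (cases t "0::real" rule: linorder_cases)
  case less
  have "((\<lambda>_. 0) has_real_derivative 0) (at t)" by simp
  then have "(flat m has_real_derivative 0) (at t)"
    by (rule has_field_derivative_transform_within_open[where S = "{..<0}"])
      (use less in \<open>auto simp: flat_def\<close>)
  then show ?thesis using less by (simp add: flat_def)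
next
  case greater
  have "((\<lambda>t. exp (- 1 / t) / t ^ m) has_real_derivative
      (exp (- 1 / t) * (1 / t\<^sup>2) * t ^ m - exp (- 1 / t) * (real m * t ^ (m - 1))) / (t ^ m * t ^ m)) (at t)"
    using greater by (auto intro!: derivative_eq_intros simp: power2_eq_square)
  moreover have "(exp (- 1 / t) * (1 / t\<^sup>2) * t ^ m - exp (- 1 / t) * (real m * t ^ (m - 1))) / (t ^ m * t ^ m) =
      - real m * flat (Suc m) t + flat (m + 2) t"
    using greater by (cases m) (simp_all add: flat_def field_simps power2_eq_square)
  ultimately have "((\<lambda>t. exp (- 1 / t) / t ^ m) has_real_derivative
      (- real m * flat (Suc m) t + flat (m + 2) t)) (at t)"
    by simp
  then show ?thesis
    by (rule has_field_derivative_transform_within_open[where S = "{0<..}"])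
      (use greater in \<open>auto simp: flat_def\<close>)
next
  case equal
  have "((\<lambda>h. (flat m h - flat m 0) / (h - 0)) \<longlongrightarrow> 0) (at_left 0)"
    by (rule tendsto_eventually) (auto simp: flat_def eventually_at_filter)
  moreover have "((\<lambda>h. (flat m h - flat m 0) / (h - 0)) \<longlongrightarrow> 0) (at_right 0)"
    using flat_tendsto_0[of "Suc m"]
    by (rule Lim_transform_eventually) (auto simp: flat_def eventually_at_filter field_simps)
  ultimately have "((\<lambda>h. (flat m h - flat m 0) / (h - 0)) \<longlongrightarrow> 0) (at 0)"
    by (simp add: filterlim_split_at)
  then show ?thesis using equal
    by (simp add: has_field_derivative_iff flat_def)
qed

text \<open>Affine arguments c x_i + d cover both x_i - a_i and b_i - x_i, the distances to the two
  faces of a box.\<close>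

lemma grad_flat_affine:
  "grad (\<lambda>x::real^'n. flat m (c * x $ i + d)) x $ j =
     (if i = j then c else 0) * (- real m) * flat (Suc m) (c * x $ i + d)
     + (if i = j then c else 0) * flat (m + 2) (c * x $ i + d)" (is ?grad)
  and differentiable_flat_affine:
  "(\<lambda>x::real^'n. flat m (c * x $ i + d)) differentiable (at x)" (is ?diff)
proof -
  have D: "((\<lambda>x::real^'n. c * x $ i + d) has_derivative (\<lambda>h. (c *\<^sub>R axis i 1) \<bullet> h)) (at x)"
    by (auto intro!: derivative_eq_intros bounded_linear_imp_has_derivative bounded_linear_vec_nth
        simp: inner_axis' fun_eq_iff)
  then have d: "(\<lambda>x::real^'n. c * x $ i + d) differentiable (at x)"
    by (auto simp: differentiable_def)
  show ?grad
    unfolding grad_compose[OF d flat_has_derivative] grad_eqI[OF D]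
    by (simp add: axis_def algebra_simps)
  show ?diff
    using has_derivative_compose_grad[OF d flat_has_derivative, of m]
    by (auto simp: differentiable_def)
qed

text \<open>The induction is over all m at once, as differentiation leads from m to m + 1 and m +
  2.\<close>

lemma Ck_on_flat_affine: "Ck_on k UNIV (\<lambda>x::real^'n. flat m (c * x $ i + d))"
proof (induction k arbitrary: m)
  case 0
  show ?case
    using differentiable_flat_affine[of m c i d]
    by (auto intro!: continuous_at_imp_continuous_on differentiable_imp_continuous_within)
next
  case (Suc k)
  have "Ck_on k UNIV (\<lambda>x. grad (\<lambda>x::real^'n. flat m (c * x $ i + d)) x $ j)" for j
    unfolding grad_flat_affine
    by (intro Ck_on_add Ck_on_mult Ck_on_const Suc open_UNIV)
  then show ?case by (simp add: differentiable_flat_affine)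
qed

text \<open>A smooth function that is positive exactly on the open box. The factors are spelled as c
  x_i + d with c = 1 and c = -1 so that \<open>Ck_on_flat_affine\<close> matches them.\<close>

definition bump :: "real^'n \<Rightarrow> real^'n \<Rightarrow> real^'n \<Rightarrow> real" where
  "bump a b x = (\<Prod>i\<in>UNIV. flat 0 (1 * x $ i + - a $ i) * flat 0 (- 1 * x $ i + b $ i))"

lemma Ck_on_bump: "Ck_on k UNIV (bump a b)"
  unfolding bump_def[abs_def]
  by (intro Ck_on_prod Ck_on_mult open_UNIV Ck_on_flat_affine) auto

lemma bump_nonneg: "0 \<le> bump a b x"
  unfolding bump_def by (intro prod_nonneg) (auto simp: flat_def)

lemma bump_pos_iff: "0 < bump a b x \<longleftrightarrow> x \<in> box a b"
proof
  assume "x \<in> box a b"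
  then show "0 < bump a b x"
    unfolding bump_def by (intro prod_pos) (simp add: mem_box_cart flat_def not_le zero_less_mult_iff)
next
  assume "0 < bump a b x"
  then have "bump a b x \<noteq> 0" by simp
  then have "\<forall>i. flat 0 (1 * x $ i + - a $ i) * flat 0 (- 1 * x $ i + b $ i) \<noteq> 0"
    unfolding bump_def by simp
  then show "x \<in> box a b"
    by (auto simp: mem_box_cart flat_def not_le[symmetric] split: if_splits)
qed

lemma bump_eq_0: "x \<notin> box a b \<Longrightarrow> bump a b x = 0"
  using bump_pos_iff[of a b x] bump_nonneg[of a b x] by linarith

subsection \<open>Mollification\<close>

lemma uniformly_continuous_on_compact_support:
  fixes f :: "'a::euclidean_space \<Rightarrow> 'b::metric_space"
  assumes "continuous_on UNIV f" "\<And>x. R < norm x \<Longrightarrow> f x = c"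
  shows "uniformly_continuous_on UNIV f"
  unfolding uniformly_continuous_on_def
proof (intro allI impI)
  fix e :: real assume "0 < e"
  have "uniformly_continuous_on (cball 0 (R + 1)) f"
    using assms(1) by (intro compact_uniformly_continuous continuous_on_subset[OF assms(1)]) auto
  then obtain d where d: "0 < d" "\<And>x y. x \<in> cball 0 (R + 1) \<Longrightarrow> y \<in> cball 0 (R + 1) \<Longrightarrow> dist y x < d \<Longrightarrow> dist (f y) (f x) < e"
    using \<open>0 < e\<close> unfolding uniformly_continuous_on_def by meson
  show "\<exists>d>0. \<forall>x\<in>UNIV. \<forall>x'\<in>UNIV. dist x' x < d \<longrightarrow> dist (f x') (f x) < e"
  proof (intro exI[of _ "min d 1"] conjI ballI impI)
    fix x y :: 'a assume xy: "dist y x < min d 1"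
    show "dist (f y) (f x) < e"
    proof (cases "norm x \<le> R + 1 \<and> norm y \<le> R + 1")
      case True
      then show ?thesis using xy by (intro d(2)) auto
    next
      case False
      have "norm x \<le> norm y + dist y x" "norm y \<le> norm x + dist y x"
        by (metis dist_norm norm_minus_commute norm_triangle_sub add.commute)+
      then have "R < norm x" "R < norm y" using False xy by auto
      then show ?thesis using assms(2) \<open>0 < e\<close> by simp
    qed
  qed (use d in auto)
qed

lemma grad_eq_0_outside:
  fixes u :: "real^'n \<Rightarrow> real"
  assumes "\<And>x. R < norm x \<Longrightarrow> u x = 0" "R < norm x"
  shows "grad u x = 0"
proof -
  have "open {x::real^'n. R < norm x}"
    by (intro open_Collect_less continuous_intros)
  then have "grad u x = grad (\<lambda>_. 0) x"
    using assms by (intro grad_cong_open[where \<Omega> = "{x. R < norm x}"]) auto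
  then show ?thesis by (simp add: grad_const)
qed

lemma bounded_compact_support:
  fixes f :: "'a::euclidean_space \<Rightarrow> 'b::real_normed_vector"
  assumes "continuous_on UNIV f" "\<And>x. R < norm x \<Longrightarrow> f x = 0"
  obtains B where "\<And>x. norm (f x) \<le> B" "0 \<le> B"
proof -
  have "bounded (f ` cball 0 R)"
    by (intro compact_imp_bounded compact_continuous_image continuous_on_subset[OF assms(1)]) auto
  then obtain B where B: "\<forall>x\<in>cball 0 R. norm (f x) \<le> B"
    unfolding bounded_iff by auto
  then have "norm (f x) \<le> max B 0" for x
    using assms(2)[of x] B by (cases "norm x \<le> R") (auto simp: le_max_iff_disj not_le)
  then show thesis using that[of "max B 0"] by auto
qed

lemma integrable_compact_support:
  fixes f :: "'a::euclidean_space \<Rightarrow> 'b::{banach, second_countable_topology}"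
  assumes "continuous_on UNIV f" "\<And>x. R < norm x \<Longrightarrow> f x = 0"
  shows "integrable lborel f"
proof -
  obtain B where B: "\<And>x. norm (f x) \<le> B" "0 \<le> B"
    using bounded_compact_support[OF assms] by blast
  have "integrable lborel (\<lambda>x. B * indicator (cball 0 R) x :: real)"
    by (intro integrable_mult_right integrable_real_indicator) (simp_all add: emeasure_bounded_finite[OF bounded_cball, unfolded infinity_ennreal_def])
  then show ?thesis
  proof (rule Bochner_Integration.integrable_bound)
    show "f \<in> borel_measurable lborel"
      using borel_measurable_continuous_onI[OF assms(1)] by simp
    show "AE x in lborel. norm (f x) \<le> norm (B * indicator (cball 0 R) x :: real)"
      using assms(2) B by (auto simp: indicator_def)
  qed
qed

lemma continuous_on_grad:
  assumes "\<And>i. continuous_on S (\<lambda>x. grad u x $ i)"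
  shows "continuous_on S (grad u)"
  using continuous_on_vec_lambda[of S "\<lambda>i x. grad u x $ i", OF assms] by simp

lemma lebesgue_integral_norm_le:
  fixes f :: "'a \<Rightarrow> 'b::{banach, second_countable_topology}"
  assumes "integrable M f" "integrable M g" "\<And>x. x \<in> space M \<Longrightarrow> norm (f x) \<le> g x"
  shows "norm (integral\<^sup>L M f) \<le> integral\<^sup>L M g"
  using integral_norm_bound[of M f] integral_mono[OF integrable_norm[OF assms(1)] assms(2,3)]
  by linarith

text \<open>The factor \<open>u\<close> may be vector-valued so that the convolution of a gradient
  is of the same form. Derivatives always fall on \<open>u\<close>; the factor \<open>v\<close> is
  merely integrable.\<close>

definition convol :: "(real^'n \<Rightarrow> 'b::{banach, second_countable_topology}) \<Rightarrow> (real^'n \<Rightarrow> real) \<Rightarrow> real^'n \<Rightarrow> 'b" where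
  "convol u v x = (LINT y|lborel. v y *\<^sub>R u (x - y))"

lemma integrable_convol:
  fixes u :: "real^'n \<Rightarrow> 'b::{banach, second_countable_topology}"
  assumes "continuous_on UNIV u" "\<And>x. R < norm x \<Longrightarrow> u x = 0" "integrable lborel v"
  shows "integrable lborel (\<lambda>y. v y *\<^sub>R u (x - y))"
proof -
  obtain B where B: "\<And>x. norm (u x) \<le> B" "0 \<le> B"
    using bounded_compact_support[OF assms(1,2)] by blast
  have "integrable lborel (\<lambda>y. B * v y)" using assms(3) by simp
  then show ?thesis
  proof (rule Bochner_Integration.integrable_bound)
    have "(\<lambda>y. u (x - y)) \<in> borel_measurable borel"
      by (intro borel_measurable_continuous_onI continuous_on_compose2[OF assms(1)] continuous_intros) auto
    then show "(\<lambda>y. v y *\<^sub>R u (x - y)) \<in> borel_measurable lborel"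
      using borel_measurable_integrable[OF assms(3)] by (intro borel_measurable_scaleR) simp_all
    show "AE y in lborel. norm (v y *\<^sub>R u (x - y)) \<le> norm (B * v y)"
      using B by (intro AE_I2) (simp add: abs_mult mult.commute[of B] mult_left_mono)
  qed
qed

text \<open>The gradient of u is uniformly continuous, so the linearization error of u is small
  relative to the increment uniformly in the base point. Integrating this error against v gives the
  differentiability of the convolution directly.\<close>

lemma convol_has_derivative:
  fixes u :: "real^'n \<Rightarrow> real"
  assumes u: "\<And>x. u differentiable (at x)" and g: "continuous_on UNIV (grad u)"
    and supp: "\<And>x. R < norm x \<Longrightarrow> u x = 0" and v: "integrable lborel v"
  shows "(convol u v has_derivative (\<lambda>h. convol (grad u) v x \<bullet> h)) (at x)"
  unfolding has_derivative_at_alt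
proof (intro conjI allI impI)
  show "bounded_linear ((\<bullet>) (convol (grad u) v x))" by (rule bounded_linear_inner_right)
  fix e :: real assume "0 < e"
  \<comment> \<open>The summand 1 keeps V positive for v = 0; the accuracy e / V is chosen so that
    integration against v returns at most e.\<close>
  define V where "V = (LINT y|lborel. \<bar>v y\<bar>) + 1"
  have "0 < V" unfolding V_def by (intro add_nonneg_pos integral_nonneg_AE) auto
  have cu: "continuous_on UNIV u"
    using u by (auto intro!: continuous_at_imp_continuous_on differentiable_imp_continuous_within)
  have supp': "grad u x = 0" if "R < norm x" for x
    using supp that by (rule grad_eq_0_outside)
  have "uniformly_continuous_on UNIV (grad u)"
    using g supp' by (rule uniformly_continuous_on_compact_support)
  then obtain d where d: "0 < d" "\<And>x y. dist y x < d \<Longrightarrow> dist (grad u y) (grad u x) < e / V"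
    using \<open>0 < e\<close> \<open>0 < V\<close> unfolding uniformly_continuous_on_def by (metis UNIV_I divide_pos_pos)
  have lin: "\<bar>u b - u a - grad u a \<bullet> (b - a)\<bar> \<le> norm (b - a) * (e / V)" if "norm (b - a) < d" for a b
  proof -
    have "norm (u b - u a - grad u a \<bullet> (b - a)) \<le> norm (b - a) * (e / V)"
    proof (rule differentiable_bound_linearization[where S = "ball a d" and f' = "\<lambda>x h. grad u x \<bullet> h"])
      show "a + t *\<^sub>R (b - a) \<in> ball a d" if "t \<in> {0..1}" for t
      proof -
        have "\<bar>t\<bar> * norm (b - a) \<le> 1 * norm (b - a)"
          using that by (intro mult_right_mono) auto
        then show ?thesis using \<open>norm (b - a) < d\<close> by (simp add: dist_norm)
      qed
      show "(u has_derivative (\<lambda>h. grad u x \<bullet> h)) (at x within ball a d)" for x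
        using has_derivative_grad[OF u] by (rule has_derivative_at_withinI)
      show "onorm ((\<lambda>h. grad u x \<bullet> h) - (\<lambda>h. grad u a \<bullet> h)) \<le> e / V" if "x \<in> ball a d" for x
        unfolding fun_diff_def
      proof (rule onorm_le)
        fix h
        have "norm (grad u x \<bullet> h - grad u a \<bullet> h) \<le> norm (grad u x - grad u a) * norm h"
          by (metis inner_diff_left Cauchy_Schwarz_ineq2 real_norm_def)
        also have "\<dots> \<le> e / V * norm h"
          using d(2)[of x a] that by (intro mult_right_mono) (auto simp: dist_norm norm_minus_commute)
        finally show "norm (grad u x \<bullet> h - grad u a \<bullet> h) \<le> e / V * norm h" .
      qed
    qed (use d in auto)
    then show ?thesis by simp
  qed
  have i1: "integrable lborel (\<lambda>y. v y *\<^sub>R u (x - y))" for x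
    using integrable_convol[OF cu supp v] .
  have i2: "integrable lborel (\<lambda>y. v y *\<^sub>R grad u (x - y))" for x
    using integrable_convol[OF g supp' v] .
  have i3: "integrable lborel (\<lambda>z. (v z *\<^sub>R grad u (x - z)) \<bullet> w)" for x w
    using i2 by (rule integrable_inner_left)
  show "\<exists>d>0. \<forall>y. norm (y - x) < d \<longrightarrow>
      norm (convol u v y - convol u v x - convol (grad u) v x \<bullet> (y - x)) \<le> e * norm (y - x)"
  proof (intro exI[of _ d] conjI allI impI)
    fix y assume y: "norm (y - x) < d"
    have "convol u v y - convol u v x - convol (grad u) v x \<bullet> (y - x) =
        (LINT z|lborel. v z *\<^sub>R u (y - z) - v z *\<^sub>R u (x - z) - (v z *\<^sub>R grad u (x - z)) \<bullet> (y - x))"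
      unfolding convol_def using i1 i2 i3
      by (subst integral_inner_left[symmetric], simp,
          subst Bochner_Integration.integral_diff[symmetric], simp, simp,
          subst Bochner_Integration.integral_diff[symmetric], simp_all)
    also have "norm \<dots> \<le> (LINT z|lborel. \<bar>v z\<bar> * (norm (y - x) * (e / V)))"
    proof (rule lebesgue_integral_norm_le)
      fix z
      have "v z *\<^sub>R u (y - z) - v z *\<^sub>R u (x - z) - (v z *\<^sub>R grad u (x - z)) \<bullet> (y - x) =
          v z * (u (y - z) - u (x - z) - grad u (x - z) \<bullet> ((y - z) - (x - z)))"
        by (simp add: algebra_simps)
      also have "norm \<dots> \<le> \<bar>v z\<bar> * (norm ((y - z) - (x - z)) * (e / V))"
        using mult_left_mono[OF lin[of "y - z" "x - z"] abs_ge_zero[of "v z"]] y by (simp add: abs_mult)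
      finally show "norm (v z *\<^sub>R u (y - z) - v z *\<^sub>R u (x - z) - (v z *\<^sub>R grad u (x - z)) \<bullet> (y - x))
          \<le> \<bar>v z\<bar> * (norm (y - x) * (e / V))" by simp
    qed (use i1 i3 v in \<open>simp_all del: inner_scaleR_left integrable_inner_left\<close>)
    also have "\<dots> = (LINT z|lborel. \<bar>v z\<bar>) / V * (e * norm (y - x))"
      by simp
    also have "\<dots> \<le> 1 * (e * norm (y - x))"
      using \<open>0 < V\<close> \<open>0 < e\<close> by (intro mult_right_mono) (auto simp: V_def)
    finally show "norm (convol u v y - convol u v x - convol (grad u) v x \<bullet> (y - x)) \<le> e * norm (y - x)"
      by simp
  qed (use d in auto)
qed

text \<open>The partial derivatives of the convolution are convolutions of the partial derivatives
  of u. Smoothness of u is assumed for every order so that its partial derivatives inherit the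
  hypothesis; even continuity, the base case, is read off from differentiability.\<close>

lemma Ck_on_convol:
  fixes u :: "real^'n \<Rightarrow> real"
  assumes "\<And>k. Ck_on k UNIV u" "\<And>x. R < norm x \<Longrightarrow> u x = 0" "integrable lborel v"
  shows "Ck_on k UNIV (convol u v)"
  using assms(1,2)
proof (induction k arbitrary: u)
  case (0 u)
  have "continuous_on UNIV (grad u)"
    using 0(1)[of 1] by (intro continuous_on_grad) auto
  then have "(convol u v has_derivative (\<lambda>h. convol (grad u) v x \<bullet> h)) (at x)" for x
    using 0(1)[of 1] 0(2) assms(3) by (intro convol_has_derivative) auto
  then show ?case
    by (auto intro!: continuous_at_imp_continuous_on has_derivative_continuous)
next
  case (Suc k u)
  have Ck: "Ck_on k UNIV (\<lambda>x. grad u x $ i)" for k i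
    using Suc.prems(1)[of "Suc k"] by simp
  have g: "continuous_on UNIV (grad u)"
    using Ck[of 0] by (intro continuous_on_grad) auto
  have supp: "grad u x = 0" if "R < norm x" for x
    using Suc.prems(2) that by (rule grad_eq_0_outside)
  have D: "(convol u v has_derivative (\<lambda>h. convol (grad u) v x \<bullet> h)) (at x)" for x
    using Suc.prems(1)[of 1] Suc.prems(2) g assms(3) by (intro convol_has_derivative) auto
  have "grad (convol u v) x $ i = convol (\<lambda>x. grad u x $ i) v x" for x i
    unfolding grad_eqI[OF D] unfolding convol_def
    using integrable_convol[OF g supp assms(3), where x = x]
    by (subst integral_bounded_linear[OF bounded_linear_vec_nth, symmetric]) auto
  then have "(\<lambda>x. grad (convol u v) x $ i) = convol (\<lambda>x. grad u x $ i) v" for i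
    by (rule ext)
  moreover have "Ck_on k UNIV (convol (\<lambda>x. grad u x $ i) v)" for i
    by (rule Suc.IH[OF Ck]) (simp add: supp)
  ultimately show ?case
    using D by (auto simp: differentiable_def)
qed

text \<open>Joins two views of a mollified function: \<open>convol \<rho> \<phi>\<close> is smooth
  because derivatives fall on \<rho>, and \<open>convol \<phi> \<rho>\<close> has the mollified
  gradient of \<phi> as its gradient.\<close>

lemma convol_commute:
  fixes u v :: "real^'n \<Rightarrow> real"
  assumes [measurable]: "u \<in> borel_measurable borel" "v \<in> borel_measurable borel"
  shows "convol u v x = convol v u x"
proof -
  have "convol v u x = (LINT y|density (distr lborel borel (\<lambda>y. x + (-1) *\<^sub>R y)) (\<lambda>_. \<bar>-1::real\<bar> ^ DIM(real^'n)). u y *\<^sub>R v (x - y))"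
    unfolding convol_def using lborel_affine[where c = "-1" and t = x] by simp
  also have "\<dots> = (LINT y|distr lborel borel (\<lambda>y. x + (-1) *\<^sub>R y). u y *\<^sub>R v (x - y))"
    by (simp add: density_1)
  also have "\<dots> = (LINT y|lborel. u (x - y) *\<^sub>R v y)"
    by (subst integral_distr) auto
  finally show ?thesis by (simp add: convol_def mult.commute)
qed

lemma mollifier_exists:
  assumes "0 < r"
  obtains \<rho> :: "real^'n \<Rightarrow> real" where "\<And>k. Ck_on k UNIV \<rho>" "\<And>x. 0 \<le> \<rho> x" "\<And>x. r < norm x \<Longrightarrow> \<rho> x = 0"
    "integrable lborel \<rho>" "(LINT x|lborel. \<rho> x) = 1"
proof -
  obtain a b :: "real^'n" where ab: "0 \<in> box a b" "box a b \<subseteq> ball 0 r"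
    using rational_boxes[OF assms, where x = "0::real^'n"] by blast
  have c: "continuous_on UNIV (bump a b)"
    using Ck_on_bump by (rule Ck_on_continuous)
  have s: "bump a b x = 0" if "r < norm x" for x
    using ab(2) that by (intro bump_eq_0) auto
  have i: "integrable lborel (bump a b)"
    using c s by (rule integrable_compact_support)
  define I where "I = (LINT x|lborel. bump a b x)"
  \<comment> \<open>The bump is positive on a nonempty open box; a vanishing integral would make
    this box a null set.\<close>
  have "I \<noteq> 0"
  proof
    assume "I = 0"
    then have "AE x in lborel. bump a b x = 0"
      unfolding I_def using i by (subst (asm) integral_nonneg_eq_0_iff_AE) (auto simp: bump_nonneg)
    then have "AE x in lborel. x \<notin> box a b"
      by (rule AE_mp) (auto simp flip: bump_pos_iff)
    then have "box a b \<in> null_sets lborel"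
      by (subst (asm) AE_iff_null) (auto simp: Collect_mem_eq)
    then have "negligible (box a b)"
      by (simp add: negligible_iff_null_sets null_sets_completionI)
    then show False
      using open_not_negligible[OF open_box, of a b] ab by blast
  qed
  moreover have "0 \<le> I" unfolding I_def by (intro integral_nonneg_AE) (auto simp: bump_nonneg)
  ultimately have "0 < I" by simp
  show thesis
  proof (rule that[of "\<lambda>x. 1 / I * bump a b x"])
    show "Ck_on k UNIV (\<lambda>x. 1 / I * bump a b x)" for k
      by (intro Ck_on_mult Ck_on_const Ck_on_bump open_UNIV)
    show "(LINT x|lborel. 1 / I * bump a b x) = 1"
      using \<open>0 < I\<close> by (simp add: I_def)
  qed (use \<open>0 < I\<close> i s in \<open>auto simp: bump_nonneg\<close>)
qed

text \<open>The mollified value is a weighted average of values of u at distance at most d, so it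
  deviates by no more than the oscillation of u over that distance.\<close>

lemma convol_mollifier_close:
  fixes u :: "real^'n \<Rightarrow> 'b::{banach, second_countable_topology}"
  assumes u: "continuous_on UNIV u" "\<And>x. R < norm x \<Longrightarrow> u x = 0"
    and d: "\<And>x y. norm (x - y) \<le> d \<Longrightarrow> norm (u x - u y) \<le> e"
    and \<rho>: "\<And>x. 0 \<le> \<rho> x" "\<And>x. d < norm x \<Longrightarrow> \<rho> x = 0" "integrable lborel \<rho>" "(LINT x|lborel. \<rho> x) = 1"
  shows "norm (convol u \<rho> x - u x) \<le> e"
proof -
  have "u x = (LINT y|lborel. \<rho> y *\<^sub>R u x)"
    using \<rho>(3,4) by simp
  then have "norm (convol u \<rho> x - u x) = norm (LINT y|lborel. \<rho> y *\<^sub>R u (x - y) - \<rho> y *\<^sub>R u x)"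
    unfolding convol_def using integrable_convol[OF u \<rho>(3), where x = x] \<rho>(3)
    by (subst Bochner_Integration.integral_diff) auto
  also have "\<dots> \<le> (LINT y|lborel. \<rho> y * e)"
  proof (rule lebesgue_integral_norm_le)
    show "norm (\<rho> y *\<^sub>R u (x - y) - \<rho> y *\<^sub>R u x) \<le> \<rho> y * e" for y
      using d[of "x - y" x] \<rho>(1,2)[of y]
      by (cases "d < norm y") (auto simp flip: scaleR_diff_right intro: mult_left_mono)
  qed (use integrable_convol[OF u \<rho>(3), where x = x] \<rho>(3) in auto)
  also have "\<dots> = e" using \<rho>(4) by simp
  finally show ?thesis .
qed

text \<open>Mollification at a scale below the distance of K to the complement of \<Omega>. The
  compact set K' is fixed before the accuracy e, so that a function in L^p can later be integrated
  over one set for all approximations.\<close>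

lemma smooth_approx_C1:
  fixes \<phi> :: "real^'n \<Rightarrow> real"
  assumes \<Omega>: "open \<Omega>" "compact K" "K \<subseteq> \<Omega>"
    and \<phi>: "\<And>x. \<phi> differentiable (at x)" "continuous_on UNIV (grad \<phi>)" "\<And>x. x \<notin> K \<Longrightarrow> \<phi> x = 0"
  obtains K' where "compact K'" "K' \<subseteq> \<Omega>" "\<And>e. 0 < e \<Longrightarrow> \<exists>\<psi>. (\<forall>k. Ck_on k UNIV \<psi>) \<and> (\<forall>x. x \<notin> K' \<longrightarrow> \<psi> x = 0) \<and>
      (\<forall>x. \<bar>\<psi> x - \<phi> x\<bar> \<le> e \<and> norm (grad \<psi> x - grad \<phi> x) \<le> e)"
proof -
  obtain \<epsilon> where \<epsilon>: "0 < \<epsilon>" "(\<Union>x\<in>K. cball x \<epsilon>) \<subseteq> \<Omega>"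
    using compact_subset_open_imp_cball_epsilon_subset[OF \<Omega>(2,1,3)] by blast
  define K' where "K' = (\<Union>x\<in>K. cball x \<epsilon>)"
  obtain R where "\<forall>x\<in>K. norm x \<le> R"
    using compact_imp_bounded[OF \<Omega>(2)] unfolding bounded_iff by blast
  then have supp: "\<phi> x = 0" if "R < norm x" for x
    using \<phi>(3)[of x] that by fastforce
  have supp': "grad \<phi> x = 0" if "R < norm x" for x
    using supp that by (rule grad_eq_0_outside)
  have c: "continuous_on UNIV \<phi>"
    using \<phi>(1) by (auto intro!: continuous_at_imp_continuous_on differentiable_imp_continuous_within)
  show thesis
  proof (rule that[of K'])
    show "compact K'"
      unfolding K'_def by (rule compact_minkowski_sum_cball[OF \<Omega>(2)])
    show "K' \<subseteq> \<Omega>" unfolding K'_def by (rule \<epsilon>(2))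
    fix e :: real assume "0 < e"
    obtain d1 where d1: "0 < d1" "\<And>x y. dist y x < d1 \<Longrightarrow> dist (\<phi> y) (\<phi> x) < e"
      using uniformly_continuous_on_compact_support[OF c supp] \<open>0 < e\<close>
      unfolding uniformly_continuous_on_def by (metis UNIV_I)
    obtain d2 where d2: "0 < d2" "\<And>x y. dist y x < d2 \<Longrightarrow> dist (grad \<phi> y) (grad \<phi> x) < e"
      using uniformly_continuous_on_compact_support[OF \<phi>(2) supp'] \<open>0 < e\<close>
      unfolding uniformly_continuous_on_def by (metis UNIV_I)
    \<comment> \<open>Halving turns the strict bounds of uniform continuity into the non-strict one
      of \<open>convol_mollifier_close\<close>; the bound \<epsilon> keeps the support inside
      K'.\<close>
    define d where "d = min (min d1 d2 / 2) \<epsilon>"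
    have "0 < d" using d1 d2 \<epsilon> by (simp add: d_def)
    obtain \<rho> :: "real^'n \<Rightarrow> real" where \<rho>: "\<And>k. Ck_on k UNIV \<rho>" "\<And>x. 0 \<le> \<rho> x" "\<And>x. d < norm x \<Longrightarrow> \<rho> x = 0"
      "integrable lborel \<rho>" "(LINT x|lborel. \<rho> x) = 1"
      using mollifier_exists[OF \<open>0 < d\<close>] by blast
    have eq: "convol \<rho> \<phi> = convol \<phi> \<rho>"
      using Ck_on_continuous[OF \<rho>(1)] c by (intro ext convol_commute borel_measurable_continuous_onI)
    have gr: "grad (convol \<rho> \<phi>) x = convol (grad \<phi>) \<rho> x" for x
      unfolding eq by (rule grad_eqI, rule convol_has_derivative[OF \<phi>(1,2) supp \<rho>(4)])
    show "\<exists>\<psi>. (\<forall>k. Ck_on k UNIV \<psi>) \<and> (\<forall>x. x \<notin> K' \<longrightarrow> \<psi> x = 0) \<and>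
      (\<forall>x. \<bar>\<psi> x - \<phi> x\<bar> \<le> e \<and> norm (grad \<psi> x - grad \<phi> x) \<le> e)"
    proof (intro exI[of _ "convol \<rho> \<phi>"] conjI allI impI)
      show "Ck_on k UNIV (convol \<rho> \<phi>)" for k
        using \<rho>(1,3) integrable_compact_support[OF c supp] by (rule Ck_on_convol)
      show "convol \<rho> \<phi> x = 0" if "x \<notin> K'" for x
      proof -
        have "\<phi> y *\<^sub>R \<rho> (x - y) = 0" for y
        proof (cases "y \<in> K")
          case True
          then have "\<epsilon> < norm (x - y)"
            using that by (auto simp: K'_def dist_norm norm_minus_commute)
          then show ?thesis using \<rho>(3)[of "x - y"] by (simp add: d_def)
        qed (simp add: \<phi>(3))
        then show ?thesis unfolding convol_def by (simp only: integral_zero)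
      qed
      show "\<bar>convol \<rho> \<phi> x - \<phi> x\<bar> \<le> e" for x
      proof -
        have "norm (convol \<phi> \<rho> x - \<phi> x) \<le> e"
          using d1 d2(1) by (intro convol_mollifier_close[OF c supp _ \<rho>(2,3,4,5)])
            (auto simp: d_def dist_norm intro!: less_imp_le)
        then show ?thesis by (simp add: eq)
      qed
      show "norm (grad (convol \<rho> \<phi>) x - grad \<phi> x) \<le> e" for x
        unfolding gr using d2 d1(1)
        by (intro convol_mollifier_close[OF \<phi>(2) supp' _ \<rho>(2,3,4,5)])
          (auto simp: d_def dist_norm intro!: less_imp_le)
    qed
  qed
qed

subsection \<open>Weak convergence in \<open>L\<^sup>1\<close>\<close>

text \<open>Round \<psi> down to an integer multiple of e; boundedness leaves finitely many levels,
  indexed by integers.\<close>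

lemma uniform_simple_approx:
  fixes \<psi> :: "'a \<Rightarrow> real"
  assumes \<psi>: "\<psi> \<in> borel_measurable M" "\<And>x. x \<in> space M \<Longrightarrow> \<bar>\<psi> x\<bar> \<le> B" and "0 < e"
  obtains K :: "int set" and A where "finite K" "\<And>k. A k \<in> sets M"
    "\<And>x. x \<in> space M \<Longrightarrow> \<bar>\<psi> x - (\<Sum>k\<in>K. e * of_int k * indicator (A k) x)\<bar> \<le> e"
proof -
  define K where "K = {\<lfloor>- B / e\<rfloor>..\<lfloor>B / e\<rfloor>}"
  define A where "A k = {x \<in> space M. \<lfloor>\<psi> x / e\<rfloor> = k}" for k
  show thesis
  proof (rule that[of K A])
    show "A k \<in> sets M" for k
      unfolding A_def using \<psi>(1) by measurable
    fix x assume x: "x \<in> space M"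
    have "\<lfloor>\<psi> x / e\<rfloor> \<in> K"
      using \<psi>(2)[OF x] \<open>0 < e\<close> unfolding K_def atLeastAtMost_iff
      by (intro conjI floor_mono divide_right_mono) auto
    moreover have "(\<Sum>k\<in>K. e * of_int k * indicator (A k) x) = (\<Sum>k\<in>K. if k = \<lfloor>\<psi> x / e\<rfloor> then e * of_int k else 0)"
      using x by (intro sum.cong) (auto simp: A_def)
    ultimately have "(\<Sum>k\<in>K. e * of_int k * indicator (A k) x) = e * of_int \<lfloor>\<psi> x / e\<rfloor>"
      by (simp add: K_def)
    moreover have "of_int \<lfloor>\<psi> x / e\<rfloor> * e \<le> \<psi> x" "\<psi> x \<le> (of_int \<lfloor>\<psi> x / e\<rfloor> + 1) * e"
      using of_int_floor_le[of "\<psi> x / e"] real_of_int_floor_add_one_ge[of "\<psi> x / e"] \<open>0 < e\<close>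
      by (simp_all only: le_divide_eq divide_le_eq if_True)
    ultimately show "\<bar>\<psi> x - (\<Sum>k\<in>K. e * of_int k * indicator (A k) x)\<bar> \<le> e"
      by (simp add: algebra_simps abs_le_iff)
  qed (simp add: K_def)
qed

text \<open>Simple functions are uniformly dense among bounded measurable functions, and the
  functionals are equibounded in the supremum norm. Linearity is asked for only on bounded
  functions, since L will be a difference of Bochner integrals, possibly with respect to different
  measures. Applied to a constant sequence, the lemma extends an identity from indicators to bounded
  functions.\<close>

lemma bounded_functionals_tendsto_0:
  fixes L :: "nat \<Rightarrow> ('a \<Rightarrow> real) \<Rightarrow> real"
  assumes add: "\<And>n f g B. f \<in> borel_measurable M \<Longrightarrow> g \<in> borel_measurable M \<Longrightarrow>
      (\<And>x. x \<in> space M \<Longrightarrow> \<bar>f x\<bar> \<le> B) \<Longrightarrow> (\<And>x. x \<in> space M \<Longrightarrow> \<bar>g x\<bar> \<le> B) \<Longrightarrow>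
      L n (\<lambda>x. f x + g x) = L n f + L n g"
    and scale: "\<And>n c A. A \<in> sets M \<Longrightarrow> L n (\<lambda>x. c * indicator A x) = c * L n (indicator A)"
    and bound: "\<And>n f B. f \<in> borel_measurable M \<Longrightarrow> 0 \<le> B \<Longrightarrow> (\<And>x. x \<in> space M \<Longrightarrow> \<bar>f x\<bar> \<le> B) \<Longrightarrow>
      \<bar>L n f\<bar> \<le> C * B"
    and ind: "\<And>A. A \<in> sets M \<Longrightarrow> (\<lambda>n. L n (indicator A)) \<longlonglongrightarrow> 0"
    and \<psi>: "\<psi> \<in> borel_measurable M" "\<And>x. x \<in> space M \<Longrightarrow> \<bar>\<psi> x\<bar> \<le> B"
  shows "(\<lambda>n. L n \<psi>) \<longlonglongrightarrow> 0"
proof (rule LIMSEQ_I)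
  fix r :: real assume "0 < r"
  \<comment> \<open>The denominator makes C e smaller than r / 2 for every sign of C; the other half
    of r is spent on the simple function.\<close>
  define e where "e = r / (2 * (\<bar>C\<bar> + 1))"
  have "0 < e" using \<open>0 < r\<close> by (simp add: e_def)
  have Ce: "C * e < r / 2"
  proof -
    have "C * e < (\<bar>C\<bar> + 1) * e" using \<open>0 < e\<close> by (intro mult_strict_right_mono) auto
    also have "\<dots> = r / 2" by (simp add: e_def field_simps add_nonneg_eq_0_iff)
    finally show ?thesis .
  qed
  obtain K :: "int set" and A where KA: "finite K" "\<And>k. A k \<in> sets M"
    "\<And>x. x \<in> space M \<Longrightarrow> \<bar>\<psi> x - (\<Sum>k\<in>K. e * of_int k * indicator (A k) x)\<bar> \<le> e"
    using uniform_simple_approx[OF \<psi> \<open>0 < e\<close>] by blast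
  define S where "S K x = (\<Sum>k\<in>K. e * of_int k * indicator (A k) x)" for K x
  have Sm: "S K \<in> borel_measurable M" for K
    unfolding S_def using KA(2) by (intro borel_measurable_sum) simp
  have Sb: "\<bar>S K x\<bar> \<le> (\<Sum>k\<in>K. e * \<bar>of_int k\<bar>)" for K x
    unfolding S_def using \<open>0 < e\<close>
    by (rule_tac order_trans[OF sum_abs]) (auto intro!: sum_mono simp: abs_mult indicator_def)
  have LS: "L n (S K) = (\<Sum>k\<in>K. e * of_int k * L n (indicator (A k)))" for n
    using KA(1)
  proof (induction K rule: finite_induct)
    case empty
    have "S {} = (\<lambda>x. 0 * indicator {} x)" by (auto simp: S_def)
    then show ?case using scale[of "{}" n 0] by simp
  next
    case (insert k K)
    have "S (insert k K) = (\<lambda>x. e * of_int k * indicator (A k) x + S K x)"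
      unfolding S_def sum.insert[OF insert(1,2)] by (rule refl)
    moreover have "L n (\<lambda>x. e * of_int k * indicator (A k) x + S K x) =
        L n (\<lambda>x. e * of_int k * indicator (A k) x) + L n (S K)"
    proof (rule add[where B = "e * \<bar>of_int k\<bar> + (\<Sum>k\<in>K. e * \<bar>of_int k\<bar>)"])
      have "0 \<le> (\<Sum>k\<in>K. e * \<bar>of_int k :: real\<bar>)" using \<open>0 < e\<close> by (intro sum_nonneg) auto
      then show "\<bar>e * of_int k * indicator (A k) x\<bar> \<le> e * \<bar>of_int k\<bar> + (\<Sum>k\<in>K. e * \<bar>of_int k :: real\<bar>)" for x
        using \<open>0 < e\<close> by (auto simp: indicator_def abs_mult)
      show "\<bar>S K x\<bar> \<le> e * \<bar>of_int k\<bar> + (\<Sum>k\<in>K. e * \<bar>of_int k :: real\<bar>)" for x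
        using Sb[of K x] \<open>0 < e\<close> by (simp add: add_increasing)
    qed (use Sm KA(2) in auto)
    ultimately show ?case
      using insert scale[OF KA(2)] by simp
  qed
  have "(\<lambda>n. \<Sum>k\<in>K. e * of_int k * L n (indicator (A k))) \<longlonglongrightarrow> (\<Sum>k\<in>K. e * of_int k * 0)"
    by (intro tendsto_intros ind KA(2))
  then have lim: "(\<lambda>n. L n (S K)) \<longlonglongrightarrow> 0" unfolding LS by simp
  then obtain N where N: "\<And>n. N \<le> n \<Longrightarrow> \<bar>L n (S K)\<bar> < r / 2"
    using LIMSEQ_D[OF lim, of "r / 2"] \<open>0 < r\<close> by auto
  have "norm (L n \<psi> - 0) < r" if "N \<le> n" for n
  proof -
    have d: "\<bar>\<psi> x - S K x\<bar> \<le> e" if "x \<in> space M" for x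
      using KA(3)[OF that] by (simp add: S_def)
    have "L n (\<lambda>x. S K x + (\<psi> x - S K x)) = L n (S K) + L n (\<lambda>x. \<psi> x - S K x)"
      using Sm \<psi>(1) d Sb[of K]
      by (intro add[where B = "max (\<Sum>k\<in>K. e * \<bar>of_int k\<bar>) e"]) (auto simp: le_max_iff_disj)
    moreover have "\<bar>L n (\<lambda>x. \<psi> x - S K x)\<bar> \<le> C * e"
      using Sm \<psi>(1) d \<open>0 < e\<close> by (intro bound) auto
    ultimately show ?thesis using N[OF that] Ce by simp
  qed
  then show "\<exists>N. \<forall>n\<ge>N. norm (L n \<psi> - 0) < r" by blast
qed

lemma integrable_mult_bounded:
  fixes f :: "'a \<Rightarrow> 'b::{banach, second_countable_topology}" and \<psi> :: "'a \<Rightarrow> real"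
  assumes "integrable M f" "\<psi> \<in> borel_measurable M" "\<And>x. x \<in> space M \<Longrightarrow> \<bar>\<psi> x\<bar> \<le> B"
  shows "integrable M (\<lambda>x. \<psi> x *\<^sub>R f x)"
proof (rule Bochner_Integration.integrable_bound[where f = "\<lambda>x. B *\<^sub>R f x"])
  show "AE x in M. norm (\<psi> x *\<^sub>R f x) \<le> norm (B *\<^sub>R f x)"
    using assms(3) by (intro AE_I2) (force intro!: mult_right_mono)
qed (use assms in auto)

lemma integral_mult_bounded_le:
  fixes f \<psi> :: "'a \<Rightarrow> real"
  assumes "integrable M f" "\<psi> \<in> borel_measurable M" "\<And>x. x \<in> space M \<Longrightarrow> \<bar>\<psi> x\<bar> \<le> B"
  shows "\<bar>LINT x|M. \<psi> x * f x\<bar> \<le> B * (LINT x|M. \<bar>f x\<bar>)"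
proof -
  have "norm (LINT x|M. \<psi> x * f x) \<le> (LINT x|M. B * \<bar>f x\<bar>)"
    using assms integrable_mult_bounded[OF assms]
    by (intro lebesgue_integral_norm_le) (auto simp: abs_mult intro: mult_right_mono)
  then show ?thesis by simp
qed

lemma weak_L1_tendsto_bounded:
  fixes k :: "'a \<Rightarrow> real"
  assumes kn: "\<And>n. integrable M (kn n)" "\<And>n. (LINT x|M. \<bar>kn n x\<bar>) \<le> C" and k: "integrable M k"
    and conv: "\<And>A. A \<in> sets M \<Longrightarrow> (\<lambda>n. LINT x:A|M. kn n x) \<longlonglongrightarrow> (LINT x:A|M. k x)"
    and \<psi>: "\<psi> \<in> borel_measurable M" "\<And>x. x \<in> space M \<Longrightarrow> \<bar>\<psi> x\<bar> \<le> B"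
  shows "(\<lambda>n. LINT x|M. \<psi> x * kn n x) \<longlonglongrightarrow> (LINT x|M. \<psi> x * k x)"
proof -
  have i: "integrable M (\<lambda>x. f x * g x)"
    if "integrable M g" "f \<in> borel_measurable M" "\<And>x. x \<in> space M \<Longrightarrow> \<bar>f x\<bar> \<le> B" for f g :: "'a \<Rightarrow> real" and B
    using integrable_mult_bounded[OF that] by simp
  have ii: "integrable M (\<lambda>x. indicator A x * g x)" if "integrable M g" "A \<in> sets M" for A and g :: "'a \<Rightarrow> real"
    using that by (intro i[where B = 1]) (auto simp: indicator_def)
  have "(\<lambda>n. (LINT x|M. \<psi> x * kn n x) - (LINT x|M. \<psi> x * k x)) \<longlonglongrightarrow> 0"
  proof (rule bounded_functionals_tendsto_0[where L = "\<lambda>n f. (LINT x|M. f x * kn n x) - (LINT x|M. f x * k x)"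
        and C = "C + (LINT x|M. \<bar>k x\<bar>)", OF _ _ _ _ \<psi>])
    fix n f g B
    assume fg: "f \<in> borel_measurable M" "g \<in> borel_measurable M"
      "\<And>x. x \<in> space M \<Longrightarrow> \<bar>f x\<bar> \<le> B" "\<And>x. x \<in> space M \<Longrightarrow> \<bar>g x\<bar> \<le> (B::real)"
    show "(LINT x|M. (f x + g x) * kn n x) - (LINT x|M. (f x + g x) * k x) =
        (LINT x|M. f x * kn n x) - (LINT x|M. f x * k x) + ((LINT x|M. g x * kn n x) - (LINT x|M. g x * k x))"
      using i[OF kn(1) fg(1,3)] i[OF kn(1) fg(2,4)] i[OF k fg(1,3)] i[OF k fg(2,4)]
      by (simp add: distrib_right)
  next
    fix n c A
    show "(LINT x|M. c * indicator A x * kn n x) - (LINT x|M. c * indicator A x * k x) =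
        c * ((LINT x|M. indicator A x * kn n x) - (LINT x|M. indicator A x * k x))"
      by (simp add: mult.assoc right_diff_distrib)
  next
    fix n B and f :: "'a \<Rightarrow> real" assume f: "f \<in> borel_measurable M" "0 \<le> B" "\<And>x. x \<in> space M \<Longrightarrow> \<bar>f x\<bar> \<le> B"
    have "\<bar>LINT x|M. f x * kn n x\<bar> \<le> B * C"
      using integral_mult_bounded_le[OF kn(1) f(1,3)] mult_left_mono[OF kn(2) f(2)] by (rule order_trans)
    moreover have "\<bar>LINT x|M. f x * k x\<bar> \<le> B * (LINT x|M. \<bar>k x\<bar>)"
      using integral_mult_bounded_le[OF k f(1,3)] .
    ultimately show "\<bar>(LINT x|M. f x * kn n x) - (LINT x|M. f x * k x)\<bar> \<le> (C + (LINT x|M. \<bar>k x\<bar>)) * B"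
      by (simp add: algebra_simps)
  next
    fix A assume "A \<in> sets M"
    then show "(\<lambda>n. (LINT x|M. indicator A x * kn n x) - (LINT x|M. indicator A x * k x)) \<longlonglongrightarrow> 0"
      using conv[of A] by (subst LIM_zero_iff) (simp add: set_lebesgue_integral_def)
  qed
  then show ?thesis by (rule LIM_zero_cancel)
qed

lemma diagonal_convergent_subseq:
  fixes X :: "nat \<Rightarrow> nat \<Rightarrow> real"
  assumes "\<And>j. bounded (range (\<lambda>n. X n j))"
  obtains r where "strict_mono r" "\<And>j. convergent (\<lambda>n. X (r n) j)"
proof -
  interpret subseqs "\<lambda>j s. convergent (\<lambda>n. X (s n) j)"
  proof
    fix j and s :: "nat \<Rightarrow> nat" assume "strict_mono s"
    have "bounded (range (\<lambda>n. X (s n) j))"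
      using assms[of j] by (rule bounded_subset) auto
    then obtain l r where "strict_mono r" "((\<lambda>n. X (s n) j) \<circ> r) \<longlonglongrightarrow> l"
      using bounded_imp_convergent_subsequence by blast
    then show "\<exists>r'. strict_mono r' \<and> convergent (\<lambda>n. X ((s \<circ> r') n) j)"
      by (auto simp: convergent_def o_def)
  qed
  show thesis
  proof (rule that[OF subseq_diagseq])
    fix j
    \<comment> \<open>Only the tail beyond j of the diagonal sequence is a subsequence of the j-th
      extracted sequence.\<close>
    have "convergent (\<lambda>n. X ((diagseq \<circ> (+) (Suc j)) n) j)"
    proof (rule diagseq_holds)
      fix r s :: "nat \<Rightarrow> nat" and n
      assume "strict_mono r" "convergent (\<lambda>m. X (s m) n)"
      then show "convergent (\<lambda>m. X ((s \<circ> r) m) n)"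
        using convergent_subseq_convergent[of "\<lambda>m. X (s m) n" r] by (simp add: o_def)
    qed
    then have "convergent (\<lambda>n. X (diagseq (n + Suc j)) j)"
      by (simp add: o_def add.commute)
    then show "convergent (\<lambda>n. X (diagseq n) j)"
      by (subst (asm) convergent_ignore_initial_segment)
  qed
qed

text \<open>Absolute continuity in the \<epsilon>-\<delta> form gives continuity at the empty set,
  which turns a finitely additive set function into a measure; Radon-Nikodym then applies. It is
  meant for setwise limits of measures, whose countable additivity is not clear beforehand.\<close>

lemma (in finite_measure) additive_abs_cont_density:
  fixes \<nu> :: "'a set \<Rightarrow> real"
  assumes nonneg: "\<And>A. A \<in> sets M \<Longrightarrow> 0 \<le> \<nu> A"
    and add: "\<And>A B. A \<in> sets M \<Longrightarrow> B \<in> sets M \<Longrightarrow> A \<inter> B = {} \<Longrightarrow> \<nu> (A \<union> B) = \<nu> A + \<nu> B"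
    and ac: "\<And>e. 0 < e \<Longrightarrow> \<exists>d>0. \<forall>A\<in>sets M. measure M A < d \<longrightarrow> \<nu> A \<le> e"
  obtains f where "f \<in> borel_measurable M" "\<And>x. 0 \<le> f x" "integrable M f"
    "\<And>A. A \<in> sets M \<Longrightarrow> \<nu> A = (LINT x:A|M. f x)"
proof -
  define N where "N = measure_of (space M) (sets M) (\<lambda>A. ennreal (\<nu> A))"
  have ca: "countably_additive (sets M) (\<lambda>A. ennreal (\<nu> A))"
  proof (rule sets.empty_continuous_imp_countably_additive)
    have "\<nu> {} = 0" using add[of "{}" "{}"] by simp
    then show "positive (sets M) (\<lambda>A. ennreal (\<nu> A))" by (simp add: positive_def)
    show "additive (sets M) (\<lambda>A. ennreal (\<nu> A))"
      unfolding additive_def using add nonneg by (simp add: ennreal_plus)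
    fix A :: "nat \<Rightarrow> 'a set" assume A: "range A \<subseteq> sets M" "decseq A" "(\<Inter>i. A i) = {}"
    have "(\<lambda>i. \<nu> (A i)) \<longlonglongrightarrow> 0"
    proof (rule LIMSEQ_I)
      fix r :: real assume "0 < r"
      then obtain d where d: "0 < d" "\<And>A. A \<in> sets M \<Longrightarrow> measure M A < d \<Longrightarrow> \<nu> A \<le> r / 2"
        using ac[of "r / 2"] by auto
      have lim: "(\<lambda>i. measure M (A i)) \<longlonglongrightarrow> 0"
        using finite_Lim_measure_decseq[OF A(1,2)] A(3) by simp
      then obtain N where "\<And>i. N \<le> i \<Longrightarrow> measure M (A i) < d"
        using order_tendstoD(2)[OF lim d(1)] by (auto simp: eventually_sequentially)
      then have "norm (\<nu> (A i) - 0) < r" if "N \<le> i" for i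
        using d(2)[of "A i"] nonneg[of "A i"] A(1) that \<open>0 < r\<close> by fastforce
      then show "\<exists>N. \<forall>i\<ge>N. norm (\<nu> (A i) - 0) < r" by blast
    qed
    then show "(\<lambda>i. ennreal (\<nu> (A i))) \<longlonglongrightarrow> 0"
      using tendsto_ennrealI by fastforce
  qed simp
  have "\<nu> {} = 0" using add[of "{}" "{}"] by simp
  then have N: "emeasure N A = ennreal (\<nu> A)" if "A \<in> sets M" for A
    unfolding N_def using ca that
    by (intro emeasure_measure_of_sigma sets.sigma_algebra_axioms) (auto simp: positive_def)
  have sN: "sets N = sets M" unfolding N_def by simp
  have "absolutely_continuous M N"
    unfolding absolutely_continuous_def
  proof
    fix A assume A: "A \<in> null_sets M"
    have "\<nu> A \<le> e" if "0 < e" for e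
      using ac[OF that] A by (auto simp: null_sets_def measure_def)
    then have "\<nu> A \<le> 0" by (rule field_le_epsilon) simp
    then show "A \<in> null_sets N"
      using A by (auto simp: null_sets_def sN N ennreal_eq_0_iff)
  qed
  then obtain F where F: "F \<in> borel_measurable M" "density M F = N"
    using Radon_Nikodym[of N] sN by blast
  have FA: "(\<integral>\<^sup>+x. F x * indicator A x \<partial>M) = ennreal (\<nu> A)" if "A \<in> sets M" for A
    using N[OF that] that F(1) unfolding F(2)[symmetric] by (simp add: emeasure_density)
  have "(\<integral>\<^sup>+x. F x \<partial>M) = (\<integral>\<^sup>+x. F x * indicator (space M) x \<partial>M)"
    by (intro nn_integral_cong) simp
  then have fin: "(\<integral>\<^sup>+x. F x \<partial>M) \<noteq> \<infinity>" using FA[of "space M"] by simp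
  then have "AE x in M. F x \<noteq> \<infinity>" using F(1) by (rule nn_integral_PInf_AE[rotated])
  then have Fe: "AE x in M. F x = ennreal (enn2real (F x))" by (auto elim: AE_mp simp: less_top)
  define f where "f x = enn2real (F x)" for x
  have fm: "f \<in> borel_measurable M" unfolding f_def using F(1) by measurable
  have "(\<integral>\<^sup>+x. ennreal (f x) \<partial>M) = (\<integral>\<^sup>+x. F x \<partial>M)"
    using Fe by (intro nn_integral_cong_AE) (auto simp: f_def)
  then have fi: "integrable M f"
    using fm fin by (intro integrableI_nonneg) (auto simp: f_def less_top)
  show thesis
  proof (rule that[OF fm _ fi])
    show "0 \<le> f x" for x by (simp add: f_def)
    fix A assume A: "A \<in> sets M"
    have "ennreal (LINT x:A|M. f x) = (\<integral>\<^sup>+x. ennreal (indicator A x * f x) \<partial>M)"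
      unfolding set_lebesgue_integral_def using integrable_mult_indicator[OF A fi]
      by (subst nn_integral_eq_integral) (auto simp: f_def)
    also have "\<dots> = (\<integral>\<^sup>+x. F x * indicator A x \<partial>M)"
      using Fe by (intro nn_integral_cong_AE) (auto simp: f_def indicator_def)
    also have "\<dots> = ennreal (\<nu> A)" by (rule FA[OF A])
    finally show "\<nu> A = (LINT x:A|M. f x)"
      using nonneg[OF A] by (subst (asm) ennreal_inj)
        (auto simp: set_lebesgue_integral_def f_def intro!: integral_nonneg_AE)
  qed
qed

subsection \<open>Weak sequential compactness\<close>

text \<open>Separability of the measure algebra of M: \<A> is a countable dense family for the
  pseudometric given by the measure of the symmetric difference.\<close>

definition approximable :: "'a measure \<Rightarrow> 'a set set \<Rightarrow> bool" where
  "approximable M \<A> \<longleftrightarrow> countable \<A> \<and> \<A> \<subseteq> sets M \<and>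
     (\<forall>A\<in>sets M. \<forall>e>0. \<exists>B\<in>\<A>. measure M ((A - B) \<union> (B - A)) < e)"

text \<open>The compactness half of the Dunford-Pettis theorem. A diagonal sequence converges on the
  countable family, uniform integrability carries convergence over to all measurable sets, and the
  limit set function has a density. The finite index i provides one subsequence for all components
  of a vector, or for the positive and negative parts of a function.\<close>

lemma (in finite_measure) weak_L1_compact:
  fixes h :: "'i::finite \<Rightarrow> nat \<Rightarrow> 'a \<Rightarrow> real"
  assumes \<A>: "approximable M \<A>"
    and h: "\<And>i n. integrable M (h i n)" "\<And>i n x. 0 \<le> h i n x" "\<And>i n. (LINT x|M. h i n x) \<le> C"
    and ui: "\<And>i e. 0 < e \<Longrightarrow> \<exists>d>0. \<forall>n. \<forall>A\<in>sets M. measure M A < d \<longrightarrow> (LINT x:A|M. h i n x) \<le> e"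
  obtains r k where "strict_mono r" "\<And>i. integrable M (k i)" "\<And>i x. 0 \<le> k i x"
    "\<And>i A. A \<in> sets M \<Longrightarrow> (\<lambda>n. LINT x:A|M. h i (r n) x) \<longlonglongrightarrow> (LINT x:A|M. k i x)"
proof -
  have si: "set_integrable M A (h i n)" if "A \<in> sets M" for A i n
    using integrable_mult_indicator[OF that h(1)] by (simp add: set_integrable_def)
  have mono: "(LINT x:A|M. h i n x) \<le> (LINT x:B|M. h i n x)" if "A \<in> sets M" "B \<in> sets M" "A \<subseteq> B" for A B i n
    unfolding set_lebesgue_integral_def using si that h(2)
    by (intro integral_mono) (auto simp: set_integrable_def indicator_def)
  have nn: "0 \<le> (LINT x:A|M. h i n x)" for A i n
    unfolding set_lebesgue_integral_def using h(2) by (intro integral_nonneg_AE) auto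
  have leC: "(LINT x:A|M. h i n x) \<le> C" if "A \<in> sets M" for A i n
  proof -
    have "(LINT x:A|M. h i n x) \<le> (LINT x:space M|M. h i n x)"
      using that sets.sets_into_space by (intro mono) auto
    also have "\<dots> = (LINT x|M. h i n x)" by (rule set_integral_space[OF h(1)])
    finally show ?thesis using h(3)[of i n] by simp
  qed
  \<comment> \<open>Pairs of a component and a set enumerate all the scalar sequences that the
    diagonal argument has to make convergent.\<close>
  define J where "J = (UNIV :: 'i set) \<times> \<A>"
  have A0: "\<A> \<noteq> {}" using \<A> unfolding approximable_def by (metis empty_iff sets.empty_sets zero_less_one)
  have J: "countable J" "J \<noteq> {}"
    using \<A> A0 by (auto simp: J_def approximable_def intro: countable_finite)
  define e where "e = from_nat_into J"
  have eJ: "e j \<in> J" for j unfolding e_def using J(2) by (rule from_nat_into)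
  obtain r where r: "strict_mono r" "\<And>j. convergent (\<lambda>n. LINT x:snd (e j)|M. h (fst (e j)) (r n) x)"
  proof (rule diagonal_convergent_subseq[of "\<lambda>n j. LINT x:snd (e j)|M. h (fst (e j)) n x"])
    fix j
    have "snd (e j) \<in> sets M"
      using eJ[of j] \<A> by (auto simp: J_def approximable_def)
    then show "bounded (range (\<lambda>n. LINT x:snd (e j)|M. h (fst (e j)) n x))"
      using nn leC by (intro boundedI[of _ C]) auto
  qed blast
  have conv\<A>: "convergent (\<lambda>n. LINT x:B|M. h i (r n) x)" if "B \<in> \<A>" for i B
  proof -
    obtain j where "e j = (i, B)"
      using from_nat_into_surj[OF J(1), of "(i, B)"] \<open>B \<in> \<A>\<close> by (auto simp: J_def e_def)
    with r(2)[of j] show ?thesis by simp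
  qed
  have conv: "convergent (\<lambda>n. LINT x:A|M. h i (r n) x)" if A: "A \<in> sets M" for i A
  proof (rule Cauchy_convergent, rule metric_CauchyI)
    fix \<epsilon> :: real assume "0 < \<epsilon>"
    \<comment> \<open>Three errors of \<epsilon> / 4 will be added: passing from A to B at both
      indices, and the Cauchy error on B. Their sum stays strictly below \<epsilon>.\<close>
    then obtain d where d: "0 < d" "\<And>n A. A \<in> sets M \<Longrightarrow> measure M A < d \<Longrightarrow> (LINT x:A|M. h i n x) \<le> \<epsilon> / 4"
      using ui[of "\<epsilon> / 4" i] by auto
    obtain B where B: "B \<in> \<A>" "measure M ((A - B) \<union> (B - A)) < d"
      using \<A> A d(1) unfolding approximable_def by blast
    then have BM: "B \<in> sets M" using \<A> by (auto simp: approximable_def)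
    have close: "\<bar>(LINT x:A|M. h i n x) - (LINT x:B|M. h i n x)\<bar> \<le> \<epsilon> / 4" for n
    proof -
      have "(LINT x:A|M. h i n x) - (LINT x:B|M. h i n x) =
          (LINT x|M. indicator A x *\<^sub>R h i n x - indicator B x *\<^sub>R h i n x)"
        using si[OF A] si[OF BM] unfolding set_lebesgue_integral_def set_integrable_def by simp
      also have "norm \<dots> \<le> (LINT x:(A - B) \<union> (B - A)|M. h i n x)"
        unfolding set_lebesgue_integral_def using si[OF A] si[OF BM] si[of "(A - B) \<union> (B - A)"] A BM h(2)
        by (intro lebesgue_integral_norm_le) (auto simp: set_integrable_def indicator_def)
      also have "\<dots> \<le> \<epsilon> / 4" using A BM B(2) by (intro d(2)) auto
      finally show ?thesis by simp
    qed
    obtain N where N: "\<And>m n. N \<le> m \<Longrightarrow> N \<le> n \<Longrightarrow> dist (LINT x:B|M. h i (r m) x) (LINT x:B|M. h i (r n) x) < \<epsilon> / 4"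
      using convergent_Cauchy[OF conv\<A>[OF B(1)]] \<open>0 < \<epsilon>\<close> metric_CauchyD[of _ "\<epsilon> / 4"] by (metis divide_pos_pos zero_less_numeral)
    show "\<exists>N. \<forall>m\<ge>N. \<forall>n\<ge>N. dist (LINT x:A|M. h i (r m) x) (LINT x:A|M. h i (r n) x) < \<epsilon>"
    proof (intro exI allI impI)
      fix m n assume "N \<le> m" "N \<le> n"
      then show "dist (LINT x:A|M. h i (r m) x) (LINT x:A|M. h i (r n) x) < \<epsilon>"
        using N[of m n] close[of "r m"] close[of "r n"] unfolding dist_real_def by linarith
    qed
  qed
  define \<nu> where "\<nu> i A = lim (\<lambda>n. LINT x:A|M. h i (r n) x)" for i A
  have lim: "(\<lambda>n. LINT x:A|M. h i (r n) x) \<longlonglongrightarrow> \<nu> i A" if "A \<in> sets M" for i A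
    unfolding \<nu>_def using conv[OF that] by (rule convergent_LIMSEQ_iff[THEN iffD1])
  have "\<exists>k. k \<in> borel_measurable M \<and> (\<forall>x. 0 \<le> k x) \<and> integrable M k \<and> (\<forall>A\<in>sets M. \<nu> i A = (LINT x:A|M. k x))" for i
  proof -
    obtain k where "k \<in> borel_measurable M" "\<And>x. 0 \<le> k x" "integrable M k" "\<And>A. A \<in> sets M \<Longrightarrow> \<nu> i A = (LINT x:A|M. k x)"
    proof (rule additive_abs_cont_density[of "\<nu> i"])
      show "0 \<le> \<nu> i A" if "A \<in> sets M" for A
        by (intro LIMSEQ_le_const[OF lim[OF that]] exI allI impI nn)
      show "\<nu> i (A \<union> B) = \<nu> i A + \<nu> i B" if "A \<in> sets M" "B \<in> sets M" "A \<inter> B = {}" for A B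
      proof (rule LIMSEQ_unique[OF lim])
        show "(\<lambda>n. LINT x:A \<union> B|M. h i (r n) x) \<longlonglongrightarrow> \<nu> i A + \<nu> i B"
          using tendsto_add[OF lim[OF that(1)] lim[OF that(2)]] si that
          by (simp add: set_integral_Un)
      qed (use that in auto)
      fix e :: real assume "0 < e"
      then obtain d where d: "d>0" "\<And>n A. A\<in>sets M \<Longrightarrow> measure M A < d \<Longrightarrow> (LINT x:A|M. h i n x) \<le> e"
        using ui[of e i] by auto
      then have "\<nu> i A \<le> e" if "A \<in> sets M" "measure M A < d" for A
        using that by (intro LIMSEQ_le_const2[OF lim[OF that(1)]] exI allI impI d(2))
      with d(1) show "\<exists>d>0. \<forall>A\<in>sets M. measure M A < d \<longrightarrow> \<nu> i A \<le> e" by blast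
    qed auto
    then show ?thesis by blast
  qed
  then obtain k where k: "\<And>i x. 0 \<le> k i x" "\<And>i. integrable M (k i)"
    "\<And>i A. A\<in>sets M \<Longrightarrow> \<nu> i A = (LINT x:A|M. k i x)"
    by metis
  show thesis
    using r(1) k(2,1) lim k(3) by (intro that[of r k]) auto
qed

text \<open>Open sets approximate Borel sets from outside, and finite unions of basis sets
  approximate open sets from inside. The condition \<open>ae\<close> admits a \<sigma>-algebra
  larger than the Borel one, such as the Lebesgue measurable sets.\<close>

lemma approximable_borel:
  fixes M :: "'a::{second_countable_topology, complete_space} measure"
  assumes "finite_measure M" and m: "(\<lambda>x. x) \<in> measurable M borel"
    and ae: "\<And>A. A \<in> sets M \<Longrightarrow> \<exists>C\<in>sets borel. measure M ((A - C) \<union> (C \<inter> space M - A)) = 0"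
  obtains \<A> where "approximable M \<A>"
proof -
  interpret finite_measure M by fact
  obtain \<B> :: "'a set set" where \<B>: "countable \<B>" "topological_basis \<B>"
    using ex_countable_basis by blast
  define \<A> where "\<A> = (\<lambda>F. \<Union>F \<inter> space M) ` {F. finite F \<and> F \<subseteq> \<B>}"
  have cut: "C \<inter> space M \<in> sets M" if "C \<in> sets borel" for C
    using measurable_sets[OF m that] by simp
  \<comment> \<open>The image of M on the Borel sets of the whole space, where outer regularity is
    available.\<close>
  define N where "N = distr M borel (\<lambda>x. x)"
  have N: "measure N C = measure M (C \<inter> space M)" if "C \<in> sets borel" for C
    unfolding N_def using m that by (simp add: measure_distr)
  interpret N: finite_measure N
    unfolding N_def by (rule finite_measure_distr[OF m])
  have "approximable M \<A>"
    unfolding approximable_def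
  proof (intro conjI ballI allI impI)
    show "countable \<A>"
      unfolding \<A>_def using countable_Collect_finite_subset[OF \<B>(1)] by (rule countable_image)
    have op: "open (\<Union>F)" if "F \<subseteq> \<B>" for F
      using \<B>(2) that by (auto intro!: open_Union topological_basis_open)
    show "\<A> \<subseteq> sets M"
      unfolding \<A>_def using op cut by auto
    fix A and e :: real assume A: "A \<in> sets M" and "0 < e"
    obtain C where C: "C \<in> sets borel" "measure M ((A - C) \<union> (C \<inter> space M - A)) = 0"
      using ae[OF A] by blast
    have "emeasure N C = (INF U \<in> {U. C \<subseteq> U \<and> open U}. emeasure N U)"
      by (intro outer_regular C(1)) (simp add: N_def, rule N.emeasure_finite[unfolded infinity_ennreal_def[symmetric]])
    moreover have "emeasure N C < emeasure N C + ennreal (e / 2)"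
      using \<open>0 < e\<close> by (simp add: N.emeasure_eq_measure ennreal_less_iff flip: ennreal_plus)
    ultimately have "(INF U \<in> {U. C \<subseteq> U \<and> open U}. emeasure N U) < emeasure N C + ennreal (e / 2)"
      by simp
    then obtain U where U: "C \<subseteq> U" "open U" "emeasure N U < emeasure N C + ennreal (e / 2)"
      unfolding INF_less_iff by blast
    have U3: "measure N U < measure N C + e / 2"
      using U(3) \<open>0 < e\<close> by (simp add: N.emeasure_eq_measure ennreal_less_iff flip: ennreal_plus)
    obtain \<B>' where \<B>': "\<B>' \<subseteq> \<B>" "\<Union>\<B>' = U"
      using topological_basisE \<B>(2) U(2) unfolding topological_basis_def by blast
    \<comment> \<open>The enumeration \<open>from_nat_into\<close> is arbitrary on the empty family,
      hence the explicit default {}.\<close>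
    obtain n where n: "measure N U - e / 2 < measure N (\<Union>i<n. (if \<B>' = {} then {} else from_nat_into \<B>' i))"
    proof -
      let ?B = "\<lambda>i. if \<B>' = {} then {} else from_nat_into \<B>' i"
      have "?B i \<in> \<B>' \<or> \<B>' = {}" for i
        by (simp add: from_nat_into)
      then have oB: "open (?B i)" for i
        using \<B>'(1) \<B>(2) topological_basis_open by (cases "\<B>' = {}") auto
      have "(\<Union>n. \<Union>i<n. ?B i) = (\<Union>i. ?B i)"
        by blast
      also have "\<dots> = U"
        using \<B>' \<B>(1) by (cases "\<B>' = {}") (auto simp: range_from_nat_into countable_subset)
      finally have un: "(\<Union>n. \<Union>i<n. ?B i) = U" .
      have "(\<lambda>n. measure N (\<Union>i<n. ?B i)) \<longlonglongrightarrow> measure N (\<Union>n. \<Union>i<n. ?B i)"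
      proof (rule N.finite_Lim_measure_incseq)
        show "range (\<lambda>n. \<Union>i<n. ?B i) \<subseteq> sets N"
          unfolding N_def using oB by (intro image_subsetI) (simp only: sets_distr, intro borel_open open_UN ballI, blast)
        show "incseq (\<lambda>n. \<Union>i<n. ?B i)"
          by (rule incseq_SucI) (auto simp: less_Suc_eq)
      qed
      then have "\<forall>\<^sub>F n in sequentially. measure N U - e / 2 < measure N (\<Union>i<n. ?B i)"
        unfolding un using \<open>0 < e\<close> by (intro order_tendstoD(1)) auto
      then show thesis using that by (auto simp: eventually_sequentially)
    qed
    define F where "F = (if \<B>' = {} then {} else from_nat_into \<B>' ` {..<n})"
    have F: "finite F" "F \<subseteq> \<B>'" "F \<subseteq> \<B>"
      using \<B>'(1) from_nat_into[of \<B>'] by (auto simp: F_def)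
    have Feq: "(\<Union>i<n. (if \<B>' = {} then {} else from_nat_into \<B>' i)) = \<Union>F"
      by (auto simp: F_def)
    have FU: "\<Union>F \<subseteq> U" using F(2) \<B>'(2) by blast
    show "\<exists>B\<in>\<A>. measure M ((A - B) \<union> (B - A)) < e"
    proof
      show "\<Union>F \<inter> space M \<in> \<A>" unfolding \<A>_def using F by blast
      have Fb: "\<Union>F \<in> sets borel" "U \<in> sets borel"
        using op[OF F(3)] U(2) by auto
      let ?B = "\<Union>F \<inter> space M"
      \<comment> \<open>These three sets cover the symmetric difference of A and the approximation.
        They have measure 0, less than e / 2 and less than e / 2, by the choices of C, U and
        n.\<close>
      let ?S1 = "(A - C) \<union> (C \<inter> space M - A)" and ?S2 = "(U - C) \<inter> space M" and ?S3 = "(U - \<Union>F) \<inter> space M"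
      have s1: "?S1 \<in> sets M"
        using A cut[OF C(1)] sets.sets_into_space[OF A]
        by (metis Diff_Int2 Int_absorb2 sets.Diff sets.Int sets.Un Diff_Int_distrib2 sets.top Diff_Int inf.absorb1)
      have s2: "?S2 \<in> sets M" "?S3 \<in> sets M"
        using Fb C(1) by (auto intro!: cut)
      have "measure M ((A - ?B) \<union> (?B - A)) \<le> measure M (?S1 \<union> (?S2 \<union> ?S3))"
        using s1 s2 U(1) FU sets.sets_into_space[OF A] by (intro finite_measure_mono) auto
      also have "\<dots> \<le> measure M ?S1 + (measure M ?S2 + measure M ?S3)"
        using s1 s2 by (intro order_trans[OF measure_Un_le] add_mono order_refl measure_Un_le) auto
      also have "measure M ?S2 = measure N U - measure N C"
        using N[of "U - C"] N.finite_measure_Diff[of U C] C(1) Fb U(1) by (simp add: N_def)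
      also have "measure M ?S3 = measure N U - measure N (\<Union>F)"
        using N[of "U - \<Union>F"] N.finite_measure_Diff[of U "\<Union>F"] Fb FU by (simp add: N_def)
      finally show "measure M ((A - ?B) \<union> (?B - A)) < e"
        using C(2) U3 n unfolding Feq by simp
    qed
  qed
  then show thesis by (rule that)
qed

section \<open>Inequalities for p-th powers and products in conjugate spaces\<close>

lemma conjugate_exponent:
  fixes p :: real
  assumes "1 < p"
  shows "1 < p / (p - 1)" "1 / p + 1 / (p / (p - 1)) = 1" "(p - 1) * (p / (p - 1)) = p"
  using assms by (simp_all add: field_simps)

text \<open>Convexity of the p-th power in tangent form, derived from Young's inequality for |a| and
  |b|^(p-1). The left side is affine in a and therefore passes to weak limits; both the L^p bound of
  weak limits and the lower semicontinuity of the objective rest on it.\<close>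

lemma powr_tangent:
  fixes a b p :: real
  assumes p: "1 < p"
  shows "\<bar>b\<bar> powr p + p * (sgn b * \<bar>b\<bar> powr (p - 1)) * (a - b) \<le> \<bar>a\<bar> powr p"
proof -
  let ?q = "p / (p - 1)"
  have "\<bar>a\<bar> * \<bar>b\<bar> powr (p - 1) \<le> \<bar>a\<bar> powr p / p + (\<bar>b\<bar> powr (p - 1)) powr ?q / ?q"
    using conjugate_exponent[OF p] p by (intro Youngs_inequality) auto
  also have "(\<bar>b\<bar> powr (p - 1)) powr ?q = \<bar>b\<bar> powr p"
    unfolding powr_powr conjugate_exponent(3)[OF p] ..
  finally have "p * (\<bar>a\<bar> * \<bar>b\<bar> powr (p - 1)) \<le> p * (\<bar>a\<bar> powr p / p + \<bar>b\<bar> powr p / ?q)"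
    using p by (intro mult_left_mono) auto
  also have "\<dots> = \<bar>a\<bar> powr p + (p - 1) * \<bar>b\<bar> powr p"
    using p by (simp add: field_simps)
  finally have 1: "p * (\<bar>a\<bar> * \<bar>b\<bar> powr (p - 1)) \<le> \<bar>a\<bar> powr p + (p - 1) * \<bar>b\<bar> powr p" .
  have "sgn b * a \<le> \<bar>a\<bar>" unfolding sgn_if by (auto intro: abs_ge_self abs_ge_minus_self)
  then have 2: "(sgn b * a) * (p * \<bar>b\<bar> powr (p - 1)) \<le> \<bar>a\<bar> * (p * \<bar>b\<bar> powr (p - 1))"
    using p by (intro mult_right_mono) auto
  have 3: "sgn b * \<bar>b\<bar> powr (p - 1) * b = \<bar>b\<bar> powr p"
  proof (cases "b = 0")
    case False
    have "sgn b * b = \<bar>b\<bar>" by (simp add: sgn_if)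
    then have "sgn b * \<bar>b\<bar> powr (p - 1) * b = \<bar>b\<bar> powr (p - 1) * \<bar>b\<bar> powr 1"
      using False by (simp add: ac_simps)
    then show ?thesis using False by (simp only: powr_add[symmetric]) simp
  qed simp
  have eq: "p * (sgn b * \<bar>b\<bar> powr (p - 1)) * (a - b) = (sgn b * a) * (p * \<bar>b\<bar> powr (p - 1)) - p * (sgn b * \<bar>b\<bar> powr (p - 1) * b)"
    by (simp add: algebra_simps)
  show ?thesis using 1 2 unfolding eq 3 by (simp add: algebra_simps)
qed

text \<open>Does the work of Hoelder's inequality: \<eta> is chosen against a bound for the first
  factor, then K is absorbed by the smallness of the second. With b = 1 it gives uniform
  integrability of a set that is bounded in L^p.\<close>

lemma Youngs_inequality_eps:
  fixes p \<eta> :: real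
  assumes p: "1 < p" and "0 < \<eta>"
  obtains K where "0 < K" "\<And>a b :: real. \<bar>a * b\<bar> \<le> \<eta> * \<bar>a\<bar> powr p + K * \<bar>b\<bar> powr (p / (p - 1))"
proof -
  let ?q = "p / (p - 1)"
  \<comment> \<open>Scaling a by d and b by 1 / d leaves the product unchanged and turns the first
    term into at most \<eta> times the p-th power of a.\<close>
  define d where "d = \<eta> powr (1 / p)"
  have d: "0 < d" "d powr p = \<eta>" using assms by (auto simp: d_def powr_powr)
  show thesis
  proof (rule that[of "(1 / d) powr ?q"])
    fix a b :: real
    have "\<bar>a * b\<bar> = (d * \<bar>a\<bar>) * (1 / d * \<bar>b\<bar>)"
      using d(1) by (simp add: abs_mult)
    also have "\<dots> \<le> (d * \<bar>a\<bar>) powr p / p + (1 / d * \<bar>b\<bar>) powr ?q / ?q"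
      using conjugate_exponent[OF p] p d(1) by (intro Youngs_inequality) auto
    also have "\<dots> \<le> (d * \<bar>a\<bar>) powr p + (1 / d * \<bar>b\<bar>) powr ?q"
    proof -
      have *: "x / t \<le> x" if "0 \<le> x" "1 < t" for x t :: real
        using that by (simp add: divide_le_eq mult_le_cancel_left1)
      show ?thesis using p conjugate_exponent(1)[OF p] by (intro add_mono *) auto
    qed
    also have "(d * \<bar>a\<bar>) powr p = \<eta> * \<bar>a\<bar> powr p"
      using d by (subst powr_mult) auto
    also have "(1 / d * \<bar>b\<bar>) powr ?q = (1 / d) powr ?q * \<bar>b\<bar> powr ?q"
      using d by (subst powr_mult) auto
    finally show "\<bar>a * b\<bar> \<le> \<eta> * \<bar>a\<bar> powr p + (1 / d) powr ?q * \<bar>b\<bar> powr ?q" .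
  qed (use d in simp)
qed

lemma integrable_mult_Lp:
  fixes u v :: "'a \<Rightarrow> real"
  assumes p: "1 < p" and [measurable]: "u \<in> borel_measurable M" "v \<in> borel_measurable M"
    and i: "integrable M (\<lambda>x. \<bar>u x\<bar> powr p)" "integrable M (\<lambda>x. \<bar>v x\<bar> powr (p / (p - 1)))"
  shows "integrable M (\<lambda>x. u x * v x)"
proof -
  obtain K where K: "0 < K" "\<And>a b :: real. \<bar>a * b\<bar> \<le> 1 * \<bar>a\<bar> powr p + K * \<bar>b\<bar> powr (p / (p - 1))"
    using Youngs_inequality_eps[OF p zero_less_one] by blast
  show ?thesis
  proof (rule Bochner_Integration.integrable_bound)
    show "integrable M (\<lambda>x. \<bar>u x\<bar> powr p + K * \<bar>v x\<bar> powr (p / (p - 1)))"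
      using i by simp
    show "AE x in M. norm (u x * v x) \<le> norm (\<bar>u x\<bar> powr p + K * \<bar>v x\<bar> powr (p / (p - 1)))"
      using K by (intro AE_I2) (simp add: order_trans[OF _ abs_ge_self])
  qed measurable
qed

lemma abs_add_powr_le:
  fixes a b p :: real
  assumes "0 < p"
  shows "\<bar>a + b\<bar> powr p \<le> 2 powr p * (\<bar>a\<bar> powr p + \<bar>b\<bar> powr p)"
proof -
  have "\<bar>a + b\<bar> powr p \<le> (2 * max \<bar>a\<bar> \<bar>b\<bar>) powr p"
    using assms by (intro powr_mono2) auto
  also have "\<dots> = 2 powr p * max \<bar>a\<bar> \<bar>b\<bar> powr p"
    by (subst powr_mult) auto
  also have "\<dots> \<le> 2 powr p * (\<bar>a\<bar> powr p + \<bar>b\<bar> powr p)"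
    by (intro mult_left_mono) (auto simp: max_def)
  finally show ?thesis .
qed

lemma integrable_powr_add:
  fixes u v :: "'a \<Rightarrow> real"
  assumes "0 < p" and [measurable]: "u \<in> borel_measurable M" "v \<in> borel_measurable M"
    and i: "integrable M (\<lambda>x. \<bar>u x\<bar> powr p)" "integrable M (\<lambda>x. \<bar>v x\<bar> powr p)"
  shows "integrable M (\<lambda>x. \<bar>u x + v x\<bar> powr p)"
proof (rule Bochner_Integration.integrable_bound)
  show "integrable M (\<lambda>x. 2 powr p * (\<bar>u x\<bar> powr p + \<bar>v x\<bar> powr p))"
    using i by simp
  show "AE x in M. norm (\<bar>u x + v x\<bar> powr p) \<le> norm (2 powr p * (\<bar>u x\<bar> powr p + \<bar>v x\<bar> powr p))"
    using abs_add_powr_le[OF \<open>0 < p\<close>] by (intro AE_I2) (simp add: order_trans[OF _ abs_ge_self])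
qed measurable

lemma integrable_Fatou:
  fixes f :: "'a \<Rightarrow> real"
  assumes fj: "\<And>j::nat. integrable M (fj j)" "\<And>j x. x \<in> space M \<Longrightarrow> 0 \<le> fj j x" "\<And>j. (LINT x|M. fj j x) \<le> C"
    and f: "f \<in> borel_measurable M" "\<And>x. x \<in> space M \<Longrightarrow> (\<lambda>j. fj j x) \<longlonglongrightarrow> f x"
  shows "integrable M f" "(LINT x|M. f x) \<le> C"
proof -
  have nn: "0 \<le> f x" if "x \<in> space M" for x
    using f(2)[OF that] fj(2)[OF that] by (intro LIMSEQ_le_const) auto
  have "0 \<le> (LINT x|M. fj 0 x)"
    using fj(2) by (intro integral_nonneg_AE) auto
  then have "0 \<le> C" using fj(3)[of 0] by simp
  have "(\<integral>\<^sup>+x. ennreal (f x) \<partial>M) = (\<integral>\<^sup>+x. liminf (\<lambda>j. ennreal (fj j x)) \<partial>M)"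
    using f(2) by (intro nn_integral_cong) (auto intro!: lim_imp_Liminf[symmetric] tendsto_ennrealI)
  also have "\<dots> \<le> liminf (\<lambda>j. \<integral>\<^sup>+x. ennreal (fj j x) \<partial>M)"
    using fj(1) by (intro nn_integral_liminf) auto
  also have "\<dots> \<le> ennreal C"
  proof (rule Liminf_le)
    show "\<forall>\<^sub>F j in sequentially. (\<integral>\<^sup>+x. ennreal (fj j x) \<partial>M) \<le> ennreal C"
      using fj by (intro always_eventually allI) (subst nn_integral_eq_integral, auto intro: ennreal_leI)
  qed simp
  finally have le: "(\<integral>\<^sup>+x. ennreal (f x) \<partial>M) \<le> ennreal C" .
  show i: "integrable M f"
    using f(1) nn le by (intro integrableI_nonneg) (auto intro: le_less_trans)
  have "ennreal (LINT x|M. f x) \<le> ennreal C"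
    using le nn i by (subst nn_integral_eq_integral[symmetric]) auto
  then show "(LINT x|M. f x) \<le> C" using \<open>0 \<le> C\<close> by (simp add: ennreal_le_iff)
qed

text \<open>On a finite measure space an L^p bound makes the sequence uniformly integrable, so
  \<open>weak_L1_compact\<close> yields a limit in duality with bounded functions. The tangent
  inequality places this limit in L^p with the same bound, and truncation then extends the
  convergence to all test functions in the dual space.\<close>

lemma (in finite_measure) Lp_weak_compact_finite:
  fixes kn :: "nat \<Rightarrow> 'a \<Rightarrow> real"
  assumes \<A>: "approximable M \<A>" and p: "1 < p"
    and kn: "\<And>n. kn n \<in> borel_measurable M" "\<And>n. integrable M (\<lambda>x. \<bar>kn n x\<bar> powr p)"
      "\<And>n. (LINT x|M. \<bar>kn n x\<bar> powr p) \<le> C"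
  obtains r k where "strict_mono r" "k \<in> borel_measurable M" "integrable M (\<lambda>x. \<bar>k x\<bar> powr p)"
    "\<And>\<psi>. \<psi> \<in> borel_measurable M \<Longrightarrow> integrable M (\<lambda>x. \<bar>\<psi> x\<bar> powr (p / (p - 1))) \<Longrightarrow>
      (\<lambda>n. LINT x|M. \<psi> x * kn (r n) x) \<longlonglongrightarrow> (LINT x|M. \<psi> x * k x)"
proof -
  note [measurable] = kn(1)
  let ?q = "p / (p - 1)"
  have "0 \<le> (LINT x|M. \<bar>kn 0 x\<bar> powr p)" by (intro integral_nonneg_AE) auto
  then have "0 \<le> C" using kn(3)[of 0] by linarith
  have elem: "\<bar>a\<bar> \<le> e * \<bar>a\<bar> powr p + K" if "0 < e" "\<And>a b :: real. \<bar>a * b\<bar> \<le> e * \<bar>a\<bar> powr p + K * \<bar>b\<bar> powr ?q" for a e K :: real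
    using that(2)[of a 1] by simp
  obtain K1 where K1: "0 < K1" "\<And>a b :: real. \<bar>a * b\<bar> \<le> 1 * \<bar>a\<bar> powr p + K1 * \<bar>b\<bar> powr ?q"
    using Youngs_inequality_eps[OF p zero_less_one] by blast
  have ikn: "integrable M (kn n)" for n
  proof (rule Bochner_Integration.integrable_bound)
    show "integrable M (\<lambda>x. \<bar>kn n x\<bar> powr p + K1)" using kn(2) by simp
    show "AE x in M. norm (kn n x) \<le> norm (\<bar>kn n x\<bar> powr p + K1)"
      using elem[OF zero_less_one K1(2)] by (intro AE_I2) (simp add: order_trans[OF _ abs_ge_self])
  qed measurable
  define C1 where "C1 = C + K1 * measure M (space M)"
  have C1: "(LINT x|M. \<bar>kn n x\<bar>) \<le> C1" for n
  proof -
    have "(LINT x|M. \<bar>kn n x\<bar>) \<le> (LINT x|M. \<bar>kn n x\<bar> powr p + K1)"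
      using ikn kn(2) elem[OF zero_less_one K1(2)] by (intro integral_mono) auto
    also have "\<dots> = (LINT x|M. \<bar>kn n x\<bar> powr p) + K1 * measure M (space M)"
      using kn(2) by (subst Bochner_Integration.integral_add) auto
    finally show ?thesis using kn(3)[of n] by (simp add: C1_def)
  qed
  \<comment> \<open>Positive and negative parts, indexed by a boolean, because
    \<open>weak_L1_compact\<close> treats nonnegative functions; the common index gives both the
    same subsequence.\<close>
  define h where "h b n x = (if b then max 0 (kn n x) else max 0 (- kn n x))" for b :: bool and n x
  have h_le: "h b n x \<le> \<bar>kn n x\<bar>" and h_nn: "0 \<le> h b n x" for b n x by (auto simp: h_def)
  have h_diff: "kn n x = h True n x - h False n x" for n x by (auto simp: h_def)
  have hm[measurable]: "h b n \<in> borel_measurable M" for b n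
    by (cases b) (simp_all add: h_def[abs_def])
  have ih: "integrable M (h b n)" for b n
    using ikn[of n] h_le h_nn by (rule_tac Bochner_Integration.integrable_bound) (auto intro!: AE_I2)
  have si: "set_integrable M A f" if "A \<in> sets M" "integrable M f" for A and f :: "'a \<Rightarrow> real"
    using integrable_mult_indicator[OF that] by (simp add: set_integrable_def)
  obtain r k' where r: "strict_mono r" and k': "\<And>b. integrable M (k' b)" "\<And>b x. 0 \<le> k' b x"
    "\<And>b A. A \<in> sets M \<Longrightarrow> (\<lambda>n. LINT x:A|M. h b (r n) x) \<longlonglongrightarrow> (LINT x:A|M. k' b x)"
  proof (rule weak_L1_compact[OF \<A>, of h])
    show "(LINT x|M. h b n x) \<le> C1" for b n
      using integral_mono[OF ih[of b n] integrable_abs[OF ikn[of n]]] h_le C1[of n] by (meson order_trans)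
    fix b and e :: real assume "0 < e"
    \<comment> \<open>Half of e goes to the p-th powers, bounded by C, and the other half to K times
      the measure of A; C + 1 avoids division by 0.\<close>
    define e' where "e' = e / (2 * (C + 1))"
    have e': "0 < e'" "e' * C \<le> e / 2"
      using \<open>0 < e\<close> \<open>0 \<le> C\<close> by (auto simp: e'_def field_simps)
    obtain K where K: "0 < K" "\<And>a b :: real. \<bar>a * b\<bar> \<le> e' * \<bar>a\<bar> powr p + K * \<bar>b\<bar> powr ?q"
      using Youngs_inequality_eps[OF p e'(1)] by blast
    have "(LINT x:A|M. h b n x) \<le> e" if A: "A \<in> sets M" "measure M A < e / (2 * K)" for n A
    proof -
      have "(LINT x:A|M. h b n x) \<le> (LINT x|M. e' * \<bar>kn n x\<bar> powr p + K * indicator A x)"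
        unfolding set_lebesgue_integral_def
      proof (rule integral_mono)
        show "integrable M (\<lambda>x. indicat_real A x *\<^sub>R h b n x)"
          using si[OF A(1) ih] by (simp add: set_integrable_def)
        show "integrable M (\<lambda>x. e' * \<bar>kn n x\<bar> powr p + K * indicator A x)"
          using kn(2) A(1) by (auto simp: less_top[symmetric])
        show "indicat_real A x *\<^sub>R h b n x \<le> e' * \<bar>kn n x\<bar> powr p + K * indicator A x" for x
          using elem[OF e'(1) K(2), of "kn n x"] h_le[of b n x] e'(1) by (auto simp: indicator_def)
      qed
      also have "\<dots> = e' * (LINT x|M. \<bar>kn n x\<bar> powr p) + K * measure M A"
        using kn(2) A(1) by (subst Bochner_Integration.integral_add) (auto simp: less_top[symmetric])
      also have "\<dots> \<le> e / 2 + e / 2"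
      proof (rule add_mono)
        show "e' * (LINT x|M. \<bar>kn n x\<bar> powr p) \<le> e / 2"
          using mult_left_mono[OF kn(3)[of n], of e'] e' by linarith
        show "K * measure M A \<le> e / 2"
          using A(2) K(1) by (simp add: field_simps)
      qed
      finally show ?thesis by simp
    qed
    then show "\<exists>d>0. \<forall>n. \<forall>A\<in>sets M. measure M A < d \<longrightarrow> (LINT x:A|M. h b n x) \<le> e"
      using \<open>0 < e\<close> K(1) by (intro exI[of _ "e / (2 * K)"]) auto
  qed (use ih h_nn in auto)
  define k where "k x = k' True x - k' False x" for x
  have ik: "integrable M k" unfolding k_def using k' by auto
  then have km[measurable]: "k \<in> borel_measurable M" by simp
  have bdd: "(\<lambda>n. LINT x|M. \<psi> x * kn (r n) x) \<longlonglongrightarrow> (LINT x|M. \<psi> x * k x)"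
    if \<psi>: "\<psi> \<in> borel_measurable M" "\<And>x. x \<in> space M \<Longrightarrow> \<bar>\<psi> x\<bar> \<le> B" for \<psi> B
  proof (rule weak_L1_tendsto_bounded[OF ikn C1 ik _ \<psi>])
    fix A assume A: "A \<in> sets M"
    have "(\<lambda>n. (LINT x:A|M. h True (r n) x) - (LINT x:A|M. h False (r n) x)) \<longlonglongrightarrow> (LINT x:A|M. k' True x) - (LINT x:A|M. k' False x)"
      by (intro tendsto_diff k'(3) A)
    then show "(\<lambda>n. LINT x:A|M. kn (r n) x) \<longlonglongrightarrow> (LINT x:A|M. k x)"
      unfolding h_diff k_def using si[OF A] ih k'(1) by (simp add: set_integral_diff(2))
  qed
  have ikp: "integrable M (\<lambda>x. \<bar>k x\<bar> powr p)" and kpC: "(LINT x|M. \<bar>k x\<bar> powr p) \<le> C"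
  proof -
    let ?E = "\<lambda>j::nat. {x\<in>space M. \<bar>k x\<bar> \<le> real j}"
    let ?f = "\<lambda>j x. \<bar>k x\<bar> powr p * indicator (?E j) x"
    have if': "integrable M (?f j)" for j
      using p by (intro integrable_const_bound[where B = "real j powr p"] AE_I2)
        (auto simp: indicator_def intro!: powr_mono2)
    have le: "(LINT x|M. ?f j x) \<le> C" for j
    proof -
      \<comment> \<open>The slope of the p-th power at k, set to 0 where |k| exceeds j, which makes
        it a bounded test function. The resulting bound does not depend on j.\<close>
      define \<psi> where "\<psi> x = p * (sgn (k x) * \<bar>k x\<bar> powr (p - 1)) * indicator (?E j) x" for x
      have [measurable]: "\<psi> \<in> borel_measurable M" unfolding \<psi>_def by measurable
      have \<psi>b: "\<bar>\<psi> x\<bar> \<le> p * real j powr (p - 1)" for x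
        using p by (auto simp: \<psi>_def abs_mult indicator_def sgn_if intro!: powr_mono2)
      have i1: "integrable M (\<lambda>x. \<psi> x * kn n x)" and i2: "integrable M (\<lambda>x. \<psi> x * k x)" for n
        using integrable_mult_bounded[OF ikn, of \<psi>] integrable_mult_bounded[OF ik, of \<psi>] \<psi>b by auto
      have "(LINT x|M. ?f j x) + ((LINT x|M. \<psi> x * kn n x) - (LINT x|M. \<psi> x * k x)) \<le> C" for n
      proof -
        have "(LINT x|M. ?f j x) + ((LINT x|M. \<psi> x * kn n x) - (LINT x|M. \<psi> x * k x))
            = (LINT x|M. ?f j x + (\<psi> x * kn n x - \<psi> x * k x))"
          using if' i1 i2 by simp
        also have "\<dots> \<le> (LINT x|M. \<bar>kn n x\<bar> powr p)"
        proof (rule integral_mono)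
          show "?f j x + (\<psi> x * kn n x - \<psi> x * k x) \<le> \<bar>kn n x\<bar> powr p" for x
            using powr_tangent[OF p, of "k x" "kn n x"]
            by (auto simp: \<psi>_def indicator_def algebra_simps)
        qed (use if' i1 i2 kn(2) in auto)
        finally show ?thesis using kn(3)[of n] by simp
      qed
      moreover have "(\<lambda>n. (LINT x|M. ?f j x) + ((LINT x|M. \<psi> x * kn (r n) x) - (LINT x|M. \<psi> x * k x)))
          \<longlonglongrightarrow> (LINT x|M. ?f j x) + ((LINT x|M. \<psi> x * k x) - (LINT x|M. \<psi> x * k x))"
        using \<psi>b by (intro tendsto_intros bdd) auto
      ultimately show ?thesis
        using LIMSEQ_le_const2 by fastforce
    qed
    have lim: "(\<lambda>j. ?f j x) \<longlonglongrightarrow> \<bar>k x\<bar> powr p" if "x \<in> space M" for x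
    proof (rule tendsto_eventually)
      obtain j0 :: nat where "\<bar>k x\<bar> \<le> real j0" using real_arch_simple by blast
      then show "\<forall>\<^sub>F j in sequentially. ?f j x = \<bar>k x\<bar> powr p"
        using that by (intro eventually_sequentiallyI[of j0]) auto
    qed
    show "integrable M (\<lambda>x. \<bar>k x\<bar> powr p)" "(LINT x|M. \<bar>k x\<bar> powr p) \<le> C"
      by (rule integrable_Fatou[of M ?f, OF if' _ le _ lim]; simp)+
  qed
  show thesis
  proof (rule that[OF r km ikp])
    fix \<psi> assume [measurable]: "\<psi> \<in> borel_measurable M" and \<psi>i: "integrable M (\<lambda>x. \<bar>\<psi> x\<bar> powr ?q)"
    have q: "1 < ?q" using conjugate_exponent[OF p] by simp
    let ?E = "\<lambda>j::nat. {x\<in>space M. \<bar>\<psi> x\<bar> \<le> real j}"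
    \<comment> \<open>The bounded part of \<psi> and its remainder, which tends to 0 in L^q as j
      grows.\<close>
    define \<psi>j \<rho> where "\<psi>j j x = \<psi> x * indicator (?E j) x" and "\<rho> j x = \<psi> x * (1 - indicator (?E j) x)" for j x
    have [measurable]: "\<psi>j j \<in> borel_measurable M" "\<rho> j \<in> borel_measurable M" for j
      unfolding \<psi>j_def \<rho>_def by measurable
    have split: "\<psi> x = \<psi>j j x + \<rho> j x" for j x by (simp add: \<psi>j_def \<rho>_def algebra_simps)
    have \<rho>le: "\<bar>\<rho> j x\<bar> powr ?q \<le> \<bar>\<psi> x\<bar> powr ?q" for j x
      using q by (auto simp: \<rho>_def indicator_def)
    have \<rho>i: "integrable M (\<lambda>x. \<bar>\<rho> j x\<bar> powr ?q)" for j
      using \<psi>i \<rho>le by (rule_tac Bochner_Integration.integrable_bound) (auto intro!: AE_I2)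
    have "(\<lambda>j. LINT x|M. \<bar>\<rho> j x\<bar> powr ?q) \<longlonglongrightarrow> (LINT x|M. 0)"
    proof (rule integral_dominated_convergence[OF _ _ \<psi>i])
      show "AE x in M. (\<lambda>j. \<bar>\<rho> j x\<bar> powr ?q) \<longlonglongrightarrow> 0"
      proof (rule AE_I2, rule tendsto_eventually)
        fix x assume x: "x \<in> space M"
        obtain j0 :: nat where "\<bar>\<psi> x\<bar> \<le> real j0" using real_arch_simple by blast
        then show "\<forall>\<^sub>F j in sequentially. \<bar>\<rho> j x\<bar> powr ?q = 0"
          using x by (intro eventually_sequentiallyI[of j0]) (auto simp: \<rho>_def)
      qed
    qed (use \<rho>le in auto)
    then have \<rho>0: "(\<lambda>j. LINT x|M. \<bar>\<rho> j x\<bar> powr ?q) \<longlonglongrightarrow> 0" by simp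
    have i\<rho>: "integrable M (\<lambda>x. u x * \<rho> j x)" if "u \<in> borel_measurable M" "integrable M (\<lambda>x. \<bar>u x\<bar> powr p)" for u j
      using that \<rho>i by (intro integrable_mult_Lp[OF p]) auto
    have i\<psi>: "integrable M (\<lambda>x. \<psi>j j x * u x)" if "integrable M u" for u :: "'a \<Rightarrow> real" and j
      using integrable_mult_bounded[OF that, of "\<psi>j j" "real j"] by (auto simp: \<psi>j_def indicator_def)
    have decomp: "(LINT x|M. \<psi> x * u x) = (LINT x|M. \<psi>j j x * u x) + (LINT x|M. u x * \<rho> j x)"
      if "u \<in> borel_measurable M" "integrable M u" "integrable M (\<lambda>x. \<bar>u x\<bar> powr p)" for u j
      unfolding split[of _ j] using i\<rho>[OF that(1,3)] i\<psi>[OF that(2)]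
      by (subst Bochner_Integration.integral_add[symmetric]) (auto simp: algebra_simps)
    show "(\<lambda>n. LINT x|M. \<psi> x * kn (r n) x) \<longlonglongrightarrow> (LINT x|M. \<psi> x * k x)"
    proof (rule LIMSEQ_I)
      fix e :: real assume "0 < e"
      \<comment> \<open>The remainder contributes at most e / 6 + e / 6 for every function obeying
        the bound C, hence e / 3 each for the sequence and its limit; the truncated part leaves the
        last third.\<close>
      define \<eta> where "\<eta> = e / (6 * (C + 1))"
      have \<eta>: "0 < \<eta>" "\<eta> * C \<le> e / 6"
        using \<open>0 < e\<close> \<open>0 \<le> C\<close> by (auto simp: \<eta>_def field_simps)
      obtain K where K: "0 < K" "\<And>a b :: real. \<bar>a * b\<bar> \<le> \<eta> * \<bar>a\<bar> powr p + K * \<bar>b\<bar> powr ?q"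
        using Youngs_inequality_eps[OF p \<eta>(1)] by blast
      have "\<forall>\<^sub>F j in sequentially. (LINT x|M. \<bar>\<rho> j x\<bar> powr ?q) < e / (6 * K)"
        using \<rho>0 \<open>0 < e\<close> K(1) by (intro order_tendstoD(2)) auto
      then obtain j where j: "(LINT x|M. \<bar>\<rho> j x\<bar> powr ?q) < e / (6 * K)"
        by (auto simp: eventually_sequentially)
      have small: "\<bar>LINT x|M. u x * \<rho> j x\<bar> \<le> e / 3"
        if "u \<in> borel_measurable M" "integrable M (\<lambda>x. \<bar>u x\<bar> powr p)" "(LINT x|M. \<bar>u x\<bar> powr p) \<le> C" for u
      proof -
        have "norm (LINT x|M. u x * \<rho> j x) \<le> (LINT x|M. \<eta> * \<bar>u x\<bar> powr p + K * \<bar>\<rho> j x\<bar> powr ?q)"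
          using i\<rho>[OF that(1,2)] that(2) \<rho>i K(2) by (intro lebesgue_integral_norm_le) auto
        also have "\<dots> = \<eta> * (LINT x|M. \<bar>u x\<bar> powr p) + K * (LINT x|M. \<bar>\<rho> j x\<bar> powr ?q)"
          using that(2) \<rho>i by simp
        also have "\<dots> \<le> e / 6 + e / 6"
        proof (rule add_mono)
          show "\<eta> * (LINT x|M. \<bar>u x\<bar> powr p) \<le> e / 6"
            using mult_left_mono[OF that(3), of \<eta>] \<eta> by linarith
          show "K * (LINT x|M. \<bar>\<rho> j x\<bar> powr ?q) \<le> e / 6"
            using j K(1) by (simp add: field_simps)
        qed
        finally show ?thesis by simp
      qed
      have lim: "(\<lambda>n. LINT x|M. \<psi>j j x * kn (r n) x) \<longlonglongrightarrow> (LINT x|M. \<psi>j j x * k x)"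
        by (rule bdd[where B = "real j"]) (auto simp: \<psi>j_def indicator_def)
      then obtain N where N: "\<And>n. N \<le> n \<Longrightarrow> \<bar>(LINT x|M. \<psi>j j x * kn (r n) x) - (LINT x|M. \<psi>j j x * k x)\<bar> < e / 3"
        using LIMSEQ_D[OF lim, of "e / 3"] \<open>0 < e\<close> by auto
      have "norm ((LINT x|M. \<psi> x * kn (r n) x) - (LINT x|M. \<psi> x * k x)) < e" if "N \<le> n" for n
        using N[OF that] small[OF kn(1,2,3), of "r n"] small[OF km ikp kpC]
        unfolding decomp[OF kn(1) ikn kn(2), of _ j] decomp[OF km ik ikp, of j] real_norm_def by linarith
      then show "\<exists>N. \<forall>n\<ge>N. norm ((LINT x|M. \<psi> x * kn (r n) x) - (LINT x|M. \<psi> x * k x)) < e" by blast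
    qed
  qed
qed

text \<open>Multiplication by \<open>W\<close> to the power \<open>- 1 / p\<close> is an isometry of \<open>L\<^sup>p(M)\<close> onto the \<open>L\<^sup>p\<close> space of the
  finite measure with density \<open>W\<close>.\<close>

lemma Lp_weak_compact:
  fixes hn :: "nat \<Rightarrow> 'a \<Rightarrow> real"
  assumes W: "W \<in> borel_measurable M" "\<And>x. 0 < W x" "integrable M W" and \<A>: "approximable (density M W) \<A>" and p: "1 < p"
    and hn: "\<And>n. hn n \<in> borel_measurable M" "\<And>n. integrable M (\<lambda>x. \<bar>hn n x\<bar> powr p)"
      "\<And>n. (LINT x|M. \<bar>hn n x\<bar> powr p) \<le> C"
  obtains r h where "strict_mono r" "h \<in> borel_measurable M" "integrable M (\<lambda>x. \<bar>h x\<bar> powr p)"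
    "\<And>\<psi>. \<psi> \<in> borel_measurable M \<Longrightarrow> integrable M (\<lambda>x. \<bar>\<psi> x\<bar> powr (p / (p - 1))) \<Longrightarrow>
      (\<lambda>n. LINT x|M. \<psi> x * hn (r n) x) \<longlonglongrightarrow> (LINT x|M. \<psi> x * h x)"
proof -
  note [measurable] = W(1) hn(1)
  let ?q = "p / (p - 1)" and ?m = "density M W"
  have "emeasure ?m (space ?m) = (\<integral>\<^sup>+x. ennreal (W x) \<partial>M)"
    by (subst emeasure_density) (auto intro!: nn_integral_cong simp: indicator_def)
  also have "\<dots> = ennreal (LINT x|M. W x)"
    using W(2,3) by (intro nn_integral_eq_integral) (auto intro: less_imp_le)
  finally interpret m: finite_measure ?m by (intro finite_measureI) simp
  have dens: "integrable ?m f \<longleftrightarrow> integrable M (\<lambda>x. W x * f x)" "(LINT x|?m. f x) = (LINT x|M. W x * f x)"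
    if "f \<in> borel_measurable M" for f :: "'a \<Rightarrow> real"
    using integrable_density[OF that W(1)] integral_density[OF that W(1)] W(2) by (auto intro: less_imp_le)
  \<comment> \<open>The power -1 / s of the weight, raised to s, cancels the density W of
    \<open>?m\<close>.\<close>
  have pw: "W x * \<bar>u * W x powr (- 1 / s)\<bar> powr s = \<bar>u\<bar> powr s" if "1 < s" for x u s
  proof -
    have "\<bar>u * W x powr (- 1 / s)\<bar> powr s = \<bar>u\<bar> powr s * (W x powr (- 1 / s)) powr s"
      by (simp add: abs_mult powr_mult)
    also have "(W x powr (- 1 / s)) powr s = W x powr (-1)"
      using that by (simp add: powr_powr)
    also have "\<dots> = inverse (W x)"
      using W(2)[of x] by (simp add: powr_minus)
    finally show ?thesis using W(2)[of x] by (simp add: field_simps)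
  qed
  let ?kn = "\<lambda>n x. hn n x * W x powr (- 1 / p)"
  obtain r k where r: "strict_mono r" and k: "k \<in> borel_measurable ?m" "integrable ?m (\<lambda>x. \<bar>k x\<bar> powr p)"
    and lim: "\<And>\<psi>. \<psi> \<in> borel_measurable ?m \<Longrightarrow> integrable ?m (\<lambda>x. \<bar>\<psi> x\<bar> powr ?q) \<Longrightarrow>
      (\<lambda>n. LINT x|?m. \<psi> x * ?kn (r n) x) \<longlonglongrightarrow> (LINT x|?m. \<psi> x * k x)"
  proof (rule m.Lp_weak_compact_finite[OF \<A> p, of ?kn C])
    show "integrable ?m (\<lambda>x. \<bar>?kn n x\<bar> powr p)" "(LINT x|?m. \<bar>?kn n x\<bar> powr p) \<le> C" for n
      using hn(2,3)[of n] by (subst dens, measurable, simp only: pw[OF p])+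
  qed auto
  have [measurable]: "k \<in> borel_measurable M" using k(1) by simp
  define h where "h x = k x * W x powr (1 / p)" for x
  have [measurable]: "h \<in> borel_measurable M" unfolding h_def by measurable
  have kh: "k x = h x * W x powr (- 1 / p)" for x
    using W(2)[of x] by (simp add: h_def powr_minus field_simps)
  have q: "1 < ?q" using conjugate_exponent[OF p] by simp
  have neg: "- 1 / s + - 1 / p = - (1 / p + 1 / s)" for s :: real by simp
  \<comment> \<open>The exponents -1/q and -1/p add up to -1 and cancel the density, so the duality
    pairings in \<open>?m\<close> and in M agree.\<close>
  have WW: "W x * (\<psi> * W x powr (- 1 / ?q) * (u * W x powr (- 1 / p))) = \<psi> * u" for x \<psi> u
  proof -
    have "W x powr (- 1 / ?q) * W x powr (- 1 / p) = W x powr (- (1 / p + 1 / ?q))"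
      unfolding powr_add[symmetric] neg ..
    also have "\<dots> = inverse (W x)"
      unfolding conjugate_exponent(2)[OF p] using W(2)[of x] by (simp add: powr_minus)
    finally have "W x * (W x powr (- 1 / ?q) * W x powr (- 1 / p)) = 1"
      using W(2)[of x] by simp
    then show ?thesis by (metis mult.assoc mult.left_commute mult.right_neutral)
  qed
  show thesis
  proof (rule that[OF r])
    show "integrable M (\<lambda>x. \<bar>h x\<bar> powr p)"
      using k(2) unfolding kh by (subst (asm) dens, measurable) (simp only: pw[OF p])
    fix \<psi> assume [measurable]: "\<psi> \<in> borel_measurable M" and \<psi>: "integrable M (\<lambda>x. \<bar>\<psi> x\<bar> powr ?q)"
    have "(\<lambda>n. LINT x|?m. (\<psi> x * W x powr (- 1 / ?q)) * ?kn (r n) x) \<longlonglongrightarrow> (LINT x|?m. (\<psi> x * W x powr (- 1 / ?q)) * k x)"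
    proof (rule lim)
      show "integrable ?m (\<lambda>x. \<bar>\<psi> x * W x powr (- 1 / ?q)\<bar> powr ?q)"
        using \<psi> by (subst dens, measurable) (simp only: pw[OF q])
    qed simp
    moreover have "(LINT x|?m. (\<psi> x * W x powr (- 1 / ?q)) * ?kn (r n) x) = (LINT x|M. \<psi> x * hn (r n) x)" for n
      by (subst dens, measurable) (simp only: WW)
    moreover have "(LINT x|?m. (\<psi> x * W x powr (- 1 / ?q)) * k x) = (LINT x|M. \<psi> x * h x)"
      unfolding kh by (subst dens, measurable) (simp only: WW)
    ultimately show "(\<lambda>n. LINT x|M. \<psi> x * hn (r n) x) \<longlonglongrightarrow> (LINT x|M. \<psi> x * h x)"
      by simp
  qed simp
qed

subsection \<open>Uniqueness of the divergence\<close>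

text \<open>The positive and negative parts of v are densities of finite measures that agree on
  boxes. Boxes are stable under intersection and generate the Borel sets, so the two measures
  coincide, and with them their densities.\<close>

lemma AE_zero_if_box_integrals_zero:
  fixes v :: "'a::euclidean_space \<Rightarrow> real"
  assumes v: "integrable lborel v" and z: "\<And>a b. (LINT x|lborel. indicator (box a b) x * v x) = 0"
  shows "AE x in lborel. v x = 0"
proof -
  note [measurable] = borel_measurable_integrable[OF v]
  let ?P = "density lborel (\<lambda>x. ennreal (v x))" and ?N = "density lborel (\<lambda>x. ennreal (- v x))"
  have finP: "(\<integral>\<^sup>+x. ennreal (v x) \<partial>lborel) < \<infinity>"
  proof -
    have "(\<integral>\<^sup>+x. ennreal (v x) \<partial>lborel) \<le> (\<integral>\<^sup>+x. ennreal (norm (v x)) \<partial>lborel)"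
      by (intro nn_integral_mono ennreal_leI) auto
    also have "\<dots> < \<infinity>" using v by (simp add: integrable_iff_bounded)
    finally show ?thesis .
  qed
  have eq: "emeasure ?P (box a b) = emeasure ?N (box a b)" for a b
  proof -
    let ?w = "\<lambda>x. indicator (box a b) x * v x"
    have w: "integrable lborel ?w"
      using integrable_mult_indicator[OF _ v, of "box a b"] by simp
    have "0 = (LINT x|lborel. max 0 (?w x) - max 0 (- ?w x))"
      using z[of a b] by (intro trans[OF z[of a b, symmetric]] Bochner_Integration.integral_cong) auto
    also have "\<dots> = (LINT x|lborel. max 0 (?w x)) - (LINT x|lborel. max 0 (- ?w x))"
      using w by (intro Bochner_Integration.integral_diff integrable_max) auto
    finally have i: "(LINT x|lborel. max 0 (?w x)) = (LINT x|lborel. max 0 (- ?w x))" by simp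
    have "emeasure ?P (box a b) = (\<integral>\<^sup>+x. ennreal (max 0 (?w x)) \<partial>lborel)"
      by (subst emeasure_density) (auto intro!: nn_integral_cong simp: indicator_def ennreal_neg max_def)
    also have "\<dots> = (LINT x|lborel. max 0 (?w x))"
      using w by (intro nn_integral_eq_integral integrable_max) auto
    also have "\<dots> = ennreal (LINT x|lborel. max 0 (- ?w x))" unfolding i ..
    also have "\<dots> = (\<integral>\<^sup>+x. ennreal (max 0 (- ?w x)) \<partial>lborel)"
      using w by (intro nn_integral_eq_integral[symmetric] integrable_max) auto
    also have "\<dots> = emeasure ?N (box a b)"
      by (subst emeasure_density) (auto intro!: nn_integral_cong simp: indicator_def ennreal_neg max_def)
    finally show ?thesis .
  qed
  have "?P = ?N"
  proof (rule measure_eqI_generator_eq[where E = "range (\<lambda>(a, b). box a b)" and \<Omega> = UNIV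
        and A = "\<lambda>i::nat. box (- (real i *\<^sub>R One)) (real i *\<^sub>R One)"])
    show "Int_stable (range (\<lambda>(a::'a, b). box a b))"
      by (auto simp: Int_stable_def box_Int_box)
    show "emeasure ?P X = emeasure ?N X" if "X \<in> range (\<lambda>(a, b). box a b)" for X
      using that eq by auto
    show "sets ?P = sigma_sets UNIV (range (\<lambda>(a, b). box a b))" "sets ?N = sigma_sets UNIV (range (\<lambda>(a, b). box a b))"
      by (simp_all add: borel_eq_box)
    show "(\<Union>i::nat. box (- (real i *\<^sub>R One)) (real i *\<^sub>R One)) = (UNIV :: 'a set)"
      by (rule UN_box_eq_UNIV)
    show "emeasure ?P (box (- (real i *\<^sub>R One)) (real i *\<^sub>R One)) \<noteq> \<infinity>" for i
    proof -
      have "emeasure ?P (box (- (real i *\<^sub>R One)) (real i *\<^sub>R One)) \<le> emeasure ?P (space ?P)"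
        by (rule emeasure_space)
      also have "\<dots> = (\<integral>\<^sup>+x. ennreal (v x) \<partial>lborel)"
        by (subst emeasure_density) auto
      finally show ?thesis using finP by (auto simp: top_unique)
    qed
  qed auto
  \<comment> \<open>As \<open>ennreal\<close> sends negative reals to 0, at most one side is nonzero
    at each point; equality makes both vanish.\<close>
  then have "AE x in lborel. ennreal (v x) = ennreal (- v x)"
    using finP by (subst (asm) finite_density_unique) auto
  then show ?thesis
  proof (rule AE_mp, intro AE_I2 impI)
    fix x assume "ennreal (v x) = ennreal (- v x)"
    then show "v x = 0"
      by (cases "0 \<le> v x") (auto simp: ennreal_neg dest: sym)
  qed
qed

text \<open>A bounded function with bounded support lies in every L^s, in particular in the dual
  space. This keeps the pairing with a divergence meaningful when \<Omega> has infinite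
  volume.\<close>

lemma integrable_Lp_times_bounded_support:
  assumes p: "1 < p" and h: "h \<in> Lp_space \<Omega> p" and \<Omega>: "open \<Omega>"
    and \<phi>: "\<phi> \<in> borel_measurable (lebesgue_on \<Omega>)" "\<And>x. x \<in> \<Omega> \<Longrightarrow> \<bar>\<phi> x\<bar> \<le> B" "\<And>x. x \<in> \<Omega> \<Longrightarrow> R < norm x \<Longrightarrow> \<phi> x = 0"
  shows "0 < s \<Longrightarrow> integrable (lebesgue_on \<Omega>) (\<lambda>x. \<bar>\<phi> x\<bar> powr s)" "integrable (lebesgue_on \<Omega>) (\<lambda>x. \<phi> x * h x)"
proof -
  have i: "integrable (lebesgue_on \<Omega>) (\<lambda>x. \<bar>\<phi> x\<bar> powr s)" if "0 < s" for s
  proof (rule Bochner_Integration.integrable_bound)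
    have "integrable lborel (\<lambda>x. indicator (\<Omega> \<inter> cball 0 R) x *\<^sub>R (B powr s))"
      using \<Omega> by (intro integrable_real_indicator[THEN integrable_scaleR_left])
        (simp_all add: emeasure_bounded_finite[unfolded infinity_ennreal_def] bounded_Int)
    then have "integrable lebesgue (\<lambda>x. indicator (\<Omega> \<inter> cball 0 R) x *\<^sub>R (B powr s))"
      using \<Omega> by (subst integrable_completion) auto
    then show "integrable (lebesgue_on \<Omega>) (\<lambda>x. indicator (cball 0 R) x * (B powr s))"
      using \<Omega> by (subst integrable_restrict_space) (auto simp: indicator_inter_arith mult.assoc)
    show "AE x in lebesgue_on \<Omega>. norm (\<bar>\<phi> x\<bar> powr s) \<le> norm (indicator (cball 0 R) x * (B powr s))"
      using \<phi>(2,3) that by (intro AE_I2) (force simp: indicator_def space_restrict_space intro!: powr_mono2)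
    show "(\<lambda>x. \<bar>\<phi> x\<bar> powr s) \<in> borel_measurable (lebesgue_on \<Omega>)" using \<phi>(1) by measurable
  qed
  then show "0 < s \<Longrightarrow> integrable (lebesgue_on \<Omega>) (\<lambda>x. \<bar>\<phi> x\<bar> powr s)" .
  have "integrable (lebesgue_on \<Omega>) (\<lambda>x. h x * \<phi> x)"
    using h \<phi>(1) i[of "p / (p - 1)"] p by (intro integrable_mult_Lp[OF p]) (auto simp: Lp_space_def)
  then show "integrable (lebesgue_on \<Omega>) (\<lambda>x. \<phi> x * h x)" by (simp add: mult.commute)
qed

text \<open>The fundamental lemma of the calculus of variations. Smooth tests increase to the
  indicator of a box whose closure lies in \<Omega>, so u has zero integral over all such boxes and
  vanishes almost everywhere in each of them. Countably many closed boxes exhaust \<Omega>, and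
  their boundaries are null sets.\<close>

lemma Lp_zero_if_test_integrals_zero:
  fixes u :: "real^'n \<Rightarrow> real"
  assumes p: "1 < p" and \<Omega>: "open \<Omega>" and u: "u \<in> Lp_space \<Omega> p"
    and z: "\<And>\<phi>. \<phi> \<in> test_fun \<Omega> \<Longrightarrow> (LINT x|lebesgue_on \<Omega>. \<phi> x * u x) = 0"
  shows "AE x in lebesgue_on \<Omega>. u x = 0"
proof -
  have um[measurable]: "u \<in> borel_measurable (lebesgue_on \<Omega>)" using u by (simp add: Lp_space_def)
  have bm: "(indicator (box a b) :: _ \<Rightarrow> real) \<in> borel_measurable (lebesgue_on \<Omega>)" for a b
    by (intro measurable_restrict_space1 borel_measurable_indicator) simp
  have bi: "integrable (lebesgue_on \<Omega>) (\<lambda>x. indicator (box a b) x * u x)" for a b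
  proof -
    obtain R where "\<forall>x\<in>box a b. norm x \<le> R" using bounded_box[of a b] unfolding bounded_iff by blast
    then show ?thesis
      by (intro integrable_Lp_times_bounded_support(2)[OF p u \<Omega> bm, where B = 1 and R = R])
        (auto simp: indicator_def)
  qed
  have boxz: "(LINT x|lebesgue_on \<Omega>. indicator (box a b) x * u x) = 0" if ab: "cbox a b \<subseteq> \<Omega>" for a b
  proof -
    \<comment> \<open>test functions increasing to the indicator of the box\<close>
    define \<phi> where "\<phi> k x = 1 + (-1) * exp ((- real k) * bump a b x)" for k x
    have Ck: "Ck_on m UNIV (\<phi> k)" for m k
      unfolding \<phi>_def by (intro Ck_on_add Ck_on_mult Ck_on_const Ck_on_exp Ck_on_bump open_UNIV)
    have supp: "\<phi> k x = 0" if "x \<notin> box a b" for k x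
      using bump_eq_0[OF that] by (simp add: \<phi>_def)
    have "\<forall>x\<in>\<Omega> - cbox a b. \<phi> k x = 0" for k
      using supp[of _ k] box_subset_cbox[of a b] by blast
    then have "\<phi> k \<in> test_fun \<Omega>" for k
      unfolding test_fun_def using Ck_on_subset[OF Ck, of \<Omega>] ab compact_cbox[of a b] by blast
    then have zk: "(LINT x|lebesgue_on \<Omega>. \<phi> k x * u x) = 0" for k by (rule z)
    have ind: "\<bar>\<phi> k x\<bar> \<le> indicator (box a b) x" for k x
      using bump_nonneg[of a b x] supp[of x k] by (auto simp: indicator_def \<phi>_def)
    have lim: "(\<lambda>k. \<phi> k x) \<longlonglongrightarrow> indicator (box a b) x" for x
    proof (cases "x \<in> box a b")
      case True
      then have "0 < bump a b x" by (simp add: bump_pos_iff)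
      then have "(\<lambda>k. exp (- bump a b x) ^ k) \<longlonglongrightarrow> 0"
        by (intro LIMSEQ_power_zero) simp
      then have "(\<lambda>k. 1 + (-1) * exp (- bump a b x) ^ k) \<longlonglongrightarrow> 1 + (-1) * 0"
        by (intro tendsto_add tendsto_mult tendsto_const)
      moreover have "exp (- bump a b x) ^ k = exp ((- real k) * bump a b x)" for k
        by (simp add: exp_of_nat_mult[symmetric])
      ultimately show ?thesis using True by (simp add: \<phi>_def)
    qed (simp add: supp)
    have "(\<lambda>k. LINT x|lebesgue_on \<Omega>. \<phi> k x * u x) \<longlonglongrightarrow> (LINT x|lebesgue_on \<Omega>. indicator (box a b) x * u x)"
    proof (rule integral_dominated_convergence[where w = "\<lambda>x. \<bar>indicator (box a b) x * u x\<bar>"])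
      show "(\<lambda>x. \<phi> k x * u x) \<in> borel_measurable (lebesgue_on \<Omega>)" for k
        using borel_measurable_continuous_onI[OF Ck_on_continuous[OF Ck], of k]
        by (intro borel_measurable_times um measurable_restrict_space1 measurable_completion) simp_all
      show "AE x in lebesgue_on \<Omega>. (\<lambda>k. \<phi> k x * u x) \<longlonglongrightarrow> indicator (box a b) x * u x"
        by (intro AE_I2 tendsto_intros lim)
      show "AE x in lebesgue_on \<Omega>. norm (\<phi> k x * u x) \<le> \<bar>indicator (box a b) x * u x\<bar>" for k
        using ind[of k] by (intro AE_I2) (simp add: abs_mult mult_right_mono)
    qed (use bi bm in auto)
    then show ?thesis unfolding zk by (simp add: LIMSEQ_const_iff)
  qed
  have local: "AE x in lebesgue. x \<in> box a b \<longrightarrow> u x = 0" if ab: "cbox a b \<subseteq> \<Omega>" for a b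
  proof -
    define v where "v x = indicator \<Omega> x *\<^sub>R (indicator (box a b) x * u x)" for x
    have iv: "integrable lebesgue v"
      using bi[of a b] \<Omega> unfolding v_def by (subst (asm) integrable_restrict_space) auto
    \<comment> \<open>\<open>AE_zero_if_box_integrals_zero\<close> speaks of Borel functions, so the
      Lebesgue measurable v is replaced by a Borel version.\<close>
    obtain v' where v': "v' \<in> borel_measurable lborel" "AE x in lborel. v x = v' x"
      using completion_ex_borel_measurable_real[OF borel_measurable_integrable[OF iv]] by blast
    have iv': "integrable lebesgue v'"
      using iv v' by (subst integrable_cong_AE[symmetric]) (auto intro: AE_completion measurable_completion)
    have "AE x in lborel. v' x = 0"
    proof (rule AE_zero_if_box_integrals_zero)
      show "integrable lborel v'" using iv' v'(1) by (simp add: integrable_completion)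
      fix c d
      obtain e f where ef: "box c d \<inter> box a b = box e f"
        using box_Int_box by blast
      have "(LINT x|lborel. indicator (box c d) x * v' x) = (LINT x|lebesgue. indicator (box c d) x * v' x)"
        using v'(1) by (intro integral_completion[symmetric]) simp
      also have "\<dots> = (LINT x|lebesgue. indicator (box c d) x * v x)"
      proof (rule integral_cong_AE)
        show "(\<lambda>x. indicat_real (box c d) x * v' x) \<in> borel_measurable lebesgue"
          by (intro borel_measurable_times borel_measurable_indicator borel_measurable_integrable[OF iv']) simp
        show "(\<lambda>x. indicat_real (box c d) x * v x) \<in> borel_measurable lebesgue"
          by (intro borel_measurable_times borel_measurable_indicator borel_measurable_integrable[OF iv]) simp
        show "AE x in lebesgue. indicat_real (box c d) x * v' x = indicat_real (box c d) x * v x"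
          using AE_completion[OF v'(2)] by auto
      qed
      also have "\<dots> = (LINT x|lebesgue. indicator \<Omega> x *\<^sub>R (indicator (box e f) x * u x))"
        by (intro Bochner_Integration.integral_cong) (auto simp: v_def indicator_def simp flip: ef)
      also have "\<dots> = (LINT x|lebesgue_on \<Omega>. indicator (box e f) x * u x)"
        using \<Omega> by (subst integral_restrict_space) auto
      also have "\<dots> = 0"
      \<comment> \<open>A nonempty open box has the closed box as its closure, which places it
        inside \<Omega>. When the open box is empty, the closed one may still be nonempty and need
        not lie in \<Omega>.\<close>
      proof (cases "box e f = {}")
        case False
        have "cbox e f \<subseteq> \<Omega>"
          using closure_mono[of "box e f" "cbox a b"] closure_box[OF False] box_subset_cbox[of a b] ab ef by auto
        then show ?thesis by (rule boxz)
      qed simp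
      finally show "(LINT x|lborel. indicator (box c d) x * v' x) = 0" .
    qed
    then have "AE x in lborel. v x = 0" using v'(2) by auto
    then have "AE x in lebesgue. v x = 0" by (rule AE_completion)
    then show ?thesis
      using ab box_subset_cbox[of a b] by (auto simp: v_def indicator_def elim!: AE_mp)
  qed
  obtain \<D> where \<D>: "countable \<D>" "\<D> \<subseteq> Pow \<Omega>" "\<And>X. X \<in> \<D> \<Longrightarrow> \<exists>a b. X = cbox a b" "\<Union>\<D> = \<Omega>"
    using open_countable_Union_open_cbox[OF \<Omega>] by blast
  have "AE x in lebesgue. \<forall>X\<in>\<D>. x \<in> X \<longrightarrow> u x = 0"
  proof (subst AE_ball_countable[OF \<D>(1)], rule ballI)
    fix X assume "X \<in> \<D>"
    then obtain a b where X: "X = cbox a b" "cbox a b \<subseteq> \<Omega>" using \<D>(2,3) by blast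
    have "cbox a b - box a b \<in> null_sets lebesgue"
      using negligible_frontier_interval[of a b] by (simp add: negligible_iff_null_sets)
    then have "AE x in lebesgue. x \<notin> cbox a b - box a b" by (rule AE_not_in)
    with local[OF X(2)] show "AE x in lebesgue. x \<in> X \<longrightarrow> u x = 0" unfolding X by auto
  qed
  then have "AE x in lebesgue. x \<in> \<Omega> \<longrightarrow> u x = 0"
    using \<D>(4) by (auto elim!: AE_mp)
  then show ?thesis using \<Omega> by (subst AE_restrict_space_iff) auto
qed

subsection \<open>Vector measures with a density\<close>

definition has_vec_density ::
  "'a::topological_space set \<Rightarrow> 'a measure \<Rightarrow> ('a \<Rightarrow> 'b::{banach, second_countable_topology}) \<Rightarrow> ('a set \<Rightarrow> 'b) \<Rightarrow> bool" where
  "has_vec_density \<Omega> \<alpha> s \<sigma> \<longleftrightarrow> (\<forall>A\<in>sets (borel_on \<Omega>). \<sigma> A = (LINT x:A|\<alpha>. s x))"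

lemma pos_measuresD:
  assumes "\<alpha> \<in> pos_measures \<Omega>"
  shows "finite_measure \<alpha>" "sets \<alpha> = sets (borel_on \<Omega>)" "space \<alpha> = \<Omega>"
  using assms sets_eq_imp_space_eq[of \<alpha> "borel_on \<Omega>"] by (auto simp: pos_measures_def space_restrict_space)

lemma has_vec_density_vec_measures:
  fixes s :: "'a::topological_space \<Rightarrow> 'b::{banach, second_countable_topology}"
  assumes \<alpha>: "\<alpha> \<in> pos_measures \<Omega>" and s: "integrable \<alpha> s" and \<sigma>: "has_vec_density \<Omega> \<alpha> s \<sigma>"
  shows "\<sigma> \<in> vec_measures \<Omega>"
  unfolding vec_measures_def
proof (clarify)
  fix A :: "nat \<Rightarrow> 'a set"
  assume A: "range A \<subseteq> sets (borel_on \<Omega>)" "disjoint_family A"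
  note sets = pos_measuresD(2)[OF \<alpha>]
  have AM: "A i \<in> sets \<alpha>" for i using A(1) sets by auto
  have i: "integrable \<alpha> (\<lambda>x. indicat_real B x *\<^sub>R s x)" if "B \<in> sets \<alpha>" for B
    using integrable_mult_indicator[OF that s] .
  have part: "(\<Sum>i<n. \<sigma> (A i)) = (LINT x|\<alpha>. indicat_real (\<Union>i<n. A i) x *\<^sub>R s x)" for n
  proof -
    have "indicat_real (\<Union>i<n. A i) x = (\<Sum>i<n. indicat_real (A i) x)" for x
      using A(2) by (intro indicator_UN_disjoint) (auto simp: disjoint_family_on_def)
    then have "(LINT x|\<alpha>. indicat_real (\<Union>i<n. A i) x *\<^sub>R s x) = (LINT x|\<alpha>. (\<Sum>i<n. indicat_real (A i) x *\<^sub>R s x))"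
      by (simp add: scaleR_sum_left)
    also have "\<dots> = (\<Sum>i<n. \<sigma> (A i))"
      using \<sigma> i AM sets by (subst Bochner_Integration.integral_sum) (auto simp: has_vec_density_def set_lebesgue_integral_def)
    finally show ?thesis ..
  qed
  have "(\<lambda>n. LINT x|\<alpha>. indicat_real (\<Union>i<n. A i) x *\<^sub>R s x) \<longlonglongrightarrow> (LINT x|\<alpha>. indicat_real (\<Union>i. A i) x *\<^sub>R s x)"
  proof (rule integral_dominated_convergence[where w = "\<lambda>x. norm (s x)"])
    show "AE x in \<alpha>. (\<lambda>n. indicat_real (\<Union>i<n. A i) x *\<^sub>R s x) \<longlonglongrightarrow> indicat_real (\<Union>i. A i) x *\<^sub>R s x"
      by (intro AE_I2 tendsto_intros LIMSEQ_indicator_UN)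
    show "AE x in \<alpha>. norm (indicat_real (\<Union>i<n. A i) x *\<^sub>R s x) \<le> norm (s x)" for n
      by (intro AE_I2) (simp add: indicator_def)
  qed (use s AM i in \<open>auto intro!: borel_measurable_integrable\<close>)
  then show "(\<lambda>i. \<sigma> (A i)) sums \<sigma> (\<Union>i. A i)"
    unfolding sums_def part using \<sigma> A(1) sets
    by (subst \<sigma>[unfolded has_vec_density_def, rule_format]) (auto simp: set_lebesgue_integral_def)
qed

text \<open>The supremum in \<open>upper_variation\<close> is attained on the part of A where s is
  nonnegative.\<close>

lemma pos_part_density:
  assumes \<alpha>: "\<alpha> \<in> pos_measures \<Omega>" and s: "integrable \<alpha> s" and \<nu>: "has_vec_density \<Omega> \<alpha> s \<nu>"
  shows "pos_part \<Omega> \<nu> = density \<alpha> (\<lambda>x. ennreal (s x))"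
proof (rule measure_eqI)
  note sets = pos_measuresD(2)[OF \<alpha>]
  note [measurable] = borel_measurable_integrable[OF s]
  show "sets (pos_part \<Omega> \<nu>) = sets (density \<alpha> (\<lambda>x. ennreal (s x)))"
    using sets by simp
  fix A assume "A \<in> sets (pos_part \<Omega> \<nu>)"
  then have A: "A \<in> sets (borel_on \<Omega>)" "A \<in> sets \<alpha>" using sets by auto
  have i: "integrable \<alpha> (\<lambda>x. indicat_real B x * s x)" if "B \<in> sets \<alpha>" for B
    using integrable_mult_indicator[OF that s] by simp
  have im: "integrable \<alpha> (\<lambda>x. indicat_real B x * max 0 (s x))" if "B \<in> sets \<alpha>" for B
    using integrable_mult_indicator[OF that integrable_max[OF _ s], of "\<lambda>_. 0"] by simp
  have d: "emeasure (density \<alpha> (\<lambda>x. ennreal (s x))) A = ennreal (LINT x|\<alpha>. indicat_real A x * max 0 (s x))"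
  proof -
    have "emeasure (density \<alpha> (\<lambda>x. ennreal (s x))) A = (\<integral>\<^sup>+x. ennreal (indicat_real A x * max 0 (s x)) \<partial>\<alpha>)"
      using A(2) by (subst emeasure_density) (auto intro!: nn_integral_cong simp: indicator_def ennreal_max_0)
    also have "\<dots> = ennreal (LINT x|\<alpha>. indicat_real A x * max 0 (s x))"
      by (intro nn_integral_eq_integral im A(2)) (simp add: indicator_def)
    finally show ?thesis .
  qed
  have "upper_variation \<Omega> \<nu> A = ennreal (LINT x|\<alpha>. indicat_real A x * max 0 (s x))"
  proof (rule antisym)
    show "upper_variation \<Omega> \<nu> A \<le> ennreal (LINT x|\<alpha>. indicat_real A x * max 0 (s x))"
      unfolding upper_variation_def
    proof (rule SUP_least, clarify)
      fix B assume B: "B \<in> sets (borel_on \<Omega>)" "B \<subseteq> A"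
      have "\<nu> B = (LINT x|\<alpha>. indicat_real B x * s x)"
        using \<nu> B(1) by (simp add: has_vec_density_def set_lebesgue_integral_def)
      also have "\<dots> \<le> (LINT x|\<alpha>. indicat_real A x * max 0 (s x))"
        using B A sets by (intro integral_mono i im) (auto simp: indicator_def)
      finally show "ennreal (\<nu> B) \<le> ennreal (LINT x|\<alpha>. indicat_real A x * max 0 (s x))"
        by (rule ennreal_leI)
    qed
    let ?B = "{x \<in> A. 0 \<le> s x}"
    have B: "?B \<in> sets (borel_on \<Omega>)"
    proof -
      have "{x \<in> space \<alpha>. 0 \<le> s x} \<inter> A \<in> sets \<alpha>" using A(2) by (intro sets.Int) measurable
      moreover have "{x \<in> space \<alpha>. 0 \<le> s x} \<inter> A = ?B" using sets.sets_into_space[OF A(2)] by auto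
      ultimately show ?thesis using sets by simp
    qed
    have "(LINT x|\<alpha>. indicat_real A x * max 0 (s x)) = (LINT x|\<alpha>. indicat_real ?B x * s x)"
      by (intro Bochner_Integration.integral_cong) (auto simp: indicator_def)
    also have "\<dots> = \<nu> ?B"
      using \<nu> B by (simp add: has_vec_density_def set_lebesgue_integral_def)
    finally show "ennreal (LINT x|\<alpha>. indicat_real A x * max 0 (s x)) \<le> upper_variation \<Omega> \<nu> A"
      using upper_variation_ge[OF B, of A \<nu>] by simp
  qed
  then show "emeasure (pos_part \<Omega> \<nu>) A = emeasure (density \<alpha> (\<lambda>x. ennreal (s x))) A"
    using emeasure_pos_part[OF has_vec_density_vec_measures[OF \<alpha> s \<nu>] A(1)] d by simp
qed

lemma signed_integral_density:
  assumes \<alpha>: "\<alpha> \<in> pos_measures \<Omega>" and s: "integrable \<alpha> s" and \<nu>: "has_vec_density \<Omega> \<alpha> s \<nu>"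
    and \<phi>: "\<phi> \<in> borel_measurable \<alpha>" "\<And>x. x \<in> \<Omega> \<Longrightarrow> \<bar>\<phi> x\<bar> \<le> B"
  shows "signed_integral \<Omega> \<nu> \<phi> = (LINT x|\<alpha>. s x * \<phi> x)"
proof -
  note [measurable] = borel_measurable_integrable[OF s] \<phi>(1)
  have d: "(LINT x|density \<alpha> (\<lambda>x. ennreal (t x)). \<phi> x) = (LINT x|\<alpha>. max 0 (t x) * \<phi> x)"
    if [measurable]: "t \<in> borel_measurable \<alpha>" for t
  proof -
    have "(\<lambda>x. ennreal (t x)) = (\<lambda>x. ennreal (max 0 (t x)))" by (simp add: ennreal_max_0)
    then have "(LINT x|density \<alpha> (\<lambda>x. ennreal (t x)). \<phi> x) = (LINT x|density \<alpha> (\<lambda>x. ennreal (max 0 (t x))). \<phi> x)"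
      by simp
    also have "\<dots> = (LINT x|\<alpha>. max 0 (t x) * \<phi> x)"
      by (subst integral_density) auto
    finally show ?thesis .
  qed
  have neg: "has_vec_density \<Omega> \<alpha> (\<lambda>x. - s x) (\<lambda>A. - \<nu> A)"
    using \<nu> by (simp add: has_vec_density_def set_lebesgue_integral_def)
  have i: "integrable \<alpha> (\<lambda>x. max 0 (t x) * \<phi> x)" if "integrable \<alpha> t" for t
    using integrable_mult_bounded[OF integrable_max[OF _ that, of "\<lambda>_. 0"] \<phi>(1), of B] \<phi>(2) pos_measuresD(3)[OF \<alpha>]
    by (simp add: mult.commute)
  have "signed_integral \<Omega> \<nu> \<phi> = (LINT x|\<alpha>. max 0 (s x) * \<phi> x) - (LINT x|\<alpha>. max 0 (- s x) * \<phi> x)"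
    unfolding signed_integral_def pos_part_density[OF \<alpha> s \<nu>] pos_part_density[OF \<alpha> integrable_minus[OF s] neg]
    by (simp add: d)
  also have "\<dots> = (LINT x|\<alpha>. max 0 (s x) * \<phi> x - max 0 (- s x) * \<phi> x)"
    using i[OF s] i[OF integrable_minus[OF s]] by simp
  also have "\<dots> = (LINT x|\<alpha>. s x * \<phi> x)"
    by (intro Bochner_Integration.integral_cong) (auto simp: max_def)
  finally show ?thesis .
qed

lemma borel_measurable_vec_nth:
  fixes s :: "'a \<Rightarrow> real^'n"
  assumes "s \<in> borel_measurable M"
  shows "(\<lambda>x. s x $ i) \<in> borel_measurable M"
  using assms borel_measurable_continuous_onI[of "\<lambda>v::real^'n. v $ i"]
  by (auto intro: measurable_compose continuous_intros)

lemma vec_integral_density: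
  fixes s \<phi> :: "real^'n \<Rightarrow> real^'n"
  assumes \<alpha>: "\<alpha> \<in> pos_measures \<Omega>" and s: "integrable \<alpha> s" and \<sigma>: "has_vec_density \<Omega> \<alpha> s \<sigma>"
    and \<phi>: "\<phi> \<in> borel_measurable \<alpha>" "\<And>x. x \<in> \<Omega> \<Longrightarrow> norm (\<phi> x) \<le> B"
  shows "vec_integral \<Omega> \<sigma> \<phi> = (LINT x|\<alpha>. s x \<bullet> \<phi> x)"
proof -
  have si: "integrable \<alpha> (\<lambda>x. s x $ i)" for i
    using integrable_bounded_linear[OF bounded_linear_vec_nth s] .
  have \<phi>m: "(\<lambda>x. \<phi> x $ i) \<in> borel_measurable \<alpha>" for i
    using \<phi>(1) by (rule borel_measurable_vec_nth)
  have \<phi>b: "\<bar>\<phi> x $ i\<bar> \<le> B" if "x \<in> \<Omega>" for x i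
    using \<phi>(2)[OF that] component_le_norm_cart[of "\<phi> x" i] by linarith
  have "has_vec_density \<Omega> \<alpha> (\<lambda>x. s x $ i) (\<lambda>A. \<sigma> A $ i)" for i
    unfolding has_vec_density_def
  proof
    fix A assume A: "A \<in> sets (borel_on \<Omega>)"
    then have "integrable \<alpha> (\<lambda>x. indicat_real A x *\<^sub>R s x)"
      using integrable_mult_indicator[OF _ s] pos_measuresD(2)[OF \<alpha>] by simp
    then show "\<sigma> A $ i = (LINT x:A|\<alpha>. s x $ i)"
      using \<sigma> A integral_bounded_linear[OF bounded_linear_vec_nth, of \<alpha> "\<lambda>x. indicat_real A x *\<^sub>R s x" i]
      by (simp add: has_vec_density_def set_lebesgue_integral_def)
  qed
  then have "vec_integral \<Omega> \<sigma> \<phi> = (\<Sum>i\<in>UNIV. (LINT x|\<alpha>. s x $ i * \<phi> x $ i))"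
    unfolding vec_integral_def using \<phi>b by (intro sum.cong signed_integral_density[OF \<alpha> si _ \<phi>m]) auto
  also have "\<dots> = (LINT x|\<alpha>. (\<Sum>i\<in>UNIV. s x $ i * \<phi> x $ i))"
    using integrable_mult_bounded[OF si \<phi>m, where B = B] \<phi>b pos_measuresD(3)[OF \<alpha>]
    by (intro Bochner_Integration.integral_sum[symmetric]) (simp add: mult.commute)
  finally show ?thesis by (simp add: inner_vec_def)
qed

text \<open>The variation is at most the integral of |s| because the norm of an integral is. For the
  converse, A is cut into countably many pieces on which s is almost constant, where the two sides
  nearly agree.\<close>

lemma tot_var_density:
  fixes s :: "'a::topological_space \<Rightarrow> 'b::{banach, second_countable_topology}"
  assumes \<alpha>: "\<alpha> \<in> pos_measures \<Omega>" and s: "integrable \<alpha> s" and \<sigma>: "has_vec_density \<Omega> \<alpha> s \<sigma>"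
  shows "tot_var \<Omega> \<sigma> = density \<alpha> (\<lambda>x. ennreal (norm (s x)))"
proof (rule measure_eqI)
  interpret finite_measure \<alpha> by (rule pos_measuresD[OF \<alpha>])
  note sets = pos_measuresD(2)[OF \<alpha>]
  have sm[measurable]: "s \<in> borel_measurable \<alpha>" using s by (rule borel_measurable_integrable)
  show "sets (tot_var \<Omega> \<sigma>) = sets (density \<alpha> (\<lambda>x. ennreal (norm (s x))))" using sets by simp
  fix A assume "A \<in> sets (tot_var \<Omega> \<sigma>)"
  then have A: "A \<in> sets (borel_on \<Omega>)" "A \<in> sets \<alpha>" using sets by auto
  have i: "integrable \<alpha> (\<lambda>x. indicat_real B x *\<^sub>R s x)" if "B \<in> sets \<alpha>" for B
    using integrable_mult_indicator[OF that s] .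
  have nB: "ennreal (norm (\<sigma> B)) \<le> emeasure (density \<alpha> (\<lambda>x. ennreal (norm (s x)))) B" if B: "B \<in> sets \<alpha>" for B
  proof -
    have "ennreal (norm (\<sigma> B)) = ennreal (norm (LINT x|\<alpha>. indicat_real B x *\<^sub>R s x))"
      using \<sigma> B sets by (simp add: has_vec_density_def set_lebesgue_integral_def)
    also have "\<dots> \<le> (\<integral>\<^sup>+x. ennreal (norm (indicat_real B x *\<^sub>R s x)) \<partial>\<alpha>)"
      by (rule integral_norm_bound_ennreal[OF i[OF B]])
    also have "\<dots> = emeasure (density \<alpha> (\<lambda>x. ennreal (norm (s x)))) B"
      using B by (subst emeasure_density) (auto intro!: nn_integral_cong simp: indicator_def)
    finally show ?thesis .
  qed
  have "variation \<Omega> \<sigma> A = emeasure (density \<alpha> (\<lambda>x. ennreal (norm (s x)))) A" (is "_ = ?d A")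
  proof (rule antisym)
    show "variation \<Omega> \<sigma> A \<le> ?d A"
      unfolding variation_def
    proof (rule SUP_least, clarify)
      fix P :: "nat \<Rightarrow> 'a set" assume P: "range P \<subseteq> sets (borel_on \<Omega>)" "disjoint_family P" "A = (\<Union>i. P i)"
      have "(\<Sum>i. ennreal (norm (\<sigma> (P i)))) \<le> (\<Sum>i. ?d (P i))"
        using P(1) sets by (intro suminf_le nB) auto
      also have "\<dots> = ?d (\<Union>i. P i)"
        using P(1,2) sets by (intro suminf_emeasure) auto
      finally show "(\<Sum>i. ennreal (norm (\<sigma> (P i)))) \<le> ?d (\<Union>i. P i)" .
    qed
    show "?d A \<le> variation \<Omega> \<sigma> A"
    proof (rule ennreal_le_epsilon)
      fix e :: real assume "0 < e"
      \<comment> \<open>Each piece will lose 2 \<epsilon> times its measure; the choice makes the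
        total loss at most e, also when A is a null set.\<close>
      define \<epsilon> where "\<epsilon> = e / (2 * (measure \<alpha> A + 1))"
      have m: "0 < 2 * (measure \<alpha> A + 1)" by (simp add: add_nonneg_pos)
      then have "0 < \<epsilon>" unfolding \<epsilon>_def using \<open>0 < e\<close> by (rule divide_pos_pos[rotated])
      moreover have "\<epsilon> * (2 * (measure \<alpha> A + 1)) = e" using m by (simp add: \<epsilon>_def)
      ultimately have \<epsilon>: "0 < \<epsilon>" "2 * \<epsilon> * measure \<alpha> A \<le> e"
        by (simp_all add: algebra_simps)
      obtain D :: "'b set" where D: "countable D" "\<And>X. open X \<Longrightarrow> X \<noteq> {} \<Longrightarrow> \<exists>d\<in>D. d \<in> X"
        using countable_dense_setE by blast
      have D0: "D \<noteq> {}" using D(2)[of UNIV] by auto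
      define c where "c = from_nat_into D"
      \<comment> \<open>Balls of radius \<epsilon> around a countable dense set cover the space, so
        their preimages under s cover A; making them disjoint gives the partition.\<close>
      define Q where "Q j = A \<inter> (s -` (ball (c j) \<epsilon>) \<inter> space \<alpha>)" for j
      define P where "P = disjointed Q"
      have QM: "range Q \<subseteq> sets \<alpha>" unfolding Q_def using A(2) by (auto intro!: sets.Int measurable_sets[OF sm])
      have PM: "P j \<in> sets \<alpha>" for j
        using sets.range_disjointed_sets[OF QM] by (auto simp: P_def)
      have UP: "(\<Union>j. P j) = A"
        unfolding P_def UN_disjointed_eq
      proof
        show "A \<subseteq> (\<Union>j. Q j)"
        proof
          fix x assume x: "x \<in> A"
          obtain d where "d \<in> D" "d \<in> ball (s x) \<epsilon>" using D(2)[of "ball (s x) \<epsilon>"] \<epsilon>(1) by auto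
          moreover then obtain j where "c j = d"
            using from_nat_into_surj[OF D(1)] unfolding c_def by blast
          ultimately show "x \<in> (\<Union>j. Q j)"
            using x sets.sets_into_space[OF A(2)] by (auto simp: Q_def dist_commute)
        qed
      qed (auto simp: Q_def)
      have dP: "disjoint_family P" unfolding P_def by (rule disjoint_family_disjointed)
      \<comment> \<open>The error \<epsilon> enters twice: replacing s by the constant
        \<open>c j\<close> in the vector integral, and in the integral of the norm.\<close>
      have near: "?d (P j) \<le> ennreal (norm (\<sigma> (P j))) + ennreal (2 * \<epsilon>) * emeasure \<alpha> (P j)" for j
      proof -
        have close: "norm (s x - c j) \<le> \<epsilon>" if "x \<in> P j" for x
          using that disjointed_subset[of Q j] by (auto simp: P_def Q_def dist_norm norm_minus_commute)
        have ic: "integrable \<alpha> (\<lambda>x. indicat_real (P j) x *\<^sub>R c j)"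
          using PM by (intro integrable_scaleR_left integrable_real_indicator) (auto simp: less_top[symmetric])
        have in': "integrable \<alpha> (\<lambda>x. indicat_real (P j) x *\<^sub>R norm (s x))"
          using integrable_mult_indicator[OF PM integrable_norm[OF s]] .
        have ii: "integrable \<alpha> (\<lambda>x. indicat_real (P j) x * \<epsilon>)"
          using PM by (intro integrable_mult_left integrable_real_indicator) (auto simp: less_top[symmetric])
        have 1: "norm ((LINT x|\<alpha>. indicat_real (P j) x *\<^sub>R s x) - (LINT x|\<alpha>. indicat_real (P j) x *\<^sub>R c j)) \<le> \<epsilon> * measure \<alpha> (P j)"
        proof -
          have "norm (LINT x|\<alpha>. indicat_real (P j) x *\<^sub>R s x - indicat_real (P j) x *\<^sub>R c j) \<le> (LINT x|\<alpha>. indicat_real (P j) x * \<epsilon>)"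
            using i[OF PM] ic ii close by (intro lebesgue_integral_norm_le) (auto simp: indicator_def)
          then show ?thesis using i[OF PM, of j] ic PM by (simp add: mult.commute)
        qed
        have 2: "(LINT x|\<alpha>. indicat_real (P j) x *\<^sub>R norm (s x)) \<le> measure \<alpha> (P j) * norm (c j) + \<epsilon> * measure \<alpha> (P j)"
        proof -
          have "(LINT x|\<alpha>. indicat_real (P j) x *\<^sub>R norm (s x)) \<le> (LINT x|\<alpha>. indicat_real (P j) x * norm (c j) + indicat_real (P j) x * \<epsilon>)"
          proof (rule integral_mono[OF in'])
            show "integrable \<alpha> (\<lambda>x. indicat_real (P j) x * norm (c j) + indicat_real (P j) x * \<epsilon>)"
              using ii integrable_norm[OF ic] by (simp add: norm_scaleR)
            show "indicat_real (P j) x *\<^sub>R norm (s x) \<le> indicat_real (P j) x * norm (c j) + indicat_real (P j) x * \<epsilon>" for x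
              using close[of x] norm_triangle_sub[of "s x" "c j"] by (auto simp: indicator_def)
          qed
          also have "\<dots> = measure \<alpha> (P j) * norm (c j) + measure \<alpha> (P j) * \<epsilon>"
            using ii integrable_norm[OF ic] PM by (subst Bochner_Integration.integral_add) (auto simp: norm_scaleR)
          finally show ?thesis by (simp add: mult.commute)
        qed
        have 3: "norm (LINT x|\<alpha>. indicat_real (P j) x *\<^sub>R c j) = measure \<alpha> (P j) * norm (c j)"
        proof -
          have "(LINT x|\<alpha>. indicat_real (P j) x *\<^sub>R c j) = (LINT x|\<alpha>. indicat_real (P j) x) *\<^sub>R c j"
            using PM by (intro integral_scaleR_left integrable_real_indicator) (auto simp: less_top[symmetric])
          then show ?thesis using PM by simp
        qed
        have "(LINT x|\<alpha>. indicat_real (P j) x *\<^sub>R norm (s x)) \<le> norm (\<sigma> (P j)) + 2 * \<epsilon> * measure \<alpha> (P j)"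
        proof -
          have "\<sigma> (P j) = (LINT x|\<alpha>. indicat_real (P j) x *\<^sub>R s x)"
            using \<sigma> PM[of j] sets by (simp add: has_vec_density_def set_lebesgue_integral_def)
          then have "norm (LINT x|\<alpha>. indicat_real (P j) x *\<^sub>R c j) \<le> norm (\<sigma> (P j)) + \<epsilon> * measure \<alpha> (P j)"
            using 1 norm_triangle_sub[of "LINT x|\<alpha>. indicat_real (P j) x *\<^sub>R c j" "\<sigma> (P j)"] by (simp add: norm_minus_commute)
          then show ?thesis using 2 3 by simp
        qed
        moreover have "?d (P j) = ennreal (LINT x|\<alpha>. indicat_real (P j) x *\<^sub>R norm (s x))"
          using PM in' by (subst nn_integral_eq_integral[symmetric])
            (auto simp: emeasure_density indicator_def intro!: nn_integral_cong)
        ultimately have "?d (P j) \<le> ennreal (norm (\<sigma> (P j)) + 2 * \<epsilon> * measure \<alpha> (P j))"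
          by (simp add: ennreal_leI)
        also have "\<dots> = ennreal (norm (\<sigma> (P j))) + ennreal (2 * \<epsilon>) * emeasure \<alpha> (P j)"
          using \<epsilon>(1) by (simp add: emeasure_eq_measure ennreal_mult)
        finally show ?thesis .
      qed
      have "?d A = (\<Sum>j. ?d (P j))"
        unfolding UP[symmetric] using PM dP by (intro suminf_emeasure[symmetric]) auto
      also have "\<dots> \<le> (\<Sum>j. ennreal (norm (\<sigma> (P j))) + ennreal (2 * \<epsilon>) * emeasure \<alpha> (P j))"
        by (intro suminf_le near) auto
      also have "\<dots> = (\<Sum>j. ennreal (norm (\<sigma> (P j)))) + ennreal (2 * \<epsilon>) * (\<Sum>j. emeasure \<alpha> (P j))"
        by (subst suminf_add[symmetric]) auto
      also have "(\<Sum>j. emeasure \<alpha> (P j)) = emeasure \<alpha> A"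
        unfolding UP[symmetric] using PM dP by (intro suminf_emeasure) auto
      also have "(\<Sum>j. ennreal (norm (\<sigma> (P j)))) \<le> variation \<Omega> \<sigma> A"
        using PM sets dP UP by (intro variation_ge) auto
      also have "ennreal (2 * \<epsilon>) * emeasure \<alpha> A = ennreal (2 * \<epsilon> * measure \<alpha> A)"
        using \<epsilon>(1) by (simp add: emeasure_eq_measure ennreal_mult)
      also have "\<dots> \<le> ennreal e" using \<epsilon>(2) by (rule ennreal_leI)
      finally show "?d A \<le> variation \<Omega> \<sigma> A + ennreal e" by (simp add: add_left_mono)
    qed
  qed
  then show "emeasure (tot_var \<Omega> \<sigma>) A = ?d A"
    using emeasure_tot_var[OF has_vec_density_vec_measures[OF \<alpha> s \<sigma>] A(1)] by simp
qed

text \<open>On the set named in \<open>le\<close> the integrand exceeds 1 strictly, so the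
  inequality can hold only if that set is null. A single application of a domination of measures
  thus yields a pointwise bound.\<close>

lemma (in finite_measure) AE_norm_le_1:
  fixes t :: "'a \<Rightarrow> 'b::{banach, second_countable_topology}"
  assumes t: "integrable M t"
    and le: "(LINT x|M. indicat_real {x \<in> space M. 1 < norm (t x)} x * norm (t x)) \<le> measure M {x \<in> space M. 1 < norm (t x)}"
  shows "AE x in M. norm (t x) \<le> 1"
proof -
  have [measurable]: "t \<in> borel_measurable M" using t by (rule borel_measurable_integrable)
  let ?A = "{x \<in> space M. 1 < norm (t x)}"
  have A: "?A \<in> sets M" by measurable
  have i1: "integrable M (\<lambda>x. indicat_real ?A x * norm (t x))"
    using integrable_mult_indicator[OF A integrable_norm[OF t]] by simp
  have i2: "integrable M (indicat_real ?A)" using A by (auto simp: less_top[symmetric])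
  have i3: "integrable M (\<lambda>x. indicat_real ?A x * (norm (t x) - 1))"
    using Bochner_Integration.integrable_diff[OF i1 i2] by (simp add: right_diff_distrib)
  have "(LINT x|M. indicat_real ?A x * (norm (t x) - 1)) \<le> 0"
    using le i1 i2 A by (simp add: right_diff_distrib)
  moreover have nn: "0 \<le> indicat_real ?A x * (norm (t x) - 1)" for x by (simp add: indicator_def)
  ultimately have "(LINT x|M. indicat_real ?A x * (norm (t x) - 1)) = 0"
    by (intro antisym integral_nonneg_AE) auto
  then have "AE x in M. indicat_real ?A x * (norm (t x) - 1) = 0"
    using nn i3 by (subst (asm) integral_nonneg_eq_0_iff_AE) auto
  then show ?thesis by (rule AE_mp) (auto intro!: AE_I2 simp: indicator_def split: if_splits)
qed

text \<open>Domination of the total variation by \<alpha> bounds |\<sigma> A| by the measure of A,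
  which gives a density for each component. The bound on the norm follows by evaluating the total
  variation on the set where it would fail.\<close>

lemma vec_density_exists:
  fixes \<sigma> :: "'a::topological_space set \<Rightarrow> real^'n"
  assumes \<alpha>: "\<alpha> \<in> pos_measures \<Omega>" and \<sigma>: "\<sigma> \<in> vec_measures \<Omega>"
    and le: "\<And>A. A \<in> sets (borel_on \<Omega>) \<Longrightarrow> emeasure (tot_var \<Omega> \<sigma>) A \<le> emeasure \<alpha> A"
  obtains s where "s \<in> borel_measurable \<alpha>" "\<And>x. norm (s x) \<le> 1" "has_vec_density \<Omega> \<alpha> s \<sigma>"
proof -
  interpret finite_measure \<alpha> by (rule pos_measuresD[OF \<alpha>])
  note sets = pos_measuresD(2)[OF \<alpha>]
  have n\<sigma>: "norm (\<sigma> A) \<le> measure \<alpha> A" if A: "A \<in> sets \<alpha>" for A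
  proof -
    have A': "A \<in> sets (borel_on \<Omega>)" using A sets by simp
    have "ennreal (norm (\<sigma> A)) \<le> variation \<Omega> \<sigma> A"
    proof -
      let ?P = "\<lambda>i::nat. if i = 0 then A else {}"
      have "(\<Sum>i. ennreal (norm (\<sigma> (?P i)))) \<le> variation \<Omega> \<sigma> A"
        using A' by (intro variation_ge) (auto simp: disjoint_family_on_def)
      moreover have "(\<Sum>i. ennreal (norm (\<sigma> (?P i)))) = (\<Sum>i\<in>{0}. ennreal (norm (\<sigma> (?P i))))"
        using vec_measures_empty[OF \<sigma>] by (intro suminf_finite) auto
      ultimately show ?thesis by simp
    qed
    also have "\<dots> \<le> emeasure \<alpha> A" using le[OF A'] emeasure_tot_var[OF \<sigma> A'] by simp
    finally show ?thesis by (simp add: emeasure_eq_measure)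
  qed
  have "\<exists>f. f \<in> borel_measurable \<alpha> \<and> integrable \<alpha> f \<and> (\<forall>A\<in>sets \<alpha>. \<sigma> A $ i = (LINT x:A|\<alpha>. f x))" for i
  proof -
    have ni: "\<bar>\<sigma> A $ i\<bar> \<le> measure \<alpha> A" if "A \<in> sets \<alpha>" for A
      using n\<sigma>[OF that] component_le_norm_cart[of "\<sigma> A" i] by linarith
    obtain f where f: "f \<in> borel_measurable \<alpha>" "\<And>x. 0 \<le> f x" "integrable \<alpha> f"
      "\<And>A. A \<in> sets \<alpha> \<Longrightarrow> \<sigma> A $ i + measure \<alpha> A = (LINT x:A|\<alpha>. f x)"
    \<comment> \<open>Adding \<alpha> makes the component a nonnegative set function; the density is
      shifted back by 1 afterwards.\<close>
    proof (rule additive_abs_cont_density[of "\<lambda>A. \<sigma> A $ i + measure \<alpha> A"])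
      show "0 \<le> \<sigma> A $ i + measure \<alpha> A" if "A \<in> sets \<alpha>" for A
        using ni[OF that] by linarith
      show "\<sigma> (A \<union> B) $ i + measure \<alpha> (A \<union> B) = \<sigma> A $ i + measure \<alpha> A + (\<sigma> B $ i + measure \<alpha> B)"
        if "A \<in> sets \<alpha>" "B \<in> sets \<alpha>" "A \<inter> B = {}" for A B
        using vec_measures_Un[OF \<sigma>, of A B] finite_measure_Union[OF that] that sets by simp
      fix e :: real assume "0 < e"
      have "\<sigma> A $ i + measure \<alpha> A \<le> e" if "A \<in> sets \<alpha>" "measure \<alpha> A < e / 2" for A
        using ni[OF that(1)] that(2) by linarith
      then show "\<exists>d>0. \<forall>A\<in>sets \<alpha>. measure \<alpha> A < d \<longrightarrow> \<sigma> A $ i + measure \<alpha> A \<le> e"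
        using \<open>0 < e\<close> by (intro exI[of _ "e / 2"]) auto
    qed blast
    have "\<sigma> A $ i = (LINT x:A|\<alpha>. f x - 1)" if A: "A \<in> sets \<alpha>" for A
    proof -
      have "set_integrable \<alpha> A f" "set_integrable \<alpha> A (\<lambda>_. 1::real)"
        using integrable_mult_indicator[OF A f(3)] A
        by (auto simp: set_integrable_def less_top[symmetric])
      then have "(LINT x:A|\<alpha>. f x - 1) = (LINT x:A|\<alpha>. f x) - (LINT x:A|\<alpha>. 1)"
        by (rule set_integral_diff(2))
      also have "(LINT x:A|\<alpha>. (1::real)) = measure \<alpha> A"
        using A by (simp add: set_lebesgue_integral_def)
      finally show ?thesis using f(4)[OF A] by simp
    qed
    then show ?thesis using f(1,3) by (intro exI[of _ "\<lambda>x. f x - 1"]) auto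
  qed
  then obtain f where f: "\<And>i. f i \<in> borel_measurable \<alpha>" "\<And>i. integrable \<alpha> (f i)"
    "\<And>i A. A \<in> sets \<alpha> \<Longrightarrow> \<sigma> A $ i = (LINT x:A|\<alpha>. f i x)" by metis
  define t where "t x = (\<chi> i. f i x)" for x
  have t_eq: "t x = (\<Sum>i\<in>UNIV. f i x *\<^sub>R axis i 1)" for x
    using basis_expansion[of "t x"] by (simp add: t_def scalar_mult_eq_scaleR)
  have it: "integrable \<alpha> t"
    unfolding t_eq using f(2) by (intro Bochner_Integration.integrable_sum integrable_scaleR_left) auto
  then have tm[measurable]: "t \<in> borel_measurable \<alpha>" by (rule borel_measurable_integrable)
  have dt: "has_vec_density \<Omega> \<alpha> t \<sigma>"
    unfolding has_vec_density_def
  proof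
    fix A assume A: "A \<in> sets (borel_on \<Omega>)"
    then have A': "A \<in> sets \<alpha>" using sets by simp
    have "(LINT x:A|\<alpha>. t x) $ i = \<sigma> A $ i" for i
      unfolding set_lebesgue_integral_def
      using integral_bounded_linear[OF bounded_linear_vec_nth integrable_mult_indicator[OF A' it], of i] f(3)[OF A', of i]
      by (simp add: t_def set_lebesgue_integral_def)
    then show "\<sigma> A = (LINT x:A|\<alpha>. t x)" by (simp add: vec_eq_iff)
  qed
  have ae: "AE x in \<alpha>. norm (t x) \<le> 1"
  proof -
    let ?A = "{x \<in> space \<alpha>. 1 < norm (t x)}"
    have A: "?A \<in> sets \<alpha>" by measurable
    have "emeasure (tot_var \<Omega> \<sigma>) ?A \<le> emeasure \<alpha> ?A" using A sets by (intro le) simp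
    moreover have "emeasure (density \<alpha> (\<lambda>x. ennreal (norm (t x)))) ?A = (\<integral>\<^sup>+x. ennreal (indicat_real ?A x * norm (t x)) \<partial>\<alpha>)"
      using A by (subst emeasure_density) (auto intro!: nn_integral_cong simp: indicator_def)
    ultimately have "(\<integral>\<^sup>+x. ennreal (indicat_real ?A x * norm (t x)) \<partial>\<alpha>) \<le> emeasure \<alpha> ?A"
      unfolding tot_var_density[OF \<alpha> it dt] by simp
    also have "(\<integral>\<^sup>+x. ennreal (indicat_real ?A x * norm (t x)) \<partial>\<alpha>) = ennreal (LINT x|\<alpha>. indicat_real ?A x * norm (t x))"
      using integrable_mult_indicator[OF A integrable_norm[OF it]] by (intro nn_integral_eq_integral) auto
    finally have "(LINT x|\<alpha>. indicat_real ?A x * norm (t x)) \<le> measure \<alpha> ?A"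
      by (simp add: emeasure_eq_measure)
    then show ?thesis by (rule AE_norm_le_1[OF it])
  qed
  \<comment> \<open>Changing t on a null set gives the bound at every point. This matters later,
    when densities with respect to \<open>\<alpha>n n\<close> are integrated against
    \<alpha>.\<close>
  define s where "s x = (if norm (t x) \<le> 1 then t x else 0)" for x
  have sm: "s \<in> borel_measurable \<alpha>" unfolding s_def by measurable
  have "has_vec_density \<Omega> \<alpha> s \<sigma>"
    unfolding has_vec_density_def
  proof
    fix A assume A: "A \<in> sets (borel_on \<Omega>)"
    then have A': "A \<in> sets \<alpha>" using sets by simp
    have "(LINT x:A|\<alpha>. s x) = (LINT x:A|\<alpha>. t x)"
      unfolding set_lebesgue_integral_def using ae A' sm
      by (intro integral_cong_AE) (auto simp: s_def)
    then show "\<sigma> A = (LINT x:A|\<alpha>. s x)" using dt A by (simp add: has_vec_density_def)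
  qed
  then show thesis using sm by (intro that) (auto simp: s_def)
qed

subsection \<open>Extended test functions\<close>

definition C1_test :: "(real^'n) set \<Rightarrow> (real^'n \<Rightarrow> real) set" where
  "C1_test \<Omega> = {\<phi>. Ck_on 1 \<Omega> \<phi> \<and> (\<exists>K. compact K \<and> K \<subseteq> \<Omega> \<and> (\<forall>x\<in>\<Omega> - K. \<phi> x = 0))}"

definition bc_test :: "(real^'n) set \<Rightarrow> (real^'n) set \<Rightarrow> (real^'n \<Rightarrow> real) set" where
  "bc_test \<Omega> \<Gamma> = {\<phi>\<in>Cb1_bar \<Omega>. (\<forall>x\<in>closure (frontier \<Omega> - \<Gamma>). \<phi> x = 0) \<and>
      (\<exists>R. \<forall>x\<in>\<Omega>. R < norm x \<longrightarrow> \<phi> x = 0)}"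

text \<open>\<open>Mdiv_bc\<close> imposes no trace condition when \<Gamma> is empty, hence the case
  distinction. The interior tests are C^1 rather than smooth so that the set is closed under
  multiplication by the functions \<open>g n\<close>.\<close>

definition flux_test :: "(real^'n) set \<Rightarrow> (real^'n) set \<Rightarrow> (real^'n \<Rightarrow> real) set" where
  "flux_test \<Omega> \<Gamma> = C1_test \<Omega> \<union> (if \<Gamma> = {} then {} else bc_test \<Omega> \<Gamma>)"

text \<open>In \<^const>\<open>Mdiv_bc\<close> the admissible test functions depend on the divergence, through the integrability
  condition. Restricting them to bounded support loses nothing (by cut-off functions) and makes the condition
  linear in \<open>(s, h)\<close> and stable under weak limits.\<close>

definition flux_div ::
  "(real^'n) set \<Rightarrow> (real^'n) set \<Rightarrow> real \<Rightarrow> (real^'n) measure \<Rightarrow> (real^'n \<Rightarrow> real^'n) \<Rightarrow> (real^'n \<Rightarrow> real) \<Rightarrow> bool" where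
  "flux_div \<Omega> \<Gamma> p \<alpha> s h \<longleftrightarrow> h \<in> Lp_space \<Omega> p \<and>
     (\<forall>\<phi>\<in>flux_test \<Omega> \<Gamma>. (LINT x|\<alpha>. s x \<bullet> grad \<phi> x) + (LINT x|lebesgue_on \<Omega>. \<phi> x * h x) = 0)"

lemma Ck_on_1_iff:
  "Ck_on 1 \<Omega> \<phi> \<longleftrightarrow> (\<forall>x\<in>\<Omega>. \<phi> differentiable (at x)) \<and> continuous_on \<Omega> (grad \<phi>)"
proof -
  have "continuous_on \<Omega> (\<lambda>x. grad \<phi> x $ i)" if "continuous_on \<Omega> (grad \<phi>)" for i
    using that by (intro continuous_intros)
  then show ?thesis by (auto intro: continuous_on_grad)
qed

lemma Cb1_bar_bounds:
  assumes "g \<in> Cb1_bar \<Omega>"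
  obtains B where "\<And>x. x \<in> \<Omega> \<Longrightarrow> \<bar>g x\<bar> \<le> B" "\<And>x. x \<in> \<Omega> \<Longrightarrow> norm (grad g x) \<le> B"
proof -
  obtain B1 B2 where "\<forall>x\<in>\<Omega>. \<bar>g x\<bar> \<le> B1" "\<forall>x\<in>\<Omega>. norm (grad g x) \<le> B2"
    using assms by (auto simp: Cb1_bar_def Cb1_def bounded_iff)
  then show thesis by (intro that[of "max B1 B2"]) (auto simp: le_max_iff_disj)
qed

lemma Cb1_bar_mult:
  assumes \<Omega>: "open \<Omega>" and "\<phi> \<in> Cb1_bar \<Omega>" "g \<in> Cb1_bar \<Omega>"
  shows "(\<lambda>x. \<phi> x * g x) \<in> Cb1_bar \<Omega>"
proof -
  have C: "Ck_on 1 \<Omega> \<phi>" "Ck_on 1 \<Omega> g" "continuous_on (closure \<Omega>) \<phi>" "continuous_on (closure \<Omega>) g"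
    using assms(2,3) by (auto simp: Cb1_bar_def Cb1_def)
  obtain B where B: "\<And>x. x \<in> \<Omega> \<Longrightarrow> \<bar>\<phi> x\<bar> \<le> B" "\<And>x. x \<in> \<Omega> \<Longrightarrow> norm (grad \<phi> x) \<le> B"
    using Cb1_bar_bounds[OF assms(2)] by blast
  obtain D where D: "\<And>x. x \<in> \<Omega> \<Longrightarrow> \<bar>g x\<bar> \<le> D" "\<And>x. x \<in> \<Omega> \<Longrightarrow> norm (grad g x) \<le> D"
    using Cb1_bar_bounds[OF assms(3)] by blast
  have "bounded ((\<lambda>x. \<phi> x * g x) ` \<Omega>)"
  proof (intro boundedI[of _ "B * D"], clarify)
    fix x assume "x \<in> \<Omega>"
    then show "norm (\<phi> x * g x) \<le> B * D"
      unfolding real_norm_def abs_mult using B D by (intro mult_mono order_trans[OF abs_ge_zero B(1)]) auto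
  qed
  moreover have "bounded (grad (\<lambda>x. \<phi> x * g x) ` \<Omega>)"
  proof (intro boundedI[of _ "B * D + D * B"], clarify)
    fix x assume x: "x \<in> \<Omega>"
    have "grad (\<lambda>x. \<phi> x * g x) x = \<phi> x *\<^sub>R grad g x + g x *\<^sub>R grad \<phi> x"
      using C(1,2) x by (intro grad_mult) auto
    moreover have "norm (\<phi> x *\<^sub>R grad g x) \<le> B * D"
      unfolding norm_scaleR using B D x by (intro mult_mono order_trans[OF abs_ge_zero B(1)]) auto
    moreover have "norm (g x *\<^sub>R grad \<phi> x) \<le> D * B"
      unfolding norm_scaleR using B D x by (intro mult_mono order_trans[OF abs_ge_zero D(1)]) auto
    ultimately show "norm (grad (\<lambda>x. \<phi> x * g x) x) \<le> B * D + D * B"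
      using norm_triangle_mono by metis
  qed
  moreover have "Ck_on 1 \<Omega> (\<lambda>x. \<phi> x * g x)"
    using C(1,2) by (rule Ck_on_mult[OF \<Omega>])
  ultimately show ?thesis
    using C(3,4) by (auto simp: Cb1_bar_def Cb1_def intro: continuous_intros)
qed

text \<open>Feasibility of g \<sigma> against \<phi> is feasibility of \<sigma> against \<phi> g, by
  the product rule; this closure property makes the step possible. A factor g changes neither the
  support nor the boundary zeros of \<phi>.\<close>

lemma flux_test_mult:
  assumes \<Omega>: "open \<Omega>" and \<phi>: "\<phi> \<in> flux_test \<Omega> \<Gamma>" and g: "g \<in> Cb1_bar \<Omega>"
  shows "(\<lambda>x. \<phi> x * g x) \<in> flux_test \<Omega> \<Gamma>"
proof -
  have "Ck_on 1 \<Omega> g" using g by (simp add: Cb1_bar_def Cb1_def)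
  then have "(\<lambda>x. \<phi> x * g x) \<in> C1_test \<Omega>" if "\<phi> \<in> C1_test \<Omega>"
    using that Ck_on_mult[OF \<Omega>, of 1 \<phi> g] unfolding C1_test_def by fastforce
  moreover have "(\<lambda>x. \<phi> x * g x) \<in> bc_test \<Omega> \<Gamma>" if "\<phi> \<in> bc_test \<Omega> \<Gamma>"
    using that Cb1_bar_mult[OF \<Omega> _ g, of \<phi>] unfolding bc_test_def by fastforce
  ultimately show ?thesis using \<phi> by (auto simp: flux_test_def split: if_splits)
qed

text \<open>Gathers what both kinds of tests share, so that later arguments need not distinguish
  them. For interior tests the bounds come from compactness of K, as \<phi> and its gradient vanish
  on the open set \<open>\<Omega> - K\<close>.\<close>

lemma flux_testD:
  assumes \<Omega>: "open \<Omega>" and \<phi>: "\<phi> \<in> flux_test \<Omega> \<Gamma>"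
  obtains B R where "Ck_on 1 \<Omega> \<phi>" "\<And>x. x \<in> \<Omega> \<Longrightarrow> \<bar>\<phi> x\<bar> \<le> B" "\<And>x. x \<in> \<Omega> \<Longrightarrow> norm (grad \<phi> x) \<le> B"
    "\<And>x. x \<in> \<Omega> \<Longrightarrow> R < norm x \<Longrightarrow> \<phi> x = 0"
proof -
  consider "\<phi> \<in> C1_test \<Omega>" | "\<phi> \<in> bc_test \<Omega> \<Gamma>"
    using \<phi> by (auto simp: flux_test_def split: if_splits)
  then show thesis
  proof cases
    case 1
    then obtain K where K: "Ck_on 1 \<Omega> \<phi>" "compact K" "K \<subseteq> \<Omega>" "\<And>x. x \<in> \<Omega> - K \<Longrightarrow> \<phi> x = 0"
      by (auto simp: C1_test_def)
    have c: "continuous_on K \<phi>" "continuous_on K (grad \<phi>)"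
      using continuous_on_subset[OF Ck_on_continuous[OF K(1)] K(3)] K(1,3) unfolding Ck_on_1_iff
      by (auto intro: continuous_on_subset)
    obtain B1 where B1: "\<And>x. x \<in> K \<Longrightarrow> \<bar>\<phi> x\<bar> \<le> B1"
      using compact_imp_bounded[OF compact_continuous_image[OF c(1) K(2)]] by (auto simp: bounded_iff)
    obtain B2 where B2: "\<And>x. x \<in> K \<Longrightarrow> norm (grad \<phi> x) \<le> B2"
      using compact_imp_bounded[OF compact_continuous_image[OF c(2) K(2)]] by (auto simp: bounded_iff)
    have g0: "grad \<phi> x = 0" if "x \<in> \<Omega> - K" for x
    proof -
      have "open (\<Omega> - K)" using \<Omega> K(2) by (intro open_Diff compact_imp_closed)
      then have "grad \<phi> x = grad (\<lambda>_. 0) x"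
        using that K(4) by (intro grad_cong_open) auto
      then show ?thesis by (simp add: grad_const)
    qed
    obtain R where R: "\<And>x. x \<in> K \<Longrightarrow> norm x \<le> R"
      using compact_imp_bounded[OF K(2)] by (auto simp: bounded_iff)
    show thesis
    proof (rule that[OF K(1), of "max 0 (max B1 B2)" R])
      fix x assume x: "x \<in> \<Omega>"
      show "\<bar>\<phi> x\<bar> \<le> max 0 (max B1 B2)"
        using B1[of x] K(4)[of x] x by (cases "x \<in> K") (auto simp: le_max_iff_disj)
      show "norm (grad \<phi> x) \<le> max 0 (max B1 B2)"
        using B2[of x] g0[of x] x by (cases "x \<in> K") (auto simp: le_max_iff_disj)
      show "\<phi> x = 0" if "R < norm x"
        using R[of x] K(4)[of x] x that by (cases "x \<in> K") auto
    qed
  next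
    case 2
    then obtain R where "Ck_on 1 \<Omega> \<phi>" "bounded (\<phi> ` \<Omega>)" "bounded (grad \<phi> ` \<Omega>)" "\<forall>x\<in>\<Omega>. R < norm x \<longrightarrow> \<phi> x = 0"
      by (auto simp: bc_test_def Cb1_bar_def Cb1_def)
    moreover then obtain B1 B2 where "\<forall>x\<in>\<Omega>. \<bar>\<phi> x\<bar> \<le> B1" "\<forall>x\<in>\<Omega>. norm (grad \<phi> x) \<le> B2"
      by (auto simp: bounded_iff)
    ultimately show thesis by (intro that[of "max B1 B2" R]) (auto simp: le_max_iff_disj)
  qed
qed

lemma continuous_borel_measurable_pos:
  fixes f :: "'a::topological_space \<Rightarrow> 'b::{second_countable_topology, real_normed_vector}"
  assumes "\<alpha> \<in> pos_measures \<Omega>" "continuous_on \<Omega> f"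
  shows "f \<in> borel_measurable \<alpha>"
  using borel_measurable_continuous_on_restrict[OF assms(2)] measurable_cong_sets[OF pos_measuresD(2)[OF assms(1)] refl]
  by blast

lemma continuous_borel_measurable_lebesgue_on:
  fixes f :: "'a::euclidean_space \<Rightarrow> 'b::euclidean_space"
  assumes "open \<Omega>" "continuous_on \<Omega> f"
  shows "f \<in> borel_measurable (lebesgue_on \<Omega>)"
  using assms by (intro continuous_imp_measurable_on_sets_lebesgue) auto

lemma integrable_inner_bounded:
  fixes s \<psi> :: "'a \<Rightarrow> 'b::euclidean_space"
  assumes "finite_measure M" "s \<in> borel_measurable M" "\<And>x. norm (s x) \<le> 1"
    "\<psi> \<in> borel_measurable M" "\<And>x. x \<in> space M \<Longrightarrow> norm (\<psi> x) \<le> B"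
  shows "integrable M (\<lambda>x. s x \<bullet> \<psi> x)"
proof -
  interpret finite_measure M by fact
  show ?thesis
  proof (rule integrable_const_bound[where B = B])
    have "norm (s x \<bullet> \<psi> x) \<le> 1 * B" if "x \<in> space M" for x
      using Cauchy_Schwarz_ineq2[of "s x" "\<psi> x"] assms(3)[of x] assms(5)[OF that] mult_mono[of "norm (s x)" 1 "norm (\<psi> x)" B]
      by auto
    then show "AE x in M. norm (s x \<bullet> \<psi> x) \<le> B" by (intro AE_I2) simp
  qed (use assms in measurable)
qed

lemma integrable_bounded_density:
  fixes s :: "'a::topological_space \<Rightarrow> 'b::{banach, second_countable_topology}"
  assumes \<alpha>: "\<alpha> \<in> pos_measures \<Omega>" and s: "s \<in> borel_measurable \<alpha>" "\<And>x. norm (s x) \<le> (1::real)"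
  shows "integrable \<alpha> s"
proof -
  interpret finite_measure \<alpha> by (rule pos_measuresD[OF \<alpha>])
  show ?thesis using s by (intro integrable_const_bound[where B = 1]) auto
qed

text \<open>Both integrals are continuous under uniform convergence of tests and gradients with
  supports in one compact set, so mollification transfers the identity from smooth to C^1 tests. The
  premise \<open>test\<close> asks for bounded gradients because the vector integral is rewritten
  through the density for bounded integrands.\<close>

lemma C1_test_divergence:
  fixes s :: "real^'n \<Rightarrow> real^'n"
  assumes \<Omega>: "open \<Omega>" and p: "1 < p" and \<alpha>: "\<alpha> \<in> pos_measures \<Omega>"
    and s: "s \<in> borel_measurable \<alpha>" "\<And>x. norm (s x) \<le> 1" and h: "h \<in> Lp_space \<Omega> p"
    and test: "\<And>\<phi>. \<phi> \<in> test_fun \<Omega> \<Longrightarrow> bounded (grad \<phi> ` \<Omega>) \<Longrightarrow>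
      (LINT x|\<alpha>. s x \<bullet> grad \<phi> x) + (LINT x|lebesgue_on \<Omega>. \<phi> x * h x) = 0"
    and \<phi>: "\<phi> \<in> C1_test \<Omega>"
  shows "(LINT x|\<alpha>. s x \<bullet> grad \<phi> x) + (LINT x|lebesgue_on \<Omega>. \<phi> x * h x) = 0"
proof -
  interpret finite_measure \<alpha> by (rule pos_measuresD[OF \<alpha>])
  note sp = pos_measuresD(3)[OF \<alpha>]
  have \<phi>f: "\<phi> \<in> flux_test \<Omega> {}" using \<phi> by (simp add: flux_test_def)
  obtain B R where B: "Ck_on 1 \<Omega> \<phi>" "\<And>x. x \<in> \<Omega> \<Longrightarrow> \<bar>\<phi> x\<bar> \<le> B" "\<And>x. x \<in> \<Omega> \<Longrightarrow> norm (grad \<phi> x) \<le> B"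
    "\<And>x. x \<in> \<Omega> \<Longrightarrow> R < norm x \<Longrightarrow> \<phi> x = 0"
    using flux_testD[OF \<Omega> \<phi>f] by blast
  obtain K where K: "compact K" "K \<subseteq> \<Omega>" "\<And>x. x \<in> \<Omega> - K \<Longrightarrow> \<phi> x = 0"
    using \<phi> by (auto simp: C1_test_def)
  \<comment> \<open>Extension by 0 gives a C^1 function on the whole space, since \<Omega> and the
    complement of K form an open cover.\<close>
  define \<phi>0 where "\<phi>0 x = (if x \<in> \<Omega> then \<phi> x else 0)" for x
  have oK: "open (- K)" using K(1) by (simp add: compact_imp_closed open_Compl)
  have z: "\<phi>0 x = 0" if "x \<notin> K" for x using K(3) that by (auto simp: \<phi>0_def)
  have d\<Omega>: "\<phi>0 differentiable (at x)" "grad \<phi>0 x = grad \<phi> x" if "x \<in> \<Omega>" for x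
    using differentiable_cong_open[OF \<Omega> that, of \<phi> \<phi>0] grad_cong_open[OF \<Omega> that, of \<phi> \<phi>0] B(1) that
    by (auto simp: \<phi>0_def)
  have dK: "\<phi>0 differentiable (at x)" "grad \<phi>0 x = 0" if "x \<in> - K" for x
    using differentiable_cong_open[OF oK that, of "\<lambda>_. 0" \<phi>0] grad_cong_open[OF oK that, of "\<lambda>_. 0" \<phi>0] z
    by (auto simp: grad_const)
  have diff: "\<phi>0 differentiable (at x)" for x
    using d\<Omega>(1) dK(1) K(2) by blast
  have "continuous_on (\<Omega> \<union> - K) (grad \<phi>0)"
  proof (rule continuous_on_open_Un[OF \<Omega> oK])
    show "continuous_on \<Omega> (grad \<phi>0)"
      using B(1) d\<Omega>(2) unfolding Ck_on_1_iff by (metis continuous_on_cong)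
    show "continuous_on (- K) (grad \<phi>0)"
      using dK(2) by (metis continuous_on_cong continuous_on_const)
  qed
  moreover have "\<Omega> \<union> - K = UNIV" using K(2) by blast
  ultimately have cg: "continuous_on UNIV (grad \<phi>0)" by simp
  obtain K' where K': "compact K'" "K' \<subseteq> \<Omega>" and approx: "\<And>e. 0 < e \<Longrightarrow> \<exists>\<psi>. (\<forall>k. Ck_on k UNIV \<psi>) \<and> (\<forall>x. x \<notin> K' \<longrightarrow> \<psi> x = 0) \<and>
      (\<forall>x. \<bar>\<psi> x - \<phi>0 x\<bar> \<le> e \<and> norm (grad \<psi> x - grad \<phi>0 x) \<le> e)"
    using smooth_approx_C1[OF \<Omega> K(1,2) diff cg z] by metis
  have um: "indicat_real (K \<union> K') \<in> borel_measurable (lebesgue_on \<Omega>)"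
    by (intro measurable_restrict_space1 borel_measurable_indicator sets.Un fmeasurableD lmeasurable_compact K(1) K'(1))
  obtain R' where R': "\<And>x. x \<in> K \<union> K' \<Longrightarrow> norm x \<le> R'"
    using compact_imp_bounded[OF compact_Un[OF K(1) K'(1)]] unfolding bounded_iff by blast
  have uh: "integrable (lebesgue_on \<Omega>) (\<lambda>x. indicat_real (K \<union> K') x * h x)"
    by (rule integrable_Lp_times_bounded_support(2)[OF p h \<Omega> um, of 1 R']) (use R' in \<open>force simp: indicator_def\<close>)+
  \<comment> \<open>The L^1 norm of h over all supports that occur; it controls the second integral
    uniformly in the accuracy e.\<close>
  define H where "H = (LINT x|lebesgue_on \<Omega>. \<bar>indicat_real (K \<union> K') x * h x\<bar>)"
  have gm: "grad \<phi> \<in> borel_measurable \<alpha>"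
    using B(1) unfolding Ck_on_1_iff by (intro continuous_borel_measurable_pos[OF \<alpha>]) auto
  have \<phi>m: "\<phi> \<in> borel_measurable (lebesgue_on \<Omega>)"
    by (rule continuous_borel_measurable_lebesgue_on[OF \<Omega> Ck_on_continuous[OF B(1)]])
  have i1: "integrable \<alpha> (\<lambda>x. s x \<bullet> grad \<phi> x)"
    using integrable_inner_bounded[OF finite_measure_axioms s gm, of B] B(3) sp by simp
  have i2: "integrable (lebesgue_on \<Omega>) (\<lambda>x. \<phi> x * h x)"
    using integrable_Lp_times_bounded_support(2)[OF p h \<Omega> \<phi>m, of B R] B(2,4) by blast
  let ?I = "(LINT x|\<alpha>. s x \<bullet> grad \<phi> x) + (LINT x|lebesgue_on \<Omega>. \<phi> x * h x)"
  have small: "\<bar>?I\<bar> \<le> e * (measure \<alpha> \<Omega> + H)" if "0 < e" for e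
  proof -
    obtain \<psi> where \<psi>: "\<And>k. Ck_on k UNIV \<psi>" "\<And>x. x \<notin> K' \<Longrightarrow> \<psi> x = 0"
      "\<And>x. \<bar>\<psi> x - \<phi>0 x\<bar> \<le> e" "\<And>x. norm (grad \<psi> x - grad \<phi>0 x) \<le> e"
      using approx[OF \<open>0 < e\<close>] by blast
    have gb: "norm (grad \<psi> x) \<le> B + e" if "x \<in> \<Omega>" for x
      using B(3)[OF that] \<psi>(4)[of x] norm_triangle_sub[of "grad \<psi> x" "grad \<phi>0 x"] unfolding d\<Omega>(2)[OF that] by linarith
    have t: "\<psi> \<in> test_fun \<Omega>"
      unfolding test_fun_def using \<psi>(1,2) Ck_on_subset[OF \<psi>(1), of \<Omega>] K' by auto
    have "bounded (grad \<psi> ` \<Omega>)" by (intro boundedI[of _ "B + e"]) (use gb in auto)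
    with t have zero: "(LINT x|\<alpha>. s x \<bullet> grad \<psi> x) + (LINT x|lebesgue_on \<Omega>. \<psi> x * h x) = 0"
      by (rule test)
    have g\<psi>m: "grad \<psi> \<in> borel_measurable \<alpha>"
      using Ck_on_subset[OF \<psi>(1)[of 1], of \<Omega>] unfolding Ck_on_1_iff by (intro continuous_borel_measurable_pos[OF \<alpha>]) auto
    have \<psi>m: "\<psi> \<in> borel_measurable (lebesgue_on \<Omega>)"
      by (rule continuous_borel_measurable_lebesgue_on[OF \<Omega> continuous_on_subset[OF Ck_on_continuous[OF \<psi>(1)]]]) auto
    have j1: "integrable \<alpha> (\<lambda>x. s x \<bullet> grad \<psi> x)"
      using integrable_inner_bounded[OF finite_measure_axioms s g\<psi>m, of "B + e"] gb sp by simp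
    have j2: "integrable (lebesgue_on \<Omega>) (\<lambda>x. \<psi> x * h x)"
    proof (rule integrable_Lp_times_bounded_support(2)[OF p h \<Omega> \<psi>m, of "B + e" R'])
      show "\<bar>\<psi> x\<bar> \<le> B + e" if "x \<in> \<Omega>" for x
        using B(2)[OF that] \<psi>(3)[of x] that by (auto simp: \<phi>0_def)
      show "\<psi> x = 0" if "R' < norm x" for x
        using R'[of x] that \<psi>(2)[of x] by fastforce
    qed
    have "norm (LINT x|\<alpha>. s x \<bullet> grad \<phi> x - s x \<bullet> grad \<psi> x) \<le> (LINT x|\<alpha>. e)"
    proof (rule lebesgue_integral_norm_le)
      fix x assume "x \<in> space \<alpha>"
      then have x: "x \<in> \<Omega>" using sp by simp
      have "norm (s x \<bullet> grad \<phi> x - s x \<bullet> grad \<psi> x) \<le> norm (s x) * norm (grad \<phi> x - grad \<psi> x)"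
        unfolding inner_diff_right[symmetric] real_norm_def by (rule Cauchy_Schwarz_ineq2)
      also have "\<dots> \<le> 1 * e"
        using s(2)[of x] \<psi>(4)[of x] d\<Omega>(2)[OF x] by (intro mult_mono) (auto simp: norm_minus_commute)
      finally show "norm (s x \<bullet> grad \<phi> x - s x \<bullet> grad \<psi> x) \<le> e" by simp
    qed (use i1 j1 in auto)
    then have 1: "\<bar>(LINT x|\<alpha>. s x \<bullet> grad \<phi> x) - (LINT x|\<alpha>. s x \<bullet> grad \<psi> x)\<bar> \<le> e * measure \<alpha> \<Omega>"
      using i1 j1 sp by (simp add: mult.commute)
    have "norm (LINT x|lebesgue_on \<Omega>. \<phi> x * h x - \<psi> x * h x) \<le> (LINT x|lebesgue_on \<Omega>. e * \<bar>indicat_real (K \<union> K') x * h x\<bar>)"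
    proof (rule lebesgue_integral_norm_le)
      fix x assume "x \<in> space (lebesgue_on \<Omega>)"
      then have x: "x \<in> \<Omega>" by (simp add: space_restrict_space)
      have "\<bar>\<phi> x - \<psi> x\<bar> \<le> e * indicat_real (K \<union> K') x"
        using \<psi>(2,3)[of x] K(3)[of x] x by (cases "x \<in> K \<union> K'") (auto simp: \<phi>0_def)
      then have "\<bar>\<phi> x - \<psi> x\<bar> * \<bar>h x\<bar> \<le> e * indicat_real (K \<union> K') x * \<bar>h x\<bar>"
        by (rule mult_right_mono) simp
      then show "norm (\<phi> x * h x - \<psi> x * h x) \<le> e * \<bar>indicat_real (K \<union> K') x * h x\<bar>"
        by (simp add: abs_mult flip: left_diff_distrib)
    qed (use i2 j2 uh in auto)
    then have 2: "\<bar>(LINT x|lebesgue_on \<Omega>. \<phi> x * h x) - (LINT x|lebesgue_on \<Omega>. \<psi> x * h x)\<bar> \<le> e * H"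
      using i2 j2 by (simp add: H_def)
    show ?thesis using 1 2 zero by (simp add: algebra_simps abs_le_iff)
  qed
  have "\<bar>?I\<bar> \<le> 0"
  proof (rule field_le_epsilon)
    fix e :: real assume "0 < e"
    \<comment> \<open>The summand 1 allows the division when both \<alpha> and H vanish.\<close>
    have m: "0 < measure \<alpha> \<Omega> + H + 1" by (auto simp: H_def intro!: add_nonneg_pos add_nonneg_nonneg integral_nonneg_AE)
    have "\<bar>?I\<bar> \<le> e / (measure \<alpha> \<Omega> + H + 1) * (measure \<alpha> \<Omega> + H)"
      using \<open>0 < e\<close> m by (intro small divide_pos_pos)
    also have "\<dots> \<le> e / (measure \<alpha> \<Omega> + H + 1) * (measure \<alpha> \<Omega> + H + 1)"
      using \<open>0 < e\<close> m by (intro mult_left_mono divide_nonneg_pos) auto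
    also have "\<dots> = e" using m by simp
    finally show "\<bar>?I\<bar> \<le> 0 + e" by simp
  qed
  then show ?thesis by simp
qed

subsection \<open>Cut-off functions\<close>

text \<open>Squaring the positive part of a quadratic gives a C^1 function, the regularity that
  \<open>flux_test\<close> asks for, with an explicit gradient of order 1 / R.\<close>

definition cutoff :: "real \<Rightarrow> real^'n \<Rightarrow> real" where
  "cutoff R x = (max 0 (1 - (x \<bullet> x) / R\<^sup>2))\<^sup>2"

lemma max_0_square_has_derivative:
  "((\<lambda>t::real. (max 0 t)\<^sup>2) has_real_derivative 2 * max 0 t) (at t)"
proof (cases t "0::real" rule: linorder_cases)
  case less
  have "((\<lambda>_. 0) has_real_derivative 0) (at t)" by simp
  then have "((\<lambda>t::real. (max 0 t)\<^sup>2) has_real_derivative 0) (at t)"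
    by (rule has_field_derivative_transform_within_open[where S = "{..<0}"]) (use less in auto)
  then show ?thesis using less by simp
next
  case greater
  have "((\<lambda>t. t\<^sup>2) has_real_derivative 2 * t) (at t)" by (auto intro!: derivative_eq_intros)
  then have "((\<lambda>t::real. (max 0 t)\<^sup>2) has_real_derivative 2 * t) (at t)"
    by (rule has_field_derivative_transform_within_open[where S = "{0<..}"]) (use greater in auto)
  then show ?thesis using greater by simp
next
  case equal
  have "((\<lambda>h::real. ((max 0 h)\<^sup>2 - (max 0 0)\<^sup>2) / (h - 0)) \<longlongrightarrow> 0) (at 0)"
  proof (rule Lim_null_comparison)
    show "\<forall>\<^sub>F h in at 0. norm (((max 0 h)\<^sup>2 - (max 0 0)\<^sup>2) / (h - 0)) \<le> \<bar>h::real\<bar>"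
      by (auto simp: eventually_at_filter max_def power2_eq_square)
    show "((\<lambda>h::real. \<bar>h\<bar>) \<longlongrightarrow> 0) (at 0)"
      using tendsto_rabs[OF tendsto_ident_at[of "0::real" UNIV]] by simp
  qed
  then show ?thesis using equal by (simp add: has_field_derivative_iff)
qed

lemma cutoff_has_derivative:
  fixes x :: "real^'n"
  assumes "0 < R"
  shows "(cutoff R has_derivative (\<lambda>h. ((- 4 * max 0 (1 - (x \<bullet> x) / R\<^sup>2) / R\<^sup>2) *\<^sub>R x) \<bullet> h)) (at x)"
proof -
  have D0: "((\<lambda>x::real^'n. 1 - c * (x \<bullet> x)) has_derivative (\<lambda>h. ((- 2 * c) *\<^sub>R x) \<bullet> h)) (at x)" for c
    by (auto intro!: derivative_eq_intros simp: inner_commute fun_eq_iff)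
  have D: "((\<lambda>x::real^'n. 1 - (x \<bullet> x) / R\<^sup>2) has_derivative (\<lambda>h. ((- 2 / R\<^sup>2) *\<^sub>R x) \<bullet> h)) (at x)"
    using D0[of "1 / R\<^sup>2"] by simp
  then have d: "(\<lambda>x::real^'n. 1 - (x \<bullet> x) / R\<^sup>2) differentiable (at x)"
    by (auto simp: differentiable_def)
  show ?thesis
    unfolding cutoff_def
    by (rule has_derivative_eq_rhs, rule has_derivative_compose_grad[OF d max_0_square_has_derivative])
      (simp add: grad_eqI[OF D])
qed

lemma cutoff_properties:
  fixes x :: "real^'n"
  assumes R: "0 < R"
  shows "Ck_on 1 UNIV (cutoff R :: real^'n \<Rightarrow> real)" "0 \<le> cutoff R x" "cutoff R x \<le> 1" "norm (grad (cutoff R) x) \<le> 4 / R"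
    "R < norm x \<Longrightarrow> cutoff R x = 0"
proof -
  have g: "grad (cutoff R) x = (- 4 * max 0 (1 - (x \<bullet> x) / R\<^sup>2) / R\<^sup>2) *\<^sub>R x" for x :: "real^'n"
    by (rule grad_eqI[OF cutoff_has_derivative[OF R]])
  have "cutoff R differentiable (at x)" for x :: "real^'n"
    using cutoff_has_derivative[OF R] by (auto simp: differentiable_def)
  moreover have "continuous_on UNIV (grad (cutoff R :: real^'n \<Rightarrow> real))"
    unfolding g[abs_def] by (intro continuous_intros) (use R in auto)
  ultimately show "Ck_on 1 UNIV (cutoff R :: real^'n \<Rightarrow> real)" unfolding Ck_on_1_iff by blast
  have n: "0 \<le> (x \<bullet> x) / R\<^sup>2" by simp
  show "0 \<le> cutoff R x" by (simp add: cutoff_def)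
  show "cutoff R x \<le> 1" unfolding cutoff_def using n by (intro power_le_one) auto
  have out: "max 0 (1 - (x \<bullet> x) / R\<^sup>2) = 0" if "R < norm x"
  proof -
    have "R\<^sup>2 \<le> (norm x)\<^sup>2" using R that by (intro power_mono) auto
    then show ?thesis using R by (simp add: power2_norm_eq_inner)
  qed
  then show "R < norm x \<Longrightarrow> cutoff R x = 0" by (simp add: cutoff_def)
  show "norm (grad (cutoff R) x) \<le> 4 / R"
  proof (cases "R < norm x")
    case True
    then show ?thesis using R unfolding g out[OF True] by simp
  next
    case False
    have "norm (grad (cutoff R) x) = 4 * max 0 (1 - (x \<bullet> x) / R\<^sup>2) / R\<^sup>2 * norm x"
      unfolding g norm_scaleR by simp
    also have "\<dots> \<le> 4 * 1 / R\<^sup>2 * R"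
      using False R n by (intro mult_mono divide_right_mono mult_left_mono) auto
    also have "\<dots> = 4 / R" using R by (simp add: power2_eq_square)
    finally show ?thesis .
  qed
qed

lemma cutoff_tendsto_1: "(\<lambda>n. cutoff (real (Suc n)) x) \<longlonglongrightarrow> 1"
proof -
  have "(\<lambda>n. (max 0 (1 - (x \<bullet> x) * (inverse (real (Suc n)))\<^sup>2))\<^sup>2) \<longlonglongrightarrow> (max 0 (1 - (x \<bullet> x) * 0\<^sup>2))\<^sup>2"
    by (intro tendsto_intros LIMSEQ_inverse_real_of_nat)
  then show ?thesis unfolding cutoff_def by (simp add: divide_inverse power_inverse)
qed

subsection \<open>Feasible measures and their densities\<close>

lemma test_fun_subset_flux_test: "test_fun \<Omega> \<subseteq> flux_test \<Omega> \<Gamma>"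
  unfolding test_fun_def C1_test_def flux_test_def by blast

lemma vec_integral_grad:
  fixes s :: "real^'n \<Rightarrow> real^'n"
  assumes \<alpha>: "\<alpha> \<in> pos_measures \<Omega>" and s: "s \<in> borel_measurable \<alpha>" "\<And>x. norm (s x) \<le> 1"
    and \<sigma>: "has_vec_density \<Omega> \<alpha> s \<sigma>" and \<phi>: "Ck_on 1 \<Omega> \<phi>" "bounded (grad \<phi> ` \<Omega>)"
  shows "vec_integral \<Omega> \<sigma> (grad \<phi>) = (LINT x|\<alpha>. s x \<bullet> grad \<phi> x)"
proof -
  obtain B where "\<And>x. x \<in> \<Omega> \<Longrightarrow> norm (grad \<phi> x) \<le> B"
    using \<phi>(2) by (auto simp: bounded_iff)
  then show ?thesis
    using \<phi>(1) unfolding Ck_on_1_iff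
    by (intro vec_integral_density[OF \<alpha> integrable_bounded_density[OF \<alpha> s] \<sigma>] continuous_borel_measurable_pos[OF \<alpha>]) auto
qed

text \<open>Interior tests follow from smooth ones by \<open>C1_test_divergence\<close>. For
  boundary tests the bounded support supplies the integrability that \<open>Mdiv_bc\<close> asks for
  before it grants a vanishing trace.\<close>

lemma Kdiv_imp_flux_div:
  fixes \<sigma> :: "(real^'n) set \<Rightarrow> real^'n"
  assumes \<Omega>: "open \<Omega>" and p: "1 < p" and \<alpha>: "\<alpha> \<in> pos_measures \<Omega>" and \<sigma>: "\<sigma> \<in> Kdiv \<Omega> p \<Gamma> \<alpha>"
  obtains s where "s \<in> borel_measurable \<alpha>" "\<And>x. norm (s x) \<le> 1" "has_vec_density \<Omega> \<alpha> s \<sigma>"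
    "flux_div \<Omega> \<Gamma> p \<alpha> s (vdiv \<Omega> p \<sigma>)"
proof -
  have \<sigma>M: "\<sigma> \<in> Mdiv \<Omega> p" using \<sigma> by (auto simp: Kdiv_def Mdiv_bc_def split: if_splits)
  then have \<sigma>v: "\<sigma> \<in> vec_measures \<Omega>" by (simp add: Mdiv_def)
  have "\<exists>h. has_divergence \<Omega> p \<sigma> h" using \<sigma>M by (simp add: Mdiv_def)
  then have hd: "has_divergence \<Omega> p \<sigma> (vdiv \<Omega> p \<sigma>)" unfolding vdiv_def by (rule someI_ex)
  obtain s where s: "s \<in> borel_measurable \<alpha>" "\<And>x. norm (s x) \<le> 1" "has_vec_density \<Omega> \<alpha> s \<sigma>"
    using vec_density_exists[OF \<alpha> \<sigma>v] \<sigma> by (auto simp: Kdiv_def)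
  have h: "vdiv \<Omega> p \<sigma> \<in> Lp_space \<Omega> p" using hd by (simp add: has_divergence_def)
  note vi = vec_integral_grad[OF \<alpha> s]
  have "(LINT x|\<alpha>. s x \<bullet> grad \<phi> x) + (LINT x|lebesgue_on \<Omega>. \<phi> x * vdiv \<Omega> p \<sigma> x) = 0"
    if \<phi>: "\<phi> \<in> flux_test \<Omega> \<Gamma>" for \<phi>
  proof -
    consider "\<phi> \<in> C1_test \<Omega>" | "\<Gamma> \<noteq> {}" "\<phi> \<in> bc_test \<Omega> \<Gamma>"
      using \<phi> by (auto simp: flux_test_def split: if_splits)
    then show ?thesis
    proof cases
      case 1
      show ?thesis
      proof (rule C1_test_divergence[OF \<Omega> p \<alpha> s(1,2) h _ 1])
        fix \<psi> assume \<psi>: "\<psi> \<in> test_fun \<Omega>" "bounded (grad \<psi> ` \<Omega>)"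
        have "Ck_on 1 \<Omega> \<psi>" using \<psi>(1) unfolding test_fun_def by blast
        then show "(LINT x|\<alpha>. s x \<bullet> grad \<psi> x) + (LINT x|lebesgue_on \<Omega>. \<psi> x * vdiv \<Omega> p \<sigma> x) = 0"
          using vi[OF _ \<psi>(2)] hd \<psi>(1) by (simp add: has_divergence_def)
      qed
    next
      case 2
      obtain B R where B: "Ck_on 1 \<Omega> \<phi>" "\<And>x. x \<in> \<Omega> \<Longrightarrow> \<bar>\<phi> x\<bar> \<le> B" "\<And>x. x \<in> \<Omega> \<Longrightarrow> norm (grad \<phi> x) \<le> B"
        "\<And>x. x \<in> \<Omega> \<Longrightarrow> R < norm x \<Longrightarrow> \<phi> x = 0"
        using flux_testD[OF \<Omega> \<phi>] by blast
      have "integrable (lebesgue_on \<Omega>) (\<lambda>x. \<phi> x * vdiv \<Omega> p \<sigma> x)"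
        using B(2,4) by (intro integrable_Lp_times_bounded_support(2)[OF p h \<Omega>
              continuous_borel_measurable_lebesgue_on[OF \<Omega> Ck_on_continuous[OF B(1)]], of B R]) auto
      then have "normal_trace \<Omega> p \<phi> \<sigma> = 0"
        using \<sigma> 2 by (auto simp: Kdiv_def Mdiv_bc_def bc_test_def)
      then show ?thesis
        using vi[OF B(1)] 2 by (simp add: normal_trace_def bc_test_def Cb1_bar_def Cb1_def)
    qed
  qed
  then show thesis using s h by (intro that) (auto simp: flux_div_def)
qed

text \<open>Identifies the representative picked by \<open>vdiv\<close> with the function h of any
  admissible pair.\<close>

lemma flux_div_unique:
  assumes \<Omega>: "open \<Omega>" and p: "1 < p" and "h \<in> Lp_space \<Omega> p" "h' \<in> Lp_space \<Omega> p"
    and eq: "\<And>\<phi>. \<phi> \<in> test_fun \<Omega> \<Longrightarrow> (LINT x|lebesgue_on \<Omega>. \<phi> x * h x) = (LINT x|lebesgue_on \<Omega>. \<phi> x * h' x)"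
  shows "AE x in lebesgue_on \<Omega>. h x = h' x"
proof -
  have hm: "h \<in> borel_measurable (lebesgue_on \<Omega>)" "h' \<in> borel_measurable (lebesgue_on \<Omega>)"
    using assms(3,4) by (auto simp: Lp_space_def)
  have "(\<lambda>x. h x + - h' x) \<in> Lp_space \<Omega> p"
    using integrable_powr_add[of p h "lebesgue_on \<Omega>" "\<lambda>x. - h' x"] assms(2-4) by (auto simp: Lp_space_def)
  then have d: "(\<lambda>x. h x - h' x) \<in> Lp_space \<Omega> p" by simp
  have "AE x in lebesgue_on \<Omega>. h x - h' x = 0"
  proof (rule Lp_zero_if_test_integrals_zero[OF p \<Omega> d])
    fix \<phi> assume t: "\<phi> \<in> test_fun \<Omega>"
    then have f: "\<phi> \<in> flux_test \<Omega> {}" using test_fun_subset_flux_test by blast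
    obtain B R where B: "Ck_on 1 \<Omega> \<phi>" "\<And>x. x \<in> \<Omega> \<Longrightarrow> \<bar>\<phi> x\<bar> \<le> B" "\<And>x. x \<in> \<Omega> \<Longrightarrow> norm (grad \<phi> x) \<le> B"
      "\<And>x. x \<in> \<Omega> \<Longrightarrow> R < norm x \<Longrightarrow> \<phi> x = 0"
      using flux_testD[OF \<Omega> f] by blast
    have i: "integrable (lebesgue_on \<Omega>) (\<lambda>x. \<phi> x * u x)" if "u \<in> Lp_space \<Omega> p" for u
      using B(2,4) by (intro integrable_Lp_times_bounded_support(2)[OF p that \<Omega>
            continuous_borel_measurable_lebesgue_on[OF \<Omega> Ck_on_continuous[OF B(1)]], of B R]) auto
    show "(LINT x|lebesgue_on \<Omega>. \<phi> x * (h x - h' x)) = 0"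
      using eq[OF t] i[OF assms(3)] i[OF assms(4)] by (simp add: right_diff_distrib)
  qed
  then show ?thesis by simp
qed

text \<open>The trace condition of \<open>Mdiv_bc\<close> also concerns tests with unbounded
  support. They are multiplied by cut-offs of growing radius: the gradients of the cut-offs are
  bounded and tend to 0, which suffices against the finite measure \<alpha>.\<close>

lemma flux_div_imp_Kdiv:
  fixes \<sigma> :: "(real^'n) set \<Rightarrow> real^'n"
  assumes \<Omega>: "open \<Omega>" and p: "1 < p" and \<alpha>: "\<alpha> \<in> pos_measures \<Omega>"
    and s: "s \<in> borel_measurable \<alpha>" "\<And>x. norm (s x) \<le> 1" "has_vec_density \<Omega> \<alpha> s \<sigma>"
    and fd: "flux_div \<Omega> \<Gamma> p \<alpha> s h"
  shows "\<sigma> \<in> Kdiv \<Omega> p \<Gamma> \<alpha>" "vdiv \<Omega> p \<sigma> \<in> Lp_space \<Omega> p" "AE x in lebesgue_on \<Omega>. vdiv \<Omega> p \<sigma> x = h x"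
proof -
  interpret finite_measure \<alpha> by (rule pos_measuresD[OF \<alpha>])
  note sp = pos_measuresD(3)[OF \<alpha>]
  note si = integrable_bounded_density[OF \<alpha> s(1,2)]
  note vi = vec_integral_grad[OF \<alpha> s]
  have h: "h \<in> Lp_space \<Omega> p" using fd by (simp add: flux_div_def)
  have dual: "(LINT x|\<alpha>. s x \<bullet> grad \<phi> x) + (LINT x|lebesgue_on \<Omega>. \<phi> x * h x) = 0" if "\<phi> \<in> flux_test \<Omega> \<Gamma>" for \<phi>
    using fd that by (simp add: flux_div_def)
  have "has_divergence \<Omega> p \<sigma> h"
    unfolding has_divergence_def
  proof (intro conjI h ballI)
    fix \<phi> assume t: "\<phi> \<in> test_fun \<Omega>"
    then have f: "\<phi> \<in> flux_test \<Omega> \<Gamma>" using test_fun_subset_flux_test by blast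
    obtain B R where B: "Ck_on 1 \<Omega> \<phi>" "\<And>x. x \<in> \<Omega> \<Longrightarrow> norm (grad \<phi> x) \<le> B"
      using flux_testD[OF \<Omega> f] by metis
    have "bounded (grad \<phi> ` \<Omega>)" by (intro boundedI[of _ B]) (use B(2) in auto)
    then show "vec_integral \<Omega> \<sigma> (grad \<phi>) = - (LINT x|lebesgue_on \<Omega>. \<phi> x * h x)"
      using vi[OF B(1)] dual[OF f] by simp
  qed
  then have ex: "\<exists>h. has_divergence \<Omega> p \<sigma> h" by blast
  then have hd: "has_divergence \<Omega> p \<sigma> (vdiv \<Omega> p \<sigma>)" unfolding vdiv_def by (rule someI_ex)
  then show v: "vdiv \<Omega> p \<sigma> \<in> Lp_space \<Omega> p" by (simp add: has_divergence_def)
  show ae: "AE x in lebesgue_on \<Omega>. vdiv \<Omega> p \<sigma> x = h x"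
    using hd \<open>has_divergence \<Omega> p \<sigma> h\<close> by (intro flux_div_unique[OF \<Omega> p v h]) (auto simp: has_divergence_def)
  have M: "\<sigma> \<in> Mdiv \<Omega> p"
    using ex has_vec_density_vec_measures[OF \<alpha> si s(3)] by (simp add: Mdiv_def)
  have bc: "normal_trace \<Omega> p \<phi> \<sigma> = 0"
    if "\<Gamma> \<noteq> {}" and \<phi>: "\<phi> \<in> Cb1_bar \<Omega>" "\<forall>x\<in>closure (frontier \<Omega> - \<Gamma>). \<phi> x = 0"
      and i: "integrable (lebesgue_on \<Omega>) (\<lambda>x. \<phi> x * vdiv \<Omega> p \<sigma> x)" for \<phi>
  proof -
    have C: "Ck_on 1 \<Omega> \<phi>" "bounded (grad \<phi> ` \<Omega>)" "bounded (\<phi> ` \<Omega>)" using \<phi>(1) by (auto simp: Cb1_bar_def Cb1_def)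
    obtain B1 B2 where B: "\<And>x. x \<in> \<Omega> \<Longrightarrow> \<bar>\<phi> x\<bar> \<le> B1" "\<And>x. x \<in> \<Omega> \<Longrightarrow> norm (grad \<phi> x) \<le> B2"
      using C(2,3) by (auto simp: bounded_iff)
    define \<eta> :: "nat \<Rightarrow> real^'n \<Rightarrow> real" where "\<eta> n = cutoff (real (Suc n))" for n
    have \<eta>C: "Ck_on 1 \<Omega> (\<eta> n)" for n
      unfolding \<eta>_def by (rule Ck_on_subset[OF cutoff_properties(1)]) auto
    have \<eta>b: "0 \<le> \<eta> n x" "\<eta> n x \<le> 1" "norm (grad (\<eta> n) x) \<le> 4 / real (Suc n)" "real (Suc n) < norm x \<Longrightarrow> \<eta> n x = 0" for n x
      unfolding \<eta>_def by (rule cutoff_properties; simp)+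
    have \<eta>4: "norm (grad (\<eta> n) x) \<le> 4" for n x
      using \<eta>b(3)[of n x] by (rule order_trans) (simp add: divide_le_eq)
    have \<eta>1: "\<eta> n \<in> Cb1_bar \<Omega>" for n
      unfolding Cb1_bar_def Cb1_def
    proof (intro CollectI conjI \<eta>C)
      show "bounded (\<eta> n ` \<Omega>)" by (intro boundedI[of _ 1]) (use \<eta>b in auto)
      show "bounded (grad (\<eta> n) ` \<Omega>)" by (intro boundedI[of _ 4]) (use \<eta>4 in auto)
      show "continuous_on (closure \<Omega>) (\<eta> n)"
        unfolding \<eta>_def by (rule continuous_on_subset[OF Ck_on_continuous[OF cutoff_properties(1)]]) auto
    qed
    have ft: "(\<lambda>x. \<phi> x * \<eta> n x) \<in> flux_test \<Omega> \<Gamma>" for n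
    proof -
      have "\<forall>x\<in>\<Omega>. real (Suc n) < norm x \<longrightarrow> \<phi> x * \<eta> n x = 0" using \<eta>b(4)[of n] by simp
      then have "(\<lambda>x. \<phi> x * \<eta> n x) \<in> bc_test \<Omega> \<Gamma>"
        using Cb1_bar_mult[OF \<Omega> \<phi>(1) \<eta>1] \<phi>(2) unfolding bc_test_def
        by (intro CollectI conjI exI[of _ "real (Suc n)"]) simp_all
      then show ?thesis using \<open>\<Gamma> \<noteq> {}\<close> by (simp add: flux_test_def)
    qed
    have gr: "grad (\<lambda>x. \<phi> x * \<eta> n x) x = \<phi> x *\<^sub>R grad (\<eta> n) x + \<eta> n x *\<^sub>R grad \<phi> x" if "x \<in> \<Omega>" for n x
      using C(1) \<eta>C that by (intro grad_mult) auto
    have cg: "continuous_on \<Omega> (grad (\<lambda>x. \<phi> x * \<eta> n x))" for n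
      using Ck_on_mult[OF \<Omega> C(1) \<eta>C[of n]] unfolding Ck_on_1_iff by blast
    have "(\<lambda>n. LINT x|\<alpha>. s x \<bullet> grad (\<lambda>x. \<phi> x * \<eta> n x) x) \<longlonglongrightarrow> (LINT x|\<alpha>. s x \<bullet> grad \<phi> x)"
    proof (rule integral_dominated_convergence[where w = "\<lambda>_. B1 * 4 + B2"])
      show "AE x in \<alpha>. (\<lambda>n. s x \<bullet> grad (\<lambda>x. \<phi> x * \<eta> n x) x) \<longlonglongrightarrow> s x \<bullet> grad \<phi> x"
      proof (rule AE_I2)
        fix x assume "x \<in> space \<alpha>"
        then have x: "x \<in> \<Omega>" using sp by simp
        have "(\<lambda>n. grad (\<eta> n) x) \<longlonglongrightarrow> 0"
        proof (rule Lim_null_comparison)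
          show "\<forall>\<^sub>F n in sequentially. norm (grad (\<eta> n) x) \<le> 4 * inverse (real (Suc n))"
            using \<eta>b(3)[of _ x] by (intro always_eventually) (simp add: divide_inverse)
          show "(\<lambda>n. 4 * inverse (real (Suc n))) \<longlonglongrightarrow> 0"
            using tendsto_mult_right_zero[OF LIMSEQ_inverse_real_of_nat] by simp
        qed
        then have "(\<lambda>n. s x \<bullet> (\<phi> x *\<^sub>R grad (\<eta> n) x + \<eta> n x *\<^sub>R grad \<phi> x)) \<longlonglongrightarrow> s x \<bullet> (\<phi> x *\<^sub>R 0 + 1 *\<^sub>R grad \<phi> x)"
          unfolding \<eta>_def by (intro tendsto_intros cutoff_tendsto_1) simp
        then show "(\<lambda>n. s x \<bullet> grad (\<lambda>x. \<phi> x * \<eta> n x) x) \<longlonglongrightarrow> s x \<bullet> grad \<phi> x"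
          using gr[OF x] by simp
      qed
      show "AE x in \<alpha>. norm (s x \<bullet> grad (\<lambda>x. \<phi> x * \<eta> n x) x) \<le> B1 * 4 + B2" for n
      proof (rule AE_I2)
        fix x assume "x \<in> space \<alpha>"
        then have x: "x \<in> \<Omega>" using sp by simp
        have "norm (\<phi> x *\<^sub>R grad (\<eta> n) x) \<le> B1 * 4"
          unfolding norm_scaleR using B(1)[OF x] \<eta>4 by (intro mult_mono) auto
        moreover have "norm (\<eta> n x *\<^sub>R grad \<phi> x) \<le> 1 * B2"
          unfolding norm_scaleR using B(2)[OF x] \<eta>b by (intro mult_mono) auto
        ultimately have G: "norm (grad (\<lambda>x. \<phi> x * \<eta> n x) x) \<le> B1 * 4 + B2"
          unfolding gr[OF x] using norm_triangle_mono by fastforce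
        have "norm (s x \<bullet> grad (\<lambda>x. \<phi> x * \<eta> n x) x) \<le> norm (s x) * norm (grad (\<lambda>x. \<phi> x * \<eta> n x) x)"
          by (simp add: Cauchy_Schwarz_ineq2)
        also have "\<dots> \<le> 1 * (B1 * 4 + B2)" using s(2)[of x] G by (intro mult_mono) auto
        finally show "norm (s x \<bullet> grad (\<lambda>x. \<phi> x * \<eta> n x) x) \<le> B1 * 4 + B2" by simp
      qed
      show "(\<lambda>x. s x \<bullet> grad (\<lambda>x. \<phi> x * \<eta> n x) x) \<in> borel_measurable \<alpha>" for n
        by (intro borel_measurable_inner s(1) continuous_borel_measurable_pos[OF \<alpha> cg])
      show "(\<lambda>x. s x \<bullet> grad \<phi> x) \<in> borel_measurable \<alpha>"
        using C(1) unfolding Ck_on_1_iff by (intro borel_measurable_inner s(1) continuous_borel_measurable_pos[OF \<alpha>]) auto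
    qed simp
    moreover have "(\<lambda>n. LINT x|lebesgue_on \<Omega>. \<phi> x * \<eta> n x * h x) \<longlonglongrightarrow> (LINT x|lebesgue_on \<Omega>. \<phi> x * vdiv \<Omega> p \<sigma> x)"
    \<comment> \<open>Here the integrability condition in \<open>Mdiv_bc\<close> enters: it provides
      the dominating function, as the cut-offs lie between 0 and 1.\<close>
    proof (rule integral_dominated_convergence[where w = "\<lambda>x. \<bar>\<phi> x * vdiv \<Omega> p \<sigma> x\<bar>"])
      show "AE x in lebesgue_on \<Omega>. (\<lambda>n. \<phi> x * \<eta> n x * h x) \<longlonglongrightarrow> \<phi> x * vdiv \<Omega> p \<sigma> x"
      proof (rule AE_mp[OF ae], intro AE_I2 impI)
        fix x assume e: "vdiv \<Omega> p \<sigma> x = h x"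
        have "(\<lambda>n. \<phi> x * \<eta> n x * h x) \<longlonglongrightarrow> \<phi> x * 1 * h x"
          unfolding \<eta>_def by (intro tendsto_intros cutoff_tendsto_1)
        then show "(\<lambda>n. \<phi> x * \<eta> n x * h x) \<longlonglongrightarrow> \<phi> x * vdiv \<Omega> p \<sigma> x" by (simp add: e)
      qed
      show "AE x in lebesgue_on \<Omega>. norm (\<phi> x * \<eta> n x * h x) \<le> \<bar>\<phi> x * vdiv \<Omega> p \<sigma> x\<bar>" for n
      proof (rule AE_mp[OF ae], intro AE_I2 impI)
        fix x assume e: "vdiv \<Omega> p \<sigma> x = h x"
        have "\<eta> n x * \<bar>\<phi> x * h x\<bar> \<le> 1 * \<bar>\<phi> x * h x\<bar>" using \<eta>b by (intro mult_right_mono) auto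
        then show "norm (\<phi> x * \<eta> n x * h x) \<le> \<bar>\<phi> x * vdiv \<Omega> p \<sigma> x\<bar>"
          using \<eta>b(1)[of n x] by (simp add: e abs_mult ac_simps)
      qed
      show "(\<lambda>x. \<phi> x * \<eta> n x * h x) \<in> borel_measurable (lebesgue_on \<Omega>)" for n
        using h by (intro borel_measurable_times[OF
            continuous_borel_measurable_lebesgue_on[OF \<Omega> Ck_on_continuous[OF Ck_on_mult[OF \<Omega> C(1) \<eta>C[of n]]]]])
          (simp add: Lp_space_def)
    qed (use i in auto)
    ultimately have "(\<lambda>n. (LINT x|\<alpha>. s x \<bullet> grad (\<lambda>x. \<phi> x * \<eta> n x) x) + (LINT x|lebesgue_on \<Omega>. \<phi> x * \<eta> n x * h x))
        \<longlonglongrightarrow> (LINT x|\<alpha>. s x \<bullet> grad \<phi> x) + (LINT x|lebesgue_on \<Omega>. \<phi> x * vdiv \<Omega> p \<sigma> x)"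
      by (rule tendsto_add)
    then have "(LINT x|\<alpha>. s x \<bullet> grad \<phi> x) + (LINT x|lebesgue_on \<Omega>. \<phi> x * vdiv \<Omega> p \<sigma> x) = 0"
      unfolding dual[OF ft] by (simp add: LIMSEQ_const_iff)
    then show ?thesis unfolding normal_trace_def vi[OF C(1,2)] .
  qed
  have "emeasure (tot_var \<Omega> \<sigma>) A \<le> emeasure \<alpha> A" if A: "A \<in> sets (borel_on \<Omega>)" for A
  proof -
    have A': "A \<in> sets \<alpha>" using A pos_measuresD(2)[OF \<alpha>] by simp
    have "emeasure (tot_var \<Omega> \<sigma>) A = (\<integral>\<^sup>+x. ennreal (norm (s x)) * indicator A x \<partial>\<alpha>)"
      unfolding tot_var_density[OF \<alpha> si s(3)] using A' s(1) by (subst emeasure_density) auto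
    also have "\<dots> \<le> (\<integral>\<^sup>+x. indicator A x \<partial>\<alpha>)"
      using s(2) by (intro nn_integral_mono) (auto simp: indicator_def)
    also have "\<dots> = emeasure \<alpha> A" using A' by simp
    finally show ?thesis .
  qed
  then show "\<sigma> \<in> Kdiv \<Omega> p \<Gamma> \<alpha>"
    using M bc by (auto simp: Kdiv_def Mdiv_bc_def)
qed

lemma objective_density:
  assumes \<Omega>: "open \<Omega>" and \<alpha>: "\<alpha> \<in> pos_measures \<Omega>"
    and s: "s \<in> borel_measurable \<alpha>" "\<And>x. norm (s x) \<le> 1" "has_vec_density \<Omega> \<alpha> s \<sigma>"
    and h: "h \<in> Lp_space \<Omega> p" "vdiv \<Omega> p \<sigma> \<in> Lp_space \<Omega> p" "AE x in lebesgue_on \<Omega>. vdiv \<Omega> p \<sigma> x = h x"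
    and f: "f \<in> Lp_space \<Omega> p" and \<beta>: "continuous_on \<Omega> \<beta>"
  shows "objective \<Omega> p f \<beta> \<sigma> = 1 / p * (LINT x|lebesgue_on \<Omega>. \<bar>h x - f x\<bar> powr p) + (LINT x|\<alpha>. \<beta> x * norm (s x))"
proof -
  have [measurable]: "h \<in> borel_measurable (lebesgue_on \<Omega>)" "vdiv \<Omega> p \<sigma> \<in> borel_measurable (lebesgue_on \<Omega>)"
    "f \<in> borel_measurable (lebesgue_on \<Omega>)"
    using h f by (auto simp: Lp_space_def)
  have "(LINT x|lebesgue_on \<Omega>. \<bar>vdiv \<Omega> p \<sigma> x - f x\<bar> powr p) = (LINT x|lebesgue_on \<Omega>. \<bar>h x - f x\<bar> powr p)"
    by (rule integral_cong_AE) (use h(3) in \<open>auto elim!: AE_mp\<close>)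
  moreover have "(LINT x|tot_var \<Omega> \<sigma>. \<beta> x) = (LINT x|\<alpha>. \<beta> x * norm (s x))"
    unfolding tot_var_density[OF \<alpha> integrable_bounded_density[OF \<alpha> s(1,2)] s(3)]
    using continuous_borel_measurable_pos[OF \<alpha> \<beta>] s(1)
    by (subst integral_density) (auto simp: mult.commute)
  ultimately show ?thesis by (simp add: objective_def)
qed

subsection \<open>Compactness of feasible sequences\<close>

text \<open>As \<Omega> may have infinite volume, a positive integrable weight, available by
  \<sigma>-finiteness, supplies the finite measure behind \<open>Lp_weak_compact\<close>. Lebesgue
  sets differ from F-sigma sets by null sets, which is the Borel approximation required in
  \<open>approximable_borel\<close>.\<close>

lemma lebesgue_on_approximable_weight:
  fixes \<Omega> :: "'a::euclidean_space set"
  assumes \<Omega>: "open \<Omega>"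
  obtains W \<A> where "W \<in> borel_measurable (lebesgue_on \<Omega>)" "\<And>x. (0::real) < W x" "integrable (lebesgue_on \<Omega>) W"
    "approximable (density (lebesgue_on \<Omega>) W) \<A>"
proof -
  obtain w :: "'a \<Rightarrow> ennreal" where w: "w \<in> borel_measurable lborel" "integral\<^sup>N lborel w \<noteq> \<infinity>"
    "\<And>x. 0 < w x" "\<And>x. w x < \<infinity>"
    using sigma_finite_measure.Ex_finite_integrable_function[OF sigma_finite_lborel] by auto
  define W where "W x = enn2real (w x)" for x
  have Wm: "W \<in> borel_measurable lborel" unfolding W_def using w(1) by measurable
  have W0: "0 < W x" for x using w(3,4)[of x] by (simp add: W_def enn2real_positive_iff)
  have "(\<integral>\<^sup>+x. ennreal (W x) \<partial>lborel) = integral\<^sup>N lborel w"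
    using w(4) by (intro nn_integral_cong) (simp add: W_def)
  then have "integrable lborel W"
    using Wm w(2) W0 by (intro integrableI_nonneg) (auto simp: less_top intro: less_imp_le)
  then have "integrable lebesgue W" using Wm by (simp add: integrable_completion)
  then have Wi: "integrable (lebesgue_on \<Omega>) W"
    using \<Omega> integrable_mult_indicator[of \<Omega> lebesgue W] by (subst integrable_restrict_space) auto
  have Wm': "W \<in> borel_measurable (lebesgue_on \<Omega>)" using Wi by (rule borel_measurable_integrable)
  let ?m = "density (lebesgue_on \<Omega>) W"
  have "emeasure ?m (space ?m) = (\<integral>\<^sup>+x. ennreal (W x) \<partial>lebesgue_on \<Omega>)"
    using Wm' by (subst emeasure_density) (auto intro!: nn_integral_cong simp: indicator_def)
  also have "\<dots> = ennreal (LINT x|lebesgue_on \<Omega>. W x)"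
    using W0 Wi by (intro nn_integral_eq_integral) (auto intro: less_imp_le)
  finally have "finite_measure ?m" by (intro finite_measureI) simp
  moreover have "(\<lambda>x. x) \<in> measurable ?m borel"
    unfolding measurable_cong_sets[OF sets_density refl] by (intro measurable_restrict_space1 measurable_completion) simp
  moreover have "\<exists>C\<in>sets borel. measure ?m ((A - C) \<union> (C \<inter> space ?m - A)) = 0" if A: "A \<in> sets ?m" for A
  proof -
    have A': "A \<in> sets lebesgue" "A \<subseteq> \<Omega>"
      using A \<Omega> sets_restrict_space_iff[of \<Omega> lebesgue A] by auto
    obtain C T where CT: "fsigma C" "T \<in> null_sets lebesgue" "C \<union> T = A" "disjnt C T"
      using lebesgue_set_almost_fsigma[OF A'(1)] .
    obtain K :: "nat \<Rightarrow> 'a set" where K: "range K \<subseteq> Collect compact" "C = \<Union>(range K)"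
      using CT(1) unfolding fsigma_Union_compact by blast
    have "C \<in> sets borel"
      unfolding K(2) using K(1) by (intro sets.countable_UN) (auto intro: borel_compact)
    moreover have "(A - C) \<union> (C \<inter> space ?m - A) = T" using CT(3,4) by (auto simp: disjnt_def)
    moreover have "T \<in> null_sets (lebesgue_on \<Omega>)"
      using CT(2,3) A'(2) \<Omega> by (subst null_sets_restrict_space) auto
    then have "emeasure ?m T = 0"
      using Wm' by (subst emeasure_density) (auto simp: nn_integral_null_set)
    then have "measure ?m T = 0" by (simp add: measure_def)
    ultimately show ?thesis by auto
  qed
  ultimately obtain \<A> where "approximable ?m \<A>" using approximable_borel[of ?m] by blast
  with Wm' W0 Wi show thesis by (rule that)
qed

lemma Lp_space_weak_compact:
  fixes hn :: "nat \<Rightarrow> real^'n \<Rightarrow> real"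
  assumes \<Omega>: "open \<Omega>" and p: "1 < p" and h: "\<And>n. hn n \<in> Lp_space \<Omega> p"
    "\<And>n. (LINT x|lebesgue_on \<Omega>. \<bar>hn n x\<bar> powr p) \<le> C"
  obtains r h where "strict_mono r" "weakly_converges_Lp \<Omega> p (\<lambda>n. hn (r n)) h"
proof -
  obtain W \<A> where W: "W \<in> borel_measurable (lebesgue_on \<Omega>)" "\<And>x. (0::real) < W x" "integrable (lebesgue_on \<Omega>) W"
    "approximable (density (lebesgue_on \<Omega>) W) \<A>"
    using lebesgue_on_approximable_weight[OF \<Omega>] by blast
  obtain r h' where "strict_mono r" "h' \<in> borel_measurable (lebesgue_on \<Omega>)" "integrable (lebesgue_on \<Omega>) (\<lambda>x. \<bar>h' x\<bar> powr p)"
    "\<And>\<psi>. \<psi> \<in> borel_measurable (lebesgue_on \<Omega>) \<Longrightarrow> integrable (lebesgue_on \<Omega>) (\<lambda>x. \<bar>\<psi> x\<bar> powr (p / (p - 1))) \<Longrightarrow>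
      (\<lambda>n. LINT x|lebesgue_on \<Omega>. \<psi> x * hn (r n) x) \<longlonglongrightarrow> (LINT x|lebesgue_on \<Omega>. \<psi> x * h' x)"
    using Lp_weak_compact[OF W p, of hn C] h by (auto simp: Lp_space_def)
  then show thesis
    using h(1) by (intro that[of r h']) (auto simp: weakly_converges_Lp_def Lp_space_def mult.commute)
qed

lemma pos_measures_approximable:
  fixes \<alpha> :: "'a::euclidean_space measure"
  assumes \<Omega>: "open \<Omega>" and \<alpha>: "\<alpha> \<in> pos_measures \<Omega>"
  obtains \<A> where "approximable \<alpha> \<A>"
proof (rule approximable_borel[OF pos_measuresD(1)[OF \<alpha>]])
  note sets = pos_measuresD(2)[OF \<alpha>]
  show "(\<lambda>x. x) \<in> measurable \<alpha> borel"
    unfolding measurable_cong_sets[OF sets refl] by (intro measurable_restrict_space1) simp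
  show "\<exists>C\<in>sets borel. measure \<alpha> ((A - C) \<union> (C \<inter> space \<alpha> - A)) = 0" if "A \<in> sets \<alpha>" for A
  proof
    show "A \<in> sets borel" using that \<Omega> sets sets_restrict_space_iff[of \<Omega> borel A] by auto
    have "(A - A) \<union> (A \<inter> space \<alpha> - A) = {}" by auto
    then show "measure \<alpha> ((A - A) \<union> (A \<inter> space \<alpha> - A)) = 0" by (simp only: measure_empty)
  qed
qed (rule that)

lemma inner_sgn_self: "x \<bullet> sgn x = norm (x :: 'a::real_inner)"
  by (cases "x = 0") (simp_all add: sgn_div_norm dot_square_norm power2_eq_square)

text \<open>Bounded components are uniformly integrable on a finite measure space, so all of them
  converge along one subsequence. The Euclidean bound does not follow componentwise; it is recovered
  by testing with the direction of the limit.\<close>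

lemma bounded_density_weak_compact:
  fixes s :: "nat \<Rightarrow> 'a::euclidean_space \<Rightarrow> real^'n"
  assumes \<Omega>: "open \<Omega>" and \<alpha>: "\<alpha> \<in> pos_measures \<Omega>"
    and s: "\<And>n. s n \<in> borel_measurable \<alpha>" "\<And>n x. norm (s n x) \<le> 1"
  obtains r t where "strict_mono r" "t \<in> borel_measurable \<alpha>" "\<And>x. norm (t x) \<le> 1"
    "\<And>\<psi> B. \<psi> \<in> borel_measurable \<alpha> \<Longrightarrow> (\<And>x. x \<in> \<Omega> \<Longrightarrow> norm (\<psi> x) \<le> B) \<Longrightarrow>
      (\<lambda>n. LINT x|\<alpha>. s (r n) x \<bullet> \<psi> x) \<longlonglongrightarrow> (LINT x|\<alpha>. t x \<bullet> \<psi> x)"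
proof -
  interpret finite_measure \<alpha> by (rule pos_measuresD[OF \<alpha>])
  note sp = pos_measuresD(3)[OF \<alpha>]
  obtain \<A> where \<A>: "approximable \<alpha> \<A>" using pos_measures_approximable[OF \<Omega> \<alpha>] .
  have s1: "\<bar>s n x $ i\<bar> \<le> 1" for n x i
    using component_le_norm_cart[of "s n x" i] s(2)[of n x] by linarith
  have sm: "(\<lambda>x. s n x $ i) \<in> borel_measurable \<alpha>" for n i using s(1) by (rule borel_measurable_vec_nth)
  have ic: "integrable \<alpha> (\<lambda>x. s n x $ i)" for n i
    using sm s1 by (intro integrable_const_bound[where B = 1]) auto
  \<comment> \<open>Shifting by 1 places the components in the interval from 0 to 2, as
    \<open>weak_L1_compact\<close> wants nonnegative functions.\<close>
  define h where "h i n x = s n x $ i + 1" for i n x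
  have h: "0 \<le> h i n x" "h i n x \<le> 2" for i n x using s1[of n x i] by (auto simp: h_def)
  have hi: "integrable \<alpha> (h i n)" for i n unfolding h_def using ic by simp
  obtain r k where r: "strict_mono r" and k: "\<And>i. integrable \<alpha> (k i)" "\<And>i x. 0 \<le> k i x"
    "\<And>i A. A \<in> sets \<alpha> \<Longrightarrow> (\<lambda>n. LINT x:A|\<alpha>. h i (r n) x) \<longlonglongrightarrow> (LINT x:A|\<alpha>. k i x)"
  proof (rule weak_L1_compact[OF \<A>, of h])
    show "(LINT x|\<alpha>. h i n x) \<le> 2 * measure \<alpha> (space \<alpha>)" for i n
      using integral_mono[OF hi[of i n], of "\<lambda>_. 2"] h(2) by (simp add: mult.commute)
    fix i and e :: real assume "0 < e"
    have "(LINT x:A|\<alpha>. h i n x) \<le> e" if A: "A \<in> sets \<alpha>" "measure \<alpha> A < e / 2" for n A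
    proof -
      have "integrable \<alpha> (\<lambda>x. 2 * indicat_real A x)" using A(1) by (simp add: less_top[symmetric])
      then have "(LINT x:A|\<alpha>. h i n x) \<le> (LINT x|\<alpha>. 2 * indicat_real A x)"
        unfolding set_lebesgue_integral_def using h(2) integrable_mult_indicator[OF A(1) hi]
        by (intro integral_mono) (auto simp: indicator_def)
      then show ?thesis using A by simp
    qed
    then show "\<exists>d>0. \<forall>n. \<forall>A\<in>sets \<alpha>. measure \<alpha> A < d \<longrightarrow> (LINT x:A|\<alpha>. h i n x) \<le> e"
      using \<open>0 < e\<close> by (intro exI[of _ "e / 2"]) auto
  qed (use hi h in auto)
  define t0 where "t0 x = (\<chi> i. k i x - 1)" for x
  have t0i: "integrable \<alpha> (\<lambda>x. t0 x $ i)" for i using k(1) by (simp add: t0_def)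
  have t0_eq: "t0 x = (\<Sum>i\<in>UNIV. (k i x - 1) *\<^sub>R axis i 1)" for x
    using basis_expansion[of "t0 x"] by (simp add: t0_def scalar_mult_eq_scaleR)
  have it0: "integrable \<alpha> t0"
    unfolding t0_eq using k(1) by (intro Bochner_Integration.integrable_sum integrable_scaleR_left) auto
  then have t0m[measurable]: "t0 \<in> borel_measurable \<alpha>" by (rule borel_measurable_integrable)
  have lim: "(\<lambda>n. LINT x|\<alpha>. s (r n) x \<bullet> \<psi> x) \<longlonglongrightarrow> (LINT x|\<alpha>. t0 x \<bullet> \<psi> x)"
    if \<psi>: "\<psi> \<in> borel_measurable \<alpha>" "\<And>x. x \<in> \<Omega> \<Longrightarrow> norm (\<psi> x) \<le> B" for \<psi> B
  proof -
    have \<psi>m: "(\<lambda>x. \<psi> x $ i) \<in> borel_measurable \<alpha>" for i using \<psi>(1) by (rule borel_measurable_vec_nth)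
    have \<psi>b: "\<bar>\<psi> x $ i\<bar> \<le> B" if "x \<in> \<Omega>" for x i
      using \<psi>(2)[OF that] component_le_norm_cart[of "\<psi> x" i] by linarith
    have comp: "(\<lambda>n. LINT x|\<alpha>. \<psi> x $ i * s (r n) x $ i) \<longlonglongrightarrow> (LINT x|\<alpha>. \<psi> x $ i * t0 x $ i)" for i
    proof (rule weak_L1_tendsto_bounded[OF ic _ t0i _ \<psi>m])
      show "(LINT x|\<alpha>. \<bar>s (r n) x $ i\<bar>) \<le> 1 * measure \<alpha> (space \<alpha>)" for n
        using integral_mono[OF integrable_abs[OF ic[of "r n" i]], of "\<lambda>_. 1"] s1 by simp
      fix A assume A: "A \<in> sets \<alpha>"
      have si: "set_integrable \<alpha> A u" if "integrable \<alpha> u" for u :: "'a \<Rightarrow> real"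
        using integrable_mult_indicator[OF A that] by (simp add: set_integrable_def)
      have "(\<lambda>n. (LINT x:A|\<alpha>. h i (r n) x) - (LINT x:A|\<alpha>. 1)) \<longlonglongrightarrow> (LINT x:A|\<alpha>. k i x) - (LINT x:A|\<alpha>. 1)"
        by (intro tendsto_intros k(3) A)
      moreover have "(LINT x:A|\<alpha>. h i (r n) x) - (LINT x:A|\<alpha>. 1) = (LINT x:A|\<alpha>. s (r n) x $ i)" for n
        using set_integral_diff(2)[OF si[OF hi[of i "r n"]] si[of "\<lambda>_. 1"]] by (simp add: h_def)
      moreover have "(LINT x:A|\<alpha>. k i x) - (LINT x:A|\<alpha>. 1) = (LINT x:A|\<alpha>. t0 x $ i)"
        using set_integral_diff(2)[OF si[OF k(1)[of i]] si[of "\<lambda>_. 1"]] by (simp add: t0_def)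
      ultimately show "(\<lambda>n. LINT x:A|\<alpha>. s (r n) x $ i) \<longlonglongrightarrow> (LINT x:A|\<alpha>. t0 x $ i)" by simp
    qed (use \<psi>b sp in auto)
    have sum: "(LINT x|\<alpha>. u x \<bullet> \<psi> x) = (\<Sum>i\<in>UNIV. (LINT x|\<alpha>. \<psi> x $ i * u x $ i))"
      if "\<And>i. integrable \<alpha> (\<lambda>x. u x $ i)" for u
      unfolding inner_vec_def inner_real_def
      using integrable_mult_bounded[OF that \<psi>m, where B = B] \<psi>b sp
      by (subst Bochner_Integration.integral_sum) (simp_all add: mult.commute)
    show ?thesis unfolding sum[OF ic] sum[OF t0i] by (intro tendsto_sum comp)
  qed
  have ae: "AE x in \<alpha>. norm (t0 x) \<le> 1"
  proof -
    let ?A = "{x \<in> space \<alpha>. 1 < norm (t0 x)}"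
    have A: "?A \<in> sets \<alpha>" by measurable
    \<comment> \<open>Against t0 this test gives the integral of the norm over the set where it
      exceeds 1; against \<open>s n\<close> it gives at most the measure of that set.\<close>
    define \<psi> where "\<psi> x = indicat_real ?A x *\<^sub>R sgn (t0 x)" for x
    have \<psi>m: "\<psi> \<in> borel_measurable \<alpha>" unfolding \<psi>_def sgn_div_norm by measurable
    have \<psi>b: "norm (\<psi> x) \<le> indicat_real ?A x" for x by (simp add: \<psi>_def indicator_def norm_sgn)
    have \<psi>1: "norm (\<psi> x) \<le> 1" for x using \<psi>b[of x] indicator_le_1[of ?A x] by (rule order_trans)
    have "(LINT x|\<alpha>. s n x \<bullet> \<psi> x) \<le> measure \<alpha> ?A" for n
    proof -
      have "(LINT x|\<alpha>. s n x \<bullet> \<psi> x) \<le> (LINT x|\<alpha>. indicat_real ?A x)"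
      proof (rule integral_mono)
        show "integrable \<alpha> (\<lambda>x. s n x \<bullet> \<psi> x)"
          by (rule integrable_inner_bounded[OF finite_measure_axioms s(1,2) \<psi>m \<psi>1])
        show "s n x \<bullet> \<psi> x \<le> indicat_real ?A x" for x
          using Cauchy_Schwarz_ineq2[of "s n x" "\<psi> x"] mult_mono[OF s(2)[of n x] \<psi>b[of x]] by auto
      qed (use A in \<open>auto simp: less_top[symmetric]\<close>)
      then show ?thesis using A by simp
    qed
    then have "(LINT x|\<alpha>. t0 x \<bullet> \<psi> x) \<le> measure \<alpha> ?A"
      by (intro LIMSEQ_le_const2[OF lim[OF \<psi>m \<psi>1]]) auto
    moreover have "t0 x \<bullet> \<psi> x = indicat_real ?A x * norm (t0 x)" for x
      by (simp add: \<psi>_def inner_sgn_self)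
    ultimately have "(LINT x|\<alpha>. indicat_real ?A x * norm (t0 x)) \<le> measure \<alpha> ?A" by simp
    then show ?thesis by (rule AE_norm_le_1[OF it0])
  qed
  \<comment> \<open>The correction on a null set makes the bound hold everywhere and leaves all
    integrals unchanged.\<close>
  define t where "t x = (if norm (t0 x) \<le> 1 then t0 x else 0)" for x
  have tm: "t \<in> borel_measurable \<alpha>" unfolding t_def by measurable
  have tt: "(LINT x|\<alpha>. t x \<bullet> \<psi> x) = (LINT x|\<alpha>. t0 x \<bullet> \<psi> x)" if "\<psi> \<in> borel_measurable \<alpha>" for \<psi>
    using ae that tm by (intro integral_cong_AE) (auto simp: t_def)
  show thesis
    using tm lim tt by (intro that[OF r, of t]) (auto simp: t_def)
qed

definition flux_objective ::
  "(real^'n) set \<Rightarrow> real \<Rightarrow> (real^'n \<Rightarrow> real) \<Rightarrow> (real^'n \<Rightarrow> real) \<Rightarrow> (real^'n) measure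
    \<Rightarrow> (real^'n \<Rightarrow> real^'n) \<Rightarrow> (real^'n \<Rightarrow> real) \<Rightarrow> real" where
  "flux_objective \<Omega> p f \<beta> \<alpha> s h =
     1 / p * (LINT x|lebesgue_on \<Omega>. \<bar>h x - f x\<bar> powr p) + (LINT x|\<alpha>. \<beta> x * norm (s x))"

lemma Lp_space_add:
  assumes "1 < p" "u \<in> Lp_space \<Omega> p" "v \<in> Lp_space \<Omega> p"
  shows "(\<lambda>x. u x + v x) \<in> Lp_space \<Omega> p"
  using assms integrable_powr_add[of p u "lebesgue_on \<Omega>" v] unfolding Lp_space_def
  by (auto intro!: borel_measurable_add)

lemma Lp_space_minus: "u \<in> Lp_space \<Omega> p \<Longrightarrow> (\<lambda>x. - u x) \<in> Lp_space \<Omega> p"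
  by (simp add: Lp_space_def)

lemma Lp_space_diff:
  assumes "1 < p" "u \<in> Lp_space \<Omega> p" "v \<in> Lp_space \<Omega> p"
  shows "(\<lambda>x. u x - v x) \<in> Lp_space \<Omega> p"
  using Lp_space_add[OF assms(1,2) Lp_space_minus[OF assms(3)]] by simp

lemma Lp_space_bounded_mult:
  assumes "0 < p" "u \<in> Lp_space \<Omega> p" "g \<in> borel_measurable (lebesgue_on \<Omega>)" "\<And>x. x \<in> \<Omega> \<Longrightarrow> \<bar>g x\<bar> \<le> B"
  shows "(\<lambda>x. g x * u x) \<in> Lp_space \<Omega> p"
proof -
  have m: "(\<lambda>x. \<bar>g x\<bar> powr p) \<in> borel_measurable (lebesgue_on \<Omega>)" using assms(3) by measurable
  have "integrable (lebesgue_on \<Omega>) (\<lambda>x. \<bar>g x\<bar> powr p *\<^sub>R \<bar>u x\<bar> powr p)"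
    using assms(2) assms(1,4)
    by (intro integrable_mult_bounded[OF _ m, of _ "B powr p"]) (auto simp: Lp_space_def space_restrict_space intro: powr_mono2)
  then show ?thesis
    using assms(2,3) unfolding Lp_space_def by (auto simp: abs_mult powr_mult intro!: borel_measurable_times)
qed

text \<open>Coercivity: the \<beta> term is nonnegative, so the objective controls h - f, and the
  elementary inequality for sums adds f.\<close>

lemma Lp_bound_from_objective:
  assumes p: "1 < p" and "h \<in> Lp_space \<Omega> p" "f \<in> Lp_space \<Omega> p"
    and \<beta>: "\<And>x. x \<in> space \<alpha> \<Longrightarrow> 0 \<le> \<beta> x" and J: "flux_objective \<Omega> p f \<beta> \<alpha> s h \<le> J0"
  shows "(LINT x|lebesgue_on \<Omega>. \<bar>h x\<bar> powr p) \<le> 2 powr p * (p * J0 + (LINT x|lebesgue_on \<Omega>. \<bar>f x\<bar> powr p))"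
proof -
  have d: "(\<lambda>x. h x - f x) \<in> Lp_space \<Omega> p" by (rule Lp_space_diff[OF p assms(2,3)])
  have "0 \<le> (LINT x|\<alpha>. \<beta> x * norm (s x))"
    using \<beta> by (intro integral_nonneg_AE AE_I2) auto
  then have "1 / p * (LINT x|lebesgue_on \<Omega>. \<bar>h x - f x\<bar> powr p) \<le> J0"
    using J by (simp add: flux_objective_def)
  then have 1: "(LINT x|lebesgue_on \<Omega>. \<bar>h x - f x\<bar> powr p) \<le> p * J0"
    using p by (simp add: field_simps)
  have "(LINT x|lebesgue_on \<Omega>. \<bar>h x\<bar> powr p) \<le> (LINT x|lebesgue_on \<Omega>. 2 powr p * (\<bar>h x - f x\<bar> powr p + \<bar>f x\<bar> powr p))"
  proof (rule integral_mono)
    show "\<bar>h x\<bar> powr p \<le> 2 powr p * (\<bar>h x - f x\<bar> powr p + \<bar>f x\<bar> powr p)" for x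
      using abs_add_powr_le[of p "h x - f x" "f x"] p by simp
  qed (use assms(2,3) d in \<open>auto simp: Lp_space_def\<close>)
  also have "\<dots> = 2 powr p * ((LINT x|lebesgue_on \<Omega>. \<bar>h x - f x\<bar> powr p) + (LINT x|lebesgue_on \<Omega>. \<bar>f x\<bar> powr p))"
    using assms(3) d by (simp add: Lp_space_def)
  also have "\<dots> \<le> 2 powr p * (p * J0 + (LINT x|lebesgue_on \<Omega>. \<bar>f x\<bar> powr p))"
    using 1 by (intro mult_left_mono) auto
  finally show ?thesis .
qed

text \<open>The assumption on \<open>\<delta>\<close> is convergence of \<open>\<alpha>k\<close> to \<open>\<alpha>\<close> in total variation.\<close>

lemma flux_compactness:
  fixes \<Omega> \<Gamma> :: "(real^'n) set" and s :: "nat \<Rightarrow> real^'n \<Rightarrow> real^'n" and \<delta> :: "nat \<Rightarrow> real"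
    and h :: "nat \<Rightarrow> real^'n \<Rightarrow> real" and f \<beta> :: "real^'n \<Rightarrow> real"
  assumes \<Omega>: "open \<Omega>" and p: "1 < p" and \<alpha>: "\<alpha> \<in> pos_measures \<Omega>" and \<alpha>k: "\<And>k. \<alpha>k k \<in> pos_measures \<Omega>"
    and tv: "\<delta> \<longlonglongrightarrow> 0" "\<And>k \<psi> B. \<psi> \<in> borel_measurable \<alpha> \<Longrightarrow> (\<And>x. x \<in> \<Omega> \<Longrightarrow> \<bar>\<psi> x\<bar> \<le> B) \<Longrightarrow>
      \<bar>(LINT x|\<alpha>k k. \<psi> x) - (LINT x|\<alpha>. \<psi> x)\<bar> \<le> B * \<delta> k"
    and s: "\<And>k. s k \<in> borel_measurable \<alpha>" "\<And>k x. norm (s k x) \<le> 1"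
    and fd: "\<And>k. flux_div \<Omega> \<Gamma> p (\<alpha>k k) (s k) (h k)"
    and hC: "\<And>k. (LINT x|lebesgue_on \<Omega>. \<bar>h k x\<bar> powr p) \<le> C"
    and f: "f \<in> Lp_space \<Omega> p" and \<beta>: "\<forall>x\<in>\<Omega>. 0 \<le> \<beta> x" "continuous_on \<Omega> \<beta>" "bounded (\<beta> ` \<Omega>)"
  obtains r t u where "strict_mono r" "t \<in> borel_measurable \<alpha>" "\<And>x. norm (t x) \<le> 1" "flux_div \<Omega> \<Gamma> p \<alpha> t u"
    "weakly_converges_Lp \<Omega> p (\<lambda>k. h (r k)) u"
    "\<And>\<psi> B. \<psi> \<in> borel_measurable \<alpha> \<Longrightarrow> (\<And>x. x \<in> \<Omega> \<Longrightarrow> norm (\<psi> x) \<le> B) \<Longrightarrow>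
      (\<lambda>k. LINT x|\<alpha>k (r k). s (r k) x \<bullet> \<psi> x) \<longlonglongrightarrow> (LINT x|\<alpha>. t x \<bullet> \<psi> x)"
    "\<And>b c. b \<longlonglongrightarrow> c \<Longrightarrow> (\<forall>\<^sub>F k in sequentially. flux_objective \<Omega> p f \<beta> (\<alpha>k k) (s k) (h k) \<le> b k) \<Longrightarrow>
      flux_objective \<Omega> p f \<beta> \<alpha> t u \<le> c"
proof -
  interpret finite_measure \<alpha> by (rule pos_measuresD[OF \<alpha>])
  note sp = pos_measuresD(3)[OF \<alpha>]
  have sets_k: "sets (\<alpha>k k) = sets \<alpha>" for k using pos_measuresD(2)[OF \<alpha>] pos_measuresD(2)[OF \<alpha>k] by simp
  have mk: "\<psi> \<in> borel_measurable (\<alpha>k k) \<longleftrightarrow> \<psi> \<in> borel_measurable \<alpha>" for k and \<psi> :: "real^'n \<Rightarrow> 'c::topological_space"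
    by (simp add: measurable_cong_sets[OF sets_k refl])
  obtain r1 t where r1: "strict_mono r1" and t: "t \<in> borel_measurable \<alpha>" "\<And>x. norm (t x) \<le> 1"
    and lim1: "\<And>\<psi> B. \<psi> \<in> borel_measurable \<alpha> \<Longrightarrow> (\<And>x. x \<in> \<Omega> \<Longrightarrow> norm (\<psi> x) \<le> B) \<Longrightarrow>
      (\<lambda>n. LINT x|\<alpha>. s (r1 n) x \<bullet> \<psi> x) \<longlonglongrightarrow> (LINT x|\<alpha>. t x \<bullet> \<psi> x)"
  proof (rule bounded_density_weak_compact[where s = s, OF \<Omega> \<alpha> s])
    fix r t assume "strict_mono r" "t \<in> borel_measurable \<alpha>" "\<And>x. norm (t x) \<le> 1"
      "\<And>\<psi> B. \<psi> \<in> borel_measurable \<alpha> \<Longrightarrow> (\<And>x. x \<in> \<Omega> \<Longrightarrow> norm (\<psi> x) \<le> B) \<Longrightarrow>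
        (\<lambda>n. LINT x|\<alpha>. s (r n) x \<bullet> \<psi> x) \<longlonglongrightarrow> (LINT x|\<alpha>. t x \<bullet> \<psi> x)"
    then show thesis by (rule that)
  qed
  have hL: "h k \<in> Lp_space \<Omega> p" for k using fd[of k] by (simp add: flux_div_def)
  obtain r2 u where r2: "strict_mono r2" and u: "weakly_converges_Lp \<Omega> p (\<lambda>n. h (r1 (r2 n))) u"
    using Lp_space_weak_compact[OF \<Omega> p, of "\<lambda>n. h (r1 n)" C] hL hC by blast
  define r where "r = r1 \<circ> r2"
  have r: "strict_mono r" unfolding r_def using r1 r2 by (rule strict_mono_o)
  have uL: "u \<in> Lp_space \<Omega> p" using u by (simp add: weakly_converges_Lp_def)
  have limh: "(\<lambda>k. LINT x|lebesgue_on \<Omega>. h (r k) x * \<psi> x) \<longlonglongrightarrow> (LINT x|lebesgue_on \<Omega>. u x * \<psi> x)"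
    if "\<psi> \<in> Lp_space \<Omega> (p / (p - 1))" for \<psi>
    using u that by (simp add: weakly_converges_Lp_def r_def)
  have lim: "(\<lambda>k. LINT x|\<alpha>k (r k). s (r k) x \<bullet> \<psi> x) \<longlonglongrightarrow> (LINT x|\<alpha>. t x \<bullet> \<psi> x)"
    if \<psi>: "\<psi> \<in> borel_measurable \<alpha>" "\<And>x. x \<in> \<Omega> \<Longrightarrow> norm (\<psi> x) \<le> B" for \<psi> B
  proof -
    have b: "\<bar>s k x \<bullet> \<psi> x\<bar> \<le> B" if "x \<in> \<Omega>" for k x
      using Cauchy_Schwarz_ineq2[of "s k x" "\<psi> x"] mult_mono[OF s(2)[of k x] \<psi>(2)[OF that]] by auto
    \<comment> \<open>The integrands depend on k but share the bound B, so convergence in total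
      variation allows the moving measure to be replaced by \<alpha>.\<close>
    have "(\<lambda>k. (LINT x|\<alpha>k (r k). s (r k) x \<bullet> \<psi> x) - (LINT x|\<alpha>. s (r k) x \<bullet> \<psi> x)) \<longlonglongrightarrow> 0"
    proof (rule Lim_null_comparison)
      show "\<forall>\<^sub>F k in sequentially. norm ((LINT x|\<alpha>k (r k). s (r k) x \<bullet> \<psi> x) - (LINT x|\<alpha>. s (r k) x \<bullet> \<psi> x)) \<le> B * \<delta> (r k)"
        using b s(1) \<psi>(1) by (intro always_eventually allI) (simp add: tv(2))
      show "(\<lambda>k. B * \<delta> (r k)) \<longlonglongrightarrow> 0"
        using LIMSEQ_subseq_LIMSEQ[OF tv(1) r] by (intro tendsto_mult_right_zero) (simp add: o_def)
    qed
    moreover have "(\<lambda>k. LINT x|\<alpha>. s (r k) x \<bullet> \<psi> x) \<longlonglongrightarrow> (LINT x|\<alpha>. t x \<bullet> \<psi> x)"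
      using LIMSEQ_subseq_LIMSEQ[OF lim1[OF \<psi>] r2] by (simp add: r_def o_def)
    ultimately show ?thesis using tendsto_add by fastforce
  qed
  have fdt: "flux_div \<Omega> \<Gamma> p \<alpha> t u"
    unfolding flux_div_def
  proof (intro conjI uL ballI)
    fix \<phi> assume \<phi>: "\<phi> \<in> flux_test \<Omega> \<Gamma>"
    obtain B R where B: "Ck_on 1 \<Omega> \<phi>" "\<And>x. x \<in> \<Omega> \<Longrightarrow> \<bar>\<phi> x\<bar> \<le> B" "\<And>x. x \<in> \<Omega> \<Longrightarrow> norm (grad \<phi> x) \<le> B"
      "\<And>x. x \<in> \<Omega> \<Longrightarrow> R < norm x \<Longrightarrow> \<phi> x = 0"
      using flux_testD[OF \<Omega> \<phi>] by blast
    have \<phi>m: "\<phi> \<in> borel_measurable (lebesgue_on \<Omega>)"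
      by (rule continuous_borel_measurable_lebesgue_on[OF \<Omega> Ck_on_continuous[OF B(1)]])
    have \<phi>q: "\<phi> \<in> Lp_space \<Omega> (p / (p - 1))"
      using integrable_Lp_times_bounded_support(1)[OF p uL \<Omega> \<phi>m, of B R "p / (p - 1)"] B(2,4) \<phi>m p
      by (auto simp: Lp_space_def)
    have gm: "grad \<phi> \<in> borel_measurable \<alpha>"
      using B(1) unfolding Ck_on_1_iff by (intro continuous_borel_measurable_pos[OF \<alpha>]) auto
    have "(\<lambda>k. (LINT x|\<alpha>k (r k). s (r k) x \<bullet> grad \<phi> x) + (LINT x|lebesgue_on \<Omega>. h (r k) x * \<phi> x))
        \<longlonglongrightarrow> (LINT x|\<alpha>. t x \<bullet> grad \<phi> x) + (LINT x|lebesgue_on \<Omega>. u x * \<phi> x)"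
      by (intro tendsto_add lim[OF gm B(3)] limh[OF \<phi>q])
    moreover have "(LINT x|\<alpha>k (r k). s (r k) x \<bullet> grad \<phi> x) + (LINT x|lebesgue_on \<Omega>. h (r k) x * \<phi> x) = 0" for k
      using fd[of "r k"] \<phi> by (simp add: flux_div_def mult.commute)
    ultimately show "(LINT x|\<alpha>. t x \<bullet> grad \<phi> x) + (LINT x|lebesgue_on \<Omega>. \<phi> x * u x) = 0"
      by (simp add: LIMSEQ_const_iff mult.commute)
  qed
  have lsc: "flux_objective \<Omega> p f \<beta> \<alpha> t u \<le> c"
    if bc: "b \<longlonglongrightarrow> c" and le: "\<forall>\<^sub>F k in sequentially. flux_objective \<Omega> p f \<beta> (\<alpha>k k) (s k) (h k) \<le> b k" for b c
  proof -
    have \<beta>m: "\<beta> \<in> borel_measurable \<alpha>" by (rule continuous_borel_measurable_pos[OF \<alpha> \<beta>(2)])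
    obtain B where B: "\<And>x. x \<in> \<Omega> \<Longrightarrow> \<bar>\<beta> x\<bar> \<le> B" using \<beta>(3) by (auto simp: bounded_iff)
    \<comment> \<open>As \<beta> is nonnegative, pairing with this field stays below \<beta> times
      the norm of any density, with equality for t.\<close>
    let ?\<psi> = "\<lambda>x. \<beta> x *\<^sub>R sgn (t x)"
    have \<psi>m: "?\<psi> \<in> borel_measurable \<alpha>" using \<beta>m t(1) unfolding sgn_div_norm by measurable
    have \<psi>b: "norm (?\<psi> x) \<le> B" if "x \<in> \<Omega>" for x
      using B[OF that] abs_ge_zero[of "\<beta> x"] by (auto simp: norm_sgn simp del: abs_ge_zero)
    have ineq1: "(LINT x|\<alpha>k k. s k x \<bullet> ?\<psi> x) \<le> (LINT x|\<alpha>k k. \<beta> x * norm (s k x))" for k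
    proof (rule integral_mono)
      interpret k: finite_measure "\<alpha>k k" by (rule pos_measuresD[OF \<alpha>k])
      note spk = pos_measuresD(3)[OF \<alpha>k[of k]]
      show "integrable (\<alpha>k k) (\<lambda>x. s k x \<bullet> ?\<psi> x)"
        using s \<psi>m \<psi>b spk by (intro integrable_inner_bounded[OF k.finite_measure_axioms, of _ _ B]) (auto simp: mk)
      show "integrable (\<alpha>k k) (\<lambda>x. \<beta> x * norm (s k x))"
      proof (rule k.integrable_const_bound[where B = B])
        show "AE x in \<alpha>k k. norm (\<beta> x * norm (s k x)) \<le> B"
        proof (rule AE_I2)
          fix x assume "x \<in> space (\<alpha>k k)"
          then have "\<bar>\<beta> x\<bar> \<le> B" using B spk by simp
          then have "\<bar>\<beta> x\<bar> * norm (s k x) \<le> B * 1" using s(2)[of k x] by (intro mult_mono) auto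
          then show "norm (\<beta> x * norm (s k x)) \<le> B" by (simp add: abs_mult)
        qed
        show "(\<lambda>x. \<beta> x * norm (s k x)) \<in> borel_measurable (\<alpha>k k)"
          unfolding mk using \<beta>m s(1) by measurable
      qed
      fix x assume "x \<in> space (\<alpha>k k)"
      then have "0 \<le> \<beta> x" using \<beta>(1) spk by simp
      moreover have "s k x \<bullet> sgn (t x) \<le> norm (s k x) * norm (sgn (t x))"
        using Cauchy_Schwarz_ineq2 abs_le_D1 by blast
      moreover have "norm (s k x) * norm (sgn (t x)) \<le> norm (s k x)" by (simp add: norm_sgn)
      ultimately show "s k x \<bullet> ?\<psi> x \<le> \<beta> x * norm (s k x)"
        by (simp add: mult_left_mono)
    qed
    have eq1: "(LINT x|\<alpha>. t x \<bullet> ?\<psi> x) = (LINT x|\<alpha>. \<beta> x * norm (t x))"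
    proof -
      show ?thesis by (simp add: inner_sgn_self)
    qed
    \<comment> \<open>Up to the factor p, the slope of the p-th power at u - f; it lies in the dual
      space, so weak convergence of the divergences applies to it.\<close>
    let ?w = "\<lambda>x. sgn (u x - f x) * \<bar>u x - f x\<bar> powr (p - 1)"
    have uf: "(\<lambda>x. u x - f x) \<in> Lp_space \<Omega> p" by (rule Lp_space_diff[OF p uL f])
    have wq: "\<bar>?w x\<bar> powr (p / (p - 1)) = \<bar>u x - f x\<bar> powr p" for x
    proof (cases "u x = f x")
      case False
      then have "\<bar>?w x\<bar> = \<bar>u x - f x\<bar> powr (p - 1)" by (simp add: abs_mult abs_sgn_eq)
      then show ?thesis by (simp only: powr_powr conjugate_exponent(3)[OF p])
    qed simp
    have w: "?w \<in> Lp_space \<Omega> (p / (p - 1))"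
    proof -
      have "integrable (lebesgue_on \<Omega>) (\<lambda>x. \<bar>?w x\<bar> powr (p / (p - 1)))"
        unfolding wq using uf by (simp add: Lp_space_def)
      moreover have "(\<lambda>x. u x - f x) \<in> borel_measurable (lebesgue_on \<Omega>)"
        using uf by (simp add: Lp_space_def)
      then have "?w \<in> borel_measurable (lebesgue_on \<Omega>)"
        unfolding sgn_div_norm by measurable
      ultimately show ?thesis unfolding Lp_space_def by blast
    qed
    have iw: "integrable (lebesgue_on \<Omega>) (\<lambda>x. v x * ?w x)" if "v \<in> Lp_space \<Omega> p" for v
      using that w by (intro integrable_mult_Lp[OF p]) (auto simp: Lp_space_def)
    have ineq2: "(LINT x|lebesgue_on \<Omega>. \<bar>u x - f x\<bar> powr p) + p * ((LINT x|lebesgue_on \<Omega>. h k x * ?w x) - (LINT x|lebesgue_on \<Omega>. u x * ?w x))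
        \<le> (LINT x|lebesgue_on \<Omega>. \<bar>h k x - f x\<bar> powr p)" for k
    proof -
      have "(LINT x|lebesgue_on \<Omega>. \<bar>u x - f x\<bar> powr p) + p * ((LINT x|lebesgue_on \<Omega>. h k x * ?w x) - (LINT x|lebesgue_on \<Omega>. u x * ?w x))
          = (LINT x|lebesgue_on \<Omega>. \<bar>u x - f x\<bar> powr p + p * (h k x * ?w x - u x * ?w x))"
        using uf iw[OF hL] iw[OF uL] by (simp add: Lp_space_def)
      also have "\<dots> \<le> (LINT x|lebesgue_on \<Omega>. \<bar>h k x - f x\<bar> powr p)"
      proof (rule integral_mono)
        show "\<bar>u x - f x\<bar> powr p + p * (h k x * ?w x - u x * ?w x) \<le> \<bar>h k x - f x\<bar> powr p" for x
          using powr_tangent[OF p, of "u x - f x" "h k x - f x"] by (simp add: algebra_simps)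
        show "integrable (lebesgue_on \<Omega>) (\<lambda>x. \<bar>h k x - f x\<bar> powr p)"
          using Lp_space_diff[OF p hL f] by (simp add: Lp_space_def)
      qed (use uf iw[OF hL] iw[OF uL] in \<open>auto simp: Lp_space_def\<close>)
      finally show ?thesis .
    qed
    \<comment> \<open>An affine minorant of the objective at (s k, h k). It converges along the
      subsequence, and its limit is the objective at (t, u), where the tangent touches.\<close>
    define T where "T k = 1 / p * ((LINT x|lebesgue_on \<Omega>. \<bar>u x - f x\<bar> powr p) + p * ((LINT x|lebesgue_on \<Omega>. h k x * ?w x) - (LINT x|lebesgue_on \<Omega>. u x * ?w x)))
        + (LINT x|\<alpha>k k. s k x \<bullet> ?\<psi> x)" for k
    have "(\<lambda>k. T (r k)) \<longlonglongrightarrow> 1 / p * ((LINT x|lebesgue_on \<Omega>. \<bar>u x - f x\<bar> powr p) + p * ((LINT x|lebesgue_on \<Omega>. u x * ?w x) - (LINT x|lebesgue_on \<Omega>. u x * ?w x)))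
        + (LINT x|\<alpha>. t x \<bullet> ?\<psi> x)"
      unfolding T_def by (intro tendsto_intros limh[OF w] lim[OF \<psi>m \<psi>b])
    then have T: "(\<lambda>k. T (r k)) \<longlonglongrightarrow> flux_objective \<Omega> p f \<beta> \<alpha> t u"
      unfolding eq1 flux_objective_def by simp
    have TJ: "T k \<le> flux_objective \<Omega> p f \<beta> (\<alpha>k k) (s k) (h k)" for k
      unfolding T_def flux_objective_def using p by (intro add_mono mult_left_mono ineq1 ineq2) auto
    show ?thesis
    proof (rule tendsto_le[OF sequentially_bot _ T])
      show "(\<lambda>k. b (r k)) \<longlonglongrightarrow> c" using LIMSEQ_subseq_LIMSEQ[OF bc r] by (simp add: o_def)
      have "\<forall>\<^sub>F k in sequentially. flux_objective \<Omega> p f \<beta> (\<alpha>k (r k)) (s (r k)) (h (r k)) \<le> b (r k)"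
        using le r by (rule eventually_subseq[rotated])
      then show "\<forall>\<^sub>F k in sequentially. T (r k) \<le> b (r k)"
        by (rule eventually_mono) (use TJ in \<open>rule order_trans\<close>)
    qed
  qed
  show thesis
  proof (rule that[OF r t fdt _ lim lsc])
    show "weakly_converges_Lp \<Omega> p (\<lambda>k. h (r k)) u" using u by (simp add: r_def)
  qed
qed

subsection \<open>Existence of minimizers\<close>

text \<open>With \<open>flux_div_Kdiv_objective\<close> this is the dictionary between feasible
  measures and pairs; afterwards only values of \<open>flux_objective\<close> are compared.\<close>

lemma Kdiv_flux_objective:
  fixes \<sigma> :: "(real^'n) set \<Rightarrow> real^'n"
  assumes \<Omega>: "open \<Omega>" and p: "1 < p" and \<alpha>: "\<alpha> \<in> pos_measures \<Omega>"
    and f: "f \<in> Lp_space \<Omega> p" and \<beta>: "continuous_on \<Omega> \<beta>" and \<sigma>: "\<sigma> \<in> Kdiv \<Omega> p \<Gamma> \<alpha>"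
  shows "\<exists>s. s \<in> borel_measurable \<alpha> \<and> (\<forall>x. norm (s x) \<le> 1) \<and> has_vec_density \<Omega> \<alpha> s \<sigma> \<and>
    flux_div \<Omega> \<Gamma> p \<alpha> s (vdiv \<Omega> p \<sigma>) \<and> objective \<Omega> p f \<beta> \<sigma> = flux_objective \<Omega> p f \<beta> \<alpha> s (vdiv \<Omega> p \<sigma>)"
proof -
  obtain s where s: "s \<in> borel_measurable \<alpha>" "\<And>x. norm (s x) \<le> 1" "has_vec_density \<Omega> \<alpha> s \<sigma>"
    "flux_div \<Omega> \<Gamma> p \<alpha> s (vdiv \<Omega> p \<sigma>)"
    using Kdiv_imp_flux_div[OF \<Omega> p \<alpha> \<sigma>] by blast
  have "vdiv \<Omega> p \<sigma> \<in> Lp_space \<Omega> p" using s(4) by (simp add: flux_div_def)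
  with s objective_density[OF \<Omega> \<alpha> s(1-3) this this _ f \<beta>] show ?thesis
    by (intro exI[of _ s]) (auto simp: flux_objective_def)
qed

lemma flux_div_Kdiv_objective:
  fixes s :: "real^'n \<Rightarrow> real^'n"
  assumes \<Omega>: "open \<Omega>" and p: "1 < p" and \<alpha>: "\<alpha> \<in> pos_measures \<Omega>"
    and f: "f \<in> Lp_space \<Omega> p" and \<beta>: "continuous_on \<Omega> \<beta>"
    and s: "s \<in> borel_measurable \<alpha>" "\<And>x. norm (s x) \<le> 1" and fd: "flux_div \<Omega> \<Gamma> p \<alpha> s h"
  shows "\<exists>\<sigma>. has_vec_density \<Omega> \<alpha> s \<sigma> \<and> \<sigma> \<in> Kdiv \<Omega> p \<Gamma> \<alpha> \<and> vdiv \<Omega> p \<sigma> \<in> Lp_space \<Omega> p \<and>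
    (AE x in lebesgue_on \<Omega>. vdiv \<Omega> p \<sigma> x = h x) \<and> objective \<Omega> p f \<beta> \<sigma> = flux_objective \<Omega> p f \<beta> \<alpha> s h"
proof -
  define \<sigma> where "\<sigma> A = (LINT x:A|\<alpha>. s x)" for A
  have d: "has_vec_density \<Omega> \<alpha> s \<sigma>" by (simp add: has_vec_density_def \<sigma>_def)
  note K = flux_div_imp_Kdiv[OF \<Omega> p \<alpha> s d fd]
  have "h \<in> Lp_space \<Omega> p" using fd by (simp add: flux_div_def)
  then have "objective \<Omega> p f \<beta> \<sigma> = flux_objective \<Omega> p f \<beta> \<alpha> s h"
    using objective_density[OF \<Omega> \<alpha> s d _ K(2,3) f \<beta>] by (simp add: flux_objective_def)
  with d K show ?thesis by (intro exI[of _ \<sigma>] conjI)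
qed

lemma flux_objective_nonneg:
  assumes "0 < p" "\<And>x. x \<in> space \<alpha> \<Longrightarrow> 0 \<le> \<beta> x"
  shows "0 \<le> flux_objective \<Omega> p f \<beta> \<alpha> s h"
  unfolding flux_objective_def using assms
  by (intro add_nonneg_nonneg mult_nonneg_nonneg integral_nonneg_AE AE_I2) auto

text \<open>The zero flux is feasible for every \<alpha>. It makes the feasible sets nonempty and
  bounds the minimal values uniformly in n.\<close>

lemma flux_div_zero: "flux_div \<Omega> \<Gamma> p \<alpha> (\<lambda>_. 0) (\<lambda>_. 0)"
  by (simp add: flux_div_def Lp_space_def)

text \<open>The direct method: \<open>flux_compactness\<close> with the constant sequence \<alpha>
  and distance 0 turns a minimizing sequence into a minimizer.\<close>

lemma solution_exists:
  fixes \<Omega> :: "(real^'n) set"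
  assumes \<Omega>: "open \<Omega>" and p: "1 < p" and \<alpha>: "\<alpha> \<in> pos_measures \<Omega>"
    and f: "f \<in> Lp_space \<Omega> p" and \<beta>: "\<forall>x\<in>\<Omega>. 0 \<le> \<beta> x" "continuous_on \<Omega> \<beta>" "bounded (\<beta> ` \<Omega>)"
  shows "\<exists>\<mu>. solves \<Omega> p \<Gamma> f \<beta> \<alpha> \<mu>"
proof -
  note sp = pos_measuresD(3)[OF \<alpha>]
  have \<beta>0: "\<And>x. x \<in> space \<alpha> \<Longrightarrow> 0 \<le> \<beta> x" using \<beta>(1) sp by simp
  let ?J = "objective \<Omega> p f \<beta>" and ?K = "Kdiv \<Omega> p \<Gamma> \<alpha>"
  obtain z where z: "z \<in> ?K"
    using flux_div_Kdiv_objective[OF \<Omega> p \<alpha> f \<beta>(2) _ _ flux_div_zero] by auto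
  have nn: "0 \<le> ?J \<sigma>" if \<sigma>K: "\<sigma> \<in> ?K" for \<sigma>
  proof -
    obtain s where "?J \<sigma> = flux_objective \<Omega> p f \<beta> \<alpha> s (vdiv \<Omega> p \<sigma>)"
      using Kdiv_flux_objective[OF \<Omega> p \<alpha> f \<beta>(2) \<sigma>K] by auto
    moreover have "0 \<le> flux_objective \<Omega> p f \<beta> \<alpha> s (vdiv \<Omega> p \<sigma>)"
      by (rule flux_objective_nonneg) (use p \<beta>0 in auto)
    ultimately show ?thesis by simp
  qed
  define m where "m = Inf (?J ` ?K)"
  have bdd: "bdd_below (?J ` ?K)" using nn by (intro bdd_belowI2[of _ 0])
  have "\<exists>\<sigma>\<in>?K. ?J \<sigma> < m + inverse (real (Suc k))" for k
    using cInf_lessD[of "?J ` ?K" "m + inverse (real (Suc k))"] z by (auto simp: m_def)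
  then obtain \<sigma> where \<sigma>: "\<And>k. \<sigma> k \<in> ?K" "\<And>k. ?J (\<sigma> k) < m + inverse (real (Suc k))" by metis
  have "\<exists>s. s \<in> borel_measurable \<alpha> \<and> (\<forall>x. norm (s x) \<le> 1) \<and> flux_div \<Omega> \<Gamma> p \<alpha> s (vdiv \<Omega> p (\<sigma> k)) \<and>
      ?J (\<sigma> k) = flux_objective \<Omega> p f \<beta> \<alpha> s (vdiv \<Omega> p (\<sigma> k))" for k
    using Kdiv_flux_objective[OF \<Omega> p \<alpha> f \<beta>(2) \<sigma>(1)[of k]] by blast
  then obtain s where s: "\<And>k. s k \<in> borel_measurable \<alpha>" "\<And>k x. norm (s k x) \<le> 1"
    "\<And>k. flux_div \<Omega> \<Gamma> p \<alpha> (s k) (vdiv \<Omega> p (\<sigma> k))"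
    "\<And>k. ?J (\<sigma> k) = flux_objective \<Omega> p f \<beta> \<alpha> (s k) (vdiv \<Omega> p (\<sigma> k))" by metis
  have bound: "(LINT x|lebesgue_on \<Omega>. \<bar>vdiv \<Omega> p (\<sigma> k) x\<bar> powr p) \<le> 2 powr p * (p * (m + 1) + (LINT x|lebesgue_on \<Omega>. \<bar>f x\<bar> powr p))" for k
  proof (rule Lp_bound_from_objective[OF p _ f \<beta>0])
    show "vdiv \<Omega> p (\<sigma> k) \<in> Lp_space \<Omega> p" using s(3)[of k] by (simp add: flux_div_def)
    have "inverse (real (Suc k)) \<le> 1" by (simp add: inverse_le_1_iff)
    then show "flux_objective \<Omega> p f \<beta> \<alpha> (s k) (vdiv \<Omega> p (\<sigma> k)) \<le> m + 1" using \<sigma>(2)[of k] s(4)[of k] by linarith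
  qed
  obtain t u where t: "t \<in> borel_measurable \<alpha>" "\<And>x. norm (t x) \<le> 1" "flux_div \<Omega> \<Gamma> p \<alpha> t u"
    and J: "flux_objective \<Omega> p f \<beta> \<alpha> t u \<le> m"
  proof (rule flux_compactness[where \<alpha>k = "\<lambda>_. \<alpha>" and \<delta> = "\<lambda>_. 0", OF \<Omega> p \<alpha> \<alpha> tendsto_const _ s(1-3) bound f \<beta>])
    fix r t u
    assume "t \<in> borel_measurable \<alpha>" "\<And>x. norm (t x) \<le> 1" "flux_div \<Omega> \<Gamma> p \<alpha> t u"
      and "\<And>b c. b \<longlonglongrightarrow> c \<Longrightarrow> (\<forall>\<^sub>F k in sequentially. flux_objective \<Omega> p f \<beta> \<alpha> (s k) (vdiv \<Omega> p (\<sigma> k)) \<le> b k) \<Longrightarrow>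
        flux_objective \<Omega> p f \<beta> \<alpha> t u \<le> c"
    moreover have "(\<lambda>k. m + inverse (real (Suc k))) \<longlonglongrightarrow> m + 0"
      by (intro tendsto_intros LIMSEQ_inverse_real_of_nat)
    moreover have "\<forall>\<^sub>F k in sequentially. flux_objective \<Omega> p f \<beta> \<alpha> (s k) (vdiv \<Omega> p (\<sigma> k)) \<le> m + inverse (real (Suc k))"
      using \<sigma>(2) s(4) by (intro always_eventually allI less_imp_le) simp
    ultimately show thesis using that[of t u] by simp
  qed simp
  obtain \<mu> where \<mu>: "\<mu> \<in> ?K" "?J \<mu> = flux_objective \<Omega> p f \<beta> \<alpha> t u"
    using flux_div_Kdiv_objective[OF \<Omega> p \<alpha> f \<beta>(2) t] by blast
  have "?J \<mu> \<le> ?J \<tau>" if "\<tau> \<in> ?K" for \<tau>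
    using J \<mu>(2) cInf_lower[OF imageI[OF that] bdd] by (simp add: m_def)
  then show ?thesis using \<mu>(1) by (auto simp: solves_def)
qed

subsection \<open>Recovery sequences\<close>

text \<open>The defect of the identity vanishes on indicators, and
  \<open>bounded_functionals_tendsto_0\<close>, used with a constant sequence, extends this to
  bounded functions. As g carries no sign, the right side is treated as a functional and not as a
  measure.\<close>

lemma lebesgue_decomposition_integral:
  fixes \<psi> :: "'a::topological_space \<Rightarrow> real"
  assumes \<alpha>: "\<alpha> \<in> pos_measures \<Omega>" and dec: "lebesgue_decomposition \<Omega> \<alpha> \<rho> g s"
    and \<rho>: "space \<rho> = \<Omega>" "\<And>\<psi> :: 'a \<Rightarrow> real. \<psi> \<in> borel_measurable \<alpha> \<Longrightarrow> \<psi> \<in> borel_measurable \<rho>"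
    and \<psi>: "\<psi> \<in> borel_measurable \<alpha>" "\<And>x. x \<in> \<Omega> \<Longrightarrow> \<bar>\<psi> x\<bar> \<le> B"
  shows "(LINT x|\<alpha>. \<psi> x) = (LINT x|\<rho>. \<psi> x * g x) + (LINT x|s. \<psi> x)"
proof -
  interpret \<alpha>: finite_measure \<alpha> by (rule pos_measuresD[OF \<alpha>])
  have s: "s \<in> pos_measures \<Omega>" and g: "integrable \<rho> g"
    and eq: "\<And>A. A \<in> sets (borel_on \<Omega>) \<Longrightarrow> measure \<alpha> A = (LINT x:A|\<rho>. g x) + measure s A"
    using dec by (auto simp: lebesgue_decomposition_def)
  interpret s: finite_measure s by (rule pos_measuresD[OF s])
  note sp = pos_measuresD(3)[OF \<alpha>] pos_measuresD(3)[OF s]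
  have ms: "f \<in> borel_measurable s \<longleftrightarrow> f \<in> borel_measurable \<alpha>" for f :: "'a \<Rightarrow> real"
    using pos_measuresD(2)[OF \<alpha>] pos_measuresD(2)[OF s] by (simp cong: measurable_cong_sets)
  have i\<alpha>: "integrable \<alpha> f" if "f \<in> borel_measurable \<alpha>" "\<And>x. x \<in> \<Omega> \<Longrightarrow> \<bar>f x\<bar> \<le> B" for f :: "'a \<Rightarrow> real" and B
    using that sp by (intro \<alpha>.integrable_const_bound[where B = B] AE_I2) auto
  have ist: "integrable s f" if "f \<in> borel_measurable \<alpha>" "\<And>x. x \<in> \<Omega> \<Longrightarrow> \<bar>f x\<bar> \<le> B" for f :: "'a \<Rightarrow> real" and B
    using that sp ms by (intro s.integrable_const_bound[where B = B] AE_I2) auto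
  have i\<rho>: "integrable \<rho> (\<lambda>x. f x * g x)" if "f \<in> borel_measurable \<alpha>" "\<And>x. x \<in> \<Omega> \<Longrightarrow> \<bar>f x\<bar> \<le> B" for f B
    using integrable_mult_bounded[OF g \<rho>(2)[OF that(1)], of B] that(2) \<rho>(1) by simp
  let ?L = "\<lambda>f. (LINT x|\<alpha>. f x) - ((LINT x|\<rho>. f x * g x) + (LINT x|s. f x))"
  have "(\<lambda>n::nat. ?L \<psi>) \<longlonglongrightarrow> 0"
  proof (rule bounded_functionals_tendsto_0[where M = \<alpha> and L = "\<lambda>n. ?L" and C = "measure \<alpha> \<Omega> + ((LINT x|\<rho>. \<bar>g x\<bar>) + measure s \<Omega>)"])
    fix n :: nat and u v :: "'a \<Rightarrow> real" and B
    assume u: "u \<in> borel_measurable \<alpha>" and v: "v \<in> borel_measurable \<alpha>"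
      and uB: "\<And>x. x \<in> space \<alpha> \<Longrightarrow> \<bar>u x\<bar> \<le> B" and vB: "\<And>x. x \<in> space \<alpha> \<Longrightarrow> \<bar>v x\<bar> \<le> B"
    note i = i\<alpha>[OF u uB[unfolded sp]] i\<alpha>[OF v vB[unfolded sp]] ist[OF u uB[unfolded sp]] ist[OF v vB[unfolded sp]]
      i\<rho>[OF u uB[unfolded sp]] i\<rho>[OF v vB[unfolded sp]]
    have "(LINT x|\<alpha>. u x + v x) = (LINT x|\<alpha>. u x) + (LINT x|\<alpha>. v x)"
      using i by (intro Bochner_Integration.integral_add)
    moreover have "(LINT x|s. u x + v x) = (LINT x|s. u x) + (LINT x|s. v x)"
      using i by (intro Bochner_Integration.integral_add)
    moreover have "(LINT x|\<rho>. (u x + v x) * g x) = (LINT x|\<rho>. u x * g x) + (LINT x|\<rho>. v x * g x)"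
      unfolding distrib_right using i by (intro Bochner_Integration.integral_add)
    ultimately show "?L (\<lambda>x. u x + v x) = ?L u + ?L v" by linarith
  next
    fix n :: nat and c A assume "A \<in> sets \<alpha>"
    show "?L (\<lambda>x. c * indicator A x) = c * ?L (indicator A)"
      by (simp add: mult.assoc algebra_simps)
  next
    fix n :: nat and u :: "'a \<Rightarrow> real" and B assume u: "u \<in> borel_measurable \<alpha>" "0 \<le> B" "\<And>x. x \<in> space \<alpha> \<Longrightarrow> \<bar>u x\<bar> \<le> B"
    note uB = u(3)[unfolded sp]
    have "norm (LINT x|\<alpha>. u x) \<le> (LINT x|\<alpha>. B)"
      using uB sp by (intro lebesgue_integral_norm_le i\<alpha>[OF u(1) uB]) auto
    moreover have "norm (LINT x|s. u x) \<le> (LINT x|s. B)"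
      using uB sp by (intro lebesgue_integral_norm_le ist[OF u(1) uB]) auto
    moreover have "\<bar>LINT x|\<rho>. u x * g x\<bar> \<le> B * (LINT x|\<rho>. \<bar>g x\<bar>)"
      using u(3) sp \<rho>(1) by (intro integral_mult_bounded_le[OF g \<rho>(2)[OF u(1)]]) auto
    ultimately show "\<bar>?L u\<bar> \<le> (measure \<alpha> \<Omega> + ((LINT x|\<rho>. \<bar>g x\<bar>) + measure s \<Omega>)) * B"
      using sp by (simp add: algebra_simps abs_le_iff)
  next
    fix A assume A: "A \<in> sets \<alpha>"
    then have "A \<in> sets (borel_on \<Omega>)" "A \<subseteq> \<Omega>" "A \<in> sets s"
      using pos_measuresD(2)[OF \<alpha>] pos_measuresD(2)[OF s] sets.sets_into_space[OF A] sp by auto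
    then have "?L (indicator A) = 0"
      using eq[of A] sp A by (simp add: set_lebesgue_integral_def Int_absorb2)
    then show "(\<lambda>n::nat. ?L (indicator A)) \<longlonglongrightarrow> 0" by simp
  next
    show "\<bar>\<psi> x\<bar> \<le> B" if "x \<in> space \<alpha>" for x using that \<psi>(2) sp by simp
  qed (rule \<psi>(1))
  then show ?thesis by (simp add: LIMSEQ_const_iff)
qed

text \<open>The complement of the support is a possibly uncountable union of open null sets; by the
  Lindeloef property countably many of them have the same union.\<close>

lemma AE_measure_support:
  fixes \<nu> :: "'a::second_countable_topology measure"
  assumes \<Omega>: "open \<Omega>" and \<nu>: "\<nu> \<in> pos_measures \<Omega>"
  shows "AE x in \<nu>. x \<in> measure_support \<Omega> \<nu>"
proof -
  let ?\<F> = "{\<Omega> - C |C. closedin (top_of_set \<Omega>) C \<and> emeasure \<nu> (\<Omega> - C) = 0}"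
  have op: "open U" if U: "U \<in> ?\<F>" for U
  proof -
    obtain C where C: "U = \<Omega> - C" "closedin (top_of_set \<Omega>) C" using U by blast
    then have "openin (top_of_set \<Omega>) U" by (metis openin_diff openin_subtopology_self topspace_euclidean_subtopology)
    then show ?thesis using \<Omega> openin_open_trans by blast
  qed
  obtain \<F>' where F': "\<F>' \<subseteq> ?\<F>" "countable \<F>'" "\<Union>\<F>' = \<Union>?\<F>"
    using Lindelof[of ?\<F>, OF op] .
  have "(\<Union>U\<in>\<F>'. U) \<in> null_sets \<nu>"
  proof (rule null_sets_UN'[OF F'(2)])
    fix U assume "U \<in> \<F>'"
    then have U: "U \<in> ?\<F>" using F'(1) by blast
    then have "U \<subseteq> \<Omega>" "emeasure \<nu> U = 0" by auto
    moreover have "U \<in> sets \<nu>"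
      using op[OF U] \<open>U \<subseteq> \<Omega>\<close> \<Omega> pos_measuresD(2)[OF \<nu>] by (simp add: sets_restrict_space_iff)
    ultimately show "U \<in> null_sets \<nu>" by (simp add: null_sets_def)
  qed
  then have "AE x in \<nu>. x \<notin> (\<Union>U\<in>\<F>'. U)" by (rule AE_not_in)
  then have "AE x in \<nu>. x \<notin> \<Union>?\<F>" unfolding F'(3)[symmetric] by simp
  then show ?thesis
  proof (rule AE_mp, intro AE_I2 impI)
    fix x assume "x \<in> space \<nu>" "x \<notin> \<Union>?\<F>"
    then show "x \<in> measure_support \<Omega> \<nu>"
      using pos_measuresD(3)[OF \<nu>] unfolding measure_support_def by blast
  qed
qed

text \<open>\<open>Lp_norm\<close> may be infinite for finitely many n, so membership in L^p is part
  of the eventual conclusion.\<close>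

lemma Lp_norm_tendsto_0_iff_integral:
  assumes p: "0 < p" and v: "\<And>n. v n \<in> borel_measurable (lebesgue_on \<Omega>)" and lim: "(\<lambda>n. Lp_norm \<Omega> p (v n)) \<longlonglongrightarrow> 0"
    and "0 < e"
  shows "\<forall>\<^sub>F n in sequentially. v n \<in> Lp_space \<Omega> p \<and> (LINT x|lebesgue_on \<Omega>. \<bar>v n x\<bar> powr p) < e"
proof -
  have "0 < ennreal (e powr (1 / p))" using \<open>0 < e\<close> by simp
  then have "\<forall>\<^sub>F n in sequentially. Lp_norm \<Omega> p (v n) < ennreal (e powr (1 / p))"
    using lim by (rule order_tendstoD(2)[rotated])
  then show ?thesis
  proof (rule eventually_mono)
    fix n assume less: "Lp_norm \<Omega> p (v n) < ennreal (e powr (1 / p))"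
    let ?I = "\<integral>\<^sup>+x. ennreal (\<bar>v n x\<bar> powr p) \<partial>lebesgue_on \<Omega>"
    have fin: "?I \<noteq> \<infinity>" using less by (auto simp: Lp_norm_def Let_def)
    have m: "(\<lambda>x. \<bar>v n x\<bar> powr p) \<in> borel_measurable (lebesgue_on \<Omega>)" using v[of n] by measurable
    have i: "integrable (lebesgue_on \<Omega>) (\<lambda>x. \<bar>v n x\<bar> powr p)"
      using fin m by (intro integrableI_nonneg) (auto simp: less_top)
    have "enn2real ?I powr (1 / p) < e powr (1 / p)"
      using less fin by (simp add: Lp_norm_def Let_def ennreal_less_iff)
    then have "enn2real ?I < e"
      using p powr_mono2[of "1 / p" e "enn2real ?I"] \<open>0 < e\<close> by fastforce
    then have "(LINT x|lebesgue_on \<Omega>. \<bar>v n x\<bar> powr p) < e"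
      using m by (subst integral_eq_nn_integral) auto
    then show "v n \<in> Lp_space \<Omega> p \<and> (LINT x|lebesgue_on \<Omega>. \<bar>v n x\<bar> powr p) < e"
      using v i by (simp add: Lp_space_def)
  qed
qed

text \<open>For \<open>l \<rightarrow> 0\<close> this replaces Minkowski's inequality in the strong convergence of the divergences.\<close>

lemma powr_add_convex:
  fixes a b l p :: real
  assumes p: "1 < p" and l: "0 < l" "l < 1"
  shows "\<bar>a + b\<bar> powr p \<le> (1 - l) powr (1 - p) * \<bar>a\<bar> powr p + l powr (1 - p) * \<bar>b\<bar> powr p"
proof -
  \<comment> \<open>The sum a + b is the combination of a / (1 - l) and b / l with weights 1 - l and
    l. The tangent inequalities at a + b, added with these weights, lose their linear terms.\<close>
  let ?z = "a + b" and ?x = "a / (1 - l)" and ?y = "b / l"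
  let ?c = "p * (sgn ?z * \<bar>?z\<bar> powr (p - 1))"
  have 1: "(1 - l) * (\<bar>?z\<bar> powr p + ?c * (?x - ?z)) + l * (\<bar>?z\<bar> powr p + ?c * (?y - ?z))
      \<le> (1 - l) * \<bar>?x\<bar> powr p + l * \<bar>?y\<bar> powr p"
    using l by (intro add_mono mult_left_mono powr_tangent[OF p]) auto
  have 2: "(1 - l) * (\<bar>?z\<bar> powr p + ?c * (?x - ?z)) + l * (\<bar>?z\<bar> powr p + ?c * (?y - ?z)) = \<bar>?z\<bar> powr p"
  proof -
    have e: "(1 - l) * (Z + c * (X - z)) + l * (Z + c * (Y - z)) = Z + c * ((1 - l) * X + l * Y - z)" for Z c X Y z :: real
      by (simp add: algebra_simps)
    have "(1 - l) * ?x + l * ?y - ?z = 0" using l by simp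
    then show ?thesis unfolding e by simp
  qed
  have 3: "w * \<bar>v / w\<bar> powr p = w powr (1 - p) * \<bar>v\<bar> powr p" if "0 < w" for v w :: real
    using that by (simp add: abs_divide powr_divide powr_diff)
  have "0 < 1 - l" using l by simp
  then show ?thesis using 1[unfolded 2 3[OF \<open>0 < 1 - l\<close>] 3[OF l(1)]] by blast
qed

lemma pos_measurable_lebesgue_on:
  fixes f :: "'a::euclidean_space \<Rightarrow> 'b::topological_space"
  assumes \<Omega>: "open \<Omega>" and \<alpha>: "\<alpha> \<in> pos_measures \<Omega>" and f: "f \<in> borel_measurable \<alpha>"
  shows "f \<in> borel_measurable (lebesgue_on \<Omega>)"
proof -
  have "f \<in> borel_measurable (borel_on \<Omega>)"
    using f pos_measuresD(2)[OF \<alpha>] by (simp cong: measurable_cong_sets)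
  moreover have "sets (borel_on \<Omega>) \<subseteq> sets (lebesgue_on \<Omega>)"
    unfolding sets_restrict_space by (intro image_mono) auto
  ultimately show ?thesis
    using measurable_mono[of borel borel "borel_on \<Omega>" "lebesgue_on \<Omega>"] by (auto simp: space_restrict_space)
qed

text \<open>The flux \<open>g \<sigma>\<close> is feasible for \<open>\<alpha>n = g \<alpha> + \<alpha>ns\<close>: its density with respect to \<open>\<alpha>n\<close> is the density of
  \<open>\<sigma>\<close> cut off to a set where \<open>\<alpha>ns\<close> vanishes.\<close>

lemma recovery_flux:
  fixes \<Omega> \<Gamma> :: "(real^'n) set" and t :: "real^'n \<Rightarrow> real^'n" and g F k \<beta> :: "real^'n \<Rightarrow> real"
  assumes \<Omega>: "open \<Omega>" and p: "1 < p" and \<alpha>: "\<alpha> \<in> pos_measures \<Omega>" and \<alpha>n: "\<alpha>n \<in> pos_measures \<Omega>"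
    and dec: "lebesgue_decomposition \<Omega> \<alpha>n \<alpha> g \<alpha>ns" and g: "g \<in> Cb1_bar \<Omega>"
    and decL: "lebesgue_decomposition \<Omega> \<alpha> (lebesgue_on \<Omega>) F \<alpha>s"
    and gz: "\<And>x. x \<in> measure_support \<Omega> \<alpha>s \<Longrightarrow> grad g x = 0"
    and t: "t \<in> borel_measurable \<alpha>" "\<And>x. norm (t x) \<le> 1" and fd: "flux_div \<Omega> \<Gamma> p \<alpha> t k"
    and v: "(\<lambda>x. norm (grad g x) * F x) \<in> Lp_space \<Omega> p"
    and \<beta>: "\<beta> \<in> borel_measurable \<alpha>" "\<And>x. x \<in> \<Omega> \<Longrightarrow> \<bar>\<beta> x\<bar> \<le> D"
  obtains t' \<kappa> where "t' \<in> borel_measurable \<alpha>n" "\<And>x. norm (t' x) \<le> 1" "\<kappa> \<in> Lp_space \<Omega> p"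
    "\<And>x. \<bar>\<kappa> x\<bar> \<le> \<bar>norm (grad g x) * F x\<bar>" "flux_div \<Omega> \<Gamma> p \<alpha>n t' (\<lambda>x. g x * k x + \<kappa> x)"
    "(LINT x|\<alpha>n. \<beta> x * norm (t' x)) = (LINT x|\<alpha>. \<beta> x * norm (t x) * g x)"
proof -
  interpret \<alpha>: finite_measure \<alpha> by (rule pos_measuresD[OF \<alpha>])
  have \<alpha>ns: "\<alpha>ns \<in> pos_measures \<Omega>" using dec by (simp add: lebesgue_decomposition_def)
  have \<alpha>s: "\<alpha>s \<in> pos_measures \<Omega>" using decL by (simp add: lebesgue_decomposition_def)
  interpret \<alpha>s: finite_measure \<alpha>s by (rule pos_measuresD[OF \<alpha>s])
  note sp = pos_measuresD(3)[OF \<alpha>]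
  have sets_n: "sets \<alpha>n = sets \<alpha>" "sets \<alpha>ns = sets \<alpha>" "sets \<alpha>s = sets \<alpha>"
    using pos_measuresD(2)[OF \<alpha>] pos_measuresD(2)[OF \<alpha>n] pos_measuresD(2)[OF \<alpha>ns] pos_measuresD(2)[OF \<alpha>s] by simp_all
  \<comment> \<open>S carries all of \<alpha> and none of the singular part of
    \<open>\<alpha>n\<close>.\<close>
  obtain S where S: "S \<in> sets \<alpha>ns" "S \<in> sets \<alpha>" "emeasure \<alpha>ns S = 0" "emeasure \<alpha> (space \<alpha> - S) = 0"
    using dec by (auto simp: lebesgue_decomposition_def mutually_singular_def)
  have aeS: "AE x in \<alpha>. x \<in> S"
  proof -
    have "AE x in \<alpha>. x \<notin> space \<alpha> - S" using S by (intro AE_not_in) (simp add: null_sets_def)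
    then show ?thesis by (rule AE_mp) (auto intro!: AE_I2)
  qed
  have aeN: "AE x in \<alpha>ns. x \<notin> S" using S by (intro AE_not_in) (simp add: null_sets_def)
  have gC: "Ck_on 1 \<Omega> g" using g by (simp add: Cb1_bar_def Cb1_def)
  have g\<alpha>: "g \<in> borel_measurable \<alpha>" by (rule continuous_borel_measurable_pos[OF \<alpha> Ck_on_continuous[OF gC]])
  have gg\<alpha>: "grad g \<in> borel_measurable \<alpha>"
    using gC unfolding Ck_on_1_iff by (intro continuous_borel_measurable_pos[OF \<alpha>]) auto
  obtain G where G: "\<And>x. x \<in> \<Omega> \<Longrightarrow> \<bar>g x\<bar> \<le> G" "\<And>x. x \<in> \<Omega> \<Longrightarrow> norm (grad g x) \<le> G"
    using Cb1_bar_bounds[OF g] by blast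
  \<comment> \<open>Restricted to S, the measure \<open>\<alpha>n\<close> is g \<alpha>, so
    integrals of a flux cut off to S become integrals against \<alpha> with factor g.\<close>
  have cut: "(LINT x|\<alpha>n. indicat_real S x * \<psi> x) = (LINT x|\<alpha>. \<psi> x * g x)"
    if \<psi>: "\<psi> \<in> borel_measurable \<alpha>" "\<And>x. x \<in> \<Omega> \<Longrightarrow> \<bar>\<psi> x\<bar> \<le> B" for \<psi> B
  proof -
    have m: "(\<lambda>x. indicat_real S x * \<psi> x) \<in> borel_measurable \<alpha>" using \<psi>(1) S(2) by measurable
    have "(LINT x|\<alpha>n. indicat_real S x * \<psi> x) = (LINT x|\<alpha>. indicat_real S x * \<psi> x * g x) + (LINT x|\<alpha>ns. indicat_real S x * \<psi> x)"
    proof (rule lebesgue_decomposition_integral[OF \<alpha>n dec sp, of "\<lambda>x. indicat_real S x * \<psi> x" "\<bar>B\<bar>"])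
      show "\<bar>indicat_real S x * \<psi> x\<bar> \<le> \<bar>B\<bar>" if "x \<in> \<Omega>" for x
        using \<psi>(2)[OF that] by (auto simp: indicator_def)
    qed (use m sets_n in \<open>auto cong: measurable_cong_sets\<close>)
    also have "(LINT x|\<alpha>ns. indicat_real S x * \<psi> x) = (LINT x|\<alpha>ns. 0)"
      using aeN m sets_n by (intro integral_cong_AE) (auto cong: measurable_cong_sets)
    also have "(LINT x|\<alpha>. indicat_real S x * \<psi> x * g x) = (LINT x|\<alpha>. \<psi> x * g x)"
      using aeS m \<psi>(1) g\<alpha> by (intro integral_cong_AE) auto
    finally show ?thesis by simp
  qed
  define t' where "t' x = indicat_real S x *\<^sub>R t x" for x
  \<comment> \<open>The Lebesgue density of the measure obtained from pairing \<sigma> with the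
    gradient of g; it is the new term that the product rule creates in the divergence.\<close>
  define \<kappa> where "\<kappa> x = (t x \<bullet> grad g x) * F x" for x
  have tg: "\<bar>t x \<bullet> w\<bar> \<le> norm w" for x w
    using Cauchy_Schwarz_ineq2[of "t x" w] mult_right_mono[OF t(2)[of x] norm_ge_zero[of w]] by auto
  have \<kappa>le: "\<bar>\<kappa> x\<bar> \<le> \<bar>norm (grad g x) * F x\<bar>" for x
    unfolding \<kappa>_def abs_mult abs_norm_cancel by (intro mult_right_mono tg) auto
  have Fm: "F \<in> borel_measurable (lebesgue_on \<Omega>)"
    using decL by (auto simp: lebesgue_decomposition_def)
  have \<kappa>m: "\<kappa> \<in> borel_measurable (lebesgue_on \<Omega>)"
    unfolding \<kappa>_def[abs_def] using t(1) gg\<alpha>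
    by (intro borel_measurable_times Fm pos_measurable_lebesgue_on[OF \<Omega> \<alpha>] borel_measurable_inner)
  have \<kappa>L: "\<kappa> \<in> Lp_space \<Omega> p"
    unfolding Lp_space_def
  proof (intro CollectI conjI \<kappa>m, rule Bochner_Integration.integrable_bound)
    show "integrable (lebesgue_on \<Omega>) (\<lambda>x. \<bar>norm (grad g x) * F x\<bar> powr p)" using v by (simp add: Lp_space_def)
    show "(\<lambda>x. \<bar>\<kappa> x\<bar> powr p) \<in> borel_measurable (lebesgue_on \<Omega>)" using \<kappa>m by measurable
    show "AE x in lebesgue_on \<Omega>. norm (\<bar>\<kappa> x\<bar> powr p) \<le> norm (\<bar>norm (grad g x) * F x\<bar> powr p)"
      using p \<kappa>le by (intro AE_I2) (simp add: powr_mono2)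
  qed
  have kL: "k \<in> Lp_space \<Omega> p" using fd by (simp add: flux_div_def)
  have gkL: "(\<lambda>x. g x * k x) \<in> Lp_space \<Omega> p"
    using p by (intro Lp_space_bounded_mult[OF _ kL pos_measurable_lebesgue_on[OF \<Omega> \<alpha> g\<alpha>] G(1)]) auto
  have "flux_div \<Omega> \<Gamma> p \<alpha>n t' (\<lambda>x. g x * k x + \<kappa> x)"
    unfolding flux_div_def
  proof (intro conjI ballI Lp_space_add[OF p gkL \<kappa>L])
    fix \<phi> assume \<phi>: "\<phi> \<in> flux_test \<Omega> \<Gamma>"
    obtain B R where B: "Ck_on 1 \<Omega> \<phi>" "\<And>x. x \<in> \<Omega> \<Longrightarrow> \<bar>\<phi> x\<bar> \<le> B" "\<And>x. x \<in> \<Omega> \<Longrightarrow> norm (grad \<phi> x) \<le> B"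
      "\<And>x. x \<in> \<Omega> \<Longrightarrow> R < norm x \<Longrightarrow> \<phi> x = 0"
      using flux_testD[OF \<Omega> \<phi>] by blast
    have g\<phi>m: "grad \<phi> \<in> borel_measurable \<alpha>"
      using B(1) unfolding Ck_on_1_iff by (intro continuous_borel_measurable_pos[OF \<alpha>]) auto
    have \<phi>m: "\<phi> \<in> borel_measurable \<alpha>" by (rule continuous_borel_measurable_pos[OF \<alpha> Ck_on_continuous[OF B(1)]])
    have \<phi>mL: "\<phi> \<in> borel_measurable (lebesgue_on \<Omega>)" by (rule pos_measurable_lebesgue_on[OF \<Omega> \<alpha> \<phi>m])
    have i\<phi>: "integrable (lebesgue_on \<Omega>) (\<lambda>x. \<phi> x * u x)" if "u \<in> Lp_space \<Omega> p" for u
      using integrable_Lp_times_bounded_support(2)[OF p that \<Omega> \<phi>mL, of B R] B(2,4) by blast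
    have m1: "(\<lambda>x. t x \<bullet> grad \<phi> x) \<in> borel_measurable \<alpha>" and m2: "(\<lambda>x. \<phi> x * (t x \<bullet> grad g x)) \<in> borel_measurable \<alpha>"
      using t(1) g\<phi>m gg\<alpha> \<phi>m by auto
    have b1: "\<bar>t x \<bullet> grad \<phi> x\<bar> \<le> B" if "x \<in> \<Omega>" for x
      using tg[of x "grad \<phi> x"] B(3)[OF that] by linarith
    have b2: "\<bar>\<phi> x * (t x \<bullet> grad g x)\<bar> \<le> B * G" if "x \<in> \<Omega>" for x
      unfolding abs_mult using B(2)[OF that] tg[of x "grad g x"] G(2)[OF that] by (intro mult_mono) auto
    have "(LINT x|\<alpha>n. t' x \<bullet> grad \<phi> x) = (LINT x|\<alpha>n. indicat_real S x * (t x \<bullet> grad \<phi> x))"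
      by (simp add: t'_def)
    also have "\<dots> = (LINT x|\<alpha>. (t x \<bullet> grad \<phi> x) * g x)"
      using m1 b1 by (rule cut)
    finally have 1: "(LINT x|\<alpha>n. t' x \<bullet> grad \<phi> x) = (LINT x|\<alpha>. (t x \<bullet> grad \<phi> x) * g x)" .
    \<comment> \<open>The decomposition of \<alpha> with respect to Lebesgue measure turns this
      integral into one over \<Omega>; its singular part vanishes because the gradient of g is zero
      on the support.\<close>
    have "(LINT x|\<alpha>. \<phi> x * (t x \<bullet> grad g x)) = (LINT x|lebesgue_on \<Omega>. \<phi> x * (t x \<bullet> grad g x) * F x) + (LINT x|\<alpha>s. \<phi> x * (t x \<bullet> grad g x))"
      using pos_measurable_lebesgue_on[OF \<Omega> \<alpha>] m2 b2
      by (intro lebesgue_decomposition_integral[OF \<alpha> decL]) (auto simp: space_restrict_space)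
    also have "(LINT x|\<alpha>s. \<phi> x * (t x \<bullet> grad g x)) = (LINT x|\<alpha>s. 0)"
    proof (rule integral_cong_AE)
      show "AE x in \<alpha>s. \<phi> x * (t x \<bullet> grad g x) = 0"
        using AE_measure_support[OF \<Omega> \<alpha>s] by (rule AE_mp) (auto intro!: AE_I2 simp: gz)
    qed (use m2 sets_n in \<open>auto cong: measurable_cong_sets\<close>)
    finally have 2: "(LINT x|\<alpha>. \<phi> x * (t x \<bullet> grad g x)) = (LINT x|lebesgue_on \<Omega>. \<phi> x * \<kappa> x)"
      by (simp add: \<kappa>_def mult.assoc)
    have i1: "integrable \<alpha> (\<lambda>x. (t x \<bullet> grad \<phi> x) * g x)"
    proof (rule \<alpha>.integrable_const_bound[where B = "B * G"])
      show "AE x in \<alpha>. norm ((t x \<bullet> grad \<phi> x) * g x) \<le> B * G"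
      proof (rule AE_I2)
        fix x assume "x \<in> space \<alpha>"
        then have "x \<in> \<Omega>" using sp by simp
        then show "norm ((t x \<bullet> grad \<phi> x) * g x) \<le> B * G"
          unfolding real_norm_def abs_mult using b1[of x] G(1)[of x] by (intro mult_mono) auto
      qed
    qed (use m1 g\<alpha> in auto)
    have i2: "integrable \<alpha> (\<lambda>x. \<phi> x * (t x \<bullet> grad g x))"
      using b2 m2 sp by (intro \<alpha>.integrable_const_bound[where B = "B * G"] AE_I2) auto
    \<comment> \<open>Feasibility of t is used with the test \<phi> g; the product rule then splits
      off the term with \<kappa>.\<close>
    have "(LINT x|\<alpha>. t x \<bullet> grad (\<lambda>x. \<phi> x * g x) x) + (LINT x|lebesgue_on \<Omega>. \<phi> x * g x * k x) = 0"
      using fd flux_test_mult[OF \<Omega> \<phi> g] by (simp add: flux_div_def)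
    moreover have "(LINT x|\<alpha>. t x \<bullet> grad (\<lambda>x. \<phi> x * g x) x) = (LINT x|\<alpha>. (t x \<bullet> grad \<phi> x) * g x + \<phi> x * (t x \<bullet> grad g x))"
    proof (rule Bochner_Integration.integral_cong[OF refl])
      fix x assume "x \<in> space \<alpha>"
      then have "grad (\<lambda>x. \<phi> x * g x) x = \<phi> x *\<^sub>R grad g x + g x *\<^sub>R grad \<phi> x"
        using B(1) gC sp by (intro grad_mult) auto
      then show "t x \<bullet> grad (\<lambda>x. \<phi> x * g x) x = (t x \<bullet> grad \<phi> x) * g x + \<phi> x * (t x \<bullet> grad g x)"
        by (simp add: inner_add_right)
    qed
    moreover have "\<dots> = (LINT x|\<alpha>. (t x \<bullet> grad \<phi> x) * g x) + (LINT x|\<alpha>. \<phi> x * (t x \<bullet> grad g x))"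
      using i1 i2 by (rule Bochner_Integration.integral_add)
    moreover have "(LINT x|lebesgue_on \<Omega>. \<phi> x * (g x * k x + \<kappa> x)) = (LINT x|lebesgue_on \<Omega>. \<phi> x * g x * k x) + (LINT x|lebesgue_on \<Omega>. \<phi> x * \<kappa> x)"
      using i\<phi>[OF gkL] i\<phi>[OF \<kappa>L] by (simp add: distrib_left mult.assoc)
    ultimately show "(LINT x|\<alpha>n. t' x \<bullet> grad \<phi> x) + (LINT x|lebesgue_on \<Omega>. \<phi> x * (g x * k x + \<kappa> x)) = 0"
      using 1 2 by linarith
  qed
  moreover have "(LINT x|\<alpha>n. \<beta> x * norm (t' x)) = (LINT x|\<alpha>. \<beta> x * norm (t x) * g x)"
  proof -
    have "(LINT x|\<alpha>n. \<beta> x * norm (t' x)) = (LINT x|\<alpha>n. indicat_real S x * (\<beta> x * norm (t x)))"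
      by (simp add: t'_def ac_simps)
    also have "\<dots> = (LINT x|\<alpha>. \<beta> x * norm (t x) * g x)"
    proof (rule cut)
      show "(\<lambda>x. \<beta> x * norm (t x)) \<in> borel_measurable \<alpha>" using \<beta>(1) t(1) by measurable
      show "\<bar>\<beta> x * norm (t x)\<bar> \<le> D * 1" if "x \<in> \<Omega>" for x
        unfolding abs_mult abs_norm_cancel using \<beta>(2)[OF that] t(2)[of x] by (intro mult_mono) auto
    qed
    finally show ?thesis .
  qed
  moreover have "t' \<in> borel_measurable \<alpha>n"
  proof -
    have "t' \<in> borel_measurable \<alpha>" unfolding t'_def[abs_def] using t(1) S(2) by measurable
    then show ?thesis using sets_n by (simp cong: measurable_cong_sets)
  qed
  moreover have "norm (t' x) \<le> 1" for x using t(2)[of x] by (simp add: t'_def indicator_def)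
  ultimately show thesis using \<kappa>L \<kappa>le by (intro that[of t' \<kappa>])
qed

text \<open>The partition with \<Omega> as its only nonempty piece is admissible in the
  variation.\<close>

lemma measure_le_vm_norm:
  assumes "s \<in> pos_measures \<Omega>"
  shows "ennreal (measure s \<Omega>) \<le> vm_norm \<Omega> (measure s)"
proof -
  interpret finite_measure s by (rule pos_measuresD[OF assms])
  note sets = pos_measuresD(2)[OF assms]
  have v: "measure s \<in> vec_measures \<Omega>"
    unfolding vec_measures_def using sets by (auto intro: finite_measure_UNION)
  have \<Omega>: "\<Omega> \<in> sets (borel_on \<Omega>)"
    using sets.top[of s] sets pos_measuresD(3)[OF assms] by simp
  let ?P = "\<lambda>i::nat. if i = 0 then \<Omega> else {}"
  have "(\<Sum>i. ennreal (norm (measure s (?P i)))) \<le> variation \<Omega> (measure s) \<Omega>"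
    using \<Omega> by (intro variation_ge) (auto simp: disjoint_family_on_def)
  moreover have "(\<Sum>i. ennreal (norm (measure s (?P i)))) = (\<Sum>i\<in>{0}. ennreal (norm (measure s (?P i))))"
    by (intro suminf_finite) auto
  ultimately show ?thesis
    using emeasure_tot_var[OF v \<Omega>] by (simp add: vm_norm_def)
qed

theorem theorem5p2:
  fixes \<Omega> \<Gamma> :: "(real^'n) set" and p :: real
    and f \<beta> F :: "real^'n \<Rightarrow> real" and g :: "nat \<Rightarrow> real^'n \<Rightarrow> real"
    and \<alpha> \<alpha>s :: "(real^'n) measure" and \<alpha>n \<alpha>ns :: "nat \<Rightarrow> (real^'n) measure"
  assumes "open \<Omega>" and "1 < p" and "f \<in> Lp_space \<Omega> p"
    and "\<forall>x\<in>\<Omega>. 0 \<le> \<beta> x" and "continuous_on \<Omega> \<beta>" and "bounded (\<beta> ` \<Omega>)"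
    and "frontier \<Omega> \<noteq> {}" and "\<Gamma> \<subseteq> frontier \<Omega>"
    and "\<forall>n. \<alpha>n n \<in> pos_measures \<Omega>" and "\<alpha> \<in> pos_measures \<Omega>"
    and "(\<lambda>n. vm_norm \<Omega> (\<lambda>A. measure (\<alpha>n n) A - measure \<alpha> A)) \<longlonglongrightarrow> 0"
    and "\<forall>n. lebesgue_decomposition \<Omega> (\<alpha>n n) \<alpha> (g n) (\<alpha>ns n)"
    and "(\<lambda>n. vm_norm \<Omega> (measure (\<alpha>ns n))) \<longlonglongrightarrow> 0"
    and "\<forall>n. g n \<in> Cb1_bar \<Omega>"
    and "\<forall>n. integrable \<alpha> (grad (g n))"
    and "(\<lambda>n. SUP x\<in>\<Omega>. \<bar>g n x - 1\<bar>) \<longlonglongrightarrow> 0"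
    and "lebesgue_decomposition \<Omega> \<alpha> (lebesgue_on \<Omega>) F \<alpha>s"
    and "\<forall>n. \<forall>x\<in>measure_support \<Omega> \<alpha>s. grad (g n) x = 0"
    and "(\<lambda>n. Lp_norm \<Omega> p (\<lambda>x. norm (grad (g n) x) * F x)) \<longlonglongrightarrow> 0"
  shows "\<exists>\<mu>. (\<forall>n. solves \<Omega> p \<Gamma> f \<beta> (\<alpha>n n) (\<mu> n)) \<and>
    (\<exists>(r::nat \<Rightarrow> nat) \<mu>star. strict_mono r \<and>
       \<mu>star \<in> Kdiv \<Omega> p \<Gamma> \<alpha> \<and> solves \<Omega> p \<Gamma> f \<beta> \<alpha> \<mu>star \<and>
       narrowly_converges \<Omega> (\<lambda>n. \<mu> (r n)) \<mu>star \<and>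
       weakly_converges_Lp \<Omega> p (\<lambda>n. vdiv \<Omega> p (\<mu> (r n))) (vdiv \<Omega> p \<mu>star))"
proof -
  note \<Omega> = \<open>open \<Omega>\<close> and p = \<open>1 < p\<close> and f = \<open>f \<in> Lp_space \<Omega> p\<close> and \<alpha> = \<open>\<alpha> \<in> pos_measures \<Omega>\<close>
  note \<beta> = \<open>\<forall>x\<in>\<Omega>. 0 \<le> \<beta> x\<close> \<open>continuous_on \<Omega> \<beta>\<close> \<open>bounded (\<beta> ` \<Omega>)\<close>
  note decL = \<open>lebesgue_decomposition \<Omega> \<alpha> (lebesgue_on \<Omega>) F \<alpha>s\<close>
  have \<alpha>n: "\<alpha>n n \<in> pos_measures \<Omega>" for n using assms by blast
  have dec: "lebesgue_decomposition \<Omega> (\<alpha>n n) \<alpha> (g n) (\<alpha>ns n)" for n using assms by blast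
  have g: "g n \<in> Cb1_bar \<Omega>" for n using assms by blast
  have gz: "grad (g n) x = 0" if "x \<in> measure_support \<Omega> \<alpha>s" for n x using assms that by blast
  have \<alpha>ns: "\<alpha>ns n \<in> pos_measures \<Omega>" for n using dec[of n] by (simp add: lebesgue_decomposition_def)
  \<comment> \<open>A set with nonempty frontier is nonempty. The point x0 witnesses that \<gamma>
    and all bounds over \<Omega> are nonnegative.\<close>
  obtain x0 where x0: "x0 \<in> \<Omega>" using \<open>frontier \<Omega> \<noteq> {}\<close> by fastforce
  interpret \<alpha>: finite_measure \<alpha> by (rule pos_measuresD[OF \<alpha>])
  note sp = pos_measuresD(3)[OF \<alpha>]
  have sets_n: "sets (\<alpha>n n) = sets \<alpha>" "sets (\<alpha>ns n) = sets \<alpha>" for n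
    using pos_measuresD(2)[OF \<alpha>] pos_measuresD(2)[OF \<alpha>n] pos_measuresD(2)[OF \<alpha>ns] by simp_all
  have mn: "\<psi> \<in> borel_measurable (\<alpha>n n) \<longleftrightarrow> \<psi> \<in> borel_measurable \<alpha>" for n and \<psi> :: "real^'n \<Rightarrow> 'c::topological_space"
    by (simp add: measurable_cong_sets[OF sets_n(1) refl])
  have mns: "\<psi> \<in> borel_measurable (\<alpha>ns n) \<longleftrightarrow> \<psi> \<in> borel_measurable \<alpha>" for n and \<psi> :: "real^'n \<Rightarrow> 'c::topological_space"
    by (simp add: measurable_cong_sets[OF sets_n(2) refl])
  have gC: "Ck_on 1 \<Omega> (g n)" for n using g[of n] by (simp add: Cb1_bar_def Cb1_def)
  have gm: "g n \<in> borel_measurable \<alpha>" for n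
    by (rule continuous_borel_measurable_pos[OF \<alpha> Ck_on_continuous[OF gC]])

  \<comment> \<open>Total variation distance between \<open>\<alpha>n n\<close> and \<alpha>\<close>
  define \<gamma> where "\<gamma> n = (SUP x\<in>\<Omega>. \<bar>g n x - 1\<bar>)" for n
  have \<gamma>: "\<bar>g n x - 1\<bar> \<le> \<gamma> n" if "x \<in> \<Omega>" for n x
  proof -
    obtain B where "\<forall>x\<in>\<Omega>. \<bar>g n x\<bar> \<le> B" using g[of n] by (auto simp: Cb1_bar_def Cb1_def bounded_iff)
    then have "bdd_above ((\<lambda>x. \<bar>g n x - 1\<bar>) ` \<Omega>)"
      by (intro bdd_aboveI2[of _ _ "B + 1"]) force
    then show ?thesis unfolding \<gamma>_def using that by (rule cSUP_upper[rotated])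
  qed
  have \<gamma>0: "\<gamma> \<longlonglongrightarrow> 0" unfolding \<gamma>_def using assms by blast
  have \<gamma>nn: "0 \<le> \<gamma> n" for n using \<gamma>[OF x0, of n] by linarith
  have ns0: "(\<lambda>n. measure (\<alpha>ns n) \<Omega>) \<longlonglongrightarrow> 0"
  proof (rule LIMSEQ_I)
    fix e :: real assume "0 < e"
    have "(\<lambda>n. vm_norm \<Omega> (measure (\<alpha>ns n))) \<longlonglongrightarrow> 0" using assms by blast
    then have "\<forall>\<^sub>F n in sequentially. vm_norm \<Omega> (measure (\<alpha>ns n)) < ennreal e"
      using \<open>0 < e\<close> by (intro order_tendstoD(2)) auto
    then obtain N where N: "\<And>n. N \<le> n \<Longrightarrow> vm_norm \<Omega> (measure (\<alpha>ns n)) < ennreal e"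
      by (auto simp: eventually_sequentially)
    have "norm (measure (\<alpha>ns n) \<Omega> - 0) < e" if "N \<le> n" for n
      using le_less_trans[OF measure_le_vm_norm[OF \<alpha>ns[of n]] N[OF that]] by (simp add: ennreal_less_iff)
    then show "\<exists>N. \<forall>n\<ge>N. norm (measure (\<alpha>ns n) \<Omega> - 0) < e" by blast
  qed
  \<comment> \<open>Read off from the Lebesgue decomposition: replacing \<open>g n\<close> by 1
    costs \<open>\<gamma> n\<close> times the mass of \<alpha>, and dropping the singular part costs
    its own mass.\<close>
  define \<delta> where "\<delta> n = \<gamma> n * measure \<alpha> \<Omega> + measure (\<alpha>ns n) \<Omega>" for n
  have \<delta>0: "\<delta> \<longlonglongrightarrow> 0"
    unfolding \<delta>_def using tendsto_add[OF tendsto_mult_left_zero[OF \<gamma>0] ns0] by simp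
  have tv: "\<bar>(LINT x|\<alpha>n n. \<psi> x) - (LINT x|\<alpha>. \<psi> x)\<bar> \<le> B * \<delta> n"
    if \<psi>: "\<psi> \<in> borel_measurable \<alpha>" "\<And>x. x \<in> \<Omega> \<Longrightarrow> \<bar>\<psi> x\<bar> \<le> B" for n \<psi> B
  proof -
    interpret ns: finite_measure "\<alpha>ns n" by (rule pos_measuresD[OF \<alpha>ns])
    note spn = pos_measuresD(3)[OF \<alpha>ns[of n]]
    have "0 \<le> B" using \<psi>(2)[OF x0] by linarith
    have eq: "(LINT x|\<alpha>n n. \<psi> x) = (LINT x|\<alpha>. \<psi> x * g n x) + (LINT x|\<alpha>ns n. \<psi> x)"
      using \<psi> sp by (intro lebesgue_decomposition_integral[OF \<alpha>n dec]) (auto simp: mn)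
    have i: "integrable \<alpha> \<psi>" using \<psi> sp by (intro \<alpha>.integrable_const_bound[where B = B] AE_I2) auto
    have ig: "integrable \<alpha> (\<lambda>x. \<psi> x * g n x)"
    proof -
      have "integrable \<alpha> (g n)" using dec[of n] by (simp add: lebesgue_decomposition_def)
      then show ?thesis using integrable_mult_bounded[of \<alpha> "g n" \<psi> B] \<psi> sp by simp
    qed
    have 1: "norm (LINT x|\<alpha>. \<psi> x * g n x - \<psi> x) \<le> (LINT x|\<alpha>. B * \<gamma> n)"
    proof (rule lebesgue_integral_norm_le)
      fix x assume "x \<in> space \<alpha>"
      then have x: "x \<in> \<Omega>" using sp by simp
      have "\<bar>\<psi> x * g n x - \<psi> x\<bar> = \<bar>\<psi> x\<bar> * \<bar>g n x - 1\<bar>" by (simp add: right_diff_distrib flip: abs_mult)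
      also have "\<dots> \<le> B * \<gamma> n" using \<psi>(2)[OF x] \<gamma>[OF x] \<open>0 \<le> B\<close> by (intro mult_mono) auto
      finally show "norm (\<psi> x * g n x - \<psi> x) \<le> B * \<gamma> n" by simp
    qed (use i ig in auto)
    have 2: "norm (LINT x|\<alpha>ns n. \<psi> x) \<le> (LINT x|\<alpha>ns n. B)"
    proof (rule lebesgue_integral_norm_le)
      show "integrable (\<alpha>ns n) \<psi>"
        using \<psi> spn by (intro ns.integrable_const_bound[where B = B] AE_I2) (auto simp: mns)
    qed (use \<psi> spn in auto)
    have "(LINT x|\<alpha>. \<psi> x * g n x - \<psi> x) = (LINT x|\<alpha>. \<psi> x * g n x) - (LINT x|\<alpha>. \<psi> x)"
      using i ig by simp
    then show ?thesis
      using 1 2 sp spn unfolding eq \<delta>_def by (simp add: algebra_simps abs_le_iff)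
  qed

  \<comment> \<open>Minimizers for \<open>\<alpha>n n\<close> and a convergent subsequence\<close>
  have "\<exists>\<mu>. \<forall>n. solves \<Omega> p \<Gamma> f \<beta> (\<alpha>n n) (\<mu> n)"
    using solution_exists[OF \<Omega> p \<alpha>n f \<beta>] by (intro choice allI)
  then obtain \<mu> where \<mu>: "\<And>n. solves \<Omega> p \<Gamma> f \<beta> (\<alpha>n n) (\<mu> n)" by blast
  have \<mu>K: "\<mu> n \<in> Kdiv \<Omega> p \<Gamma> (\<alpha>n n)"
    and \<mu>min: "\<And>\<sigma>. \<sigma> \<in> Kdiv \<Omega> p \<Gamma> (\<alpha>n n) \<Longrightarrow> objective \<Omega> p f \<beta> (\<mu> n) \<le> objective \<Omega> p f \<beta> \<sigma>" for n
    using \<mu>[of n] by (auto simp: solves_def)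
  define h where "h n = vdiv \<Omega> p (\<mu> n)" for n
  have "\<exists>s. s \<in> borel_measurable (\<alpha>n n) \<and> (\<forall>x. norm (s x) \<le> 1) \<and> has_vec_density \<Omega> (\<alpha>n n) s (\<mu> n) \<and>
      flux_div \<Omega> \<Gamma> p (\<alpha>n n) s (h n) \<and> objective \<Omega> p f \<beta> (\<mu> n) = flux_objective \<Omega> p f \<beta> (\<alpha>n n) s (h n)" for n
    unfolding h_def by (rule Kdiv_flux_objective[OF \<Omega> p \<alpha>n f \<beta>(2) \<mu>K])
  then obtain s where sn: "\<And>n. s n \<in> borel_measurable (\<alpha>n n)" "\<And>n x. norm (s n x) \<le> 1"
    "\<And>n. has_vec_density \<Omega> (\<alpha>n n) (s n) (\<mu> n)" "\<And>n. flux_div \<Omega> \<Gamma> p (\<alpha>n n) (s n) (h n)"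
    "\<And>n. objective \<Omega> p f \<beta> (\<mu> n) = flux_objective \<Omega> p f \<beta> (\<alpha>n n) (s n) (h n)" by metis
  \<comment> \<open>All measures live on the same Borel sets and \<open>s n\<close> is bounded
    everywhere, so it may be integrated against \<alpha> too.\<close>
  have s\<alpha>: "s n \<in> borel_measurable \<alpha>" for n using sn(1)[of n] by (simp add: mn)
  have opt: "flux_objective \<Omega> p f \<beta> (\<alpha>n n) (s n) (h n) \<le> flux_objective \<Omega> p f \<beta> (\<alpha>n n) t k"
    if tk: "t \<in> borel_measurable (\<alpha>n n)" "\<And>x. norm (t x) \<le> 1" "flux_div \<Omega> \<Gamma> p (\<alpha>n n) t k" for n t k
  proof -
    obtain \<sigma> where "\<sigma> \<in> Kdiv \<Omega> p \<Gamma> (\<alpha>n n)" "objective \<Omega> p f \<beta> \<sigma> = flux_objective \<Omega> p f \<beta> (\<alpha>n n) t k"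
      using flux_div_Kdiv_objective[OF \<Omega> p \<alpha>n f \<beta>(2) tk] by blast
    then show ?thesis using \<mu>min[of \<sigma> n] sn(5)[of n] by simp
  qed
  have hL: "h n \<in> Lp_space \<Omega> p" for n using sn(4)[of n] by (simp add: flux_div_def)
  have hC: "(LINT x|lebesgue_on \<Omega>. \<bar>h n x\<bar> powr p) \<le>
      2 powr p * (p * (1 / p * (LINT x|lebesgue_on \<Omega>. \<bar>f x\<bar> powr p)) + (LINT x|lebesgue_on \<Omega>. \<bar>f x\<bar> powr p))" for n
  proof (rule Lp_bound_from_objective[OF p hL f])
    show "0 \<le> \<beta> x" if "x \<in> space (\<alpha>n n)" for x using that \<beta>(1) pos_measuresD(3)[OF \<alpha>n] by simp
    \<comment> \<open>Comparison with the zero flux gives a bound that is independent of n.\<close>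
    show "flux_objective \<Omega> p f \<beta> (\<alpha>n n) (s n) (h n) \<le> 1 / p * (LINT x|lebesgue_on \<Omega>. \<bar>f x\<bar> powr p)"
      using opt[OF _ _ flux_div_zero, of n] by (simp add: flux_objective_def)
  qed
  obtain r t u where r: "strict_mono r" and t: "t \<in> borel_measurable \<alpha>" "\<And>x. norm (t x) \<le> 1" "flux_div \<Omega> \<Gamma> p \<alpha> t u"
    and wk: "weakly_converges_Lp \<Omega> p (\<lambda>k. h (r k)) u"
    and lim: "\<And>\<psi> B. \<psi> \<in> borel_measurable \<alpha> \<Longrightarrow> (\<And>x. x \<in> \<Omega> \<Longrightarrow> norm (\<psi> x) \<le> B) \<Longrightarrow>
      (\<lambda>k. LINT x|\<alpha>n (r k). s (r k) x \<bullet> \<psi> x) \<longlonglongrightarrow> (LINT x|\<alpha>. t x \<bullet> \<psi> x)"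
    and lsc: "\<And>b c. b \<longlonglongrightarrow> c \<Longrightarrow> (\<forall>\<^sub>F k in sequentially. flux_objective \<Omega> p f \<beta> (\<alpha>n k) (s k) (h k) \<le> b k) \<Longrightarrow>
      flux_objective \<Omega> p f \<beta> \<alpha> t u \<le> c"
  proof (rule flux_compactness[where \<delta> = \<delta> and \<alpha>k = \<alpha>n and s = s and h = h, OF \<Omega> p \<alpha> \<alpha>n \<delta>0 tv s\<alpha> sn(2,4) hC f \<beta>])
    fix r t u
    assume "strict_mono r" "t \<in> borel_measurable \<alpha>" "\<And>x. norm (t x) \<le> 1" "flux_div \<Omega> \<Gamma> p \<alpha> t u"
      "weakly_converges_Lp \<Omega> p (\<lambda>k. h (r k)) u"
      "\<And>\<psi> B. \<psi> \<in> borel_measurable \<alpha> \<Longrightarrow> (\<And>x. x \<in> \<Omega> \<Longrightarrow> norm (\<psi> x) \<le> B) \<Longrightarrow>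
        (\<lambda>k. LINT x|\<alpha>n (r k). s (r k) x \<bullet> \<psi> x) \<longlonglongrightarrow> (LINT x|\<alpha>. t x \<bullet> \<psi> x)"
      "\<And>b c. b \<longlonglongrightarrow> c \<Longrightarrow> (\<forall>\<^sub>F k in sequentially. flux_objective \<Omega> p f \<beta> (\<alpha>n k) (s k) (h k) \<le> b k) \<Longrightarrow>
        flux_objective \<Omega> p f \<beta> \<alpha> t u \<le> c"
    then show thesis by (rule that)
  qed
  obtain \<mu>star where \<mu>star: "has_vec_density \<Omega> \<alpha> t \<mu>star" "\<mu>star \<in> Kdiv \<Omega> p \<Gamma> \<alpha>" "vdiv \<Omega> p \<mu>star \<in> Lp_space \<Omega> p"
    "AE x in lebesgue_on \<Omega>. vdiv \<Omega> p \<mu>star x = u x" "objective \<Omega> p f \<beta> \<mu>star = flux_objective \<Omega> p f \<beta> \<alpha> t u"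
    using flux_div_Kdiv_objective[OF \<Omega> p \<alpha> f \<beta>(2) t] by blast
  have uL: "u \<in> Lp_space \<Omega> p" using wk by (simp add: weakly_converges_Lp_def)

  \<comment> \<open>Narrow convergence and weak convergence of the divergences\<close>
  have "narrowly_converges \<Omega> (\<lambda>n. \<mu> (r n)) \<mu>star"
    unfolding narrowly_converges_def
  proof (intro allI impI, elim conjE)
    fix \<phi> :: "real^'n \<Rightarrow> real^'n" assume \<phi>: "continuous_on \<Omega> \<phi>" "bounded (\<phi> ` \<Omega>)"
    obtain B where B: "\<And>x. x \<in> \<Omega> \<Longrightarrow> norm (\<phi> x) \<le> B" using \<phi>(2) by (auto simp: bounded_iff)
    have \<phi>m: "\<phi> \<in> borel_measurable \<alpha>" by (rule continuous_borel_measurable_pos[OF \<alpha> \<phi>(1)])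
    have "vec_integral \<Omega> (\<mu> n) \<phi> = (LINT x|\<alpha>n n. s n x \<bullet> \<phi> x)" for n
      using \<phi>m B by (intro vec_integral_density[OF \<alpha>n integrable_bounded_density[OF \<alpha>n sn(1,2)] sn(3)]) (auto simp: mn)
    moreover have "vec_integral \<Omega> \<mu>star \<phi> = (LINT x|\<alpha>. t x \<bullet> \<phi> x)"
      using \<phi>m B by (intro vec_integral_density[OF \<alpha> integrable_bounded_density[OF \<alpha> t(1,2)] \<mu>star(1)])
    ultimately show "(\<lambda>n. vec_integral \<Omega> (\<mu> (r n)) \<phi>) \<longlonglongrightarrow> vec_integral \<Omega> \<mu>star \<phi>"
      using lim[OF \<phi>m B] by simp
  qed
  moreover have "weakly_converges_Lp \<Omega> p (\<lambda>n. vdiv \<Omega> p (\<mu> (r n))) (vdiv \<Omega> p \<mu>star)"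
    unfolding weakly_converges_Lp_def
  proof (intro conjI allI ballI \<mu>star(3))
    show "vdiv \<Omega> p (\<mu> (r n)) \<in> Lp_space \<Omega> p" for n using hL[of "r n"] by (simp add: h_def)
    fix \<psi> assume \<psi>: "\<psi> \<in> Lp_space \<Omega> (p / (p - 1))"
    have "(LINT x|lebesgue_on \<Omega>. vdiv \<Omega> p \<mu>star x * \<psi> x) = (LINT x|lebesgue_on \<Omega>. u x * \<psi> x)"
      using \<mu>star(3,4) uL \<psi> by (intro integral_cong_AE borel_measurable_times) (auto simp: Lp_space_def elim!: AE_mp)
    then show "(\<lambda>n. LINT x|lebesgue_on \<Omega>. vdiv \<Omega> p (\<mu> (r n)) x * \<psi> x) \<longlonglongrightarrow> (LINT x|lebesgue_on \<Omega>. vdiv \<Omega> p \<mu>star x * \<psi> x)"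
      using wk \<psi> by (simp add: weakly_converges_Lp_def h_def)
  qed

  \<comment> \<open>Optimality of the limit by recovery sequences\<close>
  moreover have "solves \<Omega> p \<Gamma> f \<beta> \<alpha> \<mu>star"
    unfolding solves_def
  proof (intro conjI ballI \<mu>star(2))
    fix \<sigma> assume \<sigma>: "\<sigma> \<in> Kdiv \<Omega> p \<Gamma> \<alpha>"
    define k where "k = vdiv \<Omega> p \<sigma>"
    obtain \<tau> where \<tau>: "\<tau> \<in> borel_measurable \<alpha>" "\<And>x. norm (\<tau> x) \<le> 1" "flux_div \<Omega> \<Gamma> p \<alpha> \<tau> k"
      "objective \<Omega> p f \<beta> \<sigma> = flux_objective \<Omega> p f \<beta> \<alpha> \<tau> k"
      using Kdiv_flux_objective[OF \<Omega> p \<alpha> f \<beta>(2) \<sigma>] unfolding k_def by blast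
    have kL: "k \<in> Lp_space \<Omega> p" using \<tau>(3) by (simp add: flux_div_def)
    have kfL: "(\<lambda>x. k x - f x) \<in> Lp_space \<Omega> p" by (rule Lp_space_diff[OF p kL f])
    have \<beta>m: "\<beta> \<in> borel_measurable \<alpha>" by (rule continuous_borel_measurable_pos[OF \<alpha> \<beta>(2)])
    obtain D where D: "\<And>x. x \<in> \<Omega> \<Longrightarrow> \<bar>\<beta> x\<bar> \<le> D" using \<beta>(3) by (auto simp: bounded_iff)
    have D0: "0 \<le> D" using D[OF x0] by linarith
    define v where "v n x = norm (grad (g n) x) * F x" for n x
    have vm: "v n \<in> borel_measurable (lebesgue_on \<Omega>)" for n
    proof -
      have "grad (g n) \<in> borel_measurable (lebesgue_on \<Omega>)"
        using gC[of n] unfolding Ck_on_1_iff by (intro continuous_borel_measurable_lebesgue_on[OF \<Omega>]) auto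
      moreover have "F \<in> borel_measurable (lebesgue_on \<Omega>)" using decL by (auto simp: lebesgue_decomposition_def)
      ultimately show ?thesis unfolding v_def by measurable
    qed
    have vlim: "(\<lambda>n. Lp_norm \<Omega> p (v n)) \<longlonglongrightarrow> 0" unfolding v_def using assms by blast
    define V where "V n = (LINT x|lebesgue_on \<Omega>. \<bar>v n x\<bar> powr p)" for n
    have Vnn: "0 \<le> V n" for n unfolding V_def by (intro integral_nonneg_AE) auto
    have vL: "\<forall>\<^sub>F n in sequentially. v n \<in> Lp_space \<Omega> p \<and> V n < e" if "0 < e" for e
      unfolding V_def using p that by (intro Lp_norm_tendsto_0_iff_integral[OF _ vm vlim]) auto
    have V0: "V \<longlonglongrightarrow> 0"
    proof (rule tendstoI)
      fix e :: real assume "0 < e"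
      from vL[OF this] show "\<forall>\<^sub>F n in sequentially. dist (V n) 0 < e"
        by (rule eventually_mono) (simp add: Vnn)
    qed
    define A where "A = (LINT x|lebesgue_on \<Omega>. \<bar>k x - f x\<bar> powr p)"
    define E where "E = (LINT x|\<alpha>. \<beta> x * norm (\<tau> x))"
    define P where "P = (LINT x|lebesgue_on \<Omega>. \<bar>k x\<bar> powr p)"
    \<comment> \<open>An upper bound for the objective of the recovery competitor: convexity with
      weight l for the divergence, and \<open>\<gamma> n\<close> for the change in the \<beta> term.
      First n tends to infinity with l fixed, since \<open>l powr (1 - p)\<close> blows up as l
      tends to 0.\<close>
    define b where "b l n = 1 / p * ((1 - l) powr (1 - p) * A + l powr (1 - p) * (2 powr p * (\<gamma> n powr p * P + V n)))
        + (E + D * \<gamma> n * measure \<alpha> \<Omega>)" for l n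
    have le: "flux_objective \<Omega> p f \<beta> \<alpha> t u \<le> 1 / p * ((1 - l) powr (1 - p) * A) + E" if l: "0 < l" "l < 1" for l
    proof (rule lsc)
      have "(\<lambda>n. \<gamma> n powr p) \<longlonglongrightarrow> 0"
        using \<gamma>0 \<gamma>nn p by (intro tendsto_zero_powrI[where b = p]) auto
      then have "b l \<longlonglongrightarrow> 1 / p * ((1 - l) powr (1 - p) * A + l powr (1 - p) * (2 powr p * (0 * P + 0))) + (E + D * 0 * measure \<alpha> \<Omega>)"
        unfolding b_def by (intro tendsto_intros \<gamma>0 V0)
      then show "b l \<longlonglongrightarrow> 1 / p * ((1 - l) powr (1 - p) * A) + E" by simp
      show "\<forall>\<^sub>F n in sequentially. flux_objective \<Omega> p f \<beta> (\<alpha>n n) (s n) (h n) \<le> b l n"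
        using vL[OF zero_less_one]
      proof (rule eventually_mono, elim conjE)
        fix n assume "v n \<in> Lp_space \<Omega> p"
        then have vn: "(\<lambda>x. norm (grad (g n) x) * F x) \<in> Lp_space \<Omega> p" by (simp add: v_def[abs_def])
        obtain t' \<kappa> where t': "t' \<in> borel_measurable (\<alpha>n n)" "\<And>x. norm (t' x) \<le> 1" and \<kappa>: "\<kappa> \<in> Lp_space \<Omega> p"
          "\<And>x. \<bar>\<kappa> x\<bar> \<le> \<bar>norm (grad (g n) x) * F x\<bar>" and fd: "flux_div \<Omega> \<Gamma> p (\<alpha>n n) t' (\<lambda>x. g n x * k x + \<kappa> x)"
          and \<beta>t': "(LINT x|\<alpha>n n. \<beta> x * norm (t' x)) = (LINT x|\<alpha>. \<beta> x * norm (\<tau> x) * g n x)"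
          using recovery_flux[OF \<Omega> p \<alpha> \<alpha>n dec g decL gz \<tau>(1-3) vn \<beta>m D] by blast
        \<comment> \<open>The difference between the divergence of the recovery competitor and k. It
          is small in L^p by the bounds on \<open>g n\<close> - 1 and on \<kappa>.\<close>
        let ?w = "\<lambda>x. (g n x - 1) * k x + \<kappa> x"
        have gkL: "(\<lambda>x. (g n x - 1) * k x) \<in> Lp_space \<Omega> p"
          using pos_measurable_lebesgue_on[OF \<Omega> \<alpha> gm[of n]] \<gamma> p
          by (intro Lp_space_bounded_mult[OF _ kL, where B = "\<gamma> n"]) auto
        have wL: "?w \<in> Lp_space \<Omega> p" by (rule Lp_space_add[OF p gkL \<kappa>(1)])
        have sumL: "(\<lambda>x. (k x - f x) + ?w x) \<in> Lp_space \<Omega> p" by (rule Lp_space_add[OF p kfL wL])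
        have "(LINT x|lebesgue_on \<Omega>. \<bar>?w x\<bar> powr p) \<le> (LINT x|lebesgue_on \<Omega>. 2 powr p * (\<gamma> n powr p * \<bar>k x\<bar> powr p + \<bar>v n x\<bar> powr p))"
        proof (rule integral_mono)
          fix x assume "x \<in> space (lebesgue_on \<Omega>)"
          then have x: "x \<in> \<Omega>" by (simp add: space_restrict_space)
          have "\<bar>?w x\<bar> powr p \<le> 2 powr p * (\<bar>(g n x - 1) * k x\<bar> powr p + \<bar>\<kappa> x\<bar> powr p)"
            using p by (intro abs_add_powr_le) simp
          also have "\<dots> \<le> 2 powr p * (\<gamma> n powr p * \<bar>k x\<bar> powr p + \<bar>v n x\<bar> powr p)"
            using p \<gamma>[OF x, of n] \<kappa>(2)[of x] unfolding abs_mult[of "g n x - 1"]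
            by (intro mult_left_mono add_mono powr_mono2) (auto simp: powr_mult v_def intro!: mult_right_mono powr_mono2)
          finally show "\<bar>?w x\<bar> powr p \<le> 2 powr p * (\<gamma> n powr p * \<bar>k x\<bar> powr p + \<bar>v n x\<bar> powr p)" .
        qed (use wL kL \<open>v n \<in> Lp_space \<Omega> p\<close> in \<open>auto simp: Lp_space_def\<close>)
        also have "\<dots> = 2 powr p * (\<gamma> n powr p * P + V n)"
          using kL \<open>v n \<in> Lp_space \<Omega> p\<close> by (simp add: Lp_space_def P_def V_def)
        finally have w: "(LINT x|lebesgue_on \<Omega>. \<bar>?w x\<bar> powr p) \<le> 2 powr p * (\<gamma> n powr p * P + V n)" .
        have "(LINT x|lebesgue_on \<Omega>. \<bar>g n x * k x + \<kappa> x - f x\<bar> powr p)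
            \<le> (LINT x|lebesgue_on \<Omega>. (1 - l) powr (1 - p) * \<bar>k x - f x\<bar> powr p + l powr (1 - p) * \<bar>?w x\<bar> powr p)"
        proof (rule integral_mono)
          have eq: "g n x * k x + \<kappa> x - f x = (k x - f x) + ?w x" for x by (simp add: algebra_simps)
          show "integrable (lebesgue_on \<Omega>) (\<lambda>x. \<bar>g n x * k x + \<kappa> x - f x\<bar> powr p)"
            using sumL unfolding eq by (simp add: Lp_space_def)
          show "integrable (lebesgue_on \<Omega>) (\<lambda>x. (1 - l) powr (1 - p) * \<bar>k x - f x\<bar> powr p + l powr (1 - p) * \<bar>?w x\<bar> powr p)"
            using kfL wL by (simp add: Lp_space_def)
          show "\<bar>g n x * k x + \<kappa> x - f x\<bar> powr p \<le> (1 - l) powr (1 - p) * \<bar>k x - f x\<bar> powr p + l powr (1 - p) * \<bar>?w x\<bar> powr p" for x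
            unfolding eq by (rule powr_add_convex[OF p l])
        qed
        also have "\<dots> = (1 - l) powr (1 - p) * A + l powr (1 - p) * (LINT x|lebesgue_on \<Omega>. \<bar>?w x\<bar> powr p)"
          using kfL wL by (simp add: Lp_space_def A_def)
        also have "\<dots> \<le> (1 - l) powr (1 - p) * A + l powr (1 - p) * (2 powr p * (\<gamma> n powr p * P + V n))"
          using w by (intro add_left_mono mult_left_mono) auto
        finally have 1: "(LINT x|lebesgue_on \<Omega>. \<bar>g n x * k x + \<kappa> x - f x\<bar> powr p)
            \<le> (1 - l) powr (1 - p) * A + l powr (1 - p) * (2 powr p * (\<gamma> n powr p * P + V n))" .
        have 2: "(LINT x|\<alpha>. \<beta> x * norm (\<tau> x) * g n x) \<le> E + D * \<gamma> n * measure \<alpha> \<Omega>"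
        proof -
          have \<beta>\<tau>: "\<bar>\<beta> x * norm (\<tau> x)\<bar> \<le> D" if "x \<in> \<Omega>" for x
          proof -
            have "\<bar>\<beta> x\<bar> * norm (\<tau> x) \<le> D * 1" using D[OF that] D0 \<tau>(2)[of x] by (intro mult_mono) auto
            then show ?thesis by (simp add: abs_mult)
          qed
          have m: "(\<lambda>x. \<beta> x * norm (\<tau> x)) \<in> borel_measurable \<alpha>" using \<beta>m \<tau>(1) by measurable
          have i: "integrable \<alpha> (\<lambda>x. \<beta> x * norm (\<tau> x))"
            using \<beta>\<tau> m sp by (intro \<alpha>.integrable_const_bound[where B = D] AE_I2) auto
          have "integrable \<alpha> (g n)" using dec[of n] by (simp add: lebesgue_decomposition_def)
          then have ig: "integrable \<alpha> (\<lambda>x. \<beta> x * norm (\<tau> x) * g n x)"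
            using integrable_mult_bounded[OF _ m, of "g n" D] \<beta>\<tau> sp by simp
          have "(LINT x|\<alpha>. \<beta> x * norm (\<tau> x) * g n x) \<le> (LINT x|\<alpha>. \<beta> x * norm (\<tau> x) + D * \<gamma> n)"
          proof (rule integral_mono[OF ig])
            show "integrable \<alpha> (\<lambda>x. \<beta> x * norm (\<tau> x) + D * \<gamma> n)" using i by simp
            fix x assume "x \<in> space \<alpha>"
            then have x: "x \<in> \<Omega>" using sp by simp
            have "\<bar>\<beta> x * norm (\<tau> x)\<bar> * \<bar>g n x - 1\<bar> \<le> D * \<gamma> n"
              using \<beta>\<tau>[OF x] \<gamma>[OF x] D0 by (intro mult_mono) auto
            then have "\<beta> x * norm (\<tau> x) * (g n x - 1) \<le> D * \<gamma> n"
              unfolding abs_mult[symmetric] by linarith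
            then show "\<beta> x * norm (\<tau> x) * g n x \<le> \<beta> x * norm (\<tau> x) + D * \<gamma> n"
              by (simp add: right_diff_distrib)
          qed
          also have "\<dots> = E + D * \<gamma> n * measure \<alpha> \<Omega>"
            using i sp by (simp add: E_def)
          finally show ?thesis .
        qed
        have "flux_objective \<Omega> p f \<beta> (\<alpha>n n) (s n) (h n) \<le> flux_objective \<Omega> p f \<beta> (\<alpha>n n) t' (\<lambda>x. g n x * k x + \<kappa> x)"
          by (rule opt[OF t' fd])
        also have "\<dots> \<le> b l n"
          unfolding flux_objective_def b_def \<beta>t' using 1 2 p by (intro add_mono mult_left_mono) auto
        finally show "flux_objective \<Omega> p f \<beta> (\<alpha>n n) (s n) (h n) \<le> b l n" .
      qed
    qed
    have "flux_objective \<Omega> p f \<beta> \<alpha> t u \<le> 1 / p * A + E"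
    proof (rule LIMSEQ_le_const)
      \<comment> \<open>Starting at 1 / 2 keeps the weights strictly between 0 and 1 for every
        m.\<close>
      let ?l = "\<lambda>m. inverse (real (Suc (Suc m)))"
      have "(\<lambda>m. (1 - ?l m) powr (1 - p)) \<longlonglongrightarrow> (1 - 0) powr (1 - p)"
        by (intro tendsto_intros LIMSEQ_Suc[OF LIMSEQ_inverse_real_of_nat]) auto
      then have "(\<lambda>m. 1 / p * ((1 - ?l m) powr (1 - p) * A) + E) \<longlonglongrightarrow> 1 / p * ((1 - 0) powr (1 - p) * A) + E"
        by (intro tendsto_add tendsto_mult tendsto_const)
      then show "(\<lambda>m. 1 / p * ((1 - ?l m) powr (1 - p) * A) + E) \<longlonglongrightarrow> 1 / p * A + E" by simp
      have "?l m < 1" for m by (simp add: inverse_less_1_iff)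
      then show "\<exists>N. \<forall>m\<ge>N. flux_objective \<Omega> p f \<beta> \<alpha> t u \<le> 1 / p * ((1 - ?l m) powr (1 - p) * A) + E"
        by (intro exI allI impI le) auto
    qed
    then show "objective \<Omega> p f \<beta> \<mu>star \<le> objective \<Omega> p f \<beta> \<sigma>"
      unfolding \<mu>star(5) \<tau>(4) by (simp add: flux_objective_def A_def E_def)
  qed
  ultimately show ?thesis
    using \<mu> r \<mu>star(2) by blast
qed

end
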